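(* Let $a>0$, $\Omega_{\mathbf x}=(0,a)\times(0,a)$, $\Omega=\Omega_{\mathbf x}\times(0,\infty)$ and $\Gamma=\{(\mathbf x,z)\;|\;\mathbf x\in\Omega_{\mathbf x},\ z=0\}$. Let $\beta\in S_\infty$ with $\beta>\frac{\sqrt2\,\pi}{a}$. Assume that $u_0\in H^2(\Omega)$, $u_0|_{\partial\Omega}=0$, $u_0>0$ in $\Omega$, and that $\psi_0\in H^3(\Omega)$ satisfies $$\psi|_{\partial\Omega\setminus\Gamma}=0,\qquad(\psi_z+\beta\psi)|_\Gamma=0. \qquad (\ast)$$ Let $\alpha=\frac{2\pi^2}{\beta a^2}$ and define $$\phi(\mathbf x,z)=e^{-\alpha z}\sin\frac{\pi x_1}{a}\sin\frac{\pi x_2}{a},\qquad(\mathbf x,z)\in\Omega,$$ $$A=\int_\Omega(\log u_0)\phi\,d\mathbf x\,dz,\quad B=2\int_\Omega\psi_{0z}\phi\,d\mathbf x\,dz,\quad D=\frac{\pi\alpha^{5/2}}{a\left(2\left(\frac\pi a\right)^2-\alpha^2\right)},\quad I_\infty=\int_0^\infty\frac{dx}{\sqrt{x^3+1}}.$$ If $A>0$ and $B>0$, then the solution $(u,\psi)$ of $$u_t=2u\psi_z,\qquad-\Delta\psi_t=(u^2)_z\qquad\text{in }\Omega,$$ with $\psi$ satisfying the boundary condition $(\ast)$ and with initial data $u|_{t=0}=u_0$, $\psi|_{t=0}=\psi_0$, develops a finite time singularity in the $H^2$ norm no later than $$T^*=\left(\frac{2DB}{3}\,\frac{\sqrt\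alpha\,\pi}{2a}\right)^{-1/3}I_\infty.$$
   Context: Here $\mathbf x=(x_1,x_2)$, $\Delta=\partial_{x_1}^2+\partial_{x_2}^2+\partial_z^2$, and subscripts $t,z$ denote partial derivatives ($\psi_{0z}=\partial_z\psi_0$). $S_\infty=\{\beta\;|\;\beta\neq\frac{\pi|k|}{a}\text{ for all }k\in\mathbb Z^2\}$, where $|k|=\sqrt{k_1^2+k_2^2}$. "Develops a finite time singularity in the $H^2$ norm no later than $T^*$" means: if $T_b$ is the largest time for which there is a solution with $u\in C^1([0,T_b);H^2(\Omega))$ and $\psi\in C^1([0,T_b);H^3(\Omega))$, then $T_b\le T^*$. *)

theory Defs
  imports "HOL-Analysis.Analysis"
begin

text \<open>Points of three-dimensional space are \<open>x :: real^3\<close>, with horizontal coordinates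
  \<open>x$1, x$2\<close> and vertical coordinate \<open>z = x$3\<close>.  Multi-indices are \<open>\<alpha> :: nat^3\<close>;
  thus \<open>axis i 1\<close> is the multi-index of \<open>\<partial>\<^sub>i\<close> and \<open>axis i 2\<close> that of \<open>\<partial>\<^sub>i\<^sup>2\<close>.\<close>

section \<open>Sobolev spaces\<close>

definition partial_deriv :: "3 \<Rightarrow> (real^3 \<Rightarrow> real) \<Rightarrow> (real^3 \<Rightarrow> real)" where
  "partial_deriv i f = (\<lambda>x. frechet_derivative f (at x) (axis i 1))"

definition multi_order :: "nat^3 \<Rightarrow> nat" where
  "multi_order \<alpha> = (\<Sum>i\<in>UNIV. \<alpha> $ i)"

definition multi_deriv :: "nat^3 \<Rightarrow> (real^3 \<Rightarrow> real) \<Rightarrow> (real^3 \<Rightarrow> real)" where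
  "multi_deriv \<alpha> f =
     (partial_deriv 1 ^^ (\<alpha>$1)) ((partial_deriv 2 ^^ (\<alpha>$2)) ((partial_deriv 3 ^^ (\<alpha>$3)) f))"

text \<open>Every derivative being (Frechet) differentiable, all of them are continuous, so this is
  \<open>C\<^sup>\<infinity>\<close> and the order of differentiation fixed in \<open>multi_deriv\<close> is immaterial.\<close>

definition smooth :: "(real^3 \<Rightarrow> real) \<Rightarrow> bool" where
  "smooth f \<longleftrightarrow> (\<forall>\<alpha> x. multi_deriv \<alpha> f differentiable (at x))"

definition test_function :: "(real^3) set \<Rightarrow> (real^3 \<Rightarrow> real) \<Rightarrow> bool" where
  "test_function \<Omega> \<eta> \<longleftrightarrow>
     smooth \<eta> \<and> compact (closure {x. \<eta> x \<noteq> 0}) \<and> closure {x. \<eta> x \<noteq> 0} \<subseteq> \<Omega>"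

definition locally_integrable :: "(real^3) set \<Rightarrow> (real^3 \<Rightarrow> real) \<Rightarrow> bool" where
  "locally_integrable \<Omega> f \<longleftrightarrow> (\<forall>K. compact K \<and> K \<subseteq> \<Omega> \<longrightarrow> integrable (lebesgue_on K) f)"

definition has_weak_deriv ::
  "(real^3) set \<Rightarrow> nat^3 \<Rightarrow> (real^3 \<Rightarrow> real) \<Rightarrow> (real^3 \<Rightarrow> real) \<Rightarrow> bool" where
  "has_weak_deriv \<Omega> \<alpha> f g \<longleftrightarrow>
     locally_integrable \<Omega> f \<and> locally_integrable \<Omega> g \<and>
     (\<forall>\<eta>. test_function \<Omega> \<eta> \<longrightarrow>
        (LINT x|lebesgue_on \<Omega>. f x * multi_deriv \<alpha> \<eta> x) =
        (-1) ^ multi_order \<alpha> * (LINT x|lebesgue_on \<Omega>. g x * \<eta> x))"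

text \<open>Functions are used as representatives of their almost-everywhere classes; a weak derivative
  is unique up to a null set, and every use of \<open>weak_deriv\<close> below is insensitive to null sets.\<close>

definition weak_deriv :: "(real^3) set \<Rightarrow> nat^3 \<Rightarrow> (real^3 \<Rightarrow> real) \<Rightarrow> (real^3 \<Rightarrow> real)" where
  "weak_deriv \<Omega> \<alpha> f = (SOME g. has_weak_deriv \<Omega> \<alpha> f g)"

definition L2 :: "(real^3) set \<Rightarrow> (real^3 \<Rightarrow> real) set" where
  "L2 \<Omega> = {f. f \<in> borel_measurable (lebesgue_on \<Omega>) \<and>
              integrable (lebesgue_on \<Omega>) (\<lambda>x. (f x)\<^sup>2)}"

definition Sobolev_H :: "nat \<Rightarrow> (real^3) set \<Rightarrow> (real^3 \<Rightarrow> real) set" where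
  "Sobolev_H k \<Omega> =
     {f \<in> L2 \<Omega>. \<forall>\<alpha>. multi_order \<alpha> \<le> k \<longrightarrow> (\<exists>g\<in>L2 \<Omega>. has_weak_deriv \<Omega> \<alpha> f g)}"

lemma finite_multi_order_le: "finite {\<alpha> :: nat^3. multi_order \<alpha> \<le> k}"
proof -
  have "{\<alpha> :: nat^3. multi_order \<alpha> \<le> k} \<subseteq> vec_lambda ` (UNIV \<rightarrow>\<^sub>E {..k})"
  proof
    fix \<alpha> :: "nat^3"
    assume "\<alpha> \<in> {\<alpha>. multi_order \<alpha> \<le> k}"
    then have "(\<Sum>i\<in>UNIV. \<alpha> $ i) \<le> k"
      by (simp add: multi_order_def)
    then have "\<alpha> $ i \<le> k" for i
      using member_le_sum[of i UNIV "\<lambda>i. \<alpha> $ i"] by simp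
    then have "vec_nth \<alpha> \<in> UNIV \<rightarrow>\<^sub>E {..k}"
      by (auto simp: PiE_def)
    then show "\<alpha> \<in> vec_lambda ` (UNIV \<rightarrow>\<^sub>E {..k})"
      by (metis image_eqI vec_nth_inverse)
  qed
  then show ?thesis
    by (rule finite_subset) (simp add: finite_PiE)
qed

definition Sobolev_norm :: "nat \<Rightarrow> (real^3) set \<Rightarrow> (real^3 \<Rightarrow> real) \<Rightarrow> real" where
  "Sobolev_norm k \<Omega> f =
     sqrt (\<Sum>\<alpha> | multi_order \<alpha> \<le> k. LINT x|lebesgue_on \<Omega>. (weak_deriv \<Omega> \<alpha> f x)\<^sup>2)"

definition weak_laplacian :: "(real^3) set \<Rightarrow> (real^3 \<Rightarrow> real) \<Rightarrow> (real^3 \<Rightarrow> real)" where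
  "weak_laplacian \<Omega> f = (\<lambda>x. \<Sum>i\<in>UNIV. weak_deriv \<Omega> (axis i 2) f x)"

text \<open>\<open>f \<in> C\<^sup>1([0,T); H\<^sup>k(\<Omega>))\<close> with time derivative \<open>f'\<close>, both limits being taken in the
  \<open>H\<^sup>k\<close> norm (one-sided at \<open>t = 0\<close>).\<close>

definition C1_Sobolev ::
  "nat \<Rightarrow> (real^3) set \<Rightarrow> real \<Rightarrow> (real \<Rightarrow> real^3 \<Rightarrow> real) \<Rightarrow> (real \<Rightarrow> real^3 \<Rightarrow> real) \<Rightarrow> bool"
where
  "C1_Sobolev k \<Omega> T f f' \<longleftrightarrow>
     (\<forall>t\<in>{0..<T}. f t \<in> Sobolev_H k \<Omega> \<and> f' t \<in> Sobolev_H k \<Omega> \<and>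
        ((\<lambda>s. Sobolev_norm k \<Omega> (\<lambda>x. (f s x - f t x) / (s - t) - f' t x)) \<longlongrightarrow> 0)
          (at t within {0..<T}) \<and>
        ((\<lambda>s. Sobolev_norm k \<Omega> (\<lambda>x. f' s x - f' t x)) \<longlongrightarrow> 0) (at t within {0..<T}))"

text \<open>The condition \<open>f|\<^sub>S = 0\<close> for \<open>S \<subseteq> \<partial>\<Omega>\<close>.  It is only applied to elements of \<open>H\<^sup>2\<close> of a convex
  three-dimensional domain; by the Sobolev embedding these have a (unique) representative that
  is continuous up to the boundary, and its restriction to \<open>S\<close> is the trace.\<close>

definition vanishes_on :: "(real^3) set \<Rightarrow> (real^3) set \<Rightarrow> (real^3 \<Rightarrow> real) \<Rightarrow> bool" where
  "vanishes_on \<Omega> S f \<longleftrightarrow>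
     (\<exists>g. continuous_on (closure \<Omega>) g \<and> (AE x in lebesgue_on \<Omega>. g x = f x) \<and> (\<forall>x\<in>S. g x = 0))"

section \<open>The initial boundary value problem\<close>

definition domain :: "real \<Rightarrow> (real^3) set" where
  "domain a = {x. 0 < x$1 \<and> x$1 < a \<and> 0 < x$2 \<and> x$2 < a \<and> 0 < x$3}"

definition bottom :: "real \<Rightarrow> (real^3) set" where
  "bottom a = {x. 0 < x$1 \<and> x$1 < a \<and> 0 < x$2 \<and> x$2 < a \<and> x$3 = 0}"

definition S_infinity :: "real \<Rightarrow> real set" where
  "S_infinity a = {\<beta>. \<forall>k1 k2 :: int. \<beta> \<noteq> pi * sqrt ((of_int k1)\<^sup>2 + (of_int k2)\<^sup>2) / a}"

definition psi_boundary_condition :: "real \<Rightarrow> real \<Rightarrow> (real^3 \<Rightarrow> real) \<Rightarrow> bool" where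
  "psi_boundary_condition a \<beta> \<psi> \<longleftrightarrow>
     vanishes_on (domain a) (frontier (domain a) - bottom a) \<psi> \<and>
     vanishes_on (domain a) (bottom a) (\<lambda>x. weak_deriv (domain a) (axis 3 1) \<psi> x + \<beta> * \<psi> x)"

text \<open>The equation \<open>- \<Delta>\<psi>\<^sub>t = (u\<^sup>2)\<^sub>z\<close> is expressed by saying that \<open>- \<Delta>\<psi>\<^sub>t\<close> is the weak
  \<open>z\<close>-derivative of \<open>u\<^sup>2\<close>.\<close>

definition is_solution ::
  "real \<Rightarrow> real \<Rightarrow> (real^3 \<Rightarrow> real) \<Rightarrow> (real^3 \<Rightarrow> real) \<Rightarrow> real \<Rightarrow>
   (real \<Rightarrow> real^3 \<Rightarrow> real) \<Rightarrow> (real \<Rightarrow> real^3 \<Rightarrow> real) \<Rightarrow> bool" where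
  "is_solution a \<beta> u0 \<psi>0 T u \<psi> \<longleftrightarrow>
     (\<exists>u' \<psi>'.
        C1_Sobolev 2 (domain a) T u u' \<and> C1_Sobolev 3 (domain a) T \<psi> \<psi>' \<and>
        (AE x in lebesgue_on (domain a). u 0 x = u0 x) \<and>
        (AE x in lebesgue_on (domain a). \<psi> 0 x = \<psi>0 x) \<and>
        (\<forall>t\<in>{0..<T}.
           psi_boundary_condition a \<beta> (\<psi> t) \<and>
           (AE x in lebesgue_on (domain a).
              u' t x = 2 * u t x * weak_deriv (domain a) (axis 3 1) (\<psi> t) x) \<and>
           has_weak_deriv (domain a) (axis 3 1) (\<lambda>x. (u t x)\<^sup>2)
             (\<lambda>x. - weak_laplacian (domain a) (\<psi>' t) x)))"

text \<open>The largest time \<open>T\<^sub>b\<close> (possibly \<open>\<infinity>\<close>) of existence of a solution.\<close>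

definition max_existence_time ::
  "real \<Rightarrow> real \<Rightarrow> (real^3 \<Rightarrow> real) \<Rightarrow> (real^3 \<Rightarrow> real) \<Rightarrow> ereal" where
  "max_existence_time a \<beta> u0 \<psi>0 =
     Sup {ereal T | T. 0 < T \<and> (\<exists>u \<psi>. is_solution a \<beta> u0 \<psi>0 T u \<psi>)}"

definition develops_singularity_by ::
  "real \<Rightarrow> real \<Rightarrow> (real^3 \<Rightarrow> real) \<Rightarrow> (real^3 \<Rightarrow> real) \<Rightarrow> real \<Rightarrow> bool" where
  "develops_singularity_by a \<beta> u0 \<psi>0 Tstar \<longleftrightarrow> max_existence_time a \<beta> u0 \<psi>0 \<le> ereal Tstar"

end

theory Submission
  imports Defs "HOL-Computational_Algebra.Polynomial"
begin

text \<open>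
  The idea is to pair the two equations with \<open>\<phi>\<close>.  Dividing \<open>u\<^sub>t = 2 u \<psi>\<^sub>z\<close> by \<open>u\<close> and using \<open>ln \<bar>u\<bar> \<le> \<bar>u\<bar>\<close> gives
  \<open>\<integral> \<bar>u\<bar> \<phi> \<ge> Y\<close>, where \<open>Y = A + \<integral>\<^sub>0\<^sup>t G\<close> and \<open>G = 2 \<integral> \<psi>\<^sub>z \<phi>\<close>.  Since
  \<open>\<Delta> \<phi> = (\<alpha>\<^sup>2 - \<alpha> \<beta>) \<phi>\<close> and \<open>\<psi>\<close> satisfies the Robin condition, integrating the second equation by parts yields
  \<open>(\<beta> - \<alpha>) d/dt \<integral> \<psi>\<^sub>z \<phi> = \<alpha> \<integral> u\<^sup>2 \<phi>\<close>; by Cauchy-Schwarz \<open>Y'' \<ge> c Y\<^sup>2\<close>, which forces blow-up no later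
  than \<open>T_star\<close>.

  No trace theory or Sobolev embedding is needed.  A function with a square integrable weak
  \<open>z\<close>-derivative is dominated near the bottom by an integrable function of \<open>(x\<^sub>1, x\<^sub>2)\<close>.  Applied to
  \<open>\<psi>\<^sub>z\<close> and to \<open>u\<^sup>2\<close> this shows that the averages of \<open>u\<^sup>2\<close> over thin slabs above the bottom tend to zero
  at all times because they do so initially, so that the boundary term of \<open>(u\<^sup>2)\<^sub>z\<close> vanishes.
\<close>

section \<open>Smooth functions of one variable\<close>

text \<open>Two obstacles shape the argument. The weight \<phi> is not an admissible test function:
  it does not vanish at the bottom and is not compactly supported, so it is approximated by cut-off
  products. At the side walls the sine factors and the vanishing of \<psi> absorb the cut-off. At
  the bottom a derivative of size n falls on a layer of height 2/n, so averages over thin slabs must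
  be controlled, and u^2 is known to vanish there only at time 0. Moreover u(t) is not known in
  advance to be positive or even nonzero; ln |u| is therefore replaced by ln (u^2 + \<delta>^2) / 2,
  and \<delta> is sent to 0.

  The relation \<alpha> \<beta> = 2 (pi/a)^2 makes the \<psi>-terms combine to the Robin expression,
  and \<beta> > sqrt 2 pi/a says exactly that \<alpha> < \<beta>, the sign for which growth of u^2
  feeds back positively. The constant c is the product of 2 \<alpha> / (\<beta> - \<alpha>), from
  the second equation, and \<alpha> pi^2 / (4 a^2), the reciprocal of the integral of
  \<phi>.\<close>

primrec times_differentiable :: "nat \<Rightarrow> (real \<Rightarrow> real) \<Rightarrow> bool" where
  "times_differentiable 0 f \<longleftrightarrow> True"
| "times_differentiable (Suc n) f \<longleftrightarrow>
     (\<exists>f'. (\<forall>x. (f has_real_derivative f' x) (at x)) \<and> times_differentiable n f')"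

definition smooth_real :: "(real \<Rightarrow> real) \<Rightarrow> bool" where
  "smooth_real f \<longleftrightarrow> (\<forall>n. times_differentiable n f)"

text \<open>The recursion only asks for some derivative, which lets the closure proofs name theirs
  explicitly; uniqueness of the derivative identifies it with \<open>deriv\<close> here, once and
  for all.\<close>

lemma times_differentiable_Suc_deriv:
  "times_differentiable (Suc n) f \<longleftrightarrow>
     (\<forall>x. (f has_real_derivative deriv f x) (at x)) \<and> times_differentiable n (deriv f)"
proof
  assume "times_differentiable (Suc n) f"
  then obtain f' where f': "\<forall>x. (f has_real_derivative f' x) (at x)" "times_differentiable n f'"
    by auto
  then have "deriv f = f'"
    by (auto intro!: ext DERIV_imp_deriv)
  with f' show "(\<forall>x. (f has_real_derivative deriv f x) (at x)) \<and> times_differentiable n (deriv f)"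
    by simp
qed auto

lemma times_differentiable_SucI:
  "(\<And>x. (f has_real_derivative f' x) (at x)) \<Longrightarrow> times_differentiable n f' \<Longrightarrow> times_differentiable (Suc n) f"
  by auto

lemma times_differentiable_SucD: "times_differentiable (Suc n) f \<Longrightarrow> times_differentiable n f"
  by (induction n arbitrary: f) auto

lemma times_differentiable_const: "times_differentiable n (\<lambda>x. c)"
  by (induction n arbitrary: c) (auto intro!: exI[of _ "\<lambda>x. 0"])

lemma times_differentiable_add:
  "times_differentiable n f \<Longrightarrow> times_differentiable n g \<Longrightarrow> times_differentiable n (\<lambda>x. f x + g x)"
proof (induction n arbitrary: f g)
  case (Suc n)
  then obtain f' g' where
    "\<forall>x. (f has_real_derivative f' x) (at x)" "times_differentiable n f'"
    "\<forall>x. (g has_real_derivative g' x) (at x)" "times_differentiable n g'" by auto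
  then show ?case
    using Suc.IH[of f' g'] by (auto intro!: exI[of _ "\<lambda>x. f' x + g' x"] derivative_intros)
qed simp

lemma times_differentiable_mult:
  "times_differentiable n f \<Longrightarrow> times_differentiable n g \<Longrightarrow> times_differentiable n (\<lambda>x. f x * g x)"
proof (induction n arbitrary: f g)
  case (Suc n)
  then obtain f' g' where *:
    "\<forall>x. (f has_real_derivative f' x) (at x)" "times_differentiable n f'"
    "\<forall>x. (g has_real_derivative g' x) (at x)" "times_differentiable n g'" by auto
  moreover have "times_differentiable n f" "times_differentiable n g"
    using Suc.prems by (blast intro: times_differentiable_SucD)+
  ultimately have "times_differentiable n (\<lambda>x. f' x * g x + g' x * f x)"
    using Suc.IH by (auto intro!: times_differentiable_add)
  moreover have "\<forall>x. ((\<lambda>x. f x * g x) has_real_derivative f' x * g x + g' x * f x) (at x)"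
    using * by (auto intro!: derivative_eq_intros)
  ultimately show ?case by auto
qed simp

lemma times_differentiable_affine:
  "times_differentiable n f \<Longrightarrow> times_differentiable n (\<lambda>x. f (c * x + d))"
proof (induction n arbitrary: f)
  case (Suc n)
  then obtain f' where *: "\<And>x. (f has_real_derivative f' x) (at x)" "times_differentiable n f'"
    by auto
  have lin: "((\<lambda>x. c * x + d) has_real_derivative c) (at x)" for x
    by (auto intro!: derivative_eq_intros)
  have "((\<lambda>x. f (c * x + d)) has_real_derivative c * f' (c * x + d)) (at x)" for x
    using DERIV_chain2[where f=f and g="\<lambda>x. c * x + d" and x=x and s=UNIV, OF *(1)[of "c * x + d"] lin]
    by (simp add: mult.commute)
  moreover have "times_differentiable n (\<lambda>x. c * f' (c * x + d))"
    by (intro times_differentiable_mult times_differentiable_const Suc.IH *(2))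
  ultimately show ?case by (rule times_differentiable_SucI)
qed simp

lemma smooth_real_mult: "smooth_real f \<Longrightarrow> smooth_real g \<Longrightarrow> smooth_real (\<lambda>x. f x * g x)"
  and smooth_real_add: "smooth_real f \<Longrightarrow> smooth_real g \<Longrightarrow> smooth_real (\<lambda>x. f x + g x)"
  and smooth_real_const: "smooth_real (\<lambda>x. c)"
  and smooth_real_affine: "smooth_real f \<Longrightarrow> smooth_real (\<lambda>x. f (k * x + d))"
  by (auto simp: smooth_real_def times_differentiable_mult times_differentiable_add
      times_differentiable_const times_differentiable_affine)

lemma smooth_real_diff:
  assumes "smooth_real f" "smooth_real g" shows "smooth_real (\<lambda>x. f x - g x)"
proof -
  have "smooth_real (\<lambda>x. f x + (-1) * g x)"
    by (intro smooth_real_add smooth_real_mult smooth_real_const assms)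
  then show ?thesis by simp
qed

lemma smooth_real_deriv:
  assumes "smooth_real f"
  shows "smooth_real (deriv f)" "(f has_real_derivative deriv f x) (at x)"
  using assms times_differentiable_Suc_deriv[of _ f] unfolding smooth_real_def by blast+

lemma smooth_real_higher_deriv: "smooth_real f \<Longrightarrow> smooth_real ((deriv ^^ n) f)"
  by (induction n) (auto intro: smooth_real_deriv)

lemma smooth_realI:
  assumes "\<And>x. (f has_real_derivative f' x) (at x)" "smooth_real f'" shows "smooth_real f"
  unfolding smooth_real_def
proof
  fix n show "times_differentiable n f"
    using assms by (cases n) (auto simp: smooth_real_def)
qed

lemma smooth_real_continuous: "smooth_real f \<Longrightarrow> continuous_on S f"
  by (meson DERIV_isCont continuous_at_imp_continuous_on smooth_real_deriv(2))

lemma smooth_real_sin: "smooth_real (\<lambda>x. sin (c * x))"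
proof -
  \<comment> \<open>The free phase d closes the family under differentiation up to the factor c,
    since a derivative shifts the phase by pi/2.\<close>
  have "times_differentiable n (\<lambda>x. sin (c * x + d))" for n d
  proof (induction n arbitrary: d)
    case (Suc n)
    have "((\<lambda>x. sin (c * x + d)) has_real_derivative c * sin (c * x + (d + pi / 2))) (at x)" for x
      by (auto intro!: derivative_eq_intros simp: sin_add cos_add algebra_simps)
    moreover have "times_differentiable n (\<lambda>x. c * sin (c * x + (d + pi / 2)))"
      by (intro times_differentiable_mult times_differentiable_const Suc.IH)
    ultimately show ?case by (rule times_differentiable_SucI)
  qed simp
  from this[of _ 0] show ?thesis by (simp add: smooth_real_def)
qed

lemma smooth_real_exp: "smooth_real (\<lambda>x. exp (c * x))"
proof -
  have "times_differentiable n (\<lambda>x. exp (c * x))" for n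
  proof (induction n)
    case (Suc n)
    have "((\<lambda>x. exp (c * x)) has_real_derivative c * exp (c * x)) (at x)" for x
      by (auto intro!: derivative_eq_intros)
    moreover have "times_differentiable n (\<lambda>x. c * exp (c * x))"
      by (intro times_differentiable_mult times_differentiable_const Suc.IH)
    ultimately show ?case by (rule times_differentiable_SucI)
  qed simp
  then show ?thesis by (simp add: smooth_real_def)
qed

text \<open>Meant for the difference quotients at 0 of the functions P(1/x) exp(-1/x), after the
  substitution y = 1/x.\<close>

lemma poly_times_exp_tendsto_0: "((\<lambda>y. poly P y * exp (- y)) \<longlongrightarrow> (0::real)) at_top"
proof (induction P)
  case 0 then show ?case by simp
next
  case (pCons c P)
  have "((\<lambda>y::real. poly P y * y * exp (- y)) \<longlongrightarrow> 0) at_top" for P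
  proof -
    have "poly P y * y * exp (- y) = (\<Sum>i\<le>degree P. coeff P i * (y ^ Suc i / exp y))" for y :: real
      by (simp add: poly_altdef sum_distrib_left exp_minus sum_divide_distrib field_simps)
    moreover have "((\<lambda>y::real. \<Sum>i\<le>degree P. coeff P i * (y ^ Suc i / exp y)) \<longlongrightarrow>
        (\<Sum>i\<le>degree P. coeff P i * 0)) at_top"
      by (intro tendsto_intros tendsto_power_div_exp_0)
    ultimately show ?thesis by simp
  qed
  moreover have "((\<lambda>y::real. c * exp (- y)) \<longlongrightarrow> 0) at_top"
    using tendsto_mult[OF tendsto_const[of c] tendsto_power_div_exp_0[of 0]] by (simp add: exp_minus field_simps)
  ultimately have "((\<lambda>y::real. c * exp (- y) + poly P y * y * exp (- y)) \<longlongrightarrow> 0 + 0) at_top"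
    by (intro tendsto_add)
  then show ?case by (simp add: algebra_simps)
qed

text \<open>The induction runs over the whole class of functions P(1/x) exp(-1/x) extended by 0,
  because this class is closed under differentiation; the function in question is the case P =
  1.\<close>

lemma smooth_real_flat: "smooth_real (\<lambda>x. if x > 0 then exp (- (1 / x)) else 0)"
proof -
  have "times_differentiable n (\<lambda>x. if x > 0 then poly P (1 / x) * exp (- (1 / x)) else 0)" for n P
  proof (induction n arbitrary: P)
    case (Suc n)
    define f where "f = (\<lambda>x::real. if x > 0 then poly P (1 / x) * exp (- (1 / x)) else 0)"
    \<comment> \<open>With y = 1/x, d/dx is -y^2 d/dy, so P(y) exp(-y) becomes y^2 (P - P')(y)
      exp(-y).\<close>
    define Q where "Q = [:0, 0, 1:] * (P - pderiv P)"
    define f' where "f' = (\<lambda>x::real. if x > 0 then poly Q (1 / x) * exp (- (1 / x)) else 0)"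
    have "(f has_real_derivative f' x) (at x)" for x
    proof -
      consider "x < 0" | "x = 0" | "x > 0" by linarith
      then show ?thesis
      proof cases
        case 1
        have "((\<lambda>_. 0) has_real_derivative 0) (at x)" by simp
        then have "(f has_real_derivative 0) (at x)"
          by (rule has_field_derivative_transform_within_open[of _ _ _ "{..<0}"])
            (use 1 in \<open>auto simp: f_def\<close>)
        with 1 show ?thesis by (simp add: f'_def)
      next
        case 3
        have "((\<lambda>x. poly P (1 / x) * exp (- (1 / x))) has_real_derivative f' x) (at x)"
          using 3 by (auto intro!: derivative_eq_intros DERIV_chain2[OF poly_DERIV]
              simp: f'_def Q_def field_simps power2_eq_square)
        then show ?thesis
          by (rule has_field_derivative_transform_within_open[of _ _ _ "{0<..}"])
            (use 3 in \<open>auto simp: f_def\<close>)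
      next
        case 2
        \<comment> \<open>The right-hand difference quotient at 0 is y P(y) exp(-y) with y = 1/h,
          hence the extra factor y in \<open>pCons 0 P\<close>.\<close>
        have "((\<lambda>y. poly (pCons 0 P) y * exp (- y)) \<longlongrightarrow> 0) (at_top :: real filter)"
          by (rule poly_times_exp_tendsto_0)
        then have "((\<lambda>h. poly (pCons 0 P) (inverse h) * exp (- (inverse h))) \<longlongrightarrow> 0) (at_right (0::real))"
          by (rule filterlim_compose[OF _ filterlim_inverse_at_top_right])
        then have r: "((\<lambda>h. f h / h) \<longlongrightarrow> 0) (at_right 0)"
          by (rule Lim_transform_eventually)
            (auto simp: eventually_at_filter f_def field_simps)
        have l: "((\<lambda>h. f h / h) \<longlongrightarrow> 0) (at_left 0)"
          by (rule Lim_transform_eventually[of "\<lambda>_. 0"])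
            (auto simp: eventually_at_filter f_def)
        have "((\<lambda>h. f h / h) \<longlongrightarrow> 0) (at 0)"
          using l r by (simp add: filterlim_split_at_real)
        moreover have "f 0 = 0" by (simp add: f_def)
        ultimately show ?thesis
          using 2 \<open>f 0 = 0\<close> by (simp add: DERIV_def f'_def)
      qed
    qed
    moreover have "times_differentiable n f'"
      unfolding f'_def by (rule Suc.IH)
    ultimately show ?case unfolding f_def[symmetric] by auto
  qed simp
  from this[of _ "[:1:]"] show ?thesis by (simp add: smooth_real_def cong: if_cong)
qed

text \<open>The integral starts at c - 1 instead of c so that every x >= c lies in the interior of a
  slightly larger interval of integration; the derivative within it is then two-sided, and left of c
  the primitive is identically 0.\<close>

lemma antiderivative_of_vanishing:
  fixes k :: "real \<Rightarrow> real"
  assumes kc: "\<And>S. continuous_on S k" and kz: "\<And>x. x \<le> c \<Longrightarrow> k x = 0"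
  obtains K where "\<And>x. (K has_real_derivative k x) (at x)" "\<And>x. x \<le> c \<Longrightarrow> K x = 0"
proof -
  define K where "K = (\<lambda>x. integral {c-1..x} k)"
  have Kz: "K x = 0" if "x \<le> c" for x
    unfolding K_def using that kz by (intro integral_unique has_integral_is_0) auto
  have dK: "(K has_real_derivative k x) (at x)" for x
  proof (cases "x < c")
    case True
    have "((\<lambda>_. 0) has_real_derivative 0) (at x)" by simp
    then have "(K has_real_derivative 0) (at x)"
      by (rule has_field_derivative_transform_within_open[of _ _ _ "{..<c}"])
        (use True Kz in auto)
    with True kz show ?thesis by simp
  next
    case False
    have "(K has_real_derivative k x) (at x within {c-1..x+1})"
      unfolding K_def using False by (intro integral_has_real_derivative kc) auto
    moreover have "x \<in> interior {c-1..x+1}" using False by (simp add: interior_atLeastAtMost_real)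
    ultimately show ?thesis by (metis at_within_interior)
  qed
  with Kz that show ?thesis by blast
qed

text \<open>The step is the normalised primitive of the bump e(x-1) e(2-x). Monotonicity is recorded
  because it later forces the second derivative to vanish wherever the first does.\<close>

lemma smooth_step_exists:
  "\<exists>b. smooth_real b \<and> (\<forall>x\<le>1. b x = 0) \<and> (\<forall>x\<ge>2. b x = 1) \<and> (\<forall>x. 0 \<le> b x \<and> b x \<le> (1::real))
     \<and> (\<forall>x. 0 \<le> deriv b x)"
proof -
  define e where "e = (\<lambda>x::real. if x > 0 then exp (- (1 / x)) else 0)"
  define k where "k = (\<lambda>x::real. e (x - 1) * e (2 - x))"
  have se: "smooth_real e" unfolding e_def by (rule smooth_real_flat)
  have sk: "smooth_real k"
    using smooth_real_mult[OF smooth_real_affine[OF se, of 1 "-1"] smooth_real_affine[OF se, of "-1" 2]]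
    by (simp add: k_def[abs_def])
  have k0: "k x \<ge> 0" for x by (simp add: k_def e_def)
  have kpos: "k x > 0" if "1 < x" "x < 2" for x using that by (simp add: k_def e_def)
  have kz: "k x = 0" if "x \<le> 1 \<or> x \<ge> 2" for x using that by (auto simp: k_def e_def)
  have kc: "continuous_on S k" for S by (rule smooth_real_continuous[OF sk])
  obtain K where dK: "\<And>x. (K has_real_derivative k x) (at x)" and Kz: "\<And>x. x \<le> 1 \<Longrightarrow> K x = 0"
    using antiderivative_of_vanishing[of k 1] kc kz by blast
  have K2: "K 1 < K 2"
  proof (rule DERIV_pos_imp_increasing_open[where f = K])
    show "\<exists>y. (K has_real_derivative y) (at x) \<and> 0 < y" if "1 < x" "x < 2" for x
      using dK kpos that by blast
    show "continuous_on {1..2} K"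
      using dK by (meson DERIV_isCont continuous_at_imp_continuous_on)
  qed simp
  then have K2p: "K 2 > 0" using Kz by simp
  have mono: "K x \<le> K y" if "x \<le> y" for x y
    using that dK k0 by (intro DERIV_nonneg_imp_nondecreasing[of x y K]) auto
  have K2': "K x = K 2" if "x \<ge> 2" for x
  proof (cases "x = 2")
    case False
    have "K x = K 2"
    proof (rule DERIV_isconst_end[where f = K])
      show "continuous_on {2..x} K"
        using dK by (meson DERIV_isCont continuous_at_imp_continuous_on)
      show "(K has_real_derivative 0) (at y)" if "2 < y" "y < x" for y
        using dK[of y] kz[of y] that by simp
    qed (use that False in auto)
    then show ?thesis .
  qed simp
  define b where "b = (\<lambda>x. (1 / K 2) * K x)"
  have db: "(b has_real_derivative (1 / K 2) * k x) (at x)" for x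
    unfolding b_def by (intro DERIV_cmult dK)
  have "smooth_real b"
    by (rule smooth_realI[OF db]) (intro smooth_real_mult smooth_real_const sk)
  moreover have "0 \<le> b x \<and> b x \<le> 1" for x
  proof -
    have "K (min x 0) \<le> K x" "K x \<le> K (max x 2)" by (intro mono; simp)+
    then show ?thesis
      using K2p K2'[of "max x 2"] Kz[of "min x 0"] by (simp add: b_def field_simps)
  qed
  moreover have "deriv b x \<ge> 0" for x
    using DERIV_imp_deriv[OF db[of x]] k0[of x] K2p by simp
  moreover have "b x = 0" if "x \<le> 1" for x using Kz[OF that] by (simp add: b_def)
  moreover have "b x = 1" if "x \<ge> 2" for x
    unfolding b_def K2'[OF that] using K2p by simp
  ultimately show ?thesis by blast
qed

section \<open>Test functions of product form\<close>

text \<open>The transition takes place in [1,2] and not at 0, so that \<open>step (n * x)\<close>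
  vanishes for x <= 1/n, that is, on a full neighbourhood of the half line x <= 0. This is what
  makes the cut-offs compactly supported in open intervals.\<close>

definition step :: "real \<Rightarrow> real" where
  "step = (SOME b. smooth_real b \<and> (\<forall>x\<le>1. b x = 0) \<and> (\<forall>x\<ge>2. b x = 1) \<and> (\<forall>x. 0 \<le> b x \<and> b x \<le> 1)
     \<and> (\<forall>x. 0 \<le> deriv b x))"

lemma step_properties:
  "smooth_real step \<and> (\<forall>x\<le>1. step x = 0) \<and> (\<forall>x\<ge>2. step x = 1) \<and> (\<forall>x. 0 \<le> step x \<and> step x \<le> 1)
     \<and> (\<forall>x. 0 \<le> deriv step x)"
  unfolding step_def by (rule someI_ex[OF smooth_step_exists])

lemma smooth_real_step: "smooth_real step"
  and step_eq_0: "x \<le> 1 \<Longrightarrow> step x = 0"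
  and step_eq_1: "x \<ge> 2 \<Longrightarrow> step x = 1"
  and step_nonneg: "0 \<le> step x"
  and step_le_1: "step x \<le> 1"
  and deriv_step_nonneg: "0 \<le> deriv step x"
  using step_properties by blast+

lemma deriv_step_outside: "x < 1 \<or> x > 2 \<Longrightarrow> deriv step x = 0"
proof -
  assume "x < 1 \<or> x > 2"
  then have "(step has_real_derivative 0) (at x)"
  proof
    assume "x < 1"
    show ?thesis
      by (rule has_field_derivative_transform_within_open[of "\<lambda>_. 0" 0 x "{..<1}"])
        (use \<open>x < 1\<close> in \<open>auto simp: step_eq_0\<close>)
  next
    assume "x > 2"
    show ?thesis
      by (rule has_field_derivative_transform_within_open[of "\<lambda>_. 1" 0 x "{2<..}"])
        (use \<open>x > 2\<close> in \<open>auto simp: step_eq_1\<close>)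
  qed
  then show ?thesis by (rule DERIV_imp_deriv)
qed

lemma bounded_derivs_step: "\<exists>C\<ge>0. \<forall>x. \<bar>deriv step x\<bar> \<le> C \<and> \<bar>deriv (deriv step) x\<bar> \<le> C"
proof -
  have s1: "smooth_real (deriv step)" and s2: "smooth_real (deriv (deriv step))"
    by (intro smooth_real_deriv smooth_real_step)+
  have bd: "\<exists>C. \<forall>x\<in>{0..3}. \<bar>f x\<bar> \<le> C" if "smooth_real f" for f
    using compact_imp_bounded[OF compact_continuous_image[OF smooth_real_continuous[OF that] compact_Icc[of 0 3]]]
    by (auto simp: bounded_iff)
  obtain C1 where C1: "\<And>x. x \<in> {0..3} \<Longrightarrow> \<bar>deriv step x\<bar> \<le> C1" using bd[OF s1] by blast
  obtain C2 where C2: "\<And>x. x \<in> {0..3} \<Longrightarrow> \<bar>deriv (deriv step) x\<bar> \<le> C2" using bd[OF s2] by blast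
  have z: "deriv (deriv step) x = 0" if "x < 1 \<or> x > 2" for x
  proof -
    have "(deriv step has_real_derivative 0) (at x)"
      using that
    proof
      assume "x < 1"
      show ?thesis
        by (rule has_field_derivative_transform_within_open[of "\<lambda>_. 0" 0 x "{..<1}"])
          (use \<open>x < 1\<close> in \<open>auto simp: deriv_step_outside\<close>)
    next
      assume "x > 2"
      show ?thesis
        by (rule has_field_derivative_transform_within_open[of "\<lambda>_. 0" 0 x "{2<..}"])
          (use \<open>x > 2\<close> in \<open>auto simp: deriv_step_outside\<close>)
    qed
    then show ?thesis by (rule DERIV_imp_deriv)
  qed
  have "\<bar>deriv step x\<bar> \<le> max C1 C2 \<and> \<bar>deriv (deriv step) x\<bar> \<le> max C1 C2" for x
  proof (cases "x \<in> {0..3}")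
    case True
    then show ?thesis using C1[of x] C2[of x] by auto
  next
    case False
    moreover have "max C1 C2 \<ge> 0" using C1[of 0] by auto
    ultimately show ?thesis using deriv_step_outside[of x] z[of x] by auto
  qed
  moreover have "max C1 C2 \<ge> 0" using C1[of 0] by auto
  ultimately show ?thesis by blast
qed

text \<open>Compact support is expressed by a compact interval inside S. The interval may be empty,
  which covers the zero function.\<close>

definition test_real :: "real set \<Rightarrow> (real \<Rightarrow> real) \<Rightarrow> bool" where
  "test_real S p \<longleftrightarrow> smooth_real p \<and> (\<exists>c d. {c..d} \<subseteq> S \<and> (\<forall>x. x \<notin> {c..d} \<longrightarrow> p x = 0))"

lemma test_real_smooth: "test_real S p \<Longrightarrow> smooth_real p"
  by (simp add: test_real_def)

lemma test_real_outside: "test_real S p \<Longrightarrow> x \<notin> S \<Longrightarrow> p x = 0"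
  unfolding test_real_def by blast

lemma test_real_deriv:
  assumes "test_real S p" shows "test_real S (deriv p)"
proof -
  obtain c d where cd: "{c..d} \<subseteq> S" "\<And>x. x \<notin> {c..d} \<Longrightarrow> p x = 0"
    using assms by (auto simp: test_real_def)
  have "deriv p x = 0" if "x \<notin> {c..d}" for x
  proof (rule DERIV_imp_deriv)
    show "(p has_real_derivative 0) (at x)"
      by (rule has_field_derivative_transform_within_open[of "\<lambda>_. 0" 0 x "- {c..d}"])
        (use that cd in \<open>auto simp: open_Compl\<close>)
  qed
  then show ?thesis
    using cd assms smooth_real_deriv by (auto simp: test_real_def)
qed

lemma test_real_mult:
  assumes "test_real S p" "smooth_real q" shows "test_real S (\<lambda>x. q x * p x)"
proof -
  obtain c d where cd: "{c..d} \<subseteq> S" "\<forall>x. x \<notin> {c..d} \<longrightarrow> p x = 0"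
    using assms by (auto simp: test_real_def)
  have "smooth_real (\<lambda>x. q x * p x)" by (intro smooth_real_mult assms test_real_smooth[of S p])
  then show ?thesis using cd unfolding test_real_def by auto
qed

lemma test_real_bounded:
  assumes "test_real S p" shows "\<exists>C\<ge>0. \<forall>x. \<bar>p x\<bar> \<le> C"
proof -
  obtain c d where cd: "{c..d} \<subseteq> S" "\<And>x. x \<notin> {c..d} \<Longrightarrow> p x = 0"
    using assms by (auto simp: test_real_def)
  obtain C where C: "\<And>x. x \<in> {c..d} \<Longrightarrow> \<bar>p x\<bar> \<le> C"
    using compact_imp_bounded[OF compact_continuous_image[OF smooth_real_continuous[OF
          test_real_smooth[OF assms]] compact_Icc[of c d]]]
    unfolding bounded_iff by (metis image_eqI real_norm_def)
  have "\<bar>p x\<bar> \<le> max C 0" for x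
    using C[of x] cd(2)[of x] by (cases "x \<in> {c..d}") auto
  then show ?thesis by (intro exI[of _ "max C 0"]) auto
qed

text \<open>A smooth approximation from below to the indicator of the open interval (c, d). It is
  identically 0 for n = 0, and for n > 0 as long as 2/n exceeds d - c.\<close>

definition window :: "real \<Rightarrow> real \<Rightarrow> nat \<Rightarrow> real \<Rightarrow> real" where
  "window c d n x = step (real n * (x - c)) * step (real n * (d - x))"

lemma smooth_real_window: "smooth_real (window c d n)"
proof -
  have "smooth_real (\<lambda>x. step (real n * x + (- (real n * c))) * step ((- real n) * x + real n * d))"
    by (intro smooth_real_mult smooth_real_affine smooth_real_step)
  then show ?thesis by (simp add: window_def[abs_def] algebra_simps)
qed

lemma window_nonneg: "0 \<le> window c d n x" and window_le_1: "window c d n x \<le> 1"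
  using step_nonneg step_le_1 by (auto simp: window_def intro!: mult_le_one)

lemma window_outside:
  assumes "x \<notin> {c + 1 / real n..d - 1 / real n}"
  shows "window c d n x = 0"
proof (cases "n = 0")
  case False
  then have "real n * (x - c) \<le> 1 \<or> real n * (d - x) \<le> 1"
    using assms by (auto simp: field_simps)
  then show ?thesis by (auto simp: window_def step_eq_0)
qed (simp add: window_def step_eq_0)

lemma test_real_window:
  assumes "{c<..<d} \<subseteq> S" "n > 0" shows "test_real S (window c d n)"
proof -
  have "{c + 1 / real n..d - 1 / real n} \<subseteq> {c<..<d}"
  proof
    fix x assume x: "x \<in> {c + 1 / real n..d - 1 / real n}"
    have "1 / real n > 0" using assms(2) by simp
    with x show "x \<in> {c<..<d}" unfolding atLeastAtMost_iff greaterThanLessThan_iff by linarith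
  qed
  then show ?thesis
    using assms(1) window_outside smooth_real_window unfolding test_real_def by blast
qed

lemma window_tendsto: "(\<lambda>n. window c d n x) \<longlonglongrightarrow> indicator {c<..<d} x"
proof (cases "x \<in> {c<..<d}")
  case True
  have "eventually (\<lambda>n. real n \<ge> 2 / (x - c) \<and> real n \<ge> 2 / (d - x)) sequentially"
    by (intro eventually_conj eventually_sequentiallyI[of "nat \<lceil>2 / (x - c)\<rceil>"]
        eventually_sequentiallyI[of "nat \<lceil>2 / (d - x)\<rceil>"]) linarith+
  then have "eventually (\<lambda>n. window c d n x = 1) sequentially"
    by eventually_elim (use True in \<open>auto simp: window_def step_eq_1 field_simps\<close>)
  then show ?thesis using True by (simp add: tendsto_eventually)
next
  case False
  have "window c d n x = 0" for n
  proof (cases "n = 0")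
    case True
    then show ?thesis by (simp add: window_def step_eq_0)
  next
    case n: False
    show ?thesis
    proof (rule window_outside, rule notI)
      assume x: "x \<in> {c + 1 / real n..d - 1 / real n}"
      have "1 / real n > 0" using n by simp
      with x False show False
        unfolding atLeastAtMost_iff greaterThanLessThan_iff by linarith
    qed
  qed
  then show ?thesis using False by simp
qed

text \<open>Products are the only test functions used: their partial derivatives act on one factor
  at a time, they exhaust boxes, and the weight \<phi> is itself of this form on the domain.\<close>

definition tensor :: "(real \<Rightarrow> real) \<Rightarrow> (real \<Rightarrow> real) \<Rightarrow> (real \<Rightarrow> real) \<Rightarrow> real^3 \<Rightarrow> real" where
  "tensor p q r x = p (x$1) * q (x$2) * r (x$3)"

lemma tensor_has_derivative:
  assumes "smooth_real p" "smooth_real q" "smooth_real r"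
  shows "(tensor p q r has_derivative
     (\<lambda>h. deriv p (x$1) * h$1 * q (x$2) * r (x$3) + p (x$1) * (deriv q (x$2) * h$2) * r (x$3)
        + p (x$1) * q (x$2) * (deriv r (x$3) * h$3))) (at x)"
proof -
  have c: "((\<lambda>x. f (x$i)) has_derivative (\<lambda>h. deriv f (x$i) * h$i)) (at x)"
    if "smooth_real f" for f and i :: 3
    using has_derivative_compose[OF bounded_linear.has_derivative[OF bounded_linear_vec_nth[of i] has_derivative_ident]
        smooth_real_deriv(2)[OF that, of "x$i", unfolded has_field_derivative_def]] by simp
  show ?thesis
    unfolding tensor_def[abs_def]
    by (rule derivative_eq_intros c assms refl)+ (auto simp: algebra_simps fun_eq_iff)
qed

lemma partial_deriv_tensor:
  assumes "smooth_real p" "smooth_real q" "smooth_real r"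
  shows "partial_deriv 1 (tensor p q r) = tensor (deriv p) q r"
    and "partial_deriv 2 (tensor p q r) = tensor p (deriv q) r"
    and "partial_deriv 3 (tensor p q r) = tensor p q (deriv r)"
  using frechet_derivative_at[OF tensor_has_derivative[OF assms], symmetric]
  by (auto simp: partial_deriv_def fun_eq_iff tensor_def axis_def)

lemma multi_deriv_tensor:
  assumes "smooth_real p" "smooth_real q" "smooth_real r"
  shows "multi_deriv \<alpha> (tensor p q r) = tensor ((deriv ^^ (\<alpha>$1)) p) ((deriv ^^ (\<alpha>$2)) q) ((deriv ^^ (\<alpha>$3)) r)"
proof -
  note hd = smooth_real_higher_deriv
  have 3: "(partial_deriv 3 ^^ k) (tensor p q r) = tensor p q ((deriv ^^ k) r)" for k
    by (induction k) (auto simp: partial_deriv_tensor assms hd)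
  have 2: "(partial_deriv 2 ^^ k) (tensor p q r') = tensor p ((deriv ^^ k) q) r'"
    if "smooth_real r'" for k r'
    by (induction k) (auto simp: partial_deriv_tensor assms hd that)
  have 1: "(partial_deriv 1 ^^ k) (tensor p q' r') = tensor ((deriv ^^ k) p) q' r'"
    if "smooth_real r'" "smooth_real q'" for k r' q'
    by (induction k) (auto simp: partial_deriv_tensor assms hd that)
  show ?thesis
    by (simp add: multi_deriv_def 1 2 3 hd assms)
qed

lemma test_function_tensor:
  assumes "test_real {0<..<a} p" "test_real {0<..<a} q" "test_real {0<..} r"
  shows "test_function (domain a) (tensor p q r)"
proof -
  obtain c d where p: "{c..d} \<subseteq> {0<..<a}" "\<And>x. x \<notin> {c..d} \<Longrightarrow> p x = 0"
    using assms(1) by (auto simp: test_real_def)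
  obtain c' d' where q: "{c'..d'} \<subseteq> {0<..<a}" "\<And>x. x \<notin> {c'..d'} \<Longrightarrow> q x = 0"
    using assms(2) by (auto simp: test_real_def)
  obtain c'' d'' where r: "{c''..d''} \<subseteq> {0<..}" "\<And>x. x \<notin> {c''..d''} \<Longrightarrow> r x = 0"
    using assms(3) by (auto simp: test_real_def)
  define K where "K = cbox (vector [c, c', c'']) (vector [d, d', d''] :: real^3)"
  have K: "x \<in> K \<longleftrightarrow> x$1 \<in> {c..d} \<and> x$2 \<in> {c'..d'} \<and> x$3 \<in> {c''..d''}" for x
    by (auto simp: K_def mem_box_cart forall_3)
  have sub: "{x. tensor p q r x \<noteq> 0} \<subseteq> K"
  proof
    fix x assume "x \<in> {x. tensor p q r x \<noteq> 0}"
    then have "p (x$1) \<noteq> 0" "q (x$2) \<noteq> 0" "r (x$3) \<noteq> 0" by (auto simp: tensor_def)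
    then show "x \<in> K" unfolding K using p(2) q(2) r(2) by blast
  qed
  have cl: "closure {x. tensor p q r x \<noteq> 0} \<subseteq> K"
    by (rule closure_minimal[OF sub]) (simp add: K_def closed_cbox)
  have "smooth (tensor p q r)"
    unfolding smooth_def
  proof (intro allI)
    fix \<alpha> x
    note sm = assms[THEN test_real_smooth]
    show "multi_deriv \<alpha> (tensor p q r) differentiable at x"
      unfolding multi_deriv_tensor[OF sm]
      by (rule differentiableI, rule tensor_has_derivative; rule smooth_real_higher_deriv; rule sm)
  qed
  moreover have "compact (closure {x. tensor p q r x \<noteq> 0})"
    using bounded_subset[OF bounded_cbox sub[unfolded K_def]] by (simp add: compact_closure)
  moreover have "K \<subseteq> domain a"
  proof
    fix x assume "x \<in> K"
    then have "x$1 \<in> {0<..<a}" "x$2 \<in> {0<..<a}" "x$3 \<in> {0<..}"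
      using p q r K by blast+
    then show "x \<in> domain a" by (auto simp: domain_def)
  qed
  ultimately show ?thesis
    using cl by (auto simp: test_function_def)
qed

section \<open>Uniqueness of weak derivatives\<close>

text \<open>The sets on which h integrates to 0 form a Dynkin system, and the open boxes are an
  intersection-stable generator of the Borel sets. Complements require the integral over the whole
  space, which is obtained from growing boxes.\<close>

lemma AE_zero_of_box_integrals_zero:
  fixes h :: "'a::euclidean_space \<Rightarrow> real"
  assumes int: "integrable lborel h"
    and box: "\<And>c d. (LINT x:box c d|lborel. h x) = 0"
  shows "AE x in lborel. h x = 0"
proof (rule sigma_finite_measure.density_zero[OF sigma_finite_lborel int])
  let ?E = "range (\<lambda>(c, d). box c d :: 'a set)"
  have setI: "set_integrable lborel A h" if "A \<in> sets borel" for A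
    using integrable_mult_indicator[OF _ int, of A] that by (simp add: set_integrable_def)
  have tot: "(LINT x|lborel. h x) = 0"
  proof -
    have "(\<lambda>n. LINT x:box (- (real n *\<^sub>R One)) (real n *\<^sub>R One)|lborel. h x) \<longlonglongrightarrow> (LINT x|lborel. h x)"
      unfolding set_lebesgue_integral_def
    proof (rule integral_dominated_convergence[where w = "\<lambda>x. norm (h x)"])
      show "AE x in lborel. (\<lambda>n. indicator (box (- (real n *\<^sub>R One)) (real n *\<^sub>R One)) x *\<^sub>R h x) \<longlonglongrightarrow> h x"
      proof (rule AE_I2)
        fix x :: 'a
        obtain n where n: "x \<in> box (- (real n *\<^sub>R One)) (real n *\<^sub>R One)"
          using UN_box_eq_UNIV[where 'a='a] by blast
        have "x \<in> box (- (real m *\<^sub>R One)) (real m *\<^sub>R One)" if "m \<ge> n" for m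
        proof -
          have "real m \<ge> real n" using that by simp
          then show ?thesis using n by (fastforce simp: box_def)
        qed
        then have "eventually (\<lambda>m. indicator (box (- (real m *\<^sub>R One)) (real m *\<^sub>R One)) x *\<^sub>R h x = h x) sequentially"
          by (intro eventually_sequentiallyI[of n]) simp
        then show "(\<lambda>m. indicator (box (- (real m *\<^sub>R One)) (real m *\<^sub>R One)) x *\<^sub>R h x) \<longlonglongrightarrow> h x"
          by (rule tendsto_eventually)
      qed
    qed (use int in \<open>auto simp: indicator_def\<close>)
    then show ?thesis using box by (simp add: LIMSEQ_const_iff)
  qed
  fix A :: "'a set" assume "A \<in> sets lborel"
  then have AE: "A \<in> sigma_sets UNIV ?E"
    by (simp add: borel_eq_box)
  have stable: "Int_stable ?E"
    by (fastforce simp: Int_stable_def box_Int_box)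
  have sub: "?E \<subseteq> Pow UNIV" by simp
  from stable sub AE show "(LINT x:A|lborel. h x) = 0"
  proof (induction rule: sigma_sets_induct_disjoint)
    case (basic A)
    then show ?case using box by auto
  next
    case empty
    show ?case by (simp add: set_lebesgue_integral_def)
  next
    case (compl A)
    have A: "A \<in> sets borel" using compl.hyps by (simp add: borel_eq_box)
    have "(LINT x:A \<union> (UNIV - A)|lborel. h x) = (LINT x:A|lborel. h x) + (LINT x:UNIV - A|lborel. h x)"
      by (intro set_integral_Un setI) (use A in auto)
    then show ?case using compl.IH tot by (simp add: set_lebesgue_integral_def)
  next
    case (union A)
    have A: "A i \<in> sets borel" for i using union.hyps by (auto simp: borel_eq_box)
    have "(LINT x:(\<Union>i. A i)|lborel. h x) = (\<Sum>i. LINT x:A i|lborel. h x)"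
      using union.hyps A
      by (intro lebesgue_integral_countable_add setI) (auto simp: disjoint_family_on_def intro!: sets.countable_UN)
    then show ?case using union.IH by simp
  qed
qed

text \<open>Fubini's theorem and image measures are applied to Borel functions, while the data are
  only Lebesgue measurable; representatives are exchanged here.\<close>

lemma lebesgue_integrable_borel_version:
  fixes f :: "'a::euclidean_space \<Rightarrow> real"
  assumes "integrable lebesgue f"
  obtains g where "integrable lborel g" "AE x in lebesgue. f x = g x" "g \<in> borel_measurable borel"
proof -
  obtain g where g: "g \<in> borel_measurable lborel" "AE x in lborel. f x = g x"
    using completion_ex_borel_measurable_real[of f lborel] assms by auto
  then have AE: "AE x in lebesgue. f x = g x" by (simp add: AE_completion)
  have gl: "g \<in> borel_measurable lebesgue" using g(1) by (simp add: measurable_completion)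
  have "integrable lebesgue g"
    using assms integrable_cong_AE[OF borel_measurable_integrable[OF assms] gl AE] by simp
  then have "integrable lborel g" using g(1) integrable_completion by blast
  with AE g(1) that show ?thesis by simp
qed

lemma domain_open: "open (domain a)"
proof -
  have "domain a = {x. 0 < x$1} \<inter> {x. x$1 < a} \<inter> {x. 0 < x$2} \<inter> {x. x$2 < a} \<inter> {x. 0 < x$3}"
    by (auto simp: domain_def)
  then show ?thesis
    by (simp add: open_Int open_halfspace_component_gt_cart open_halfspace_component_lt_cart)
qed

lemma domain_lebesgue [measurable, simp]: "domain a \<in> sets lebesgue" "domain a \<in> sets borel"
  using domain_open by auto

lemma integrable_domain_iff:
  "integrable (lebesgue_on (domain a)) f \<longleftrightarrow> integrable lebesgue (\<lambda>x. indicator (domain a) x * f x)"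
  for f :: "real^3 \<Rightarrow> real"
  by (subst integrable_restrict_space) auto

lemma integral_domain_eq:
  "integral\<^sup>L (lebesgue_on (domain a)) f = (LINT x|lebesgue. indicator (domain a) x * f x)"
  for f :: "real^3 \<Rightarrow> real"
  by (subst integral_restrict_space) auto

lemma AE_domain_iff:
  "(AE x in lebesgue_on (domain a). P x) \<longleftrightarrow> (AE x in lebesgue. x \<in> domain a \<longrightarrow> P x)"
  by (simp add: AE_restrict_space_iff)

definition tensor_window :: "real^3 \<Rightarrow> real^3 \<Rightarrow> nat \<Rightarrow> real^3 \<Rightarrow> real" where
  "tensor_window c d n = tensor (window (c$1) (d$1) n) (window (c$2) (d$2) n) (window (c$3) (d$3) n)"

lemma tensor_window_tendsto: "(\<lambda>n. tensor_window c d n x) \<longlonglongrightarrow> indicator (box c d) x"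
proof -
  have "(\<lambda>n. tensor_window c d n x) \<longlonglongrightarrow> indicator {c$1<..<d$1} (x$1) * indicator {c$2<..<d$2} (x$2) * indicator {c$3<..<d$3} (x$3)"
    unfolding tensor_window_def tensor_def by (intro tendsto_mult window_tendsto)
  moreover have "indicator {c$1<..<d$1} (x$1) * indicator {c$2<..<d$2} (x$2) * indicator {c$3<..<d$3} (x$3) = (indicator (box c d) x :: real)"
    by (auto simp: indicator_def mem_box_cart forall_3)
  ultimately show ?thesis by simp
qed

lemma tensor_window_bounds: "0 \<le> tensor_window c d n x" "tensor_window c d n x \<le> 1"
  unfolding tensor_window_def tensor_def
  by (intro mult_nonneg_nonneg mult_le_one window_nonneg window_le_1)+

lemma tensor_window_outside: "x \<notin> box c d \<Longrightarrow> tensor_window c d n x = 0"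
proof -
  have w: "window k l n y = 0" if "y \<notin> {k<..<l}" for k l y
  proof (cases "n = 0")
    case True
    then show ?thesis by (simp add: window_def step_eq_0)
  next
    case n: False
    show ?thesis
    proof (rule window_outside, rule notI)
      assume y: "y \<in> {k + 1 / real n..l - 1 / real n}"
      have "1 / real n > 0" using n by simp
      with y that show False
        unfolding atLeastAtMost_iff greaterThanLessThan_iff by linarith
    qed
  qed
  assume "x \<notin> box c d"
  then have "x$1 \<notin> {c$1<..<d$1} \<or> x$2 \<notin> {c$2<..<d$2} \<or> x$3 \<notin> {c$3<..<d$3}"
    by (auto simp: mem_box_cart forall_3)
  then show ?thesis using w by (auto simp: tensor_window_def tensor_def simp del: greaterThanLessThan_iff)
qed

lemma tensor_continuous:
  assumes "smooth_real p" "smooth_real q" "smooth_real r"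
  shows "continuous_on S (tensor p q r)"
  using tensor_has_derivative[OF assms] has_derivative_continuous
  by (blast intro: continuous_at_imp_continuous_on)

lemma tensor_measurable [measurable]:
  assumes "smooth_real p" "smooth_real q" "smooth_real r"
  shows "tensor p q r \<in> borel_measurable borel"
  by (rule borel_measurable_continuous_onI[OF tensor_continuous[OF assms]])

lemma tensor_window_continuous: "continuous_on S (tensor_window c d n)"
  unfolding tensor_window_def by (intro tensor_continuous smooth_real_window)

lemma tensor_window_measurable [measurable]: "tensor_window c d n \<in> borel_measurable borel"
  by (rule borel_measurable_continuous_onI[OF tensor_window_continuous])

lemma integral_tensor_window_tendsto:
  assumes "integrable lebesgue h"
  shows "(\<lambda>n. LINT x|lebesgue. h x * tensor_window c d n x) \<longlonglongrightarrow> (LINT x|lebesgue. h x * indicator (box c d) x)"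
proof (rule integral_dominated_convergence[where w = "\<lambda>x. norm (h x)"])
  show "AE x in lebesgue. (\<lambda>n. h x * tensor_window c d n x) \<longlonglongrightarrow> h x * indicator (box c d) x"
    by (intro AE_I2 tendsto_intros tensor_window_tendsto)
  show "AE x in lebesgue. norm (h x * tensor_window c d n x) \<le> norm (h x)" for n
    using tensor_window_bounds by (intro AE_I2) (auto simp: abs_mult intro!: mult_left_le)
  have m: "h \<in> borel_measurable lebesgue" "tensor_window c d n \<in> borel_measurable lebesgue" for n
    using assms by (simp_all add: measurable_completion)
  show "(\<lambda>x. h x * indicator (box c d) x) \<in> borel_measurable lebesgue"
    "(\<lambda>x. h x * tensor_window c d n x) \<in> borel_measurable lebesgue" for n
    by (intro borel_measurable_times m borel_measurable_indicator; simp)+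
qed (use assms in auto)

text \<open>The fundamental lemma of the calculus of variations; the test functions \<^term>\<open>tensor_window c d n\<close>
  exhaust the boxes contained in the domain.\<close>

lemma AE_zero_of_test_integrals_zero:
  assumes loc: "locally_integrable (domain a) h"
    and test: "\<And>p q r. test_real {0<..<a} p \<Longrightarrow> test_real {0<..<a} q \<Longrightarrow> test_real {0<..} r \<Longrightarrow>
       (LINT x|lebesgue_on (domain a). h x * tensor p q r x) = 0"
  shows "AE x in lebesgue_on (domain a). h x = 0"
proof -
  \<comment> \<open>Compact boxes exhausting the domain; the upper face in the third direction
    recedes to infinity because the domain is unbounded.\<close>
  define l where "l m = (vector [1 / real (Suc m), 1 / real (Suc m), 1 / real (Suc m)] :: real^3)" for m
  define u where "u m = (vector [a - 1 / real (Suc m), a - 1 / real (Suc m), real (Suc m)] :: real^3)" for m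
  have lu: "cbox (l m) (u m) \<subseteq> domain a" for m
  proof
    fix x assume x: "x \<in> cbox (l m) (u m)"
    have "1 / real (Suc m) > 0" by simp
    with x show "x \<in> domain a"
      unfolding mem_box_cart forall_3 l_def u_def domain_def vector_3 mem_Collect_eq by linarith
  qed
  have "AE x in lebesgue. x \<in> box (l m) (u m) \<longrightarrow> h x = 0" for m
  proof -
    define H where "H = (\<lambda>x. indicator (box (l m) (u m)) x * h x)"
    have "integrable (lebesgue_on (cbox (l m) (u m))) h"
      using loc lu by (auto simp: locally_integrable_def)
    then have "integrable lebesgue (\<lambda>x. indicator (cbox (l m) (u m)) x *\<^sub>R h x)"
      by (simp add: integrable_restrict_space)
    then have "integrable lebesgue (\<lambda>x. indicator (box (l m) (u m)) x *\<^sub>R (indicator (cbox (l m) (u m)) x *\<^sub>R h x))"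
      by (rule integrable_mult_indicator[rotated]) auto
    moreover have "indicator (box (l m) (u m)) x *\<^sub>R (indicator (cbox (l m) (u m)) x *\<^sub>R h x) = H x" for x
      using box_subset_cbox[of "l m" "u m"] by (auto simp: H_def indicator_def)
    ultimately have H: "integrable lebesgue H" by simp
    obtain g where g: "integrable lborel g" "AE x in lebesgue. H x = g x" "g \<in> borel_measurable borel"
      using lebesgue_integrable_borel_version[OF H] .
    have "AE x in lborel. g x = 0"
    proof (rule AE_zero_of_box_integrals_zero[OF g(1)])
      fix c d :: "real^3"
      obtain c' d' where cd: "box c d \<inter> box (l m) (u m) = box c' d'"
        using box_Int_box by blast
      have z: "(LINT x|lebesgue. H x * tensor_window c' d' n x) = 0" if "n > 0" for n
      proof (cases "box c' d' = {}")
        case True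
        then show ?thesis using tensor_window_outside[of _ c' d'] by simp
      next
        case False
        have sub: "box c' d' \<subseteq> domain a" using cd lu box_subset_cbox by blast
        \<comment> \<open>The edges of a nonempty box are its coordinate projections, so the
          inclusion of the box in the domain yields the inclusions needed for one-variable test
          functions.\<close>
        have iv: "{c'$i<..<d'$i} \<subseteq> (\<lambda>x. x$i) ` box c' d'" for i
        proof
          fix t assume t: "t \<in> {c'$i<..<d'$i}"
          obtain x where x: "x \<in> box c' d'" using False by blast
          have "(\<chi> j. if j = i then t else x$j) \<in> box c' d'"
            using x t by (auto simp: mem_box_cart)
          then show "t \<in> (\<lambda>x. x$i) ` box c' d'" by (rule rev_image_eqI) simp
        qed
        have "(\<lambda>x. x$1) ` box c' d' \<subseteq> {0<..<a}" "(\<lambda>x. x$2) ` box c' d' \<subseteq> {0<..<a}"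
          "(\<lambda>x. x$3) ` box c' d' \<subseteq> {0<..}"
          using sub by (auto simp: domain_def)
        from this[THEN order_trans[OF iv]]
        have "{c'$1<..<d'$1} \<subseteq> {0<..<a}" "{c'$2<..<d'$2} \<subseteq> {0<..<a}" "{c'$3<..<d'$3} \<subseteq> {0<..}"
          by blast+
        then have "0 = (LINT x|lebesgue_on (domain a). h x * tensor_window c' d' n x)"
          unfolding tensor_window_def using that
          by (intro test[symmetric] test_real_window)
        also have "\<dots> = (LINT x|lebesgue. H x * tensor_window c' d' n x)"
          unfolding integral_domain_eq
        proof (intro Bochner_Integration.integral_cong refl)
          fix x show "indicator (domain a) x * (h x * tensor_window c' d' n x) = H x * tensor_window c' d' n x"
            using tensor_window_outside[of x c' d' n] sub cd
            by (cases "x \<in> box c' d'") (auto simp: H_def indicator_def)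
        qed
        finally show ?thesis ..
      qed
      have "(\<lambda>n. LINT x|lebesgue. H x * tensor_window c' d' n x) \<longlonglongrightarrow> 0"
        by (rule tendsto_eventually, rule eventually_sequentiallyI[of 1]) (simp add: z)
      with integral_tensor_window_tendsto[OF H, of c' d']
      have 0: "(LINT x|lebesgue. H x * indicator (box c' d') x) = 0"
        using LIMSEQ_unique by blast
      have "(LINT x:box c d|lborel. g x) = (LINT x|lebesgue. indicator (box c d) x * g x)"
        unfolding set_lebesgue_integral_def using g(3) by (subst integral_completion) auto
      also have "\<dots> = (LINT x|lebesgue. H x * indicator (box c' d') x)"
      proof (rule integral_cong_AE)
        show "AE x in lebesgue. indicator (box c d) x * g x = H x * indicator (box c' d') x"
          using g(2) by eventually_elim (auto simp: H_def cd[symmetric] indicator_def)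
        show "(\<lambda>x. indicator (box c d) x * g x) \<in> borel_measurable lebesgue"
          using g(3) by (intro measurable_completion borel_measurable_times) auto
        show "(\<lambda>x. H x * indicator (box c' d') x) \<in> borel_measurable lebesgue"
          using H by (intro borel_measurable_times borel_measurable_indicator) auto
      qed
      finally show "(LINT x:box c d|lborel. g x) = 0" using 0 by simp
    qed
    then have "AE x in lebesgue. g x = 0" by (rule AE_completion)
    with g(2) show ?thesis
      by eventually_elim (auto simp: H_def)
  qed
  then have "AE x in lebesgue. \<forall>m. x \<in> box (l m) (u m) \<longrightarrow> h x = 0"
    unfolding AE_all_countable by blast
  then show ?thesis
    unfolding AE_domain_iff
  proof eventually_elim
    case (elim x)
    show ?case
    proof
      assume x: "x \<in> domain a"
      \<comment> \<open>The distance of x to the nearest face; a box with margin smaller than e and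
        top above x contains x.\<close>
      define e where "e = Min {x$1, a - x$1, x$2, a - x$2, x$3}"
      have e: "e > 0" "e \<le> x$1" "e \<le> a - x$1" "e \<le> x$2" "e \<le> a - x$2" "e \<le> x$3"
        using x by (auto simp: e_def domain_def)
      obtain m where m: "real (Suc m) > max (1 / e) (x$3)"
        using reals_Archimedean2[of "max (1 / e) (x$3)"] by (metis less_trans lessI of_nat_less_iff)
      then have "1 / real (Suc m) < e" using e(1) by (simp add: field_simps)
      then have "x \<in> box (l m) (u m)"
        unfolding mem_box_cart forall_3 l_def u_def vector_3 using e m by simp
      with elim show "h x = 0" by blast
    qed
  qed
qed

section \<open>Square integrable functions on the domain\<close>

abbreviation dom_measure :: "real \<Rightarrow> (real^3) measure" where
  "dom_measure a \<equiv> lebesgue_on (domain a)"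

definition sq_int :: "real \<Rightarrow> (real^3 \<Rightarrow> real) \<Rightarrow> real" where
  "sq_int a f = (LINT x|dom_measure a. (f x)\<^sup>2)"

lemma sq_int_nonneg: "0 \<le> sq_int a f"
  by (simp add: sq_int_def)

lemma L2_measurable: "f \<in> L2 \<Omega> \<Longrightarrow> f \<in> borel_measurable (lebesgue_on \<Omega>)"
  and L2_square: "f \<in> L2 \<Omega> \<Longrightarrow> integrable (lebesgue_on \<Omega>) (\<lambda>x. (f x)\<^sup>2)"
  by (auto simp: L2_def)

lemma L2_mult_integrable:
  assumes "f \<in> L2 \<Omega>" "g \<in> L2 \<Omega>" shows "integrable (lebesgue_on \<Omega>) (\<lambda>x. f x * g x)"
proof (rule Bochner_Integration.integrable_bound)
  show "integrable (lebesgue_on \<Omega>) (\<lambda>x. (f x)\<^sup>2 + (g x)\<^sup>2)"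
    using assms by (intro Bochner_Integration.integrable_add L2_square)
  have "norm (s * t) \<le> norm (s\<^sup>2 + t\<^sup>2)" for s t :: real
  proof -
    have "2 * (\<bar>s\<bar> * \<bar>t\<bar>) \<le> s\<^sup>2 + t\<^sup>2"
      using sum_squares_bound[of "\<bar>s\<bar>" "\<bar>t\<bar>"] by (simp add: mult.assoc)
    moreover have "0 \<le> \<bar>s\<bar> * \<bar>t\<bar>" by simp
    ultimately have "\<bar>s\<bar> * \<bar>t\<bar> \<le> s\<^sup>2 + t\<^sup>2" by linarith
    then show ?thesis by (simp add: abs_mult)
  qed
  then show "AE x in lebesgue_on \<Omega>. norm (f x * g x) \<le> norm ((f x)\<^sup>2 + (g x)\<^sup>2)" by simp
qed (intro borel_measurable_times L2_measurable assms)

lemma L2_cmult: "f \<in> L2 \<Omega> \<Longrightarrow> (\<lambda>x. c * f x) \<in> L2 \<Omega>"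
  by (auto simp: L2_def power_mult_distrib)

lemma L2_add:
  assumes "f \<in> L2 \<Omega>" "g \<in> L2 \<Omega>" shows "(\<lambda>x. f x + g x) \<in> L2 \<Omega>"
proof -
  have "integrable (lebesgue_on \<Omega>) (\<lambda>x. (f x)\<^sup>2 + (g x)\<^sup>2 + 2 * (f x * g x))"
    by (intro Bochner_Integration.integrable_add integrable_mult_right L2_square L2_mult_integrable assms)
  moreover have "(f x + g x)\<^sup>2 = (f x)\<^sup>2 + (g x)\<^sup>2 + 2 * (f x * g x)" for x
    by (simp add: power2_sum)
  ultimately show ?thesis
    using assms by (auto simp: L2_def)
qed

lemma L2_diff: "f \<in> L2 \<Omega> \<Longrightarrow> g \<in> L2 \<Omega> \<Longrightarrow> (\<lambda>x. f x - g x) \<in> L2 \<Omega>"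
  using L2_add[of f \<Omega> "\<lambda>x. (-1) * g x"] L2_cmult[of g \<Omega> "-1"] by simp

lemma L2_abs: "f \<in> L2 \<Omega> \<Longrightarrow> (\<lambda>x. \<bar>f x\<bar>) \<in> L2 \<Omega>"
  by (auto simp: L2_def)

lemma L2_bounded_mult:
  assumes f: "f \<in> L2 \<Omega>" and b: "b \<in> borel_measurable (lebesgue_on \<Omega>)" "\<And>x. \<bar>b x\<bar> \<le> C"
  shows "(\<lambda>x. b x * f x) \<in> L2 \<Omega>"
    and "(LINT x|lebesgue_on \<Omega>. (b x * f x)\<^sup>2) \<le> C\<^sup>2 * (LINT x|lebesgue_on \<Omega>. (f x)\<^sup>2)"
proof -
  have le: "(b x * f x)\<^sup>2 \<le> C\<^sup>2 * (f x)\<^sup>2" for x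
    using power_mono[OF b(2)[of x], of 2] by (simp add: power_mult_distrib mult_right_mono)
  have m: "(\<lambda>x. b x * f x) \<in> borel_measurable (lebesgue_on \<Omega>)"
    by (rule borel_measurable_times[OF b(1) L2_measurable[OF f]])
  have i: "integrable (lebesgue_on \<Omega>) (\<lambda>x. C\<^sup>2 * (f x)\<^sup>2)"
    using f by (intro integrable_mult_right L2_square)
  then have i2: "integrable (lebesgue_on \<Omega>) (\<lambda>x. (b x * f x)\<^sup>2)"
    by (rule Bochner_Integration.integrable_bound)
      (use le m in \<open>auto intro!: borel_measurable_power\<close>)
  then show "(\<lambda>x. b x * f x) \<in> L2 \<Omega>" using m by (simp add: L2_def)
  show "(LINT x|lebesgue_on \<Omega>. (b x * f x)\<^sup>2) \<le> C\<^sup>2 * (LINT x|lebesgue_on \<Omega>. (f x)\<^sup>2)"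
    using integral_mono[OF i2 i le] by simp
qed

lemma sq_int_add_le:
  assumes "f \<in> L2 (domain a)" "g \<in> L2 (domain a)"
  shows "sq_int a (\<lambda>x. f x + g x) \<le> 2 * sq_int a f + 2 * sq_int a g"
proof -
  have "sq_int a (\<lambda>x. f x + g x) \<le> (LINT x|dom_measure a. 2 * (f x)\<^sup>2 + 2 * (g x)\<^sup>2)"
    unfolding sq_int_def
  proof (rule integral_mono)
    fix x show "(f x + g x)\<^sup>2 \<le> 2 * (f x)\<^sup>2 + 2 * (g x)\<^sup>2"
      using sum_squares_bound[of "f x" "g x"] by (simp add: power2_sum)
  qed (intro Bochner_Integration.integrable_add integrable_mult_right L2_square L2_add assms)+
  also have "\<dots> = 2 * sq_int a f + 2 * sq_int a g"
    unfolding sq_int_def using assms by (subst Bochner_Integration.integral_add) (auto intro: L2_square)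
  finally show ?thesis .
qed

lemma sq_int_cmult: "sq_int a (\<lambda>x. c * f x) = c\<^sup>2 * sq_int a f"
  by (simp add: sq_int_def power_mult_distrib)

text \<open>The integral of (|f| - s |g|)^2 is a nonnegative quadratic polynomial in s; s = I /
  \<open>sq_int a g\<close> gives the claim, and if the denominator is 0 a large s forces I =
  0.\<close>

lemma Cauchy_Schwarz_integral:
  assumes "f \<in> L2 (domain a)" "g \<in> L2 (domain a)"
  shows "(LINT x|dom_measure a. \<bar>f x * g x\<bar>)\<^sup>2 \<le> sq_int a f * sq_int a g"
proof -
  define I where "I = (LINT x|dom_measure a. \<bar>f x * g x\<bar>)"
  have I: "I \<ge> 0" by (simp add: I_def)
  have quad: "sq_int a f - 2 * s * I + s\<^sup>2 * sq_int a g \<ge> 0" for s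
  proof -
    have "0 \<le> (LINT x|dom_measure a. (\<bar>f x\<bar> - s * \<bar>g x\<bar>)\<^sup>2)" by simp
    also have "\<dots> = (LINT x|dom_measure a. (f x)\<^sup>2 - 2 * s * \<bar>f x * g x\<bar> + s\<^sup>2 * (g x)\<^sup>2)"
      by (intro Bochner_Integration.integral_cong) (auto simp: power2_diff abs_mult power_mult_distrib)
    also have "\<dots> = sq_int a f - 2 * s * I + s\<^sup>2 * sq_int a g"
      unfolding sq_int_def I_def using L2_square[OF assms(1)] L2_square[OF assms(2)] L2_mult_integrable[OF assms]
      by (simp add: Bochner_Integration.integral_add Bochner_Integration.integral_diff
          Bochner_Integration.integrable_diff integrable_abs)
    finally show ?thesis .
  qed
  have "I\<^sup>2 \<le> sq_int a f * sq_int a g"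
  proof (cases "sq_int a g = 0")
    case True
    have "I = 0"
    proof (rule ccontr)
      assume "I \<noteq> 0"
      then have "I > 0" using I by simp
      then have "2 * ((sq_int a f + 1) / I) * I = 2 * (sq_int a f + 1)" by simp
      then show False
        using quad[of "(sq_int a f + 1) / I"] True sq_int_nonneg[of a f] by simp
    qed
    then show ?thesis using True by simp
  next
    case False
    then have g: "sq_int a g > 0" using sq_int_nonneg[of a g] by simp
    have "sq_int a f - 2 * (I / sq_int a g) * I + (I / sq_int a g)\<^sup>2 * sq_int a g = sq_int a f - I\<^sup>2 / sq_int a g"
      using g by (simp add: power2_eq_square field_simps)
    then have "sq_int a f - I\<^sup>2 / sq_int a g \<ge> 0" using quad[of "I / sq_int a g"] by simp
    then show ?thesis using g by (simp add: field_simps)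
  qed
  then show ?thesis by (simp add: I_def)
qed

lemma Cauchy_Schwarz_abs:
  assumes "f \<in> L2 (domain a)" "g \<in> L2 (domain a)"
  shows "(LINT x|dom_measure a. \<bar>f x * g x\<bar>) \<le> sqrt (sq_int a f) * sqrt (sq_int a g)"
    and "\<bar>LINT x|dom_measure a. f x * g x\<bar> \<le> sqrt (sq_int a f) * sqrt (sq_int a g)"
proof -
  show 1: "(LINT x|dom_measure a. \<bar>f x * g x\<bar>) \<le> sqrt (sq_int a f) * sqrt (sq_int a g)"
    using real_le_rsqrt[OF Cauchy_Schwarz_integral[OF assms]] by (simp add: real_sqrt_mult)
  have "\<bar>LINT x|dom_measure a. f x * g x\<bar> \<le> (LINT x|dom_measure a. \<bar>f x * g x\<bar>)"
    by (rule integral_abs_bound)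
  with 1 show "\<bar>LINT x|dom_measure a. f x * g x\<bar> \<le> sqrt (sq_int a f) * sqrt (sq_int a g)" by linarith
qed

lemma L2_locally_integrable:
  assumes "f \<in> L2 (domain a)" shows "locally_integrable (domain a) f"
  unfolding locally_integrable_def
proof (intro allI impI)
  fix K assume K: "compact K \<and> K \<subseteq> domain a"
  have Ks: "K \<in> sets lebesgue" using K by (auto dest: compact_imp_closed)
  have fm: "integrable lebesgue (\<lambda>x. indicator K x :: real)"
    using K lmeasurable_compact[of K] by (intro integrable_real_indicator) (auto simp: fmeasurable_def)
  have f2: "integrable lebesgue (\<lambda>x. indicator (domain a) x * (f x)\<^sup>2)"
    using L2_square[OF assms] by (simp add: integrable_domain_iff)
  have fmeas: "(\<lambda>x. indicator (domain a) x * f x) \<in> borel_measurable lebesgue"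
    using L2_measurable[OF assms] by (simp add: borel_measurable_restrict_space_iff)
  have "integrable lebesgue (\<lambda>x. indicator K x * (indicator (domain a) x * f x))"
  proof (rule Bochner_Integration.integrable_bound)
    show "integrable lebesgue (\<lambda>x. indicator K x + indicator (domain a) x * (f x)\<^sup>2)"
      using fm f2 by (rule Bochner_Integration.integrable_add)
    show "(\<lambda>x. indicator K x * (indicator (domain a) x * f x)) \<in> borel_measurable lebesgue"
      using Ks by (intro borel_measurable_times fmeas borel_measurable_indicator)
    have "\<bar>t\<bar> \<le> 1 + t\<^sup>2" for t :: real
      using sum_squares_bound[of "\<bar>t\<bar>" 1] abs_ge_zero[of t] by simp
    then have "norm (indicator K x * (indicator (domain a) x * f x)) \<le> norm (indicator K x + indicator (domain a) x * (f x)\<^sup>2)" for x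
      using K by (auto simp: indicator_def)
    then show "AE x in lebesgue. norm (indicator K x * (indicator (domain a) x * f x)) \<le> norm (indicator K x + indicator (domain a) x * (f x)\<^sup>2)"
      by simp
  qed
  moreover have "indicator K x * (indicator (domain a) x * f x) = indicator K x *\<^sub>R f x" for x
    using K by (auto simp: indicator_def)
  ultimately show "integrable (lebesgue_on K) f"
    using Ks by (simp add: integrable_restrict_space)
qed

section \<open>Weak derivatives modulo null sets\<close>

lemma multi_deriv_zero_outside:
  assumes "open U" "\<And>x. x \<in> U \<Longrightarrow> f x = 0" "x \<in> U" shows "multi_deriv \<alpha> f x = 0"
proof -
  have 1: "partial_deriv i g x = 0" if "\<And>x. x \<in> U \<Longrightarrow> g x = 0" "x \<in> U" for i g x
  proof -
    have "(g has_derivative (\<lambda>h. 0)) (at x)"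
      by (rule has_derivative_transform_within_open[of "\<lambda>_. 0" _ _ _ U]) (use that assms(1) in auto)
    then show ?thesis
      by (simp add: partial_deriv_def frechet_derivative_at[symmetric])
  qed
  have 2: "\<And>x. x \<in> U \<Longrightarrow> (partial_deriv i ^^ n) g x = 0" if "\<And>x. x \<in> U \<Longrightarrow> g x = 0" for i g n
    using that by (induction n) (auto intro: 1)
  show ?thesis
    unfolding multi_deriv_def by (intro 2 assms)
qed

lemma integrable_test_mult:
  assumes f: "locally_integrable (domain a) f" and \<eta>: "test_function (domain a) \<eta>"
  shows "integrable (dom_measure a) (\<lambda>x. f x * multi_deriv \<alpha> \<eta> x)"
proof -
  define K where "K = closure {x. \<eta> x \<noteq> 0}"
  have K: "compact K" "K \<subseteq> domain a" and sm: "smooth \<eta>"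
    using \<eta> by (auto simp: test_function_def K_def)
  have out: "multi_deriv \<alpha> \<eta> x = 0" if "x \<notin> K" for x
    using K that closure_subset[of "{x. \<eta> x \<noteq> 0}"]
    by (intro multi_deriv_zero_outside[of "- K"]) (auto simp: K_def open_Compl)
  have cont: "continuous_on S (multi_deriv \<alpha> \<eta>)" for S
    using sm differentiable_imp_continuous_within unfolding smooth_def
    by (intro continuous_at_imp_continuous_on) blast
  obtain C where C: "\<And>x. x \<in> K \<Longrightarrow> \<bar>multi_deriv \<alpha> \<eta> x\<bar> \<le> C"
    using compact_imp_bounded[OF compact_continuous_image[OF cont K(1)]]
    unfolding bounded_iff by (metis image_eqI real_norm_def)
  have Ks: "K \<in> sets lebesgue" using K by (auto dest: compact_imp_closed)
  have "integrable (lebesgue_on K) f" using f K by (auto simp: locally_integrable_def)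
  then have fK: "integrable lebesgue (\<lambda>x. indicator K x * f x)"
    using Ks by (simp add: integrable_restrict_space)
  have "integrable lebesgue (\<lambda>x. (indicator K x * f x) * multi_deriv \<alpha> \<eta> x)"
  proof (rule Bochner_Integration.integrable_bound)
    show "integrable lebesgue (\<lambda>x. C * (indicator K x * f x))" using fK by (rule integrable_mult_right)
    show "(\<lambda>x. (indicator K x * f x) * multi_deriv \<alpha> \<eta> x) \<in> borel_measurable lebesgue"
      using borel_measurable_continuous_onI[OF cont]
      by (intro borel_measurable_times[OF borel_measurable_integrable[OF fK]] measurable_completion) simp
    have "norm (indicator K x * f x * multi_deriv \<alpha> \<eta> x) \<le> norm (C * (indicator K x * f x))" for x
      using C[of x] by (auto simp: indicator_def abs_mult mult.commute[of "\<bar>f x\<bar>"] intro!: mult_right_mono)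
    then show "AE x in lebesgue. norm (indicator K x * f x * multi_deriv \<alpha> \<eta> x) \<le> norm (C * (indicator K x * f x))"
      by simp
  qed
  moreover have "(indicator K x * f x) * multi_deriv \<alpha> \<eta> x = indicator (domain a) x * (f x * multi_deriv \<alpha> \<eta> x)" for x
    using K out[of x] by (auto simp: indicator_def)
  ultimately show ?thesis by (simp add: integrable_domain_iff)
qed

lemma multi_deriv_0: "multi_deriv 0 f = f"
  by (simp add: multi_deriv_def)

lemma integrable_tensor_mult:
  assumes "locally_integrable (domain a) f" "test_real {0<..<a} p" "test_real {0<..<a} q" "test_real {0<..} r"
  shows "integrable (dom_measure a) (\<lambda>x. f x * tensor p q r x)"
  using integrable_test_mult[OF assms(1) test_function_tensor[OF assms(2-4)], of 0] by (simp add: multi_deriv_0)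

lemma locally_integrable_diff:
  "locally_integrable \<Omega> f \<Longrightarrow> locally_integrable \<Omega> g \<Longrightarrow> locally_integrable \<Omega> (\<lambda>x. f x - g x)"
  unfolding locally_integrable_def by (blast intro: Bochner_Integration.integrable_diff)

text \<open>Product test functions already determine a weak derivative. The functions f and f' may
  differ on a null set, which allows the weak derivatives of the prescribed data and of the solution
  at time 0 to be compared.\<close>

lemma has_weak_deriv_unique:
  assumes "has_weak_deriv (domain a) \<alpha> f g1" "has_weak_deriv (domain a) \<alpha> f' g2"
    and ff: "AE x in dom_measure a. f x = f' x"
  shows "AE x in dom_measure a. g1 x = g2 x"
proof -
  have loc: "locally_integrable (domain a) g1" "locally_integrable (domain a) g2"
    and lf: "locally_integrable (domain a) f" "locally_integrable (domain a) f'"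
    using assms by (auto simp: has_weak_deriv_def)
  have "AE x in dom_measure a. g1 x - g2 x = 0"
  proof (rule AE_zero_of_test_integrals_zero)
    fix p q r assume t: "test_real {0<..<a} p" "test_real {0<..<a} q" "test_real {0<..} r"
    note tf = test_function_tensor[OF t]
    have "(LINT x|dom_measure a. f x * multi_deriv \<alpha> (tensor p q r) x) = (LINT x|dom_measure a. f' x * multi_deriv \<alpha> (tensor p q r) x)"
      by (rule integral_cong_AE) (use integrable_test_mult[OF lf(1) tf] integrable_test_mult[OF lf(2) tf] ff in auto)
    then have "(-1) ^ multi_order \<alpha> * (LINT x|dom_measure a. g1 x * tensor p q r x)
        = (-1) ^ multi_order \<alpha> * (LINT x|dom_measure a. g2 x * tensor p q r x)"
      using assms tf by (simp add: has_weak_deriv_def)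
    then have "(LINT x|dom_measure a. g1 x * tensor p q r x) = (LINT x|dom_measure a. g2 x * tensor p q r x)"
      by simp
    then show "(LINT x|dom_measure a. (g1 x - g2 x) * tensor p q r x) = 0"
      using integrable_tensor_mult[OF loc(1) t] integrable_tensor_mult[OF loc(2) t]
      by (simp add: left_diff_distrib)
  qed (intro locally_integrable_diff loc)
  then show ?thesis by simp
qed

lemma has_weak_deriv_lincomb:
  assumes "has_weak_deriv (domain a) \<alpha> f g" "has_weak_deriv (domain a) \<alpha> f' g'"
  shows "has_weak_deriv (domain a) \<alpha> (\<lambda>x. c * f x + d * f' x) (\<lambda>x. c * g x + d * g' x)"
proof -
  have loc: "locally_integrable (domain a) f" "locally_integrable (domain a) f'"
    "locally_integrable (domain a) g" "locally_integrable (domain a) g'"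
    using assms by (auto simp: has_weak_deriv_def)
  have lc: "locally_integrable (domain a) (\<lambda>x. c * h x + d * h' x)"
    if "locally_integrable (domain a) h" "locally_integrable (domain a) h'" for h h'
    unfolding locally_integrable_def
  proof (intro allI impI)
    fix K assume "compact K \<and> K \<subseteq> domain a"
    then have "integrable (lebesgue_on K) h" "integrable (lebesgue_on K) h'"
      using that by (auto simp: locally_integrable_def)
    then show "integrable (lebesgue_on K) (\<lambda>x. c * h x + d * h' x)" by simp
  qed
  have split: "(LINT x|dom_measure a. (c * h x + d * h' x) * multi_deriv \<beta> \<eta> x) =
      c * (LINT x|dom_measure a. h x * multi_deriv \<beta> \<eta> x) + d * (LINT x|dom_measure a. h' x * multi_deriv \<beta> \<eta> x)"
    if "locally_integrable (domain a) h" "locally_integrable (domain a) h'" "test_function (domain a) \<eta>" for h h' \<beta> \<eta>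
    using integrable_test_mult[OF that(1,3), of \<beta>] integrable_test_mult[OF that(2,3), of \<beta>]
    by (simp add: distrib_right mult.assoc)
  show ?thesis
    unfolding has_weak_deriv_def
  proof (intro conjI allI impI lc loc)
    fix \<eta> assume t: "test_function (domain a) \<eta>"
    show "(LINT x|dom_measure a. (c * f x + d * f' x) * multi_deriv \<alpha> \<eta> x) =
      (-1) ^ multi_order \<alpha> * (LINT x|dom_measure a. (c * g x + d * g' x) * \<eta> x)"
      using split[OF loc(1,2) t, of \<alpha>] split[OF loc(3,4) t, of 0] assms t
      by (simp add: has_weak_deriv_def multi_deriv_0 algebra_simps)
  qed
qed

text \<open>Measurability of g is part of the conclusion; it is inherited from f through the
  completeness of Lebesgue measure.\<close>

lemma L2_AE_cong:
  assumes f: "f \<in> L2 (domain a)" and AE: "AE x in dom_measure a. f x = g x"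
  shows "g \<in> L2 (domain a)"
proof -
  have "(\<lambda>x. indicator (domain a) x * f x) \<in> borel_measurable lebesgue"
    using L2_measurable[OF f] by (simp add: borel_measurable_restrict_space_iff)
  moreover have "AE x in lebesgue. indicator (domain a) x * f x = indicator (domain a) x * g x"
    using AE unfolding AE_domain_iff by eventually_elim (auto simp: indicator_def)
  ultimately have "(\<lambda>x. indicator (domain a) x * g x) \<in> borel_measurable lebesgue"
    by (rule borel_measurable_AE)
  then have g: "g \<in> borel_measurable (dom_measure a)"
    by (simp add: borel_measurable_restrict_space_iff)
  have "integrable (dom_measure a) (\<lambda>x. (f x)\<^sup>2) \<longleftrightarrow> integrable (dom_measure a) (\<lambda>x. (g x)\<^sup>2)"
    by (rule integrable_cong_AE) (use AE g L2_measurable[OF f] in \<open>auto intro!: borel_measurable_power\<close>)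
  then show ?thesis using g f by (simp add: L2_def)
qed

lemma sq_int_cong_AE:
  assumes f: "f \<in> L2 (domain a)" and AE: "AE x in dom_measure a. f x = g x"
  shows "sq_int a f = sq_int a g"
  unfolding sq_int_def
  by (rule integral_cong_AE)
    (use AE L2_measurable[OF f] L2_measurable[OF L2_AE_cong[OF f AE]] in \<open>auto intro!: borel_measurable_power\<close>)

text \<open>The choice operator in \<open>weak_deriv\<close> may pick another representative than
  the square integrable one provided by \<open>Sobolev_H\<close>; uniqueness almost everywhere
  transfers square integrability to the one picked.\<close>

lemma weak_deriv_Sobolev:
  assumes "f \<in> Sobolev_H k (domain a)" "multi_order \<alpha> \<le> k"
  shows "has_weak_deriv (domain a) \<alpha> f (weak_deriv (domain a) \<alpha> f)"
    and "weak_deriv (domain a) \<alpha> f \<in> L2 (domain a)"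
proof -
  obtain g where g: "g \<in> L2 (domain a)" "has_weak_deriv (domain a) \<alpha> f g"
    using assms by (auto simp: Sobolev_H_def)
  show w: "has_weak_deriv (domain a) \<alpha> f (weak_deriv (domain a) \<alpha> f)"
    unfolding weak_deriv_def by (rule someI[where P = "has_weak_deriv (domain a) \<alpha> f", OF g(2)])
  show "weak_deriv (domain a) \<alpha> f \<in> L2 (domain a)"
    using has_weak_deriv_unique[OF g(2) w] g(1) by (auto intro: L2_AE_cong)
qed

lemma weak_deriv_eqI:
  assumes "has_weak_deriv (domain a) \<alpha> f g"
  shows "AE x in dom_measure a. weak_deriv (domain a) \<alpha> f x = g x"
proof -
  have "has_weak_deriv (domain a) \<alpha> f (weak_deriv (domain a) \<alpha> f)"
    unfolding weak_deriv_def by (rule someI[where P = "has_weak_deriv (domain a) \<alpha> f", OF assms])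
  then show ?thesis by (rule has_weak_deriv_unique[OF _ assms]) simp
qed

lemma weak_deriv_0:
  assumes "f \<in> Sobolev_H k (domain a)"
  shows "AE x in dom_measure a. weak_deriv (domain a) 0 f x = f x"
proof (rule weak_deriv_eqI)
  have "locally_integrable (domain a) f"
    using assms L2_locally_integrable by (auto simp: Sobolev_H_def)
  then show "has_weak_deriv (domain a) 0 f f"
    by (simp add: has_weak_deriv_def multi_deriv_0 multi_order_def)
qed

lemma Sobolev_H_L2: "f \<in> Sobolev_H k \<Omega> \<Longrightarrow> f \<in> L2 \<Omega>"
  by (simp add: Sobolev_H_def)

lemma Sobolev_norm_ge:
  assumes "multi_order \<alpha> \<le> k"
  shows "sq_int a (weak_deriv (domain a) \<alpha> f) \<le> (Sobolev_norm k (domain a) f)\<^sup>2"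
proof -
  have "sq_int a (weak_deriv (domain a) \<alpha> f) \<le> (\<Sum>\<alpha> | multi_order \<alpha> \<le> k. sq_int a (weak_deriv (domain a) \<alpha> f))"
    by (rule member_le_sum) (use assms sq_int_nonneg finite_multi_order_le in auto)
  then show ?thesis
    by (simp add: Sobolev_norm_def sq_int_def sum_nonneg)
qed

text \<open>Uniqueness of weak derivatives makes \<^term>\<open>weak_deriv\<close> linear up to null sets, so that the
  convergence of difference quotients passes to every weak derivative.\<close>

definition L2_C1 :: "real \<Rightarrow> real \<Rightarrow> (real \<Rightarrow> real^3 \<Rightarrow> real) \<Rightarrow> (real \<Rightarrow> real^3 \<Rightarrow> real) \<Rightarrow> bool" where
  "L2_C1 a T f f' \<longleftrightarrow>
     (\<forall>t\<in>{0..<T}. f t \<in> L2 (domain a) \<and> f' t \<in> L2 (domain a) \<and>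
        ((\<lambda>s. sq_int a (\<lambda>x. (f s x - f t x) / (s - t) - f' t x)) \<longlongrightarrow> 0) (at t within {0..<T}) \<and>
        ((\<lambda>s. sq_int a (\<lambda>x. f' s x - f' t x)) \<longlongrightarrow> 0) (at t within {0..<T}))"

lemma C1_Sobolev_weak_deriv:
  assumes C1: "C1_Sobolev k (domain a) T f f'" and \<alpha>: "multi_order \<alpha> \<le> k"
  shows "L2_C1 a T (\<lambda>t. weak_deriv (domain a) \<alpha> (f t)) (\<lambda>t. weak_deriv (domain a) \<alpha> (f' t))"
  unfolding L2_C1_def
proof (intro ballI conjI)
  fix t assume t: "t \<in> {0..<T}"
  let ?D = "weak_deriv (domain a) \<alpha>"
  have H: "f s \<in> Sobolev_H k (domain a)" "f' s \<in> Sobolev_H k (domain a)" if "s \<in> {0..<T}" for s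
    using C1 that by (auto simp: C1_Sobolev_def)
  note D = H[THEN weak_deriv_Sobolev(1)[OF _ \<alpha>]] and D2 = H[THEN weak_deriv_Sobolev(2)[OF _ \<alpha>]]
  show "?D (f t) \<in> L2 (domain a)" "?D (f' t) \<in> L2 (domain a)" using D2 t by auto
  have lim1: "((\<lambda>s. (Sobolev_norm k (domain a) (\<lambda>x. (f s x - f t x) / (s - t) - f' t x))\<^sup>2) \<longlongrightarrow> 0)
      (at t within {0..<T})"
    using C1 t by (auto simp: C1_Sobolev_def intro!: tendsto_null_power)
  have lim2: "((\<lambda>s. (Sobolev_norm k (domain a) (\<lambda>x. f' s x - f' t x))\<^sup>2) \<longlongrightarrow> 0) (at t within {0..<T})"
    using C1 t by (auto simp: C1_Sobolev_def intro!: tendsto_null_power)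
  have ev: "eventually (\<lambda>s. s \<in> {0..<T}) (at t within {0..<T})"
    by (simp add: eventually_at_filter)
  show "((\<lambda>s. sq_int a (\<lambda>x. (?D (f s) x - ?D (f t) x) / (s - t) - ?D (f' t) x)) \<longlongrightarrow> 0) (at t within {0..<T})"
  proof (rule Lim_null_comparison[OF _ lim1])
    show "\<forall>\<^sub>F s in at t within {0..<T}. norm (sq_int a (\<lambda>x. (?D (f s) x - ?D (f t) x) / (s - t) - ?D (f' t) x))
      \<le> (Sobolev_norm k (domain a) (\<lambda>x. (f s x - f t x) / (s - t) - f' t x))\<^sup>2"
      using ev
    proof eventually_elim
      case (elim s)
      let ?h = "\<lambda>x. (f s x - f t x) / (s - t) - f' t x"
      let ?g = "\<lambda>x. (?D (f s) x - ?D (f t) x) / (s - t) - ?D (f' t) x"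
      \<comment> \<open>The difference quotient minus its limit is written as two nested binary
        combinations, the form that \<open>has_weak_deriv_lincomb\<close> accepts.\<close>
      have "has_weak_deriv (domain a) \<alpha> (\<lambda>x. 1 * ((1 / (s - t)) * f s x + (- 1 / (s - t)) * f t x) + (-1) * f' t x)
         (\<lambda>x. 1 * ((1 / (s - t)) * ?D (f s) x + (- 1 / (s - t)) * ?D (f t) x) + (-1) * ?D (f' t) x)"
        by (intro has_weak_deriv_lincomb D elim t)
      then have w: "has_weak_deriv (domain a) \<alpha> ?h ?g"
        by (simp add: diff_divide_distrib)
      have g2: "?g \<in> L2 (domain a)"
        using L2_diff[OF L2_cmult[OF L2_diff[OF D2(1)[OF elim] D2(1)[OF t]], of "1 / (s - t)"] D2(2)[OF t]]
        by simp
      have "AE x in dom_measure a. ?g x = ?D ?h x"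
        using weak_deriv_eqI[OF w] by eventually_elim simp
      then have "sq_int a ?g = sq_int a (?D ?h)"
        by (rule sq_int_cong_AE[OF g2])
      then show ?case
        using Sobolev_norm_ge[OF \<alpha>, of a ?h] sq_int_nonneg[of a ?g] by simp
    qed
  qed
  show "((\<lambda>s. sq_int a (\<lambda>x. ?D (f' s) x - ?D (f' t) x)) \<longlongrightarrow> 0) (at t within {0..<T})"
  proof (rule Lim_null_comparison[OF _ lim2])
    show "\<forall>\<^sub>F s in at t within {0..<T}. norm (sq_int a (\<lambda>x. ?D (f' s) x - ?D (f' t) x))
      \<le> (Sobolev_norm k (domain a) (\<lambda>x. f' s x - f' t x))\<^sup>2"
      using ev
    proof eventually_elim
      case (elim s)
      let ?h = "\<lambda>x. f' s x - f' t x"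
      let ?g = "\<lambda>x. ?D (f' s) x - ?D (f' t) x"
      have "has_weak_deriv (domain a) \<alpha> (\<lambda>x. 1 * f' s x + (-1) * f' t x) (\<lambda>x. 1 * ?D (f' s) x + (-1) * ?D (f' t) x)"
        by (intro has_weak_deriv_lincomb D elim t)
      then have w: "has_weak_deriv (domain a) \<alpha> ?h ?g" by simp
      have g2: "?g \<in> L2 (domain a)" by (intro L2_diff D2 elim t)
      have "AE x in dom_measure a. ?g x = ?D ?h x"
        using weak_deriv_eqI[OF w] by eventually_elim simp
      then have "sq_int a ?g = sq_int a (?D ?h)"
        by (rule sq_int_cong_AE[OF g2])
      then show ?case
        using Sobolev_norm_ge[OF \<alpha>, of a ?h] sq_int_nonneg[of a ?g] by simp
    qed
  qed
qed

section \<open>Functions with a weak vertical derivative\<close>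

text \<open>Fubini's theorem is used on products, while the domain lives in \<open>real^3\<close>.
  The nesting leaves the vertical coordinate alone in the second factor, so that the inner integral
  runs along a column.\<close>

definition embed3 :: "(real \<times> real) \<times> real \<Rightarrow> real^3" where
  "embed3 w = vector [fst (fst w), snd (fst w), snd w]"

lemma embed3_nth [simp]:
  "embed3 w $ 1 = fst (fst w)" "embed3 w $ 2 = snd (fst w)" "embed3 w $ 3 = snd w"
  by (simp_all add: embed3_def)

lemma embed3_measurable [measurable]: "embed3 \<in> borel \<rightarrow>\<^sub>M borel"
proof (rule borel_measurable_continuous_onI)
  have "embed3 = (\<lambda>w. fst (fst w) *\<^sub>R axis 1 1 + snd (fst w) *\<^sub>R axis 2 1 + snd w *\<^sub>R axis 3 1)"
    by (auto simp: fun_eq_iff vec_eq_iff forall_3 axis_def)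
  then show "continuous_on UNIV embed3" by (rule ssubst) (intro continuous_intros)
qed

text \<open>Lebesgue measure is determined by the volumes of boxes, and the preimage of a box is the
  box with the same edges.\<close>

lemma lborel_distr_embed3: "distr lborel borel embed3 = lborel"
proof (rule lborel_eqI[symmetric])
  fix l u :: "real^3" assume lu: "\<And>b. b \<in> Basis \<Longrightarrow> l \<bullet> b \<le> u \<bullet> b"
  then have le: "l$i \<le> u$i" for i
    using lu[of "axis i 1"] by (simp add: axis_in_Basis_iff inner_axis)
  have bp: "box ((l$1, l$2), l$3) ((u$1, u$2), u$3) = {w. l$1 < fst (fst w) \<and> fst (fst w) < u$1
      \<and> l$2 < snd (fst w) \<and> snd (fst w) < u$2 \<and> l$3 < snd w \<and> snd w < u$3}"
    by (auto simp: box_def Basis_prod_def)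
  have "embed3 -` box l u = box ((l$1, l$2), l$3) ((u$1, u$2), u$3)"
    unfolding bp vimage_def mem_box_cart forall_3 embed3_nth by blast
  then have "emeasure (distr lborel borel embed3) (box l u) = emeasure lborel (box ((l$1, l$2), l$3) ((u$1, u$2), u$3))"
    by (subst emeasure_distr) auto
  also have "\<dots> = (\<Prod>b\<in>Basis. (((u$1, u$2), u$3) - ((l$1, l$2), l$3)) \<bullet> b)"
    by (rule emeasure_lborel_box) (auto simp: Basis_prod_def le)
  also have "(\<Prod>b\<in>Basis. (((u$1, u$2), u$3) - ((l$1, l$2), l$3)) \<bullet> b) = (u$1 - l$1) * (u$2 - l$2) * (u$3 - l$3)"
    by (simp add: Basis_prod_def image_Un prod.union_disjoint)
  also have "\<dots> = (\<Prod>i\<in>UNIV. (u - l) $ i)"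
    unfolding UNIV_3 by simp
  also have "\<dots> = (\<Prod>b\<in>Basis. (u - l) \<bullet> b)"
  proof -
    have B: "Basis = (\<lambda>i. axis i (1::real)) ` (UNIV :: 3 set)" by (auto simp: Basis_vec_def)
    have "inj (\<lambda>i. axis i (1::real) :: real^3)" by (rule injI) (simp add: axis_eq_axis)
    then show ?thesis unfolding B by (simp add: prod.reindex inner_axis)
  qed
  finally show "emeasure (distr lborel borel embed3) (box l u) = (\<Prod>b\<in>Basis. (u - l) \<bullet> b)" .
qed simp

lemma integrable_embed3:
  fixes f :: "real^3 \<Rightarrow> real"
  assumes "f \<in> borel_measurable borel"
  shows "integrable lborel (\<lambda>w. f (embed3 w)) \<longleftrightarrow> integrable lborel f"
  using integrable_distr_eq[of embed3 lborel borel f] assms by (simp add: lborel_distr_embed3)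

lemma integral_embed3:
  fixes f :: "real^3 \<Rightarrow> real"
  assumes "f \<in> borel_measurable borel"
  shows "(LINT w|lborel. f (embed3 w)) = (LINT x|lborel. f x)"
  using integral_distr[of embed3 lborel borel f] assms by (simp add: lborel_distr_embed3)

lemma AE_embed3:
  assumes "AE w in lborel. P (embed3 w)" "{x. P x} \<in> sets borel"
  shows "AE x in lborel. P x"
proof -
  have "AE x in distr lborel borel embed3. P x"
    using AE_distr_iff[of embed3 lborel borel P] assms by simp
  then show ?thesis by (simp only: lborel_distr_embed3)
qed

section \<open>The fundamental theorem of calculus on almost every vertical column\<close>

lemma smooth_real_primitive:
  assumes k: "test_real {c<..<d} k"
  defines "K \<equiv> \<lambda>z. LINT y|lborel. indicator {..z} y * k y"
  shows "smooth_real K" "deriv K = k" "z \<le> c \<Longrightarrow> K z = 0" "z \<ge> d \<Longrightarrow> K z = (LINT y|lborel. k y)"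
proof -
  have sk: "smooth_real k" using k by (rule test_real_smooth)
  have kz: "k x = 0" if "x \<le> c \<or> x \<ge> d" for x
    using test_real_outside[OF k] that by auto
  obtain P where P: "\<And>x. (P has_real_derivative k x) (at x)" "\<And>x. x \<le> c \<Longrightarrow> P x = 0"
    using antiderivative_of_vanishing[of k c] smooth_real_continuous[OF sk] kz by blast
  have KP: "K z = P z" for z
  proof (cases "z \<le> c")
    case True
    then have "(\<lambda>y. indicator {..z} y * k y) = (\<lambda>y. 0)" using kz by (auto simp: indicator_def fun_eq_iff)
    then show ?thesis using P(2)[OF True] by (simp add: K_def)
  next
    case False
    have "(LINT x|lborel. k x * indicator {c..z} x) = P z - P c"
      using smooth_real_continuous[OF sk, of UNIV] False P(1)
      by (intro integral_FTC_Icc_real) (auto simp: continuous_on_eq_continuous_at)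
    moreover have "k x * indicator {c..z} x = indicator {..z} x * k x" for x
      using kz[of x] by (auto simp: indicator_def)
    ultimately show ?thesis using P(2)[of c] by (simp add: K_def)
  qed
  have "K = P" by (rule ext) (rule KP)
  then have dK: "(K has_real_derivative k x) (at x)" for x using P(1) by simp
  show "smooth_real K" by (rule smooth_realI[OF dK sk])
  show "deriv K = k" by (rule ext) (rule DERIV_imp_deriv[OF dK])
  show "K z = 0" if "z \<le> c" using KP P(2) that by simp
  show "K z = (LINT y|lborel. k y)" if "z \<ge> d"
  proof -
    have "(\<lambda>y. indicator {..z} y * k y) = k"
      using kz that by (auto simp: indicator_def fun_eq_iff)
    then show ?thesis by (simp add: K_def)
  qed
qed

lemma window_le_indicator: "window c d n x \<le> indicator {c<..<d} x"
proof (cases "x \<in> {c<..<d}")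
  case True then show ?thesis using window_le_1[of c d n x] by simp
next
  case False
  \<comment> \<open>The three-dimensional statement is read on the diagonal, where its value is the
    cube of the one-dimensional window.\<close>
  have "tensor_window (vec c) (vec d) n (vec x) = 0"
    by (rule tensor_window_outside) (use False in \<open>auto simp: mem_box_cart\<close>)
  then show ?thesis by (simp add: tensor_window_def tensor_def)
qed

text \<open>Testing the weak derivative with \<open>p(x\<^sub>1) q(x\<^sub>2) r(x\<^sub>3)\<close>, where \<open>r' = i - (\<integral>i) step'\<close>, and letting
  \<open>p, q, i\<close> tend to indicator functions.\<close>

lemma weak_deriv_box_identity:
  assumes F: "integrable lborel F" "F \<in> borel_measurable borel"
    and G: "integrable lborel G" "G \<in> borel_measurable borel"
    and test: "\<And>p q r. test_real {0<..<a} p \<Longrightarrow> test_real {0<..<a} q \<Longrightarrow> test_real {0<..<3} r \<Longrightarrow>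
      (LINT x|lborel. F x * tensor p q (deriv r) x + G x * tensor p q r x) = 0"
    and E: "{e1<..<e1'} \<subseteq> {0<..<a}" "{e2<..<e2'} \<subseteq> {0<..<a}" and I: "0 \<le> i" "i < i'" "i' \<le> 3"
  shows "(LINT x|lborel. indicator {e1<..<e1'} (x$1) * indicator {e2<..<e2'} (x$2) *
      (F x * (indicator {i<..<i'} (x$3) - (i' - i) * deriv step (x$3))
       + G x * ((LINT y|lborel. indicator {..x$3} y * indicator {i<..<i'} y) - (i' - i) * step (x$3)))) = 0"
proof -
  define k where "k n = window i i' n" for n
  define c where "c n = (LINT y|lborel. k n y)" for n
  define K where "K n = (\<lambda>z. LINT y|lborel. indicator {..z} y * k n y)" for n
  \<comment> \<open>Above the interval \<open>K n\<close> stays at its total mass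
    \<open>c n\<close>; subtracting \<open>c n * step\<close> brings r back to 0 below height 3, at
    the cost of the term with \<open>deriv step\<close>.\<close>
  define r where "r n = (\<lambda>z. K n z - c n * step z)" for n
  define m where "m = (\<lambda>z. LINT y|lborel. indicator {..z} y * (indicator {i<..<i'} y :: real))"
  have kb: "0 \<le> k n y" "k n y \<le> indicator {i<..<i'} y" for n y
    using window_nonneg window_le_indicator by (auto simp: k_def)
  have kt: "test_real {i<..<i'} (k n)" if "n > 0" for n
    unfolding k_def using that by (intro test_real_window) auto
  have ind_int: "integrable lborel (indicator {i<..<i'} :: real \<Rightarrow> real)"
    by (rule integrable_real_indicator) (use I in auto)
  have [measurable]: "k n \<in> borel_measurable borel" for n
    unfolding k_def by (rule borel_measurable_continuous_onI[OF smooth_real_continuous[OF smooth_real_window]])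
  have stepm [measurable]: "step \<in> borel_measurable borel" "deriv step \<in> borel_measurable borel"
    by (intro borel_measurable_continuous_onI smooth_real_continuous smooth_real_step smooth_real_deriv)+
  have klim: "(\<lambda>n. k n y) \<longlonglongrightarrow> indicator {i<..<i'} y" for y
    unfolding k_def by (rule window_tendsto)
  have clim: "c \<longlonglongrightarrow> i' - i"
  proof -
    have "c \<longlonglongrightarrow> (LINT y|lborel. indicator {i<..<i'} y)"
      unfolding c_def
      by (rule integral_dominated_convergence[where w = "indicator {i<..<i'}"])
        (use klim kb ind_int in auto)
    then show ?thesis using I by simp
  qed
  have Klim: "(\<lambda>n. K n z) \<longlonglongrightarrow> m z" for z
    unfolding K_def m_def
  proof (rule integral_dominated_convergence[where w = "indicator {i<..<i'}"])
    show "AE y in lborel. (\<lambda>n. indicator {..z} y * k n y) \<longlonglongrightarrow> indicator {..z} y * indicator {i<..<i'} y"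
      by (intro AE_I2 tendsto_intros klim)
    show "AE y in lborel. norm (indicator {..z} y * k n y) \<le> indicator {i<..<i'} y" for n
    proof (rule AE_I2)
      fix y show "norm (indicator {..z} y * k n y) \<le> indicator {i<..<i'} y"
        using kb[of n y] by (auto simp: indicator_def split: if_splits)
    qed
  qed (use ind_int in auto)
  have kint: "integrable lborel (k n)" for n
    by (rule Bochner_Integration.integrable_bound[OF ind_int]) (use kb in auto)
  have cb: "0 \<le> c n" "c n \<le> 3" for n
  proof -
    show "0 \<le> c n" unfolding c_def using kb by simp
    have "c n \<le> (LINT y|lborel. indicator {i<..<i'} y)"
      unfolding c_def using kint ind_int kb by (intro integral_mono) auto
    then show "c n \<le> 3" using I by simp
  qed
  have Kb: "0 \<le> K n z" "K n z \<le> 3" for n z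
  proof -
    show "0 \<le> K n z" unfolding K_def using kb by simp
    have "K n z \<le> c n"
      unfolding c_def K_def
    proof (rule integral_mono)
      show "integrable lborel (\<lambda>y. indicator {..z} y * k n y)"
        using integrable_mult_indicator[OF _ kint[of n], of "{..z}"] by simp
      show "indicator {..z} y * k n y \<le> k n y" for y using kb[of n y] by (simp add: indicator_def)
    qed (rule kint)
    then show "K n z \<le> 3" using cb[of n] by simp
  qed
  obtain C where C: "C \<ge> 0" "\<And>x. \<bar>deriv step x\<bar> \<le> C" using bounded_derivs_step by blast
  have rb: "\<bar>r n z\<bar> \<le> 6" for n z
  proof -
    have "0 \<le> c n * step z" "c n * step z \<le> 3"
      using cb[of n] step_nonneg[of z] step_le_1[of z] mult_mono[of "c n" 3 "step z" 1] by auto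
    then show ?thesis using Kb[of n z] unfolding r_def by linarith
  qed
  have rt: "test_real {0<..<3} (r n)" "deriv (r n) = (\<lambda>z. k n z - c n * deriv step z)" if "n > 0" for n
  proof -
    have kt': "test_real {i<..<i'} (k n)" using kt[OF that] .
    obtain l u where lu: "{l..u} \<subseteq> {i<..<i'}" "\<And>x. x \<notin> {l..u} \<Longrightarrow> k n x = 0"
      using kt' by (auto simp: test_real_def)
    \<comment> \<open>The hull of the support of \<open>k n\<close> and of [1,2], outside of which
      \<open>step\<close> is constant; an empty support {l..u} contributes nothing to the
      hull.\<close>
    define l' where "l' = (if l \<le> u then min l 1 else 1)"
    define u' where "u' = (if l \<le> u then max u 2 else 2)"
    have lu': "0 < l'" "u' < 3" "l' \<le> 1" "2 \<le> u'" "l' < u'"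
      using lu(1) I by (auto simp: l'_def u'_def)
    have sK: "smooth_real (K n)" "deriv (K n) = k n"
      unfolding K_def using smooth_real_primitive[OF kt'] by auto
    have Kl: "K n z = 0" if "z < l'" for z
    proof -
      have "(\<lambda>y. indicator {..z} y * k n y) = (\<lambda>y. 0)"
      proof
        fix y show "indicator {..z} y * k n y = 0"
          using lu(2)[of y] that by (auto simp: indicator_def l'_def split: if_splits)
      qed
      then show ?thesis by (simp add: K_def)
    qed
    have Ku: "K n z = c n" if "z > u'" for z
    proof -
      have "(\<lambda>y. indicator {..z} y * k n y) = k n"
      proof
        fix y show "indicator {..z} y * k n y = k n y"
          using lu(2)[of y] that by (auto simp: indicator_def u'_def split: if_splits)
      qed
      then show ?thesis by (simp add: K_def c_def)
    qed
    have sr: "smooth_real (r n)"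
      unfolding r_def by (intro smooth_real_diff smooth_real_mult smooth_real_const smooth_real_step sK)
    have "r n z = 0" if "z \<notin> {l'..u'}" for z
      using that Kl[of z] Ku[of z] lu' step_eq_0[of z] step_eq_1[of z]
      by (auto simp: r_def not_le)
    then show "test_real {0<..<3} (r n)"
      unfolding test_real_def using sr lu' by (intro conjI exI[of _ l'] exI[of _ u']) auto
    show "deriv (r n) = (\<lambda>z. k n z - c n * deriv step z)"
    proof
      fix z show "deriv (r n) z = k n z - c n * deriv step z"
        unfolding r_def
        by (rule DERIV_imp_deriv)
          (use smooth_real_deriv(2)[OF sK(1), of z] smooth_real_deriv(2)[OF smooth_real_step, of z] sK(2)
           in \<open>auto intro!: derivative_eq_intros\<close>)
    qed
  qed
  define w1 where "w1 n = window e1 e1' n" for n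
  define w2 where "w2 n = window e2 e2' n" for n
  define S where "S n x = w1 n (x$1) * w2 n (x$2) * (F x * (k n (x$3) - c n * deriv step (x$3)) + G x * r n (x$3))"
    for n and x :: "real^3"
  define L where "L x = indicator {e1<..<e1'} (x$1) * indicator {e2<..<e2'} (x$2) *
      (F x * (indicator {i<..<i'} (x$3) - (i' - i) * deriv step (x$3)) + G x * (m (x$3) - (i' - i) * step (x$3)))"
    for x :: "real^3"
  have [measurable]: "w1 n \<in> borel_measurable borel" "w2 n \<in> borel_measurable borel" for n
    unfolding w1_def w2_def by (intro borel_measurable_continuous_onI smooth_real_continuous smooth_real_window)+
  have Km [measurable]: "K n \<in> borel_measurable borel" for n
  proof (cases "n > 0")
    case True
    then show ?thesis
      unfolding K_def by (intro borel_measurable_continuous_onI smooth_real_continuous smooth_real_primitive(1)[OF kt])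
  next
    case False
    then have "k n = (\<lambda>x. 0)" by (simp add: k_def window_def[abs_def] step_eq_0)
    then show ?thesis by (simp add: K_def)
  qed
  have [measurable]: "r n \<in> borel_measurable borel" for n
    unfolding r_def by measurable
  have mm [measurable]: "m \<in> borel_measurable borel"
    by (rule borel_measurable_LIMSEQ_real[of _ K]) (use Klim Km in auto)
  note F(2)[measurable] G(2)[measurable]
  \<comment> \<open>The dominating function: the window is at most 1, its mass \<open>c n\<close> is
    at most 3 because the interval lies in [0,3], and |r n| is at most 6.\<close>
  have "(\<lambda>n. LINT x|lborel. S n x) \<longlonglongrightarrow> (LINT x|lborel. L x)"
  proof (rule integral_dominated_convergence[where w = "\<lambda>x. (1 + 3 * C) * norm (F x) + 6 * norm (G x)"])
    show "AE x in lborel. (\<lambda>n. S n x) \<longlonglongrightarrow> L x"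
      unfolding S_def L_def w1_def w2_def r_def
      by (intro AE_I2 tendsto_intros window_tendsto klim clim Klim)
    show "AE x in lborel. norm (S n x) \<le> (1 + 3 * C) * norm (F x) + 6 * norm (G x)" for n
    proof (rule AE_I2)
      fix x :: "real^3"
      have w: "0 \<le> w1 n (x$1)" "w1 n (x$1) \<le> 1" "0 \<le> w2 n (x$2)" "w2 n (x$2) \<le> 1"
        by (auto simp: w1_def w2_def window_nonneg window_le_1)
      then have w12: "0 \<le> w1 n (x$1) * w2 n (x$2)" "w1 n (x$1) * w2 n (x$2) \<le> 1"
        by (auto intro: mult_le_one)
      have "\<bar>c n * deriv step (x$3)\<bar> \<le> 3 * C"
        unfolding abs_mult using cb[of n] C by (intro mult_mono) auto
      moreover have "\<bar>k n (x$3)\<bar> \<le> 1"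
        using window_nonneg[of i i' n "x$3"] window_le_1[of i i' n "x$3"] by (simp add: k_def)
      ultimately have "\<bar>k n (x$3) - c n * deriv step (x$3)\<bar> \<le> 1 + 3 * C" by linarith
      then have "\<bar>F x * (k n (x$3) - c n * deriv step (x$3))\<bar> \<le> (1 + 3 * C) * \<bar>F x\<bar>"
        by (subst abs_mult, subst mult.commute) (intro mult_right_mono, auto)
      moreover have "\<bar>G x * r n (x$3)\<bar> \<le> 6 * \<bar>G x\<bar>"
        using rb[of n "x$3"] by (subst abs_mult, subst mult.commute) (intro mult_right_mono, auto)
      ultimately have "\<bar>F x * (k n (x$3) - c n * deriv step (x$3)) + G x * r n (x$3)\<bar> \<le> (1 + 3 * C) * \<bar>F x\<bar> + 6 * \<bar>G x\<bar>"
        by linarith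
      then show "norm (S n x) \<le> (1 + 3 * C) * norm (F x) + 6 * norm (G x)"
        using mult_left_le_one_le[of "\<bar>F x * (k n (x$3) - c n * deriv step (x$3)) + G x * r n (x$3)\<bar>" "w1 n (x$1) * w2 n (x$2)"] w12 w
        by (simp add: S_def abs_mult)
    qed
    show "integrable lborel (\<lambda>x. (1 + 3 * C) * norm (F x) + 6 * norm (G x))"
      using F(1) G(1) by (intro Bochner_Integration.integrable_add integrable_mult_right integrable_norm)
    show "L \<in> borel_measurable lborel" unfolding L_def by measurable
    show "S n \<in> borel_measurable lborel" for n unfolding S_def by measurable
  qed
  moreover have "(LINT x|lborel. S n x) = 0" if "n > 0" for n
  proof -
    have "S n x = F x * tensor (w1 n) (w2 n) (deriv (r n)) x + G x * tensor (w1 n) (w2 n) (r n) x" for x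
      by (simp add: S_def rt(2)[OF that] tensor_def algebra_simps)
    then show ?thesis
      using test[of "w1 n" "w2 n" "r n"] rt(1)[OF that] that E by (simp add: w1_def w2_def test_real_window)
  qed
  then have "(\<lambda>n. LINT x|lborel. S n x) \<longlonglongrightarrow> 0"
    by (intro tendsto_eventually eventually_sequentiallyI[of 1]) simp
  ultimately have "(LINT x|lborel. L x) = 0" by (rule LIMSEQ_unique)
  then show ?thesis by (simp add: L_def m_def)
qed

lemma fst_borel: "fst \<in> borel_measurable (borel :: ('a::second_countable_topology \<times> 'b::second_countable_topology) measure)"
  and snd_borel: "snd \<in> borel_measurable (borel :: ('a \<times> 'b) measure)"
  by (intro borel_measurable_continuous_onI continuous_intros)+

lemmas compose_fst = measurable_compose[OF fst_borel] and compose_snd = measurable_compose[OF snd_borel]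

text \<open>Both sides integrate g(z) over the pairs t <= z with t in the interval; integrating
  tails of g over t thus amounts to a weighted integral of g.\<close>

lemma Fubini_tail_integral:
  fixes g :: "real \<Rightarrow> real"
  assumes g: "integrable lborel g" and I: "i < i'"
  shows "(LINT t|lborel. indicator {i<..<i'} t * (LINT z|lborel. indicator {t..} z * g z)) =
    (LINT z|lborel. g z * (LINT t|lborel. indicator {..z} t * indicator {i<..<i'} t))"
proof -
  have [measurable]: "g \<in> borel_measurable borel" using g by simp
  have Ii: "integrable lborel (indicator {i<..<i'} :: real \<Rightarrow> real)"
    by (rule integrable_real_indicator) (use I in auto)
  have ind: "(\<lambda>w::real\<times>real. indicator {fst w..} (snd w) :: real) \<in> borel_measurable (borel \<Otimes>\<^sub>M borel)"
  proof -
    have eq: "(\<lambda>w::real\<times>real. indicator {fst w..} (snd w) :: real) = indicator {w. fst w \<le> snd w}"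
      by (auto simp: indicator_def fun_eq_iff)
    have s: "{w::real\<times>real. fst w \<le> snd w} \<in> sets (borel \<Otimes>\<^sub>M borel)"
      unfolding borel_prod by (intro borel_closed closed_Collect_le continuous_intros)
    show ?thesis unfolding eq by (rule borel_measurable_indicator[OF s])
  qed
  have "integrable (lborel \<Otimes>\<^sub>M lborel) (\<lambda>(t, z). indicator {i<..<i'} t * (indicator {t..} z * g z))"
  proof (rule Bochner_Integration.integrable_bound)
    show "integrable (lborel \<Otimes>\<^sub>M lborel) (\<lambda>(t, z). indicator {i<..<i'} t * g z)"
    proof (rule lborel_pair.Fubini_integrable)
      show "integrable lborel (\<lambda>x. LINT y|lborel. norm (case (x, y) of (t, z) \<Rightarrow> indicator {i<..<i'} t * g z))"
        using Ii by (simp add: abs_mult)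
      show "AE x in lborel. integrable lborel (\<lambda>y. case (x, y) of (t, z) \<Rightarrow> indicator {i<..<i'} t * g z)"
        using g by simp
    qed measurable
    have "(\<lambda>w. indicator {i<..<i'} (fst w) * (indicator {fst w..} (snd w) * g (snd w))) \<in> borel_measurable (borel \<Otimes>\<^sub>M borel)"
      by (intro borel_measurable_times ind) measurable
    then show "(\<lambda>(t, z). indicator {i<..<i'} t * (indicator {t..} z * g z)) \<in> borel_measurable (lborel \<Otimes>\<^sub>M lborel)"
      by (simp add: case_prod_beta' cong: measurable_cong_sets)
    show "AE x in lborel \<Otimes>\<^sub>M lborel. norm (case x of (t, z) \<Rightarrow> indicator {i<..<i'} t * (indicator {t..} z * g z))
        \<le> norm (case x of (t, z) \<Rightarrow> indicator {i<..<i'} t * g z)"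
      by (intro AE_I2) (auto simp: indicator_def)
  qed
  from lborel_pair.Fubini_integral[OF this]
  have "(LINT z|lborel. LINT t|lborel. indicator {i<..<i'} t * (indicator {t..} z * g z)) =
    (LINT t|lborel. LINT z|lborel. indicator {i<..<i'} t * (indicator {t..} z * g z))" .
  moreover have "(LINT t|lborel. indicator {i<..<i'} t * (indicator {t..} z * g z)) =
      g z * (LINT t|lborel. indicator {..z} t * indicator {i<..<i'} t)" for z
  proof -
    have "(LINT t|lborel. indicator {i<..<i'} t * (indicator {t..} z * g z)) =
      (LINT t|lborel. g z * (indicator {..z} t * indicator {i<..<i'} t))"
      by (intro Bochner_Integration.integral_cong) (auto simp: indicator_def)
    then show ?thesis by simp
  qed
  ultimately show ?thesis by simp
qed

lemma sets_borel_lborel: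
  "sets (borel \<Otimes>\<^sub>M lborel) = sets (borel :: ('a::euclidean_space \<times> 'b::euclidean_space) measure)"
  by (simp add: borel_prod[symmetric] cong: sets_pair_measure_cong)

lemma tail_indicator_measurable:
  "(\<lambda>w::((real \<times> real) \<times> real) \<times> real. indicator {snd (fst w)..} (snd w) :: real) \<in> borel_measurable borel"
proof -
  have eq: "(\<lambda>w::((real \<times> real) \<times> real) \<times> real. indicator {snd (fst w)..} (snd w) :: real) = indicator {w. snd (fst w) \<le> snd w}"
    by (auto simp: indicator_def fun_eq_iff)
  have s: "{w::((real \<times> real) \<times> real) \<times> real. snd (fst w) \<le> snd w} \<in> sets borel"
    by (intro borel_closed closed_Collect_le continuous_intros)
  show ?thesis unfolding eq by (rule borel_measurable_indicator[OF s])
qed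

lemma mem_box_real_triple:
  "w \<in> box c d \<longleftrightarrow> fst (fst c) < fst (fst w) \<and> fst (fst w) < fst (fst d) \<and> snd (fst c) < snd (fst w)
     \<and> snd (fst w) < snd (fst d) \<and> snd c < snd w \<and> snd w < snd d" for w :: "(real \<times> real) \<times> real"
  by (auto simp: box_def Basis_prod_def inner_prod_def)

text \<open>On almost every column F = A - B at heights in (0,3), where B is the integral of G above
  the given height and A does not depend on the height; both are bounded by absolute column
  integrals, which make up Z. Since the weak formulation gives no access to single columns, the
  identity is derived from the vanishing of all box integrals of F - A + B.\<close>

lemma vertical_domination_borel:
  assumes F: "integrable lborel F" "F \<in> borel_measurable borel"
    and G: "integrable lborel G" "G \<in> borel_measurable borel"
    and out: "\<And>x. x \<notin> domain a \<Longrightarrow> F x = 0" "\<And>x. x \<notin> domain a \<Longrightarrow> G x = 0"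
    and test: "\<And>p q r. test_real {0<..<a} p \<Longrightarrow> test_real {0<..<a} q \<Longrightarrow> test_real {0<..<3} r \<Longrightarrow>
      (LINT x|lborel. F x * tensor p q (deriv r) x + G x * tensor p q r x) = 0"
    and C: "\<And>x. \<bar>deriv step x\<bar> \<le> C"
  defines "Z \<equiv> \<lambda>y. LINT z|lborel. C * \<bar>F (embed3 (y, z))\<bar> + 2 * \<bar>G (embed3 (y, z))\<bar>"
  shows "AE x in lborel. x$3 \<in> {0<..<3} \<longrightarrow> \<bar>F x\<bar> \<le> Z (x$1, x$2)"
    and "integrable lborel Z" "Z \<in> borel_measurable borel" "\<And>y. 0 \<le> Z y"
    and "(LINT y|lborel. Z y) = (LINT x|lborel. C * \<bar>F x\<bar> + 2 * \<bar>G x\<bar>)"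
proof -
  define f where "f w = F (embed3 w)" for w
  define g where "g w = G (embed3 w)" for w
  note F(2)[measurable] G(2)[measurable]
  have fm [measurable]: "f \<in> borel_measurable borel" and gm [measurable]: "g \<in> borel_measurable borel"
    unfolding f_def[abs_def] g_def[abs_def] by measurable
  have fi: "integrable (lborel \<Otimes>\<^sub>M lborel) f" and gi: "integrable (lborel \<Otimes>\<^sub>M lborel) g"
    using integrable_embed3[OF F(2)] integrable_embed3[OF G(2)] F(1) G(1)
    by (simp_all add: f_def[abs_def] g_def[abs_def] lborel_prod)
  have stepm [measurable]: "step \<in> borel_measurable borel" "deriv step \<in> borel_measurable borel"
    by (intro borel_measurable_continuous_onI smooth_real_continuous smooth_real_step smooth_real_deriv)+
  have C0: "0 \<le> C" using C[of 0] by linarith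
  have Zi: "integrable (lborel \<Otimes>\<^sub>M lborel) (\<lambda>w. C * \<bar>f w\<bar> + 2 * \<bar>g w\<bar>)"
    using fi gi by (intro Bochner_Integration.integrable_add integrable_mult_right integrable_abs)
  have Zdef: "Z y = (LINT z|lborel. C * \<bar>f (y, z)\<bar> + 2 * \<bar>g (y, z)\<bar>)" for y
    by (simp add: Z_def f_def g_def)
  show Zint: "integrable lborel Z"
    unfolding Zdef[abs_def] using lborel_pair.integrable_fst'[OF Zi] by simp
  then show "Z \<in> borel_measurable borel" by simp
  show "0 \<le> Z y" for y unfolding Z_def using C0 by (intro integral_nonneg_AE) auto
  show "(LINT y|lborel. Z y) = (LINT x|lborel. C * \<bar>F x\<bar> + 2 * \<bar>G x\<bar>)"
  proof -
    have "(LINT y|lborel. Z y) = (LINT w|lborel. C * \<bar>f w\<bar> + 2 * \<bar>g w\<bar>)"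
      using lborel_pair.integral_fst'[OF Zi] by (simp add: Zdef lborel_prod)
    also have "\<dots> = (LINT x|lborel. C * \<bar>F x\<bar> + 2 * \<bar>G x\<bar>)"
      unfolding f_def g_def by (rule integral_embed3) measurable
    finally show ?thesis .
  qed
  \<comment> \<open>For a smooth column, integrating (F step)' = F step' + G step over (0,3) gives
    the value of F at 3, as \<open>step\<close> rises from 0 to 1 below that height; above it, A and
    B collect the same tail of G.\<close>
  define A where "A y = (LINT z|lborel. f (y, z) * deriv step z + g (y, z) * step z)" for y
  define B where "B w = (LINT z|lborel. indicator {snd w..} z * g (fst w, z))" for w :: "(real \<times> real) \<times> real"
  define H where "H w = indicator {0<..<3} (snd w) * (f w - A (fst w) + B w)" for w
  have Ai: "integrable (lborel \<Otimes>\<^sub>M lborel) (\<lambda>w. f w * deriv step (snd w) + g w * step (snd w))"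
  proof (rule Bochner_Integration.integrable_bound[OF Zi])
    show "(\<lambda>w. f w * deriv step (snd w) + g w * step (snd w)) \<in> borel_measurable (lborel \<Otimes>\<^sub>M lborel)"
      unfolding lborel_prod measurable_lborel2
      by (intro borel_measurable_times borel_measurable_add fm gm stepm[THEN compose_snd])
    show "AE w in lborel \<Otimes>\<^sub>M lborel. norm (f w * deriv step (snd w) + g w * step (snd w)) \<le> norm (C * \<bar>f w\<bar> + 2 * \<bar>g w\<bar>)"
    proof (rule AE_I2)
      fix w :: "(real \<times> real) \<times> real"
      have "\<bar>f w * deriv step (snd w)\<bar> \<le> C * \<bar>f w\<bar>"
        using C[of "snd w"] by (subst abs_mult, subst mult.commute) (intro mult_right_mono, auto)
      moreover have "\<bar>g w * step (snd w)\<bar> \<le> 1 * \<bar>g w\<bar>"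
        using step_nonneg[of "snd w"] step_le_1[of "snd w"]
        by (subst abs_mult, subst mult.commute) (intro mult_right_mono, auto)
      ultimately show "norm (f w * deriv step (snd w) + g w * step (snd w)) \<le> norm (C * \<bar>f w\<bar> + 2 * \<bar>g w\<bar>)"
        by simp
    qed
  qed
  have Aint: "integrable lborel A"
    unfolding A_def[abs_def] using lborel_pair.integrable_fst'[OF Ai] by simp
  have Am: "A \<in> borel_measurable borel" using Aint by simp
  have Bm [measurable]: "B \<in> borel_measurable borel"
  proof -
    have "(\<lambda>w. \<integral>z. (\<lambda>w z. indicator {snd w..} z * g (fst w, z)) w z \<partial>lborel) \<in> borel_measurable (borel :: ((real \<times> real) \<times> real) measure)"
    proof (rule lborel.borel_measurable_lebesgue_integral)
      have "(\<lambda>w::((real \<times> real) \<times> real) \<times> real. (fst (fst w), snd w)) \<in> borel_measurable borel"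
        by (intro borel_measurable_continuous_onI continuous_intros)
      from measurable_compose[OF this gm]
      have "(\<lambda>w::((real \<times> real) \<times> real) \<times> real. indicator {snd (fst w)..} (snd w) * g (fst (fst w), snd w)) \<in> borel_measurable borel"
        by (intro borel_measurable_times tail_indicator_measurable)
      then show "(\<lambda>(w, z). indicator {snd w..} z * g (fst w, z)) \<in> borel_measurable (borel \<Otimes>\<^sub>M lborel)"
        unfolding case_prod_beta' measurable_cong_sets[OF sets_borel_lborel refl] .
    qed
    then show ?thesis by (simp add: B_def[abs_def])
  qed
  define good where "good y \<longleftrightarrow> integrable lborel (\<lambda>z. f (y, z)) \<and> integrable lborel (\<lambda>z. g (y, z))" for y
  have good_AE: "AE y in lborel. good y"
    using lborel_pair.AE_integrable_fst'[OF fi] lborel_pair.AE_integrable_fst'[OF gi]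
    by eventually_elim (simp add: good_def)
  have good_m: "{y. good y} \<in> sets borel"
  proof -
    have "Measurable.pred borel (\<lambda>y. integrable lborel (\<lambda>z. f (y, z)))" "Measurable.pred borel (\<lambda>y. integrable lborel (\<lambda>z. g (y, z)))"
      by (rule lborel.borel_measurable_lebesgue_integrable;
          unfold case_prod_beta' measurable_cong_sets[OF sets_borel_lborel refl]; simp add: fm gm)+
    then have "Measurable.pred borel good" unfolding good_def[abs_def] by measurable
    then show ?thesis by (simp add: pred_def)
  qed
  have good_AE2: "AE w in (lborel \<Otimes>\<^sub>M lborel :: ((real \<times> real) \<times> real) measure). good (fst w)"
  proof (rule lborel_pair.AE_pair_measure)
    have "fst -` {y. good y} \<inter> space borel \<in> sets (borel :: ((real \<times> real) \<times> real) measure)"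
      by (rule measurable_sets[OF fst_borel good_m])
    then show "{x \<in> space (lborel \<Otimes>\<^sub>M lborel :: ((real \<times> real) \<times> real) measure). good (fst x)} \<in> sets (lborel \<Otimes>\<^sub>M lborel)"
      unfolding lborel_prod by (simp add: vimage_def)
    show "AE x in lborel. AE y in (lborel :: real measure). good (fst (x, y))" using good_AE by eventually_elim simp
  qed
  have bound: "\<bar>A y\<bar> + \<bar>B (y, t)\<bar> \<le> Z y" if "good y" for y t
  proof -
    have i1: "integrable lborel (\<lambda>z. f (y, z))" "integrable lborel (\<lambda>z. g (y, z))" using that by (auto simp: good_def)
    have i2: "integrable lborel (\<lambda>z. C * \<bar>f (y, z)\<bar> + \<bar>g (y, z)\<bar>)" "integrable lborel (\<lambda>z. \<bar>g (y, z)\<bar>)"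
      by (intro Bochner_Integration.integrable_add integrable_mult_right integrable_abs i1)+
    have "\<bar>A y\<bar> \<le> (LINT z|lborel. C * \<bar>f (y, z)\<bar> + \<bar>g (y, z)\<bar>)"
      unfolding A_def
    proof (rule integral_abs_bound_integral)
      show "\<bar>f (y, z) * deriv step z + g (y, z) * step z\<bar> \<le> C * \<bar>f (y, z)\<bar> + \<bar>g (y, z)\<bar>" for z
      proof -
        have "\<bar>f (y, z) * deriv step z\<bar> \<le> C * \<bar>f (y, z)\<bar>"
          using C[of z] by (subst abs_mult, subst mult.commute) (intro mult_right_mono, auto)
        moreover have "\<bar>g (y, z) * step z\<bar> \<le> 1 * \<bar>g (y, z)\<bar>"
          using step_nonneg[of z] step_le_1[of z]
          by (subst abs_mult, subst mult.commute) (intro mult_right_mono, auto)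
        ultimately show ?thesis by linarith
      qed
      then show "integrable lborel (\<lambda>z. f (y, z) * deriv step z + g (y, z) * step z)"
        by (intro Bochner_Integration.integrable_bound[OF i2(1)])
          (auto intro: order_trans[OF _ abs_ge_self])
    qed (rule i2)
    moreover have "\<bar>B (y, t)\<bar> \<le> (LINT z|lborel. \<bar>g (y, z)\<bar>)"
      unfolding B_def
    proof (rule integral_abs_bound_integral)
      show "integrable lborel (\<lambda>z. indicator {snd (y, t)..} z * g (fst (y, t), z))"
        using integrable_mult_indicator[OF _ i1(2), of "{t..}"] by simp
    qed (use i2 in \<open>auto simp: indicator_def\<close>)
    moreover have "Z y = (LINT z|lborel. C * \<bar>f (y, z)\<bar> + \<bar>g (y, z)\<bar>) + (LINT z|lborel. \<bar>g (y, z)\<bar>)"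
      unfolding Zdef Bochner_Integration.integral_add[OF i2, symmetric] by (simp add: algebra_simps)
    ultimately show ?thesis by linarith
  qed
  have Ii: "integrable lborel (indicator {0<..<3} :: real \<Rightarrow> real)"
    by (rule integrable_real_indicator) auto
  have ZI: "integrable (lborel \<Otimes>\<^sub>M lborel) (\<lambda>w. indicator {0<..<3::real} (snd w) * Z (fst w))"
  proof (rule lborel_pair.Fubini_integrable)
    show "(\<lambda>w. indicator {0<..<3::real} (snd w) * Z (fst w)) \<in> borel_measurable (lborel \<Otimes>\<^sub>M lborel)"
      unfolding lborel_prod measurable_lborel2
      by (intro borel_measurable_times compose_fst[OF \<open>Z \<in> borel_measurable borel\<close>] compose_snd borel_measurable_indicator) simp
    show "integrable lborel (\<lambda>x. LINT y|lborel. norm (indicator {0<..<3::real} (snd (x, y)) * Z (fst (x, y))))"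
      using Zint by (simp add: abs_mult)
    show "AE x in lborel. integrable lborel (\<lambda>y. indicator {0<..<3::real} (snd (x, y)) * Z (fst (x, y)))"
      using Ii by simp
  qed
  have Hi: "integrable (lborel \<Otimes>\<^sub>M lborel) H"
  proof (rule Bochner_Integration.integrable_bound)
    show "integrable (lborel \<Otimes>\<^sub>M lborel) (\<lambda>w. \<bar>f w\<bar> + indicator {0<..<3} (snd w) * Z (fst w))"
      by (intro Bochner_Integration.integrable_add integrable_abs fi ZI)
    show "H \<in> borel_measurable (lborel \<Otimes>\<^sub>M lborel)"
      unfolding lborel_prod H_def[abs_def] measurable_lborel2
      by (intro borel_measurable_times borel_measurable_add borel_measurable_diff fm Bm
          compose_fst[OF Am] compose_snd borel_measurable_indicator) simp
    show "AE w in lborel \<Otimes>\<^sub>M lborel. norm (H w) \<le> norm (\<bar>f w\<bar> + indicator {0<..<3} (snd w) * Z (fst w))"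
      using good_AE2
    proof eventually_elim
      case (elim w)
      then show ?case using bound[of "fst w" "snd w"] by (auto simp: H_def indicator_def)
    qed
  qed
  have "AE w in lborel. H w = 0"
  proof (rule AE_zero_of_box_integrals_zero)
    show "integrable lborel H" using Hi by (simp add: lborel_prod)
    fix c d :: "(real \<times> real) \<times> real"
    define i where "i = max 0 (snd c)"
    define i' where "i' = min 3 (snd d)"
    \<comment> \<open>E clips the horizontal edges of the box to (0,a), where the test functions
      live, and \<open>E0\<close> does not; they act alike on f and g, which vanish outside the
      domain. The vertical edge is clipped to (0,3), outside of which H vanishes.\<close>
    define E where "E y = indicator {max 0 (fst (fst c))<..<min a (fst (fst d))} (fst y) *
      (indicator {max 0 (snd (fst c))<..<min a (snd (fst d))} (snd y) :: real)" for y :: "real \<times> real"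
    define E0 where "E0 y = indicator {fst (fst c)<..<fst (fst d)} (fst y) *
      (indicator {snd (fst c)<..<snd (fst d)} (snd y) :: real)" for y :: "real \<times> real"
    have Em: "E \<in> borel_measurable borel" "E0 \<in> borel_measurable borel"
      unfolding E_def[abs_def] E0_def[abs_def]
      by (intro borel_measurable_times compose_fst compose_snd borel_measurable_indicator; simp)+
    have Eb: "0 \<le> E0 y" "E0 y \<le> 1" for y by (auto simp: E0_def indicator_def)
    have fE: "E0 y * f (y, z) = E y * f (y, z)" "E0 y * g (y, z) = E y * g (y, z)" for y z
      using out[of "embed3 (y, z)"] by (auto simp: E_def E0_def f_def g_def indicator_def domain_def)
    have ind: "indicator (box c d) (y, t) * H (y, t) = E0 y * (indicator {i<..<i'} t * (f (y, t) - A y + B (y, t)))" for y t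
      by (auto simp: indicator_def mem_box_real_triple H_def E0_def i_def i'_def)
    have Hb: "integrable (lborel \<Otimes>\<^sub>M lborel) (\<lambda>w. indicator (box c d) w * H w)"
      using integrable_mult_indicator[of "box c d" lborel H] Hi by (simp add: lborel_prod)
    have "(LINT w:box c d|lborel. H w) = (LINT w|(lborel \<Otimes>\<^sub>M lborel). indicator (box c d) w * H w)"
      by (simp add: set_lebesgue_integral_def lborel_prod)
    also have "\<dots> = (LINT y|lborel. LINT t|lborel. indicator (box c d) (y, t) * H (y, t))"
      by (rule lborel_pair.integral_fst'[symmetric, OF Hb])
    also have "\<dots> = (LINT y|lborel. E0 y * (LINT t|lborel. indicator {i<..<i'} t * (f (y, t) - A y + B (y, t))))"
      unfolding ind by simp
    also have "\<dots> = 0"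
    proof (cases "i < i'")
      case False
      then show ?thesis by simp
    next
      case I: True
      define m where "m = (\<lambda>z. LINT y|lborel. indicator {..z} y * (indicator {i<..<i'} y :: real))"
      define L where "L w = f w * (indicator {i<..<i'} (snd w) - (i' - i) * deriv step (snd w))
        + g w * (m (snd w) - (i' - i) * step (snd w))" for w :: "(real \<times> real) \<times> real"
      have Ii2: "integrable lborel (indicator {i<..<i'} :: real \<Rightarrow> real)"
        by (rule integrable_real_indicator) (use I in auto)
      have mb: "0 \<le> m z" "m z \<le> i' - i" for z
      proof -
        show "0 \<le> m z" unfolding m_def by simp
        have "m z \<le> (LINT y|lborel. indicator {i<..<i'} y)"
          unfolding m_def
        proof (rule integral_mono)
          show "integrable lborel (\<lambda>y. indicator {..z} y * (indicator {i<..<i'} y :: real))"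
            using integrable_mult_indicator[OF _ Ii2, of "{..z}"] by simp
          show "integrable lborel (indicator {i<..<i'} :: real \<Rightarrow> real)" by (rule Ii2)
        qed (auto simp: indicator_def)
        then show "m z \<le> i' - i" using I by simp
      qed
      have mm [measurable]: "m \<in> borel_measurable borel"
      proof -
        have "mono m"
          unfolding m_def
        proof (rule monoI, rule integral_mono)
          show "integrable lborel (\<lambda>y. indicator {..z} y * (indicator {i<..<i'} y :: real))" for z
            using integrable_mult_indicator[OF _ Ii2, of "{..z}"] by simp
          then show "integrable lborel (\<lambda>y. indicator {..z} y * (indicator {i<..<i'} y :: real))" for z .
        qed (auto simp: indicator_def)
        then show ?thesis by (rule borel_measurable_mono)
      qed
      \<comment> \<open>Integrating F - A + B over the vertical edge and exchanging the order of
        integration in the tail term gives the integrand of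
        \<open>weak_deriv_box_identity\<close>.\<close>
      have inner: "(LINT t|lborel. indicator {i<..<i'} t * (f (y, t) - A y + B (y, t))) = (LINT z|lborel. L (y, z))"
        if "good y" for y
      proof -
        have i1: "integrable lborel (\<lambda>z. f (y, z))" "integrable lborel (\<lambda>z. g (y, z))" using that by (auto simp: good_def)
        have i2: "integrable lborel (\<lambda>z. indicator {i<..<i'} z * f (y, z))"
          using integrable_mult_indicator[OF _ i1(1), of "{i<..<i'}"] by simp
        have i3: "integrable lborel (\<lambda>z. indicator {i<..<i'} z * A y)" using Ii2 by simp
        have i4: "integrable lborel (\<lambda>z. indicator {i<..<i'} z * B (y, z))"
        proof (rule Bochner_Integration.integrable_bound)
          show "integrable lborel (\<lambda>z. indicator {i<..<i'} z * Z y)" using Ii2 by simp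
          show "(\<lambda>z. indicator {i<..<i'} z * B (y, z)) \<in> borel_measurable lborel" by measurable
          show "AE z in lborel. norm (indicator {i<..<i'} z * B (y, z)) \<le> norm (indicator {i<..<i'} z * Z y)"
          proof (rule AE_I2)
            fix z
            have "\<bar>B (y, z)\<bar> \<le> \<bar>Z y\<bar>" using bound[OF that, of z] by linarith
            then show "norm (indicator {i<..<i'} z * B (y, z)) \<le> norm (indicator {i<..<i'} z * Z y)"
              by (auto simp: indicator_def)
          qed
        qed
        have i5: "integrable lborel (\<lambda>z. f (y, z) * deriv step z + g (y, z) * step z)"
        proof (rule Bochner_Integration.integrable_add)
          show "integrable lborel (\<lambda>z. f (y, z) * deriv step z)"
          proof (rule Bochner_Integration.integrable_bound)
            show "integrable lborel (\<lambda>z. C * f (y, z))" using i1 by simp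
            show "AE z in lborel. norm (f (y, z) * deriv step z) \<le> norm (C * f (y, z))"
              using C C0 by (intro AE_I2) (auto simp: abs_mult mult.commute[of C] intro!: mult_left_mono)
          qed measurable
          show "integrable lborel (\<lambda>z. g (y, z) * step z)"
            by (rule Bochner_Integration.integrable_bound[OF i1(2)])
              (auto simp: abs_mult step_nonneg step_le_1 intro!: mult_left_le)
        qed
        have i6: "integrable lborel (\<lambda>z. g (y, z) * m z)"
        proof (rule Bochner_Integration.integrable_bound)
          show "integrable lborel (\<lambda>z. (i' - i) * g (y, z))" using i1 by simp
          show "AE z in lborel. norm (g (y, z) * m z) \<le> norm ((i' - i) * g (y, z))"
            using mb I by (intro AE_I2) (auto simp: abs_mult mult.commute[of "i' - i"] intro!: mult_left_mono)
        qed measurable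
        have "(LINT t|lborel. indicator {i<..<i'} t * (f (y, t) - A y + B (y, t))) =
          (LINT t|lborel. indicator {i<..<i'} t * f (y, t) - indicator {i<..<i'} t * A y + indicator {i<..<i'} t * B (y, t))"
          by (simp add: algebra_simps)
        also have "\<dots> = (LINT t|lborel. indicator {i<..<i'} t * f (y, t)) - (i' - i) * A y + (LINT t|lborel. indicator {i<..<i'} t * B (y, t))"
          using i2 i3 i4 I by simp
        also have "(LINT t|lborel. indicator {i<..<i'} t * B (y, t)) = (LINT z|lborel. g (y, z) * m z)"
          unfolding m_def using Fubini_tail_integral[OF i1(2) I] by (simp add: B_def)
        also have "(LINT t|lborel. indicator {i<..<i'} t * f (y, t)) - (i' - i) * A y + (LINT z|lborel. g (y, z) * m z)
          = (LINT z|lborel. indicator {i<..<i'} z * f (y, z) - (i' - i) * (f (y, z) * deriv step z + g (y, z) * step z) + g (y, z) * m z)"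
          unfolding A_def using i2 i5 i6
          by (subst Bochner_Integration.integral_add; (subst Bochner_Integration.integral_diff)?; simp)
        also have "\<dots> = (LINT z|lborel. L (y, z))"
          by (intro Bochner_Integration.integral_cong) (auto simp: L_def algebra_simps)
        finally show ?thesis .
      qed
      have Lm: "L \<in> borel_measurable borel"
        unfolding L_def[abs_def]
        by (intro borel_measurable_times borel_measurable_add borel_measurable_diff fm gm
            stepm[THEN compose_snd] compose_snd[OF mm] compose_snd[OF borel_measurable_indicator]
            borel_measurable_const) simp
      have ELi: "integrable (lborel \<Otimes>\<^sub>M lborel) (\<lambda>w. E0 (fst w) * L w)"
      proof (rule Bochner_Integration.integrable_bound)
        show "integrable (lborel \<Otimes>\<^sub>M lborel) (\<lambda>w. (1 + (i' - i) * C) * \<bar>f w\<bar> + (i' - i) * \<bar>g w\<bar>)"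
          using fi gi by (intro Bochner_Integration.integrable_add integrable_mult_right integrable_abs)
        show "(\<lambda>w. E0 (fst w) * L w) \<in> borel_measurable (lborel \<Otimes>\<^sub>M lborel)"
          unfolding lborel_prod measurable_lborel2 by (intro borel_measurable_times compose_fst Em Lm)
        show "AE w in lborel \<Otimes>\<^sub>M lborel. norm (E0 (fst w) * L w) \<le> norm ((1 + (i' - i) * C) * \<bar>f w\<bar> + (i' - i) * \<bar>g w\<bar>)"
        proof (rule AE_I2)
          fix w :: "(real \<times> real) \<times> real"
          have "\<bar>(i' - i) * deriv step (snd w)\<bar> \<le> (i' - i) * C"
            using C I by (simp add: abs_mult)
          then have "\<bar>indicator {i<..<i'} (snd w) - (i' - i) * deriv step (snd w)\<bar> \<le> 1 + (i' - i) * C"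
            by (auto simp: indicator_def)
          then have 1: "\<bar>f w * (indicator {i<..<i'} (snd w) - (i' - i) * deriv step (snd w))\<bar> \<le> (1 + (i' - i) * C) * \<bar>f w\<bar>"
            by (subst abs_mult, subst mult.commute) (intro mult_right_mono, auto)
          have "0 \<le> (i' - i) * step (snd w)" "(i' - i) * step (snd w) \<le> i' - i"
            using I step_nonneg[of "snd w"] step_le_1[of "snd w"] by (auto simp: mult_left_le)
          then have "\<bar>m (snd w) - (i' - i) * step (snd w)\<bar> \<le> i' - i"
            using mb[of "snd w"] by linarith
          then have 2: "\<bar>g w * (m (snd w) - (i' - i) * step (snd w))\<bar> \<le> (i' - i) * \<bar>g w\<bar>"
            by (subst abs_mult, subst mult.commute) (intro mult_right_mono, auto)
          have "\<bar>L w\<bar> \<le> (1 + (i' - i) * C) * \<bar>f w\<bar> + (i' - i) * \<bar>g w\<bar>"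
            unfolding L_def using 1 2 by linarith
          moreover have "\<bar>E0 (fst w) * L w\<bar> \<le> \<bar>L w\<bar>"
            using Eb[of "fst w"] by (simp add: abs_mult mult_left_le_one_le)
          ultimately show "norm (E0 (fst w) * L w) \<le> norm ((1 + (i' - i) * C) * \<bar>f w\<bar> + (i' - i) * \<bar>g w\<bar>)"
            by simp
        qed
      qed
      have "(LINT y|lborel. E0 y * (LINT t|lborel. indicator {i<..<i'} t * (f (y, t) - A y + B (y, t))))
        = (LINT y|lborel. LINT z|lborel. E0 (fst (y, z)) * L (y, z))"
      proof (rule integral_cong_AE)
        show "AE y in lborel. E0 y * (LINT t|lborel. indicator {i<..<i'} t * (f (y, t) - A y + B (y, t))) =
          (LINT z|lborel. E0 (fst (y, z)) * L (y, z))"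
          using good_AE by eventually_elim (simp add: inner)
        show "(\<lambda>y. LINT z|lborel. E0 (fst (y, z)) * L (y, z)) \<in> borel_measurable lborel"
          using lborel_pair.integrable_fst'[OF ELi] by simp
        from lborel_pair.integrable_fst'[OF Hb]
        show "(\<lambda>y. E0 y * (LINT t|lborel. indicator {i<..<i'} t * (f (y, t) - A y + B (y, t)))) \<in> borel_measurable lborel"
          unfolding ind by simp
      qed
      also have "\<dots> = (LINT w|lborel. E0 (fst w) * L w)"
        using lborel_pair.integral_fst'[OF ELi] by (simp add: lborel_prod)
      also have "\<dots> = (LINT w|lborel. (\<lambda>x. E (x$1, x$2) * (F x * (indicator {i<..<i'} (x$3) - (i' - i) * deriv step (x$3))
         + G x * (m (x$3) - (i' - i) * step (x$3)))) (embed3 w))"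
      proof (intro Bochner_Integration.integral_cong refl)
        fix w :: "(real \<times> real) \<times> real"
        have "E0 (fst w) * f w = E (fst w) * f w" "E0 (fst w) * g w = E (fst w) * g w"
          using fE[of "fst w" "snd w"] by simp_all
        then show "E0 (fst w) * L w = (\<lambda>x. E (x$1, x$2) * (F x * (indicator {i<..<i'} (x$3) - (i' - i) * deriv step (x$3))
         + G x * (m (x$3) - (i' - i) * step (x$3)))) (embed3 w)"
          unfolding L_def distrib_left mult.assoc[symmetric] by (auto simp: f_def g_def)
      qed
      also have "\<dots> = (LINT x|lborel. E (x$1, x$2) * (F x * (indicator {i<..<i'} (x$3) - (i' - i) * deriv step (x$3))
         + G x * (m (x$3) - (i' - i) * step (x$3))))"
      proof (rule integral_embed3)
        have "(\<lambda>x::real^3. (x$1, x$2)) \<in> borel_measurable borel"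
          by (intro borel_measurable_continuous_onI continuous_intros)
        then have [measurable]: "(\<lambda>x::real^3. E (x$1, x$2)) \<in> borel_measurable borel"
          by (rule measurable_compose[OF _ Em(1)])
        show "(\<lambda>x. E (x$1, x$2) * (F x * (indicator {i<..<i'} (x$3) - (i' - i) * deriv step (x$3))
         + G x * (m (x$3) - (i' - i) * step (x$3)))) \<in> borel_measurable borel" by measurable
      qed
      also have "\<dots> = 0"
        unfolding E_def m_def fst_conv snd_conv
        by (rule weak_deriv_box_identity[OF F G test]) (use I in \<open>auto simp: i_def i'_def\<close>)
      finally show ?thesis .
    qed
    finally show "(LINT w:box c d|lborel. H w) = 0" .
  qed
  then have "AE w in lborel. snd w \<in> {0<..<3} \<longrightarrow> \<bar>f w\<bar> \<le> Z (fst w)"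
    using good_AE2 unfolding lborel_prod
  proof eventually_elim
    case (elim w)
    then show ?case using bound[of "fst w" "snd w"] by (auto simp: H_def)
  qed
  then have ae: "AE w in lborel. embed3 w $ 3 \<in> {0<..<3} \<longrightarrow> \<bar>F (embed3 w)\<bar> \<le> Z (embed3 w $ 1, embed3 w $ 2)"
    by (simp add: f_def)
  have "(\<lambda>x::real^3. (x$1, x$2)) \<in> borel_measurable borel"
    by (intro borel_measurable_continuous_onI continuous_intros)
  then have [measurable]: "(\<lambda>x::real^3. Z (x$1, x$2)) \<in> borel_measurable borel"
    using \<open>Z \<in> borel_measurable borel\<close> by (rule measurable_compose)
  have "{x. x$3 \<in> {0<..<3} \<longrightarrow> \<bar>F x\<bar> \<le> Z (x$1, x$2)} \<in> sets borel"
    by measurable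
  with ae show "AE x in lborel. x$3 \<in> {0<..<3} \<longrightarrow> \<bar>F x\<bar> \<le> Z (x$1, x$2)"
    by (rule AE_embed3)
qed

section \<open>Integrals and averages over thin slabs above the bottom\<close>

lemma test_real_mono:
  assumes "test_real S p" "S \<subseteq> T" shows "test_real T p"
proof -
  obtain c d where "smooth_real p" "{c..d} \<subseteq> S" "\<forall>x. x \<notin> {c..d} \<longrightarrow> p x = 0"
    using assms(1) unfolding test_real_def by blast
  with assms(2) show ?thesis
    unfolding test_real_def by (intro conjI exI[of _ c] exI[of _ d]) auto
qed

lemma borel_measurable_dom: "f \<in> borel_measurable borel \<Longrightarrow> f \<in> borel_measurable (dom_measure a)"
  for f :: "real^3 \<Rightarrow> real"
  by (intro measurable_restrict_space1 measurable_completion) simp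

abbreviation slab :: "real \<Rightarrow> real^3 \<Rightarrow> real" where
  "slab e \<equiv> indicator {x. x$3 < e}"

lemma slab_measurable [measurable]: "slab e \<in> borel_measurable borel"
proof -
  have "{x::real^3. x$3 < e} \<in> sets borel"
    by (intro borel_open open_halfspace_component_lt_cart)
  then show ?thesis by (rule borel_measurable_indicator)
qed

lemma compose_12_measurable:
  "H \<in> borel_measurable borel \<Longrightarrow> (\<lambda>x::real^3. H (x$1, x$2)) \<in> borel_measurable borel"
  by (rule measurable_compose[of _ _ borel])
    (auto intro!: borel_measurable_continuous_onI continuous_intros)

lemma integral_column_mult:
  fixes H :: "real \<times> real \<Rightarrow> real" and k :: "real \<Rightarrow> real"
  assumes H: "integrable lborel H" and k: "integrable lborel k"
  shows "integrable lborel (\<lambda>x::real^3. k (x$3) * H (x$1, x$2))"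
    and "(LINT x|(lborel :: (real^3) measure). k (x$3) * H (x$1, x$2)) = (LINT z|lborel. k z) * (LINT y|lborel. H y)"
proof -
  have Hm: "H \<in> borel_measurable borel" and km: "k \<in> borel_measurable borel" using H k by simp_all
  have m: "(\<lambda>x::real^3. k (x$3) * H (x$1, x$2)) \<in> borel_measurable borel"
  proof -
    have "(\<lambda>x::real^3. x$3) \<in> borel_measurable borel"
      by (intro borel_measurable_continuous_onI continuous_intros)
    then show ?thesis
      by (intro borel_measurable_times compose_12_measurable Hm measurable_compose[OF _ km])
  qed
  have i: "integrable (lborel \<Otimes>\<^sub>M lborel) (\<lambda>w. k (snd w) * H (fst w))"
  proof (rule lborel_pair.Fubini_integrable)
    show "(\<lambda>w. k (snd w) * H (fst w)) \<in> borel_measurable (lborel \<Otimes>\<^sub>M lborel)"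
      unfolding lborel_prod measurable_lborel2
      by (intro borel_measurable_times compose_fst[OF Hm] compose_snd[OF km])
    show "integrable lborel (\<lambda>x. LINT y|lborel. norm (k (snd (x, y)) * H (fst (x, y))))"
      using H by (simp add: abs_mult)
    show "AE x in lborel. integrable lborel (\<lambda>y. k (snd (x, y)) * H (fst (x, y)))"
      using k by simp
  qed
  then show "integrable lborel (\<lambda>x::real^3. k (x$3) * H (x$1, x$2))"
    using integrable_embed3[OF m] by (simp add: lborel_prod)
  show "(LINT x|(lborel :: (real^3) measure). k (x$3) * H (x$1, x$2)) = (LINT z|lborel. k z) * (LINT y|lborel. H y)"
    using integral_embed3[OF m] lborel_pair.integral_fst'[OF i] by (simp add: lborel_prod)
qed

lemma slab_integral_le:
  fixes H :: "real \<times> real \<Rightarrow> real"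
  assumes H: "integrable lborel H" "\<And>y. 0 \<le> H y" and e: "0 < e"
  shows "integrable (dom_measure a) (\<lambda>x. slab e x * H (x$1, x$2))"
    and "(LINT x|dom_measure a. slab e x * H (x$1, x$2)) \<le> e * (LINT y|lborel. H y)"
proof -
  have "integrable lborel (indicator {0<..<e} :: real \<Rightarrow> real)"
    by (rule integrable_real_indicator) (use e in auto)
  note col = integral_column_mult[OF H(1) this]
  have Hm: "H \<in> borel_measurable borel" using H by simp
  have m: "(\<lambda>x::real^3. indicator {0<..<e} (x$3) * H (x$1, x$2)) \<in> borel_measurable borel"
    using col(1) by simp
  have lc: "integrable lebesgue (\<lambda>x::real^3. indicator {0<..<e} (x$3) * H (x$1, x$2))"
    using col(1) m by (simp add: integrable_completion)
  have le: "indicator (domain a) x * (slab e x * H (x$1, x$2)) \<le> indicator {0<..<e} (x$3) * H (x$1, x$2)" for x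
    using H(2) by (auto simp: indicator_def domain_def)
  have i: "integrable lebesgue (\<lambda>x. indicator (domain a) x * (slab e x * H (x$1, x$2)))"
  proof (rule Bochner_Integration.integrable_bound[OF lc])
    show "(\<lambda>x. indicator (domain a) x * (slab e x * H (x$1, x$2))) \<in> borel_measurable lebesgue"
      by (intro measurable_completion, simp,
          intro borel_measurable_times compose_12_measurable Hm slab_measurable borel_measurable_indicator) simp
    show "AE x in lebesgue. norm (indicator (domain a) x * (slab e x * H (x$1, x$2))) \<le> norm (indicator {0<..<e} (x$3) * H (x$1, x$2))"
      using H(2) by (intro AE_I2) (auto simp: indicator_def domain_def)
  qed
  then show "integrable (dom_measure a) (\<lambda>x. slab e x * H (x$1, x$2))"
    by (simp add: integrable_domain_iff)
  have "(LINT x|dom_measure a. slab e x * H (x$1, x$2)) \<le> (LINT x|(lebesgue :: (real^3) measure). indicator {0<..<e} (x$3) * H (x$1, x$2))"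
    unfolding integral_domain_eq by (rule integral_mono[OF i lc le])
  also have "\<dots> = e * (LINT y|lborel. H y)"
    using col(2) m e by (simp add: integral_completion)
  finally show "(LINT x|dom_measure a. slab e x * H (x$1, x$2)) \<le> e * (LINT y|lborel. H y)" .
qed

text \<open>A Borel representative extended by 0 to the whole space, the form in which Fubini's
  theorem is applied.\<close>

lemma dom_borel_version:
  fixes f :: "real^3 \<Rightarrow> real"
  assumes "integrable (dom_measure a) f"
  obtains F where "integrable lborel F" "F \<in> borel_measurable borel" "\<And>x. x \<notin> domain a \<Longrightarrow> F x = 0"
    "AE x in lebesgue. F x = indicator (domain a) x * f x"
proof -
  have "integrable lebesgue (\<lambda>x. indicator (domain a) x * f x)"
    using assms by (simp add: integrable_domain_iff)
  then obtain g where g: "integrable lborel g" "AE x in lebesgue. indicator (domain a) x * f x = g x" "g \<in> borel_measurable borel"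
    by (rule lebesgue_integrable_borel_version)
  define F where "F x = indicator (domain a) x * g x" for x
  have "integrable lborel F"
    unfolding F_def using integrable_mult_indicator[OF _ g(1), of "domain a"] by simp
  moreover have "F \<in> borel_measurable borel"
    unfolding F_def[abs_def] using g(3) by (intro borel_measurable_times borel_measurable_indicator) auto
  moreover have "AE x in lebesgue. F x = indicator (domain a) x * f x"
    using g(2) by eventually_elim (auto simp: F_def indicator_def split: if_splits)
  ultimately show ?thesis using that by (auto simp: F_def)
qed

lemma integral_borel_version:
  fixes f F h :: "real^3 \<Rightarrow> real"
  assumes f: "integrable (dom_measure a) f"
    and F: "F \<in> borel_measurable borel" "AE x in lebesgue. F x = indicator (domain a) x * f x"
    and h: "h \<in> borel_measurable borel"
  shows "(LINT x|lborel. h x * F x) = (LINT x|dom_measure a. h x * f x)"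
proof -
  have "(LINT x|lborel. h x * F x) = (LINT x|lebesgue. h x * F x)"
    using h F(1) by (simp add: integral_completion)
  also have "\<dots> = (LINT x|lebesgue. indicator (domain a) x * (h x * f x))"
  proof (rule integral_cong_AE)
    show "(\<lambda>x. h x * F x) \<in> borel_measurable lebesgue"
      using h F(1) by (intro borel_measurable_times measurable_completion) auto
    have m: "(\<lambda>x. indicator (domain a) x * f x) \<in> borel_measurable lebesgue"
      using f by (simp add: integrable_domain_iff)
    have "h \<in> borel_measurable lebesgue" using h by (simp add: measurable_completion)
    then have "(\<lambda>x. h x * (indicator (domain a) x * f x)) \<in> borel_measurable lebesgue"
      by (rule borel_measurable_times[OF _ m])
    then show "(\<lambda>x. indicator (domain a) x * (h x * f x)) \<in> borel_measurable lebesgue"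
      by (simp add: mult.left_commute)
    show "AE x in lebesgue. h x * F x = indicator (domain a) x * (h x * f x)"
      using F(2) by eventually_elim simp
  qed
  finally show ?thesis by (simp add: integral_domain_eq)
qed

text \<open>Square integrable functions need not be integrable on the unbounded domain, so both
  functions are cut off at height 3. Test functions supported below that height do not see the cut,
  and the tested identity survives.\<close>

lemma vertical_domination:
  fixes f g :: "real^3 \<Rightarrow> real"
  assumes f: "integrable (dom_measure a) (\<lambda>x. slab 3 x * f x)"
    and g: "integrable (dom_measure a) (\<lambda>x. slab 3 x * g x)"
    and test: "\<And>p q r. test_real {0<..<a} p \<Longrightarrow> test_real {0<..<a} q \<Longrightarrow> test_real {0<..} r \<Longrightarrow>
      (LINT x|dom_measure a. f x * tensor p q (deriv r) x) = - (LINT x|dom_measure a. g x * tensor p q r x)"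
    and C: "\<And>x. \<bar>deriv step x\<bar> \<le> C"
  obtains Z where "integrable lborel Z" "\<And>y. 0 \<le> Z y"
    "AE x in dom_measure a. x$3 < 3 \<longrightarrow> \<bar>f x\<bar> \<le> Z (x$1, x$2)"
    "(LINT y|lborel. Z y) = (LINT x|dom_measure a. slab 3 x * (C * \<bar>f x\<bar> + 2 * \<bar>g x\<bar>))"
proof -
  obtain F where F: "integrable lborel F" "F \<in> borel_measurable borel" "\<And>x. x \<notin> domain a \<Longrightarrow> F x = 0"
    "AE x in lebesgue. F x = indicator (domain a) x * (slab 3 x * f x)"
    using dom_borel_version[OF f] by blast
  obtain G where G: "integrable lborel G" "G \<in> borel_measurable borel" "\<And>x. x \<notin> domain a \<Longrightarrow> G x = 0"
    "AE x in lebesgue. G x = indicator (domain a) x * (slab 3 x * g x)"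
    using dom_borel_version[OF g] by blast
  define Z where "Z y = (LINT z|lborel. C * \<bar>F (embed3 (y, z))\<bar> + 2 * \<bar>G (embed3 (y, z))\<bar>)" for y
  have tst: "(LINT x|lborel. F x * tensor p q (deriv r) x + G x * tensor p q r x) = 0"
    if t: "test_real {0<..<a} p" "test_real {0<..<a} q" "test_real {0<..<3} r" for p q r
  proof -
    have sm: "smooth_real p" "smooth_real q" "smooth_real r" "smooth_real (deriv r)"
      using t by (auto intro: test_real_smooth smooth_real_deriv)
    have tm: "tensor p q (deriv r) \<in> borel_measurable borel" "tensor p q r \<in> borel_measurable borel"
      by (rule tensor_measurable; rule sm)+
    have t0: "test_real {0<..} r"
      by (rule test_real_mono[OF t(3)]) auto
    have bdd: "\<exists>C. \<forall>x. \<bar>tensor p q r' x\<bar> \<le> C" if r': "test_real {0<..<3} r'" for r'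
    proof -
      obtain A B D where "A \<ge> 0" "B \<ge> 0" "D \<ge> 0" "\<forall>x. \<bar>p x\<bar> \<le> A" "\<forall>x. \<bar>q x\<bar> \<le> B" "\<forall>x. \<bar>r' x\<bar> \<le> D"
        using test_real_bounded[OF t(1)] test_real_bounded[OF t(2)] test_real_bounded[OF r'] by blast
      then have "\<forall>x. \<bar>tensor p q r' x\<bar> \<le> A * B * D"
        by (auto simp: tensor_def abs_mult intro!: mult_mono)
      then show ?thesis by blast
    qed
    have int: "integrable lborel (\<lambda>x. tensor p q r' x * H x)"
      if H: "integrable lborel H" and r': "test_real {0<..<3} r'" for r' and H :: "real^3 \<Rightarrow> real"
    proof -
      obtain C' where C': "\<And>x. \<bar>tensor p q r' x\<bar> \<le> C'" using bdd[OF r'] by blast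
      have tm': "tensor p q r' \<in> borel_measurable borel"
        by (rule tensor_measurable; rule sm test_real_smooth[OF r'])
      show ?thesis
      proof (rule Bochner_Integration.integrable_bound)
        show "integrable lborel (\<lambda>x. C' * H x)" using H by simp
        show "(\<lambda>x. tensor p q r' x * H x) \<in> borel_measurable lborel"
          using tm' H by simp
        show "AE x in lborel. norm (tensor p q r' x * H x) \<le> norm (C' * H x)"
          by (intro AE_I2) (auto simp: abs_mult intro!: mult_right_mono order_trans[OF C' abs_ge_self])
      qed
    qed
    have out: "tensor p q (deriv r) x * (slab 3 x * f x) = f x * tensor p q (deriv r) x"
      "tensor p q r x * (slab 3 x * g x) = g x * tensor p q r x" for x
      using test_real_outside[OF test_real_deriv[OF t(3)], of "x$3"] test_real_outside[OF t(3), of "x$3"]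
      by (auto simp: tensor_def indicator_def)
    have "(LINT x|lborel. F x * tensor p q (deriv r) x + G x * tensor p q r x)
      = (LINT x|lborel. tensor p q (deriv r) x * F x) + (LINT x|lborel. tensor p q r x * G x)"
      using Bochner_Integration.integral_add[OF int[OF F(1) test_real_deriv[OF t(3)]] int[OF G(1) t(3)]]
      by (simp add: mult.commute)
    also have "\<dots> = (LINT x|dom_measure a. f x * tensor p q (deriv r) x) + (LINT x|dom_measure a. g x * tensor p q r x)"
      using integral_borel_version[OF f F(2,4) tm(1)] integral_borel_version[OF g G(2,4) tm(2)]
      unfolding out by simp
    finally show ?thesis using test[OF t(1,2) t0] by simp
  qed
  note dom = vertical_domination_borel[OF F(1,2) G(1,2) F(3) G(3) tst C, folded Z_def]
  have absF: "AE x in lebesgue. \<bar>F x\<bar> = indicator (domain a) x * (slab 3 x * \<bar>f x\<bar>)"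
    using F(4) by eventually_elim (simp add: abs_mult)
  have absG: "AE x in lebesgue. \<bar>G x\<bar> = indicator (domain a) x * (slab 3 x * \<bar>g x\<bar>)"
    using G(4) by eventually_elim (simp add: abs_mult)
  have fa: "integrable (dom_measure a) (\<lambda>x. slab 3 x * \<bar>f x\<bar>)" and ga: "integrable (dom_measure a) (\<lambda>x. slab 3 x * \<bar>g x\<bar>)"
    using integrable_abs[OF f] integrable_abs[OF g] by (simp_all add: abs_mult)
  have "(LINT y|lborel. Z y) = (LINT x|lborel. C * \<bar>F x\<bar> + 2 * \<bar>G x\<bar>)"
    using dom(5) by simp
  also have "\<dots> = (LINT x|lborel. C * \<bar>F x\<bar>) + (LINT x|lborel. 2 * \<bar>G x\<bar>)"
    using F(1) G(1) by (intro Bochner_Integration.integral_add) auto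
  also have "\<dots> = (LINT x|dom_measure a. C * (slab 3 x * \<bar>f x\<bar>)) + (LINT x|dom_measure a. 2 * (slab 3 x * \<bar>g x\<bar>))"
    using integral_borel_version[OF fa _ absF, of "\<lambda>_. C"] integral_borel_version[OF ga _ absG, of "\<lambda>_. 2"] F(2) G(2)
    by simp
  also have "\<dots> = (LINT x|dom_measure a. C * (slab 3 x * \<bar>f x\<bar>) + 2 * (slab 3 x * \<bar>g x\<bar>))"
    using fa ga by (intro Bochner_Integration.integral_add[symmetric]) auto
  also have "\<dots> = (LINT x|dom_measure a. slab 3 x * (C * \<bar>f x\<bar> + 2 * \<bar>g x\<bar>))"
    by (simp add: algebra_simps)
  finally have eq: "(LINT y|lborel. Z y) = (LINT x|dom_measure a. slab 3 x * (C * \<bar>f x\<bar> + 2 * \<bar>g x\<bar>))" .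
  have "AE x in lebesgue. x$3 \<in> {0<..<3} \<longrightarrow> \<bar>F x\<bar> \<le> Z (x$1, x$2)"
    by (rule AE_completion[OF dom(1)])
  then have "AE x in dom_measure a. x$3 < 3 \<longrightarrow> \<bar>f x\<bar> \<le> Z (x$1, x$2)"
    unfolding AE_domain_iff using F(4)
    by eventually_elim (auto simp: indicator_def domain_def)
  with eq dom(2,4) that show ?thesis by blast
qed

text \<open>The dominating function is constant along columns, so a slab of height e contributes a
  factor e. Averages over slabs therefore stay bounded as e tends to 0.\<close>

lemma slab_integral_of_domination:
  assumes Z: "integrable lborel Z" "\<And>y. 0 \<le> Z y"
    "AE x in dom_measure a. x$3 < 3 \<longrightarrow> \<bar>f x\<bar> \<le> Z (x$1, x$2)"
    and e: "0 < e" "e \<le> 3" and f: "f \<in> borel_measurable (dom_measure a)"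
  shows "integrable (dom_measure a) (\<lambda>x. slab e x * f x)"
    and "(LINT x|dom_measure a. slab e x * \<bar>f x\<bar>) \<le> e * (LINT y|lborel. Z y)"
proof -
  note s = slab_integral_le[OF Z(1,2) e(1), of a]
  have m: "(\<lambda>x. slab e x * f x) \<in> borel_measurable (dom_measure a)"
    by (rule borel_measurable_times[OF borel_measurable_dom[OF slab_measurable] f])
  have ae: "AE x in dom_measure a. slab e x * \<bar>f x\<bar> \<le> slab e x * Z (x$1, x$2)"
    using Z(3) by eventually_elim (use e in \<open>auto simp: indicator_def\<close>)
  show i: "integrable (dom_measure a) (\<lambda>x. slab e x * f x)"
  proof (rule Bochner_Integration.integrable_bound[OF s(1) m])
    show "AE x in dom_measure a. norm (slab e x * f x) \<le> norm (slab e x * Z (x$1, x$2))"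
      using ae by eventually_elim (simp add: abs_mult Z(2))
  qed
  have "(LINT x|dom_measure a. slab e x * \<bar>f x\<bar>) \<le> (LINT x|dom_measure a. slab e x * Z (x$1, x$2))"
    by (rule integral_mono_AE[OF _ s(1) ae]) (use integrable_abs[OF i] in \<open>simp add: abs_mult\<close>)
  with s(2) show "(LINT x|dom_measure a. slab e x * \<bar>f x\<bar>) \<le> e * (LINT y|lborel. Z y)" by linarith
qed

lemma slab_integrable: 
  assumes "0 < e" "a > 0"
  shows "integrable (dom_measure a) (slab e)" "(LINT x|dom_measure a. slab e x) \<le> e * a\<^sup>2"
proof -
  define H where "H = (indicator (box (0, 0) (a, a)) :: real \<times> real \<Rightarrow> real)"
  have H: "integrable lborel H" "(LINT y|lborel. H y) = a\<^sup>2" "\<And>y. 0 \<le> H y"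
    unfolding H_def using \<open>a > 0\<close> emeasure_lborel_box_finite[of "(0,0)" "(a,a)"]
    by (auto intro!: integrable_real_indicator simp: Basis_prod_def prod.union_disjoint power2_eq_square measure_lborel_box_eq)
  have eq: "slab e x * H (x$1, x$2) = slab e x" if "x \<in> domain a" for x
    using that by (auto simp: H_def indicator_def domain_def box_def Basis_prod_def)
  have "integrable (dom_measure a) (\<lambda>x. slab e x * H (x$1, x$2)) \<longleftrightarrow> integrable (dom_measure a) (slab e)"
    "(LINT x|dom_measure a. slab e x * H (x$1, x$2)) = (LINT x|dom_measure a. slab e x)"
    by (rule Bochner_Integration.integrable_cong Bochner_Integration.integral_cong; simp add: eq del: mult_cancel_left1)+
  with slab_integral_le[OF H(1,3) assms(1), of a] H(2)
  show "integrable (dom_measure a) (slab e)" "(LINT x|dom_measure a. slab e x) \<le> e * a\<^sup>2" by simp_all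
qed

text \<open>A uniform integrability argument: convergence to zero in measure on thin slabs together with
  domination by a function of the horizontal variables gives convergence in mean.\<close>

lemma slab_average_tendsto_0:
  fixes \<epsilon> :: "nat \<Rightarrow> real"
  assumes a: "a > 0" and f: "f \<in> borel_measurable (dom_measure a)" "\<And>x. 0 \<le> f x"
    and Z: "integrable lborel Z" "\<And>y. 0 \<le> Z y" "AE x in dom_measure a. x$3 < 3 \<longrightarrow> \<bar>f x\<bar> \<le> Z (x$1, x$2)"
    and \<epsilon>: "\<And>n. 0 < \<epsilon> n" "\<And>n. \<epsilon> n \<le> 3"
    and small: "\<And>\<kappa>. \<kappa> > 0 \<Longrightarrow> (\<lambda>n. (LINT x|dom_measure a. slab (\<epsilon> n) x * indicator {x. f x > \<kappa>} x) / \<epsilon> n) \<longlonglongrightarrow> 0"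
  shows "(\<lambda>n. (LINT x|dom_measure a. slab (\<epsilon> n) x * f x) / \<epsilon> n) \<longlonglongrightarrow> 0"
proof (rule LIMSEQ_I)
  fix r :: real assume r: "r > 0"
  \<comment> \<open>The average is split into three parts, each worth r/3: the level \<kappa> on a
    base of area a^2, the set f > \<kappa> where Z <= N, and the set Z > N.\<close>
  define \<kappa> where "\<kappa> = r / (3 * a\<^sup>2)"
  have \<kappa>: "\<kappa> > 0" "\<kappa> * a\<^sup>2 = r / 3" using r a by (auto simp: \<kappa>_def)
  have Zm: "Z \<in> borel_measurable borel" using Z(1) by simp
  have "(\<lambda>N. LINT y|lborel. Z y * indicator {y. Z y > real N} y) \<longlonglongrightarrow> (LINT y|(lborel :: (real \<times> real) measure). (0::real))"
  proof (rule integral_dominated_convergence[where w = Z])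
    show "AE y in lborel. (\<lambda>N. Z y * indicator {y. Z y > real N} y) \<longlonglongrightarrow> 0"
    proof (rule AE_I2)
      fix y
      obtain N where "Z y < real N" using reals_Archimedean2 by blast
      then have "Z y * indicator {y. Z y > real n} y = 0" if "n \<ge> N" for n
        using that by (auto simp: indicator_def)
      then show "(\<lambda>N. Z y * indicator {y. Z y > real N} y) \<longlonglongrightarrow> 0"
        by (intro tendsto_eventually eventually_sequentiallyI[of N])
    qed
    show "AE y in lborel. norm (Z y * indicator {y. Z y > real N} y) \<le> Z y" for N
      using Z(2) by (intro AE_I2) (auto simp: indicator_def)
  qed (use Zm Z(1) in \<open>auto intro!: borel_measurable_times borel_measurable_indicator\<close>)
  then have "(\<lambda>N. LINT y|lborel. Z y * indicator {y. Z y > real N} y) \<longlonglongrightarrow> 0" by simp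
  from LIMSEQ_D[OF this, of "r / 3"] obtain N where
    "norm ((LINT y|lborel. Z y * indicator {y. Z y > real N} y) - 0) < r / 3" using r by auto
  then have N: "(LINT y|lborel. Z y * indicator {y. Z y > real N} y) < r / 3" by simp
  define ZN where "ZN y = Z y * indicator {y. Z y > real N} y" for y
  have ZN: "integrable lborel ZN" "\<And>y. 0 \<le> ZN y"
  proof -
    have "integrable lborel (\<lambda>y. indicator {y. Z y > real N} y *\<^sub>R Z y)"
      using Zm by (intro integrable_mult_indicator Z(1)) simp
    then show "integrable lborel ZN" by (simp add: ZN_def[abs_def] mult.commute)
  qed (use Z(2) in \<open>simp add: ZN_def\<close>)
  have "(\<lambda>n. real N * ((LINT x|dom_measure a. slab (\<epsilon> n) x * indicator {x. f x > \<kappa>} x) / \<epsilon> n)) \<longlonglongrightarrow> real N * 0"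
    by (intro tendsto_intros small \<kappa>)
  from LIMSEQ_D[OF this, of "r / 3"] r obtain n0 where n0:
    "\<And>n. n \<ge> n0 \<Longrightarrow> norm (real N * ((LINT x|dom_measure a. slab (\<epsilon> n) x * indicator {x. f x > \<kappa>} x) / \<epsilon> n) - real N * 0) < r / 3"
    by auto
  show "\<exists>no. \<forall>n\<ge>no. norm ((LINT x|dom_measure a. slab (\<epsilon> n) x * f x) / \<epsilon> n - 0) < r"
  proof (intro exI[of _ n0] allI impI)
    fix n assume n: "n \<ge> n0"
    let ?e = "\<epsilon> n"
    have e: "0 < ?e" "?e \<le> 3" using \<epsilon> by auto
    note s1 = slab_integrable[OF e(1) a]
    have fset: "{x \<in> space (dom_measure a). f x > \<kappa>} \<in> sets (dom_measure a)"
      using f(1) unfolding borel_measurable_iff_greater by blast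
    have s2: "integrable (dom_measure a) (\<lambda>x. slab ?e x * indicator {x. f x > \<kappa>} x)"
    proof (rule Bochner_Integration.integrable_bound[OF s1(1)])
      have "(indicator {x. f x > \<kappa>} :: real^3 \<Rightarrow> real) \<in> borel_measurable (dom_measure a)"
        using fset by (auto simp: borel_measurable_indicator_iff Int_def conj_commute)
      then show "(\<lambda>x. slab ?e x * indicator {x. f x > \<kappa>} x) \<in> borel_measurable (dom_measure a)"
        by (rule borel_measurable_times[OF borel_measurable_dom[OF slab_measurable]])
    qed (auto simp: indicator_def)
    note s3 = slab_integral_le[OF ZN e(1), of a]
    note s4 = slab_integral_of_domination(1)[OF Z e f(1)]
    have ae: "AE x in dom_measure a. slab ?e x * f x \<le> \<kappa> * slab ?e x + (real N * (slab ?e x * indicator {x. f x > \<kappa>} x) + slab ?e x * ZN (x$1, x$2))"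
      using Z(3)
    proof eventually_elim
      case (elim x)
      show ?case
      proof (cases "x$3 < ?e")
        case True
        then have "f x \<le> Z (x$1, x$2)" using elim e f(2)[of x] by auto
        then have "f x \<le> \<kappa> + (real N * indicator {x. f x > \<kappa>} x + ZN (x$1, x$2))"
          using Z(2)[of "(x$1, x$2)"] \<kappa>(1) by (auto simp: ZN_def indicator_def)
        then show ?thesis using True by simp
      qed simp
    qed
    have "(LINT x|dom_measure a. slab ?e x * f x) \<le>
      (LINT x|dom_measure a. \<kappa> * slab ?e x + (real N * (slab ?e x * indicator {x. f x > \<kappa>} x) + slab ?e x * ZN (x$1, x$2)))"
      by (rule integral_mono_AE[OF s4 _ ae]) (intro Bochner_Integration.integrable_add integrable_mult_right s1 s2 s3)
    also have "\<dots> = \<kappa> * (LINT x|dom_measure a. slab ?e x) + (real N * (LINT x|dom_measure a. slab ?e x * indicator {x. f x > \<kappa>} x)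
        + (LINT x|dom_measure a. slab ?e x * ZN (x$1, x$2)))"
      using s1(1) s2 s3(1) by simp
    also have "\<dots> \<le> \<kappa> * (?e * a\<^sup>2) + (real N * (LINT x|dom_measure a. slab ?e x * indicator {x. f x > \<kappa>} x)
        + ?e * (LINT y|lborel. ZN y))"
      using s1(2) s3(2) \<kappa>(1) by (intro add_mono mult_left_mono) auto
    finally have "(LINT x|dom_measure a. slab ?e x * f x) / ?e \<le>
      \<kappa> * a\<^sup>2 + (real N * ((LINT x|dom_measure a. slab ?e x * indicator {x. f x > \<kappa>} x) / ?e) + (LINT y|lborel. ZN y))"
      using e by (simp add: field_simps)
    also have "\<dots> < r / 3 + (r / 3 + r / 3)"
    proof -
      have "real N * ((LINT x|dom_measure a. slab ?e x * indicator {x. f x > \<kappa>} x) / ?e) < r / 3"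
        using n0[OF n] unfolding real_norm_def mult_zero_right diff_0_right by (rule le_less_trans[OF abs_ge_self])
      moreover have "(LINT y|lborel. ZN y) < r / 3" using N by (simp add: ZN_def)
      ultimately show ?thesis using \<kappa>(2) by linarith
    qed
    finally have "(LINT x|dom_measure a. slab ?e x * f x) / ?e < r" by simp
    moreover have "0 \<le> (LINT x|dom_measure a. slab ?e x * f x) / ?e"
      using f(2) e by (intro divide_nonneg_pos integral_nonneg_AE) auto
    ultimately show "norm ((LINT x|dom_measure a. slab ?e x * f x) / ?e - 0) < r" by simp
  qed
qed

section \<open>Differentiation of integrals in time\<close>

definition L2_cont :: "real \<Rightarrow> real \<Rightarrow> (real \<Rightarrow> real^3 \<Rightarrow> real) \<Rightarrow> bool" where
  "L2_cont a T f \<longleftrightarrow> (\<forall>t\<in>{0..<T}. f t \<in> L2 (domain a) \<and>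
     ((\<lambda>s. sq_int a (\<lambda>x. f s x - f t x)) \<longlongrightarrow> 0) (at t within {0..<T}))"

lemma L2_contD:
  assumes "L2_cont a T f" "t \<in> {0..<T}"
  shows "f t \<in> L2 (domain a)" "((\<lambda>s. sq_int a (\<lambda>x. f s x - f t x)) \<longlongrightarrow> 0) (at t within {0..<T})"
  using assms by (auto simp: L2_cont_def)

lemma eventually_within: "eventually (\<lambda>s. s \<in> S \<and> s \<noteq> t) (at t within S)"
  by (simp add: eventually_at_filter)

lemma L2_C1D:
  assumes "L2_C1 a T f f'" "t \<in> {0..<T}"
  shows "f t \<in> L2 (domain a)" "f' t \<in> L2 (domain a)"
    "((\<lambda>s. sq_int a (\<lambda>x. (f s x - f t x) / (s - t) - f' t x)) \<longlongrightarrow> 0) (at t within {0..<T})"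
  using assms by (auto simp: L2_C1_def)

lemma L2_quotient:
  assumes "f \<in> L2 \<Omega>" "g \<in> L2 \<Omega>" shows "(\<lambda>x. (f x - g x) / c) \<in> L2 \<Omega>"
  using L2_cmult[OF L2_diff[OF assms], of "1 / c"] by simp

lemma sq_int_quotient_le:
  assumes f: "L2_C1 a T f f'" and t: "t \<in> {0..<T}" and s: "s \<in> {0..<T}"
  shows "sq_int a (\<lambda>x. (f s x - f t x) / (s - t)) \<le>
     2 * sq_int a (\<lambda>x. (f s x - f t x) / (s - t) - f' t x) + 2 * sq_int a (f' t)"
proof -
  note f' = L2_C1D(1)[OF f s] L2_C1D(1,2)[OF f t]
  have "sq_int a (\<lambda>x. ((f s x - f t x) / (s - t) - f' t x) + f' t x) \<le>
     2 * sq_int a (\<lambda>x. (f s x - f t x) / (s - t) - f' t x) + 2 * sq_int a (f' t)"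
    by (intro sq_int_add_le L2_diff L2_quotient f')
  then show ?thesis by simp
qed

lemma L2_C1_imp_cont:
  assumes f: "L2_C1 a T f f'" shows "L2_cont a T f" "L2_cont a T f'"
proof -
  show "L2_cont a T f'" using f by (auto simp: L2_C1_def L2_cont_def)
  show "L2_cont a T f"
    unfolding L2_cont_def
  proof (intro ballI conjI)
    fix t assume t: "t \<in> {0..<T}"
    show "f t \<in> L2 (domain a)" by (rule L2_C1D(1)[OF f t])
    let ?Q = "\<lambda>s. sq_int a (\<lambda>x. (f s x - f t x) / (s - t) - f' t x)"
    have "((\<lambda>s. (s - t)\<^sup>2 * (2 * ?Q s + 2 * sq_int a (f' t))) \<longlongrightarrow> (t - t)\<^sup>2 * (2 * 0 + 2 * sq_int a (f' t))) (at t within {0..<T})"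
      by (intro tendsto_intros L2_C1D(3)[OF f t])
    then have lim: "((\<lambda>s. (s - t)\<^sup>2 * (2 * ?Q s + 2 * sq_int a (f' t))) \<longlongrightarrow> 0) (at t within {0..<T})" by simp
    show "((\<lambda>s. sq_int a (\<lambda>x. f s x - f t x)) \<longlongrightarrow> 0) (at t within {0..<T})"
    proof (rule Lim_null_comparison[OF _ lim])
      show "\<forall>\<^sub>F s in at t within {0..<T}. norm (sq_int a (\<lambda>x. f s x - f t x)) \<le> (s - t)\<^sup>2 * (2 * ?Q s + 2 * sq_int a (f' t))"
        using eventually_within
      proof eventually_elim
        case (elim s)
        have "sq_int a (\<lambda>x. f s x - f t x) = sq_int a (\<lambda>x. (s - t) * ((f s x - f t x) / (s - t)))"
          using elim by simp
        also have "\<dots> = (s - t)\<^sup>2 * sq_int a (\<lambda>x. (f s x - f t x) / (s - t))" by (rule sq_int_cmult)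
        also have "\<dots> \<le> (s - t)\<^sup>2 * (2 * ?Q s + 2 * sq_int a (f' t))"
          using sq_int_quotient_le[OF f t, of s] elim by (intro mult_left_mono) auto
        finally show ?case using sq_int_nonneg[of a "\<lambda>x. f s x - f t x"] by simp
      qed
    qed
  qed
qed

lemma has_derivative_integral_mult:
  assumes f: "L2_C1 a T f f'" and t: "t \<in> {0..<T}" and \<zeta>: "\<zeta> \<in> L2 (domain a)"
  shows "((\<lambda>s. LINT x|dom_measure a. f s x * \<zeta> x) has_real_derivative (LINT x|dom_measure a. f' t x * \<zeta> x))
     (at t within {0..<T})"
  unfolding has_field_derivative_iff
proof (rule LIM_zero_cancel, rule Lim_null_comparison)
  let ?Q = "\<lambda>s. sq_int a (\<lambda>x. (f s x - f t x) / (s - t) - f' t x)"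
  have "((\<lambda>s. sqrt (?Q s) * sqrt (sq_int a \<zeta>)) \<longlongrightarrow> sqrt 0 * sqrt (sq_int a \<zeta>)) (at t within {0..<T})"
    by (intro tendsto_intros L2_C1D(3)[OF f t])
  then show "((\<lambda>s. sqrt (?Q s) * sqrt (sq_int a \<zeta>)) \<longlongrightarrow> 0) (at t within {0..<T})" by simp
  show "\<forall>\<^sub>F s in at t within {0..<T}.
     norm (((LINT x|dom_measure a. f s x * \<zeta> x) - (LINT x|dom_measure a. f t x * \<zeta> x)) / (s - t) - (LINT x|dom_measure a. f' t x * \<zeta> x))
       \<le> sqrt (?Q s) * sqrt (sq_int a \<zeta>)"
    using eventually_within
  proof eventually_elim
    case (elim s)
    then have s: "s \<in> {0..<T}" by simp
    note f' = L2_C1D(1)[OF f s] L2_C1D(1,2)[OF f t]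
    note i = f'[THEN L2_mult_integrable[OF _ \<zeta>]]
    have "((LINT x|dom_measure a. f s x * \<zeta> x) - (LINT x|dom_measure a. f t x * \<zeta> x)) / (s - t) - (LINT x|dom_measure a. f' t x * \<zeta> x)
      = (LINT x|dom_measure a. ((f s x * \<zeta> x - f t x * \<zeta> x) / (s - t) - f' t x * \<zeta> x))"
      using i by simp
    also have "\<dots> = (LINT x|dom_measure a. ((f s x - f t x) / (s - t) - f' t x) * \<zeta> x)"
      by (simp add: algebra_simps diff_divide_distrib)
    finally show ?case
      using Cauchy_Schwarz_abs(2)[OF L2_diff[OF L2_quotient[OF f'(1,2)] f'(3)] \<zeta>, of "s - t"] by simp
  qed
qed

lemma tendsto_integral_mult:
  assumes f: "L2_cont a T f" and t: "t \<in> {0..<T}" and \<zeta>: "\<zeta> \<in> L2 (domain a)"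
  shows "((\<lambda>s. LINT x|dom_measure a. f s x * \<zeta> x) \<longlongrightarrow> (LINT x|dom_measure a. f t x * \<zeta> x)) (at t within {0..<T})"
proof (rule LIM_zero_cancel, rule Lim_null_comparison)
  let ?Q = "\<lambda>s. sq_int a (\<lambda>x. f s x - f t x)"
  have "((\<lambda>s. sqrt (?Q s) * sqrt (sq_int a \<zeta>)) \<longlongrightarrow> sqrt 0 * sqrt (sq_int a \<zeta>)) (at t within {0..<T})"
    by (intro tendsto_intros L2_contD(2)[OF f t])
  then show "((\<lambda>s. sqrt (?Q s) * sqrt (sq_int a \<zeta>)) \<longlongrightarrow> 0) (at t within {0..<T})" by simp
  show "\<forall>\<^sub>F s in at t within {0..<T}.
     norm ((LINT x|dom_measure a. f s x * \<zeta> x) - (LINT x|dom_measure a. f t x * \<zeta> x)) \<le> sqrt (?Q s) * sqrt (sq_int a \<zeta>)"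
    using eventually_within
  proof eventually_elim
    case (elim s)
    then have s: "s \<in> {0..<T}" by simp
    note f' = L2_contD(1)[OF f s] L2_contD(1)[OF f t]
    have "(LINT x|dom_measure a. f s x * \<zeta> x) - (LINT x|dom_measure a. f t x * \<zeta> x)
      = (LINT x|dom_measure a. (f s x - f t x) * \<zeta> x)"
      using f'[THEN L2_mult_integrable[OF _ \<zeta>]] by (simp add: left_diff_distrib)
    then show ?case
      using Cauchy_Schwarz_abs(2)[OF L2_diff[OF f'] \<zeta>] by simp
  qed
qed

lemma tendsto_integral_square:
  assumes f: "L2_cont a T f" and t: "t \<in> {0..<T}"
    and \<zeta>: "\<zeta> \<in> borel_measurable (dom_measure a)" "\<And>x. \<bar>\<zeta> x\<bar> \<le> C"
  shows "((\<lambda>s. LINT x|dom_measure a. (f s x)\<^sup>2 * \<zeta> x) \<longlongrightarrow> (LINT x|dom_measure a. (f t x)\<^sup>2 * \<zeta> x)) (at t within {0..<T})"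
proof (rule LIM_zero_cancel, rule Lim_null_comparison)
  let ?Q = "\<lambda>s. sq_int a (\<lambda>x. f s x - f t x)"
  have C0: "0 \<le> C" using \<zeta>(2)[of 0] by linarith
  have "((\<lambda>s. C * (?Q s + 2 * (sqrt (?Q s) * sqrt (sq_int a (f t))))) \<longlongrightarrow> C * (0 + 2 * (sqrt 0 * sqrt (sq_int a (f t))))) (at t within {0..<T})"
    by (intro tendsto_intros L2_contD(2)[OF f t])
  then show "((\<lambda>s. C * (?Q s + 2 * (sqrt (?Q s) * sqrt (sq_int a (f t))))) \<longlongrightarrow> 0) (at t within {0..<T})" by simp
  show "\<forall>\<^sub>F s in at t within {0..<T}.
     norm ((LINT x|dom_measure a. (f s x)\<^sup>2 * \<zeta> x) - (LINT x|dom_measure a. (f t x)\<^sup>2 * \<zeta> x))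
      \<le> C * (?Q s + 2 * (sqrt (?Q s) * sqrt (sq_int a (f t))))"
    using eventually_within
  proof eventually_elim
    case (elim s)
    then have s: "s \<in> {0..<T}" by simp
    note f' = L2_contD(1)[OF f s] L2_contD(1)[OF f t]
    have sq: "integrable (dom_measure a) (\<lambda>x. (f r x)\<^sup>2 * \<zeta> x)" if "f r \<in> L2 (domain a)" for r
      using L2_mult_integrable[OF that L2_bounded_mult(1)[OF that \<zeta>]] by (simp add: power2_eq_square mult.assoc mult.left_commute mult.commute)
    have d: "(\<lambda>x. f s x - f t x) \<in> L2 (domain a)" by (intro L2_diff f')
    have i1: "integrable (dom_measure a) (\<lambda>x. (f s x - f t x)\<^sup>2)" by (rule L2_square[OF d])
    have i2: "integrable (dom_measure a) (\<lambda>x. \<bar>(f s x - f t x) * f t x\<bar>)"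
      by (intro integrable_abs L2_mult_integrable d f')
    have "(LINT x|dom_measure a. (f s x)\<^sup>2 * \<zeta> x) - (LINT x|dom_measure a. (f t x)\<^sup>2 * \<zeta> x)
      = (LINT x|dom_measure a. (f s x)\<^sup>2 * \<zeta> x - (f t x)\<^sup>2 * \<zeta> x)"
      using sq f' by simp
    also have "\<bar>\<dots>\<bar> \<le> (LINT x|dom_measure a. C * ((f s x - f t x)\<^sup>2 + 2 * \<bar>(f s x - f t x) * f t x\<bar>))"
    proof (rule integral_abs_bound_integral)
      show "integrable (dom_measure a) (\<lambda>x. (f s x)\<^sup>2 * \<zeta> x - (f t x)\<^sup>2 * \<zeta> x)" using sq f' by simp
      show "integrable (dom_measure a) (\<lambda>x. C * ((f s x - f t x)\<^sup>2 + 2 * \<bar>(f s x - f t x) * f t x\<bar>))"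
        using i1 i2 by simp
      fix x
      have "(f s x)\<^sup>2 * \<zeta> x - (f t x)\<^sup>2 * \<zeta> x = \<zeta> x * ((f s x - f t x)\<^sup>2 + 2 * ((f s x - f t x) * f t x))"
        by (simp add: power2_eq_square algebra_simps)
      also have "\<bar>\<dots>\<bar> \<le> C * ((f s x - f t x)\<^sup>2 + 2 * \<bar>(f s x - f t x) * f t x\<bar>)"
        unfolding abs_mult[of "\<zeta> x"]
        by (intro mult_mono \<zeta>(2) C0 order_trans[OF abs_triangle_ineq]) (auto simp: abs_mult)
      finally show "\<bar>(f s x)\<^sup>2 * \<zeta> x - (f t x)\<^sup>2 * \<zeta> x\<bar> \<le> C * ((f s x - f t x)\<^sup>2 + 2 * \<bar>(f s x - f t x) * f t x\<bar>)" .
    qed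
    also have "\<dots> = C * (?Q s + 2 * (LINT x|dom_measure a. \<bar>(f s x - f t x) * f t x\<bar>))"
      using i1 i2 by (simp add: sq_int_def)
    also have "\<dots> \<le> C * (?Q s + 2 * (sqrt (?Q s) * sqrt (sq_int a (f t))))"
      using Cauchy_Schwarz_abs(1)[OF d f'(2)] C0 by (intro mult_left_mono add_left_mono) auto
    finally show ?case by simp
  qed
qed

lemma continuous_on_withinI:
  fixes T r :: real
  assumes "\<And>t. t \<in> {0..<T} \<Longrightarrow> (g \<longlongrightarrow> g t) (at t within {0..<T})" "r < T"
  shows "continuous_on {0..r} g"
proof -
  have "continuous_on {0..<T} g" using assms(1) by (simp add: continuous_on_def)
  then show ?thesis by (rule continuous_on_subset) (use assms(2) in auto)
qed

lemma L2_cont_bounded: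
  assumes f: "L2_cont a T f" and r: "r < T"
  obtains K where "0 \<le> K" "\<And>s. s \<in> {0..r} \<Longrightarrow> sq_int a (f s) \<le> K"
proof -
  have "continuous_on {0..r} (\<lambda>s. LINT x|dom_measure a. (f s x)\<^sup>2 * 1)"
    by (rule continuous_on_withinI[OF _ r], rule tendsto_integral_square[OF f, of _ _ 1]) auto
  then have "bounded ((\<lambda>s. sq_int a (f s)) ` {0..r})"
    by (intro compact_imp_bounded compact_continuous_image) (auto simp: sq_int_def)
  then obtain K where "\<And>s. s \<in> {0..r} \<Longrightarrow> \<bar>sq_int a (f s)\<bar> \<le> K"
    unfolding bounded_iff by (metis image_eqI real_norm_def)
  then have "sq_int a (f s) \<le> max K 0" if "s \<in> {0..r}" for s
    using that by (meson abs_ge_self max.coboundedI1 order_trans)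
  then show ?thesis using that[of "max K 0"] by simp
qed

text \<open>On the unbounded domain \<theta>(u) itself need not be integrable against the weight, so
  \<theta>(u(0)) is subtracted: by the Lipschitz bound the difference is square integrable. The
  quadratic remainder, divided by s - t, is at most C2 |s - t| times the squared difference quotient
  and tends to 0.\<close>

lemma has_derivative_integral_compose:
  assumes u: "L2_C1 a T u u'" and t: "t \<in> {0..<T}"
    and \<theta>: "\<And>y z. \<bar>\<theta> y - \<theta> z\<bar> \<le> C1 * \<bar>y - z\<bar>" "\<And>y z. \<bar>\<theta> y - \<theta> z - \<theta>' z * (y - z)\<bar> \<le> C2 * (y - z)\<^sup>2"
      "\<And>z. \<bar>\<theta>' z\<bar> \<le> C1" "\<theta> \<in> borel_measurable borel" "\<theta>' \<in> borel_measurable borel"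
    and \<zeta>: "\<zeta> \<in> L2 (domain a)" "\<And>x. \<bar>\<zeta> x\<bar> \<le> 1"
  shows "((\<lambda>s. LINT x|dom_measure a. (\<theta> (u s x) - \<theta> (u 0 x)) * \<zeta> x) has_real_derivative
     (LINT x|dom_measure a. \<theta>' (u t x) * u' t x * \<zeta> x)) (at t within {0..<T})"
  unfolding has_field_derivative_iff
proof (rule LIM_zero_cancel, rule Lim_null_comparison)
  have T: "0 \<in> {0..<T}" using t by auto
  have C10: "0 \<le> C1" using \<theta>(3)[of 0] by linarith
  have C20: "0 \<le> C2" using order_trans[OF abs_ge_zero \<theta>(2)[of 1 0]] by simp
  let ?Q = "\<lambda>s. sq_int a (\<lambda>x. (u s x - u t x) / (s - t) - u' t x)"
  let ?Z = "\<lambda>x. \<theta>' (u t x) * \<zeta> x"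
  let ?B = "\<lambda>s. sqrt (?Q s) * sqrt (sq_int a ?Z) + C2 * (\<bar>s - t\<bar> * (2 * ?Q s + 2 * sq_int a (u' t)))"
  have "(?B \<longlongrightarrow> sqrt 0 * sqrt (sq_int a ?Z) + C2 * (\<bar>t - t\<bar> * (2 * 0 + 2 * sq_int a (u' t)))) (at t within {0..<T})"
    by (intro tendsto_intros L2_C1D(3)[OF u t])
  then show "(?B \<longlongrightarrow> 0) (at t within {0..<T})" by simp
  have comp_m: "(\<lambda>x. h (v x)) \<in> borel_measurable (dom_measure a)"
    if "h \<in> borel_measurable borel" "v \<in> L2 (domain a)" for h :: "real \<Rightarrow> real" and v
    using measurable_compose[OF L2_measurable[OF that(2)] that(1)] .
  have diffL2: "(\<lambda>x. \<theta> (v x) - \<theta> (w x)) \<in> L2 (domain a)" if vw: "v \<in> L2 (domain a)" "w \<in> L2 (domain a)" for v w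
  proof -
    have m: "(\<lambda>x. \<theta> (v x) - \<theta> (w x)) \<in> borel_measurable (dom_measure a)"
      by (intro borel_measurable_diff comp_m \<theta> vw)
    have "integrable (dom_measure a) (\<lambda>x. C1\<^sup>2 * (v x - w x)\<^sup>2)"
      by (intro integrable_mult_right L2_square L2_diff vw)
    then have "integrable (dom_measure a) (\<lambda>x. (\<theta> (v x) - \<theta> (w x))\<^sup>2)"
    proof (rule Bochner_Integration.integrable_bound)
      show "AE x in dom_measure a. norm ((\<theta> (v x) - \<theta> (w x))\<^sup>2) \<le> norm (C1\<^sup>2 * (v x - w x)\<^sup>2)"
      proof (rule AE_I2)
        fix x show "norm ((\<theta> (v x) - \<theta> (w x))\<^sup>2) \<le> norm (C1\<^sup>2 * (v x - w x)\<^sup>2)"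
          using power_mono[OF \<theta>(1)[of "v x" "w x"], of 2] by (simp add: power_mult_distrib)
      qed
    qed (use m in \<open>auto intro!: borel_measurable_power\<close>)
    then show ?thesis using m by (simp add: L2_def)
  qed
  have ZL: "?Z \<in> L2 (domain a)"
    by (rule L2_bounded_mult(1)[OF \<zeta>(1) comp_m[OF \<theta>(5) L2_C1D(1)[OF u t]]]) (rule \<theta>(3))
  show "\<forall>\<^sub>F s in at t within {0..<T}. norm (((LINT x|dom_measure a. (\<theta> (u s x) - \<theta> (u 0 x)) * \<zeta> x)
       - (LINT x|dom_measure a. (\<theta> (u t x) - \<theta> (u 0 x)) * \<zeta> x)) / (s - t)
       - (LINT x|dom_measure a. \<theta>' (u t x) * u' t x * \<zeta> x)) \<le> ?B s"
    using eventually_within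
  proof eventually_elim
    case (elim s)
    then have s: "s \<in> {0..<T}" "s \<noteq> t" by auto
    note L = L2_C1D(1)[OF u s(1)] L2_C1D(1,2)[OF u t] L2_C1D(1)[OF u T]
    let ?q = "\<lambda>x. (u s x - u t x) / (s - t) - u' t x"
    let ?r = "\<lambda>x. \<theta> (u s x) - \<theta> (u t x) - \<theta>' (u t x) * (u s x - u t x)"
    have qL: "?q \<in> L2 (domain a)" by (intro L2_diff L2_quotient L)
    have i1: "integrable (dom_measure a) (\<lambda>x. (\<theta> (u s x) - \<theta> (u 0 x)) * \<zeta> x)"
      "integrable (dom_measure a) (\<lambda>x. (\<theta> (u t x) - \<theta> (u 0 x)) * \<zeta> x)"
      by (intro L2_mult_integrable diffL2 L \<zeta>)+
    have i2: "integrable (dom_measure a) (\<lambda>x. ?q x * ?Z x)" by (rule L2_mult_integrable[OF qL ZL])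
    have i3: "integrable (dom_measure a) (\<lambda>x. u' t x * ?Z x)" by (rule L2_mult_integrable[OF L(3) ZL])
    have i6: "integrable (dom_measure a) (\<lambda>x. (u s x - u t x) * ?Z x)" by (rule L2_mult_integrable[OF L2_diff[OF L(1,2)] ZL])
    have i4: "integrable (dom_measure a) (\<lambda>x. ?r x * \<zeta> x / (s - t))"
    proof -
      have "integrable (dom_measure a) (\<lambda>x. ((\<theta> (u s x) - \<theta> (u t x)) * \<zeta> x - (u s x - u t x) * ?Z x) / (s - t))"
        by (intro integrable_divide Bochner_Integration.integrable_diff i6 L2_mult_integrable diffL2 L \<zeta>)
      then show ?thesis by (simp add: algebra_simps)
    qed
    have "((LINT x|dom_measure a. (\<theta> (u s x) - \<theta> (u 0 x)) * \<zeta> x)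
       - (LINT x|dom_measure a. (\<theta> (u t x) - \<theta> (u 0 x)) * \<zeta> x)) / (s - t)
       - (LINT x|dom_measure a. \<theta>' (u t x) * u' t x * \<zeta> x)
      = (LINT x|dom_measure a. ((\<theta> (u s x) - \<theta> (u 0 x)) * \<zeta> x - (\<theta> (u t x) - \<theta> (u 0 x)) * \<zeta> x) / (s - t) - u' t x * ?Z x)"
      using i1 i3 by (simp add: mult_ac)
    also have "\<dots> = (LINT x|dom_measure a. ?q x * ?Z x + ?r x * \<zeta> x / (s - t))"
      by (intro Bochner_Integration.integral_cong refl) (simp add: diff_divide_distrib add_divide_distrib algebra_simps)
    also have "\<dots> = (LINT x|dom_measure a. ?q x * ?Z x) + (LINT x|dom_measure a. ?r x * \<zeta> x / (s - t))"
      by (rule Bochner_Integration.integral_add[OF i2 i4])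
    finally have eq: "((LINT x|dom_measure a. (\<theta> (u s x) - \<theta> (u 0 x)) * \<zeta> x)
       - (LINT x|dom_measure a. (\<theta> (u t x) - \<theta> (u 0 x)) * \<zeta> x)) / (s - t)
       - (LINT x|dom_measure a. \<theta>' (u t x) * u' t x * \<zeta> x) = \<dots>" .
    have b1: "\<bar>LINT x|dom_measure a. ?q x * ?Z x\<bar> \<le> sqrt (?Q s) * sqrt (sq_int a ?Z)"
      by (rule Cauchy_Schwarz_abs(2)[OF qL ZL])
    have "\<bar>LINT x|dom_measure a. ?r x * \<zeta> x / (s - t)\<bar> \<le> (LINT x|dom_measure a. C2 * \<bar>s - t\<bar> * ((u s x - u t x) / (s - t))\<^sup>2)"
    proof (rule integral_abs_bound_integral[OF i4])
      show "integrable (dom_measure a) (\<lambda>x. C2 * \<bar>s - t\<bar> * ((u s x - u t x) / (s - t))\<^sup>2)"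
        by (intro integrable_mult_right L2_square L2_quotient L)
      fix x
      have "\<bar>?r x * \<zeta> x / (s - t)\<bar> = \<bar>?r x\<bar> * \<bar>\<zeta> x\<bar> / \<bar>s - t\<bar>" by (simp add: abs_mult)
      also have "\<dots> \<le> C2 * (u s x - u t x)\<^sup>2 * 1 / \<bar>s - t\<bar>"
        using \<theta>(2)[of "u s x" "u t x"] \<zeta>(2)[of x] C20 by (intro divide_right_mono mult_mono) auto
      also have "\<dots> = C2 * \<bar>s - t\<bar> * ((u s x - u t x) / (s - t))\<^sup>2"
      proof -
        define k where "k = \<bar>s - t\<bar>"
        have k: "k \<noteq> 0" "(s - t)\<^sup>2 = k * k" using s(2) by (auto simp: k_def power2_eq_square)
        have eq2: "((u s x - u t x) / (s - t))\<^sup>2 = (u s x - u t x)\<^sup>2 / (k * k)"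
          by (simp add: power_divide k(2))
        show ?thesis unfolding k_def[symmetric] eq2 using k(1) by simp
      qed
      finally show "\<bar>?r x * \<zeta> x / (s - t)\<bar> \<le> C2 * \<bar>s - t\<bar> * ((u s x - u t x) / (s - t))\<^sup>2" .
    qed
    also have "\<dots> = C2 * (\<bar>s - t\<bar> * sq_int a (\<lambda>x. (u s x - u t x) / (s - t)))"
      by (simp add: sq_int_def)
    also have "\<dots> \<le> C2 * (\<bar>s - t\<bar> * (2 * ?Q s + 2 * sq_int a (u' t)))"
      using sq_int_quotient_le[OF u t s(1)] C20 by (intro mult_left_mono) auto
    finally have b2: "\<bar>LINT x|dom_measure a. ?r x * \<zeta> x / (s - t)\<bar> \<le> C2 * (\<bar>s - t\<bar> * (2 * ?Q s + 2 * sq_int a (u' t)))" .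
    show ?case
      unfolding eq real_norm_def by (rule order_trans[OF abs_triangle_ineq add_mono[OF b1 b2]])
  qed
qed

section \<open>The transport equation\<close>

text \<open>A substitute for ln |y| with bounded first and second derivatives for fixed \<delta>, so
  that the chain rule in time holds even where u vanishes or is negative.\<close>

definition reg_log :: "real \<Rightarrow> real \<Rightarrow> real" where
  "reg_log \<delta> y = ln (y\<^sup>2 + \<delta>\<^sup>2) / 2"

context
  fixes \<delta> :: real
  assumes \<delta>: "\<delta> > 0"
begin

lemma reg_pos: "y\<^sup>2 + \<delta>\<^sup>2 > 0"
  using \<delta> by (simp add: add_nonneg_pos)

lemma reg_log_deriv: "(reg_log \<delta> has_real_derivative y / (y\<^sup>2 + \<delta>\<^sup>2)) (at y)"
proof -
  have "((\<lambda>y. y\<^sup>2 + \<delta>\<^sup>2) has_real_derivative 2 * y) (at y)"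
    by (auto intro!: derivative_eq_intros)
  then have "((\<lambda>y. ln (y\<^sup>2 + \<delta>\<^sup>2)) has_real_derivative inverse (y\<^sup>2 + \<delta>\<^sup>2) * (2 * y)) (at y)"
    by (rule DERIV_chain2[where f = ln and g = "\<lambda>y. y\<^sup>2 + \<delta>\<^sup>2" and x = y and s = UNIV, OF DERIV_ln[OF reg_pos[of y]]])
  from DERIV_cdivide[OF this, of 2]
  have "(reg_log \<delta> has_real_derivative inverse (y\<^sup>2 + \<delta>\<^sup>2) * (2 * y) / 2) (at y)"
    unfolding reg_log_def[abs_def] .
  moreover have "inverse c * (2 * y) / 2 = y / c" for c :: real
    by (simp add: inverse_eq_divide)
  ultimately show ?thesis by (simp only:)
qed

lemma reg_log_deriv2:
  "((\<lambda>y. y / (y\<^sup>2 + \<delta>\<^sup>2)) has_real_derivative (\<delta>\<^sup>2 - y\<^sup>2) / (y\<^sup>2 + \<delta>\<^sup>2)\<^sup>2) (at y)"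
proof -
  have "y\<^sup>2 + \<delta>\<^sup>2 \<noteq> 0" by (rule less_imp_neq[OF reg_pos[of y], symmetric])
  moreover have "((\<lambda>y. y\<^sup>2 + \<delta>\<^sup>2) has_real_derivative 2 * y) (at y)"
    by (auto intro!: derivative_eq_intros)
  ultimately have "((\<lambda>y. y / (y\<^sup>2 + \<delta>\<^sup>2)) has_real_derivative
      (1 * (y\<^sup>2 + \<delta>\<^sup>2) - y * (2 * y)) / ((y\<^sup>2 + \<delta>\<^sup>2) * (y\<^sup>2 + \<delta>\<^sup>2))) (at y)"
    by (intro DERIV_divide DERIV_ident)
  moreover have "1 * (y\<^sup>2 + \<delta>\<^sup>2) - y * (2 * y) = \<delta>\<^sup>2 - y\<^sup>2" by (simp add: power2_eq_square)
  ultimately show ?thesis by (simp only: power2_eq_square[of "y\<^sup>2 + \<delta>\<^sup>2"])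
qed

lemma reg_log_deriv_bound: "\<bar>y / (y\<^sup>2 + \<delta>\<^sup>2)\<bar> \<le> 1 / \<delta>"
proof -
  have "2 * (\<bar>y\<bar> * \<delta>) \<le> y\<^sup>2 + \<delta>\<^sup>2"
    using sum_squares_bound[of "\<bar>y\<bar>" \<delta>] by (simp add: mult.assoc)
  moreover have "0 \<le> \<bar>y\<bar> * \<delta>" using \<delta> by simp
  ultimately have "\<bar>y\<bar> * \<delta> \<le> y\<^sup>2 + \<delta>\<^sup>2" by linarith
  then show ?thesis using reg_pos[of y] \<delta> by (simp add: field_simps)
qed

lemma reg_log_deriv2_bound: "\<bar>(\<delta>\<^sup>2 - y\<^sup>2) / (y\<^sup>2 + \<delta>\<^sup>2)\<^sup>2\<bar> \<le> 1 / \<delta>\<^sup>2"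
proof -
  have "\<bar>\<delta>\<^sup>2 - y\<^sup>2\<bar> \<le> y\<^sup>2 + \<delta>\<^sup>2" by (rule abs_leI) auto
  then have "\<bar>\<delta>\<^sup>2 - y\<^sup>2\<bar> / (y\<^sup>2 + \<delta>\<^sup>2)\<^sup>2 \<le> (y\<^sup>2 + \<delta>\<^sup>2) / (y\<^sup>2 + \<delta>\<^sup>2)\<^sup>2"
    by (intro divide_right_mono) auto
  also have "\<dots> = 1 / (y\<^sup>2 + \<delta>\<^sup>2)"
  proof -
    have "c / c\<^sup>2 = 1 / c" for c :: real by (simp add: power2_eq_square)
    then show ?thesis .
  qed
  also have "\<dots> \<le> 1 / \<delta>\<^sup>2" using \<delta> by (intro divide_left_mono) (auto simp: reg_pos add_nonneg_pos)
  finally show ?thesis by (simp add: abs_divide)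
qed

lemma reg_log_Lipschitz: "\<bar>reg_log \<delta> y - reg_log \<delta> z\<bar> \<le> (1 / \<delta>) * \<bar>y - z\<bar>"
  using field_differentiable_bound[of UNIV "reg_log \<delta>" "\<lambda>y. y / (y\<^sup>2 + \<delta>\<^sup>2)" "1 / \<delta>" y z]
    reg_log_deriv reg_log_deriv_bound by simp

text \<open>The mean value inequality for \<open>reg_log \<delta> w - k * w\<close>, whose
  derivative is at most |y - z| / \<delta>^2 on the segment; the factor 1/2 of Taylor's formula is
  given up.\<close>

lemma reg_log_Taylor:
  "\<bar>reg_log \<delta> y - reg_log \<delta> z - z / (z\<^sup>2 + \<delta>\<^sup>2) * (y - z)\<bar> \<le> (1 / \<delta>\<^sup>2) * (y - z)\<^sup>2"
proof -
  define k where "k = z / (z\<^sup>2 + \<delta>\<^sup>2)"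
  have L: "\<bar>w / (w\<^sup>2 + \<delta>\<^sup>2) - k\<bar> \<le> (1 / \<delta>\<^sup>2) * \<bar>w - z\<bar>" for w
    unfolding k_def
    using field_differentiable_bound[of UNIV "\<lambda>y. y / (y\<^sup>2 + \<delta>\<^sup>2)" "\<lambda>y. (\<delta>\<^sup>2 - y\<^sup>2) / (y\<^sup>2 + \<delta>\<^sup>2)\<^sup>2" "1 / \<delta>\<^sup>2" w z]
      reg_log_deriv2 reg_log_deriv2_bound by simp
  have "norm ((reg_log \<delta> y - k * y) - (reg_log \<delta> z - k * z)) \<le> (1 / \<delta>\<^sup>2 * \<bar>y - z\<bar>) * norm (y - z)"
  proof (rule field_differentiable_bound[of "closed_segment z y" _ "\<lambda>w. w / (w\<^sup>2 + \<delta>\<^sup>2) - k"])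
    show "((\<lambda>w. reg_log \<delta> w - k * w) has_field_derivative w / (w\<^sup>2 + \<delta>\<^sup>2) - k) (at w within closed_segment z y)" for w
      by (rule has_field_derivative_at_within) (auto intro!: derivative_eq_intros reg_log_deriv)
    show "norm (w / (w\<^sup>2 + \<delta>\<^sup>2) - k) \<le> 1 / \<delta>\<^sup>2 * \<bar>y - z\<bar>" if "w \<in> closed_segment z y" for w
    proof -
      have "\<bar>w - z\<bar> \<le> \<bar>y - z\<bar>" using that by (auto simp: closed_segment_eq_real_ivl split: if_splits)
      then have "(1 / \<delta>\<^sup>2) * \<bar>w - z\<bar> \<le> (1 / \<delta>\<^sup>2) * \<bar>y - z\<bar>" by (intro mult_left_mono) auto
      with L[of w] show ?thesis by simp
    qed
  qed auto
  moreover have "(reg_log \<delta> y - k * y) - (reg_log \<delta> z - k * z) = reg_log \<delta> y - reg_log \<delta> z - k * (y - z)"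
    by (simp add: algebra_simps)
  moreover have "(1 / \<delta>\<^sup>2 * \<bar>y - z\<bar>) * norm (y - z) = (1 / \<delta>\<^sup>2) * (y - z)\<^sup>2"
    by (simp only: real_norm_def mult.assoc abs_mult_self_eq power2_eq_square[of "y - z"])
  ultimately show ?thesis unfolding k_def[symmetric] by (simp only: real_norm_def)
qed

lemma reg_log_measurable: "reg_log \<delta> \<in> borel_measurable borel" "(\<lambda>y. y / (y\<^sup>2 + \<delta>\<^sup>2)) \<in> borel_measurable borel"
  unfolding reg_log_def[abs_def] by measurable

lemma reg_log_ge_ln: "y > 0 \<Longrightarrow> ln y \<le> reg_log \<delta> y"
proof -
  assume y: "y > 0"
  have "2 * ln y = ln (y\<^sup>2)" using y by (simp add: ln_realpow)
  also have "\<dots> \<le> ln (y\<^sup>2 + \<delta>\<^sup>2)" using y by (subst ln_le_cancel_iff) (auto simp: reg_pos)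
  finally show ?thesis by (simp add: reg_log_def)
qed

lemma reg_log_0: "reg_log \<delta> 0 = ln \<delta>"
  using \<delta> by (simp add: reg_log_def ln_realpow)

lemma reg_log_ge: "ln \<delta> \<le> reg_log \<delta> y"
proof -
  have "ln (0\<^sup>2 + \<delta>\<^sup>2) \<le> ln (y\<^sup>2 + \<delta>\<^sup>2)" using \<delta> by (subst ln_le_cancel_iff) (auto simp: add_nonneg_pos)
  then have "reg_log \<delta> 0 \<le> reg_log \<delta> y" by (simp add: reg_log_def)
  then show ?thesis by (simp add: reg_log_0)
qed

text \<open>The regularised form of ln |y| <= |y|, uniform in \<delta> <= 1: y^2 + \<delta>^2 <=
  (|y| + 1)^2 and ln (1 + |y|) <= |y|.\<close>

lemma reg_log_le_abs:
  assumes "\<delta> \<le> 1" shows "reg_log \<delta> y \<le> \<bar>y\<bar>"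
proof -
  have "\<delta>\<^sup>2 \<le> 1" using assms \<delta> by (simp add: power_le_one)
  then have "y\<^sup>2 + \<delta>\<^sup>2 \<le> (\<bar>y\<bar> + 1)\<^sup>2" by (simp add: power2_sum)
  then have "ln (y\<^sup>2 + \<delta>\<^sup>2) \<le> ln ((\<bar>y\<bar> + 1)\<^sup>2)"
    by (subst ln_le_cancel_iff) (auto simp: reg_pos)
  also have "\<dots> = 2 * ln (1 + \<bar>y\<bar>)" by (simp add: ln_realpow add.commute)
  also have "\<dots> \<le> 2 * \<bar>y\<bar>" using ln_add_one_self_le_self[of "\<bar>y\<bar>"] by simp
  finally show ?thesis by (simp add: reg_log_def)
qed

end

text \<open>The weak z-derivative tested against products only, without the local integrability
  contained in \<open>has_weak_deriv\<close>; the locales below carry vertical derivatives in this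
  form.\<close>

definition weak_dz :: "real \<Rightarrow> (real^3 \<Rightarrow> real) \<Rightarrow> (real^3 \<Rightarrow> real) \<Rightarrow> bool" where
  "weak_dz a f g \<longleftrightarrow> (\<forall>p q r. test_real {0<..<a} p \<and> test_real {0<..<a} q \<and> test_real {0<..} r \<longrightarrow>
     (LINT x|dom_measure a. f x * tensor p q (deriv r) x) = - (LINT x|dom_measure a. g x * tensor p q r x))"

section \<open>Control of slab averages along the flow\<close>

lemma slab_L2:
  assumes "a > 0" "e > 0" shows "slab e \<in> L2 (domain a)" "sq_int a (slab e) \<le> e * a\<^sup>2"
proof -
  have eq: "(slab e x)\<^sup>2 = slab e x" for x by (simp add: indicator_def)
  show "slab e \<in> L2 (domain a)" "sq_int a (slab e) \<le> e * a\<^sup>2"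
    using slab_integrable[OF assms(2,1)] by (simp_all add: L2_def sq_int_def eq borel_measurable_dom)
qed

lemma slab_mult_integrable:
  assumes "a > 0" "e > 0" "f \<in> L2 (domain a)"
  shows "integrable (dom_measure a) (\<lambda>x. slab e x * f x)"
    "(LINT x|dom_measure a. slab e x * \<bar>f x\<bar>) \<le> sqrt (e * a\<^sup>2) * sqrt (sq_int a f)"
proof -
  note s = slab_L2[OF assms(1,2)]
  show "integrable (dom_measure a) (\<lambda>x. slab e x * f x)" by (rule L2_mult_integrable[OF s(1) assms(3)])
  have "(LINT x|dom_measure a. slab e x * \<bar>f x\<bar>) = (LINT x|dom_measure a. \<bar>slab e x * f x\<bar>)"
    by (simp add: abs_mult)
  also have "\<dots> \<le> sqrt (sq_int a (slab e)) * sqrt (sq_int a f)"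
    by (rule Cauchy_Schwarz_abs(1)[OF s(1) assms(3)])
  also have "\<dots> \<le> sqrt (e * a\<^sup>2) * sqrt (sq_int a f)"
    using s(2) by (intro mult_right_mono) (auto simp: sq_int_nonneg)
  finally show "(LINT x|dom_measure a. slab e x * \<bar>f x\<bar>) \<le> sqrt (e * a\<^sup>2) * sqrt (sq_int a f)" .
qed

text \<open>The transport equation in isolation: p stands for the z-derivative of \<psi>,
  \<open>pz\<close> for its own z-derivative, and g for (u^2)_z. Only L2 regularity in time and
  tested identities are kept from the Sobolev setting.\<close>

locale flow =
  fixes a T :: real and u u' p pz g :: "real \<Rightarrow> real^3 \<Rightarrow> real"
  assumes a: "0 < a" and T: "0 < T"
    and u: "L2_C1 a T u u'" and p: "L2_cont a T p" and pz: "L2_cont a T pz" and g: "L2_cont a T g"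
    and u_eq: "t \<in> {0..<T} \<Longrightarrow> AE x in dom_measure a. u' t x = 2 * u t x * p t x"
    and p_weak: "t \<in> {0..<T} \<Longrightarrow> weak_dz a (p t) (pz t)"
    and u_weak: "t \<in> {0..<T} \<Longrightarrow> weak_dz a (\<lambda>x. (u t x)\<^sup>2) (g t)"
begin

lemma u_cont: "L2_cont a T u"
  by (rule L2_C1_imp_cont[OF u])

lemma u_L2: "t \<in> {0..<T} \<Longrightarrow> u t \<in> L2 (domain a)"
  and u'_L2: "t \<in> {0..<T} \<Longrightarrow> u' t \<in> L2 (domain a)"
  and p_L2: "t \<in> {0..<T} \<Longrightarrow> p t \<in> L2 (domain a)"
  and pz_L2: "t \<in> {0..<T} \<Longrightarrow> pz t \<in> L2 (domain a)"
  and g_L2: "t \<in> {0..<T} \<Longrightarrow> g t \<in> L2 (domain a)"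
  using L2_C1D(1,2)[OF u] L2_contD(1)[OF p] L2_contD(1)[OF pz] L2_contD(1)[OF g] by auto

text \<open>The derivative \<open>pz\<close> makes p dominated near the bottom by a function of the
  horizontal variables, whose integral is controlled by L2 norms on the slab of height 3. These
  norms are bounded on compact time intervals, which gives one K for all times up to r.\<close>

lemma p_slab_bound:
  assumes r: "r < T"
  obtains K where "0 \<le> K" "\<And>s e. s \<in> {0..r} \<Longrightarrow> 0 < e \<Longrightarrow> e \<le> 3 \<Longrightarrow> (LINT x|dom_measure a. slab e x * \<bar>p s x\<bar>) \<le> e * K"
proof -
  obtain C where C: "0 \<le> C" "\<And>x. \<bar>deriv step x\<bar> \<le> C" using bounded_derivs_step by blast
  obtain K1 where K1: "0 \<le> K1" "\<And>s. s \<in> {0..r} \<Longrightarrow> sq_int a (p s) \<le> K1" using L2_cont_bounded[OF p r] by blast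
  obtain K2 where K2: "0 \<le> K2" "\<And>s. s \<in> {0..r} \<Longrightarrow> sq_int a (pz s) \<le> K2" using L2_cont_bounded[OF pz r] by blast
  define K where "K = C * (sqrt (3 * a\<^sup>2) * sqrt K1) + 2 * (sqrt (3 * a\<^sup>2) * sqrt K2)"
  have "(LINT x|dom_measure a. slab e x * \<bar>p s x\<bar>) \<le> e * K" if s: "s \<in> {0..r}" and e: "0 < e" "e \<le> 3" for s e
  proof -
    have s': "s \<in> {0..<T}" using s r by auto
    note sp = slab_mult_integrable[OF a _ p_L2[OF s'], of 3] and spz = slab_mult_integrable[OF a _ pz_L2[OF s'], of 3]
    obtain Z where Z: "integrable lborel Z" "\<And>y. 0 \<le> Z y"
      "AE x in dom_measure a. x$3 < 3 \<longrightarrow> \<bar>p s x\<bar> \<le> Z (x$1, x$2)"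
      "(LINT y|lborel. Z y) = (LINT x|dom_measure a. slab 3 x * (C * \<bar>p s x\<bar> + 2 * \<bar>pz s x\<bar>))"
      using vertical_domination[OF sp(1) spz(1) _ C(2)] p_weak[OF s'] unfolding weak_dz_def by auto
    have "(LINT y|lborel. Z y) = (LINT x|dom_measure a. C * (slab 3 x * \<bar>p s x\<bar>) + 2 * (slab 3 x * \<bar>pz s x\<bar>))"
      unfolding Z(4) by (intro Bochner_Integration.integral_cong) (auto simp: algebra_simps)
    also have "\<dots> = C * (LINT x|dom_measure a. slab 3 x * \<bar>p s x\<bar>) + 2 * (LINT x|dom_measure a. slab 3 x * \<bar>pz s x\<bar>)"
      using integrable_abs[OF sp(1)] integrable_abs[OF spz(1)] by (simp add: abs_mult)
    also have "\<dots> \<le> C * (sqrt (3 * a\<^sup>2) * sqrt (sq_int a (p s))) + 2 * (sqrt (3 * a\<^sup>2) * sqrt (sq_int a (pz s)))"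
      using sp(2) spz(2) C(1) by (intro add_mono mult_left_mono) auto
    also have "\<dots> \<le> K"
      unfolding K_def using K1(2)[OF s] K2(2)[OF s] C(1) by (intro add_mono mult_left_mono) auto
    finally have ZK: "(LINT y|lborel. Z y) \<le> K" .
    have "(LINT x|dom_measure a. slab e x * \<bar>p s x\<bar>) \<le> e * (LINT y|lborel. Z y)"
      by (rule slab_integral_of_domination(2)[OF Z(1-3) e L2_measurable[OF p_L2[OF s']]])
    also have "\<dots> \<le> e * K" using ZK e by (intro mult_left_mono) auto
    finally show ?thesis .
  qed
  moreover have "0 \<le> K" unfolding K_def using C(1) K1(1) K2(1) a by (intro add_nonneg_nonneg mult_nonneg_nonneg) auto
  ultimately show ?thesis using that by blast
qed

text \<open>Vertical domination applied to u^2 with derivative g. The \<open>SOME\<close> term names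
  one bound for \<open>deriv step\<close> independent of t, so that the estimate is uniform in time
  wherever the L2 norms of u and g are bounded.\<close>

lemma u_square_domination:
  assumes t: "t \<in> {0..<T}"
  obtains Z where "integrable lborel Z" "\<And>y. 0 \<le> Z y"
    "AE x in dom_measure a. x$3 < 3 \<longrightarrow> \<bar>(u t x)\<^sup>2\<bar> \<le> Z (x$1, x$2)"
    "(LINT y|lborel. Z y) \<le> (SOME C. 0 \<le> C \<and> (\<forall>x. \<bar>deriv step x\<bar> \<le> C)) * sq_int a (u t) + 2 * (sqrt (3 * a\<^sup>2) * sqrt (sq_int a (g t)))"
proof -
  define C where "C = (SOME C. 0 \<le> C \<and> (\<forall>x. \<bar>deriv step x\<bar> \<le> C))"
  have C: "0 \<le> C" "\<And>x. \<bar>deriv step x\<bar> \<le> C"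
    using someI_ex[of "\<lambda>C. 0 \<le> C \<and> (\<forall>x. \<bar>deriv step x\<bar> \<le> C)"] bounded_derivs_step unfolding C_def by blast+
  note sg = slab_mult_integrable[OF a _ g_L2[OF t], of 3]
  have u2: "integrable (dom_measure a) (\<lambda>x. (u t x)\<^sup>2)" by (rule L2_square[OF u_L2[OF t]])
  have su: "integrable (dom_measure a) (\<lambda>x. slab 3 x * (u t x)\<^sup>2)"
    by (rule Bochner_Integration.integrable_bound[OF u2
          borel_measurable_times[OF borel_measurable_dom[OF slab_measurable] borel_measurable_power[OF L2_measurable[OF u_L2[OF t]]]]])
      (auto simp: indicator_def)
  obtain Z where Z: "integrable lborel Z" "\<And>y. 0 \<le> Z y"
    "AE x in dom_measure a. x$3 < 3 \<longrightarrow> \<bar>(u t x)\<^sup>2\<bar> \<le> Z (x$1, x$2)"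
    "(LINT y|lborel. Z y) = (LINT x|dom_measure a. slab 3 x * (C * \<bar>(u t x)\<^sup>2\<bar> + 2 * \<bar>g t x\<bar>))"
    using vertical_domination[OF su sg(1) _ C(2)] u_weak[OF t] unfolding weak_dz_def by auto
  have "(LINT y|lborel. Z y) = (LINT x|dom_measure a. C * (slab 3 x * (u t x)\<^sup>2) + 2 * (slab 3 x * \<bar>g t x\<bar>))"
    unfolding Z(4) by (intro Bochner_Integration.integral_cong) (auto simp: algebra_simps)
  also have "\<dots> = C * (LINT x|dom_measure a. slab 3 x * (u t x)\<^sup>2) + 2 * (LINT x|dom_measure a. slab 3 x * \<bar>g t x\<bar>)"
    using su integrable_abs[OF sg(1)] by (simp add: abs_mult)
  also have "\<dots> \<le> C * sq_int a (u t) + 2 * (sqrt (3 * a\<^sup>2) * sqrt (sq_int a (g t)))"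
  proof (intro add_mono mult_left_mono C sg(2))
    show "(LINT x|dom_measure a. slab 3 x * (u t x)\<^sup>2) \<le> sq_int a (u t)"
      unfolding sq_int_def by (rule integral_mono[OF su u2]) (auto simp: indicator_def)
  qed auto
  finally show ?thesis using that Z(1-3) unfolding C_def by blast
qed

text \<open>Being uniform in time up to r, this supplies the dominating constant when the vertical
  cut-off is removed under the time integral.\<close>

lemma u_slab_bound:
  assumes r: "r < T"
  obtains K where "0 \<le> K" "\<And>s e. s \<in> {0..r} \<Longrightarrow> 0 < e \<Longrightarrow> e \<le> 3 \<Longrightarrow> (LINT x|dom_measure a. slab e x * (u s x)\<^sup>2) \<le> e * K"
proof -
  define C where "C = (SOME C. 0 \<le> C \<and> (\<forall>x. \<bar>deriv step x\<bar> \<le> C))"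
  have C: "0 \<le> C"
    using someI_ex[of "\<lambda>C. 0 \<le> C \<and> (\<forall>x. \<bar>deriv step x\<bar> \<le> C)"] bounded_derivs_step unfolding C_def by blast
  obtain K1 where K1: "0 \<le> K1" "\<And>s. s \<in> {0..r} \<Longrightarrow> sq_int a (u s) \<le> K1" using L2_cont_bounded[OF u_cont r] by blast
  obtain K2 where K2: "0 \<le> K2" "\<And>s. s \<in> {0..r} \<Longrightarrow> sq_int a (g s) \<le> K2" using L2_cont_bounded[OF g r] by blast
  define K where "K = C * K1 + 2 * (sqrt (3 * a\<^sup>2) * sqrt K2)"
  have "(LINT x|dom_measure a. slab e x * (u s x)\<^sup>2) \<le> e * K" if s: "s \<in> {0..r}" and e: "0 < e" "e \<le> 3" for s e
  proof -
    have s': "s \<in> {0..<T}" using s r by auto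
    obtain Z where Z: "integrable lborel Z" "\<And>y. 0 \<le> Z y"
      "AE x in dom_measure a. x$3 < 3 \<longrightarrow> \<bar>(u s x)\<^sup>2\<bar> \<le> Z (x$1, x$2)"
      "(LINT y|lborel. Z y) \<le> C * sq_int a (u s) + 2 * (sqrt (3 * a\<^sup>2) * sqrt (sq_int a (g s)))"
      using u_square_domination[OF s'] unfolding C_def by blast
    have m: "(\<lambda>x. (u s x)\<^sup>2) \<in> borel_measurable (dom_measure a)"
      using L2_measurable[OF u_L2[OF s']] by (rule borel_measurable_power)
    have "(LINT x|dom_measure a. slab e x * (u s x)\<^sup>2) \<le> e * (LINT y|lborel. Z y)"
      using slab_integral_of_domination(2)[OF Z(1-3) e m] by simp
    also have "\<dots> \<le> e * (C * sq_int a (u s) + 2 * (sqrt (3 * a\<^sup>2) * sqrt (sq_int a (g s))))"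
      using Z(4) e by (intro mult_left_mono) auto
    also have "\<dots> \<le> e * K"
      unfolding K_def using K1(2)[OF s] K2(2)[OF s] C e by (intro add_mono mult_left_mono) auto
    finally show ?thesis .
  qed
  moreover have "0 \<le> K" unfolding K_def using C K1(1) K2(1) a by (intro add_nonneg_nonneg mult_nonneg_nonneg) auto
  ultimately show ?thesis using that by blast
qed

text \<open>Since u' = 2 u p, the derivative of \<open>reg_log \<delta> u\<close> is 2 p u^2 / (u^2
  + \<delta>^2). The factor multiplying 2 p lies in [0,1], which makes the bound independent of
  \<delta>.\<close>

lemma reg_log_flow_derivative:
  assumes \<delta>: "\<delta> > 0" and t: "t \<in> {0..<T}" and \<zeta>: "\<zeta> \<in> L2 (domain a)" "\<And>x. \<bar>\<zeta> x\<bar> \<le> 1"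
  shows "((\<lambda>s. LINT x|dom_measure a. (reg_log \<delta> (u s x) - reg_log \<delta> (u 0 x)) * \<zeta> x) has_real_derivative
     (LINT x|dom_measure a. 2 * p t x * ((u t x)\<^sup>2 / ((u t x)\<^sup>2 + \<delta>\<^sup>2)) * \<zeta> x)) (at t within {0..<T})"
    and "\<bar>LINT x|dom_measure a. 2 * p t x * ((u t x)\<^sup>2 / ((u t x)\<^sup>2 + \<delta>\<^sup>2)) * \<zeta> x\<bar>
      \<le> 2 * (LINT x|dom_measure a. \<bar>\<zeta> x\<bar> * \<bar>p t x\<bar>)"
    and "integrable (dom_measure a) (\<lambda>x. 2 * p t x * ((u t x)\<^sup>2 / ((u t x)\<^sup>2 + \<delta>\<^sup>2)) * \<zeta> x)"
proof -
  have m: "(\<lambda>x. (u t x)\<^sup>2 / ((u t x)\<^sup>2 + \<delta>\<^sup>2)) \<in> borel_measurable (dom_measure a)"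
    using L2_measurable[OF u_L2[OF t]] by (intro borel_measurable_divide borel_measurable_add borel_measurable_power) auto
  have b: "0 \<le> y\<^sup>2 / (y\<^sup>2 + \<delta>\<^sup>2)" "y\<^sup>2 / (y\<^sup>2 + \<delta>\<^sup>2) \<le> 1" for y
    using reg_pos[OF \<delta>, of y] by (auto simp: divide_le_eq_1)
  have b': "\<bar>y\<^sup>2 / (y\<^sup>2 + \<delta>\<^sup>2)\<bar> \<le> 1" for y using b[of y] by (subst abs_of_nonneg) auto
  have pL: "(\<lambda>x. (u t x)\<^sup>2 / ((u t x)\<^sup>2 + \<delta>\<^sup>2) * p t x) \<in> L2 (domain a)"
    by (rule L2_bounded_mult(1)[OF p_L2[OF t] m b'])
  have i: "integrable (dom_measure a) (\<lambda>x. 2 * (((u t x)\<^sup>2 / ((u t x)\<^sup>2 + \<delta>\<^sup>2) * p t x) * \<zeta> x))"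
    by (intro integrable_mult_right L2_mult_integrable pL \<zeta>)
  then show i': "integrable (dom_measure a) (\<lambda>x. 2 * p t x * ((u t x)\<^sup>2 / ((u t x)\<^sup>2 + \<delta>\<^sup>2)) * \<zeta> x)"
    by (simp add: mult_ac)
  note d = has_derivative_integral_compose[OF u t reg_log_Lipschitz[OF \<delta>] reg_log_Taylor[OF \<delta>] reg_log_deriv_bound[OF \<delta>] reg_log_measurable[OF \<delta>] \<zeta>]
  have "(LINT x|dom_measure a. u t x / ((u t x)\<^sup>2 + \<delta>\<^sup>2) * u' t x * \<zeta> x)
     = (LINT x|dom_measure a. 2 * p t x * ((u t x)\<^sup>2 / ((u t x)\<^sup>2 + \<delta>\<^sup>2)) * \<zeta> x)"
  proof (rule integral_cong_AE)
    show "AE x in dom_measure a. u t x / ((u t x)\<^sup>2 + \<delta>\<^sup>2) * u' t x * \<zeta> x = 2 * p t x * ((u t x)\<^sup>2 / ((u t x)\<^sup>2 + \<delta>\<^sup>2)) * \<zeta> x"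
      using u_eq[OF t] by eventually_elim (simp add: power2_eq_square)
    have "(\<lambda>x. u t x / ((u t x)\<^sup>2 + \<delta>\<^sup>2)) \<in> borel_measurable (dom_measure a)"
      using L2_measurable[OF u_L2[OF t]] by (intro borel_measurable_divide borel_measurable_add borel_measurable_power) auto
    then show "(\<lambda>x. u t x / ((u t x)\<^sup>2 + \<delta>\<^sup>2) * u' t x * \<zeta> x) \<in> borel_measurable (dom_measure a)"
      by (rule borel_measurable_times[OF borel_measurable_times[OF _ L2_measurable[OF u'_L2[OF t]]] L2_measurable[OF \<zeta>(1)]])
  qed (use i' in simp)
  with d show "((\<lambda>s. LINT x|dom_measure a. (reg_log \<delta> (u s x) - reg_log \<delta> (u 0 x)) * \<zeta> x) has_real_derivative
     (LINT x|dom_measure a. 2 * p t x * ((u t x)\<^sup>2 / ((u t x)\<^sup>2 + \<delta>\<^sup>2)) * \<zeta> x)) (at t within {0..<T})" by simp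
  have "\<bar>LINT x|dom_measure a. 2 * p t x * ((u t x)\<^sup>2 / ((u t x)\<^sup>2 + \<delta>\<^sup>2)) * \<zeta> x\<bar>
      \<le> (LINT x|dom_measure a. 2 * (\<bar>\<zeta> x\<bar> * \<bar>p t x\<bar>))"
  proof (rule integral_abs_bound_integral[OF i'])
    show "integrable (dom_measure a) (\<lambda>x. 2 * (\<bar>\<zeta> x\<bar> * \<bar>p t x\<bar>))"
      by (intro integrable_mult_right L2_mult_integrable L2_abs \<zeta> p_L2 t)
    fix x
    have "\<bar>2 * p t x * ((u t x)\<^sup>2 / ((u t x)\<^sup>2 + \<delta>\<^sup>2)) * \<zeta> x\<bar> = 2 * (\<bar>\<zeta> x\<bar> * \<bar>p t x\<bar>) * \<bar>(u t x)\<^sup>2 / ((u t x)\<^sup>2 + \<delta>\<^sup>2)\<bar>"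
      by (simp only: abs_mult) simp
    also have "\<dots> \<le> 2 * (\<bar>\<zeta> x\<bar> * \<bar>p t x\<bar>) * 1" by (intro mult_left_mono b') auto
    finally show "\<bar>2 * p t x * ((u t x)\<^sup>2 / ((u t x)\<^sup>2 + \<delta>\<^sup>2)) * \<zeta> x\<bar> \<le> 2 * (\<bar>\<zeta> x\<bar> * \<bar>p t x\<bar>)" by simp
  qed
  then show "\<bar>LINT x|dom_measure a. 2 * p t x * ((u t x)\<^sup>2 / ((u t x)\<^sup>2 + \<delta>\<^sup>2)) * \<zeta> x\<bar>
      \<le> 2 * (LINT x|dom_measure a. \<bar>\<zeta> x\<bar> * \<bar>p t x\<bar>)" by simp
qed

end

context flow
begin

text \<open>The regularised logarithm moves with speed at most 2 |p| for every \<delta>, so its L1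
  change over a slab up to time t is at most t times a bound for the slab integral of 2 |p|. The
  absence of \<delta> on the right leaves \<delta> free for later choice.\<close>

lemma slab_reg_log_bound:
  assumes t: "t \<in> {0..<T}" and \<delta>: "\<delta> > 0" and e: "0 < e" and B: "\<And>s. s \<in> {0..t} \<Longrightarrow> (LINT x|dom_measure a. slab e x * \<bar>p s x\<bar>) \<le> B"
  shows "integrable (dom_measure a) (\<lambda>x. slab e x * \<bar>reg_log \<delta> (u t x) - reg_log \<delta> (u 0 x)\<bar>)"
    and "(LINT x|dom_measure a. slab e x * \<bar>reg_log \<delta> (u t x) - reg_log \<delta> (u 0 x)\<bar>) \<le> 2 * B * t"
proof -
  have T0: "0 \<in> {0..<T}" and t0: "0 \<le> t" "t < T" using t by auto
  define h where "h x = reg_log \<delta> (u t x) - reg_log \<delta> (u 0 x)" for x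
  \<comment> \<open>The sign at the final time is frozen into the weight. The L1 norm at time t is
    then the value at t of a functional that is differentiable in time and starts from 0.\<close>
  define \<sigma> where "\<sigma> x = (if h x > 0 then 1 else - 1 :: real)" for x
  define \<zeta> where "\<zeta> x = \<sigma> x * slab e x" for x
  have hm: "h \<in> borel_measurable (dom_measure a)"
    unfolding h_def[abs_def]
    by (intro borel_measurable_diff measurable_compose[OF L2_measurable[OF u_L2[OF t]] reg_log_measurable(1)[OF \<delta>]]
        measurable_compose[OF L2_measurable[OF u_L2[OF T0]] reg_log_measurable(1)[OF \<delta>]])
  have "(\<lambda>y::real. if y > 0 then 1 else - 1 :: real) \<in> borel_measurable borel" by measurable
  from measurable_compose[OF hm this] have \<sigma>m: "\<sigma> \<in> borel_measurable (dom_measure a)"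
    by (simp add: \<sigma>_def[abs_def])
  have \<zeta>L: "\<zeta> \<in> L2 (domain a)"
    unfolding \<zeta>_def[abs_def] by (rule L2_bounded_mult(1)[OF slab_L2(1)[OF a e] \<sigma>m, of 1]) (simp add: \<sigma>_def)
  have \<zeta>a: "\<bar>\<zeta> x\<bar> = slab e x" for x by (simp add: \<zeta>_def \<sigma>_def)
  then have \<zeta>b: "\<bar>\<zeta> x\<bar> \<le> 1" for x by (simp add: indicator_def)
  have h\<zeta>: "h x * \<zeta> x = slab e x * \<bar>h x\<bar>" for x by (simp add: \<zeta>_def \<sigma>_def)
  define f where "f s = (LINT x|dom_measure a. (reg_log \<delta> (u s x) - reg_log \<delta> (u 0 x)) * \<zeta> x)" for s
  define f' where "f' s = (LINT x|dom_measure a. 2 * p s x * ((u s x)\<^sup>2 / ((u s x)\<^sup>2 + \<delta>\<^sup>2)) * \<zeta> x)" for s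
  note d = reg_log_flow_derivative[OF \<delta> _ \<zeta>L \<zeta>b, folded f_def f'_def]
  have "norm (f t - f 0) \<le> (2 * B) * norm (t - 0)"
  proof (rule field_differentiable_bound[of "{0..t}" f f'])
    show "(f has_real_derivative f' s) (at s within {0..t})" if "s \<in> {0..t}" for s
      by (rule DERIV_subset[OF d(1)]) (use that t0 in auto)
    show "norm (f' s) \<le> 2 * B" if "s \<in> {0..t}" for s
    proof -
      have "s \<in> {0..<T}" using that t0 by auto
      from d(2)[OF this] B[OF that] show ?thesis by (simp add: \<zeta>a)
    qed
  qed (use t0 in auto)
  moreover have "f 0 = 0" by (simp add: f_def)
  ultimately have "f t \<le> 2 * B * t" using t0 by simp
  moreover have "f t = (LINT x|dom_measure a. slab e x * \<bar>h x\<bar>)"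
    unfolding f_def h_def[symmetric] h\<zeta> ..
  ultimately show "(LINT x|dom_measure a. slab e x * \<bar>reg_log \<delta> (u t x) - reg_log \<delta> (u 0 x)\<bar>) \<le> 2 * B * t"
    by (simp add: h_def)
  have hL: "h \<in> L2 (domain a)"
  proof -
    have "integrable (dom_measure a) (\<lambda>x. (1 / \<delta>)\<^sup>2 * (u t x - u 0 x)\<^sup>2)"
      by (intro integrable_mult_right L2_square L2_diff u_L2 t T0)
    then have "integrable (dom_measure a) (\<lambda>x. (h x)\<^sup>2)"
    proof (rule Bochner_Integration.integrable_bound)
      show "AE x in dom_measure a. norm ((h x)\<^sup>2) \<le> norm ((1 / \<delta>)\<^sup>2 * (u t x - u 0 x)\<^sup>2)"
      proof (rule AE_I2)
        fix x show "norm ((h x)\<^sup>2) \<le> norm ((1 / \<delta>)\<^sup>2 * (u t x - u 0 x)\<^sup>2)"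
          using power_mono[OF reg_log_Lipschitz[OF \<delta>, of "u t x" "u 0 x"], of 2]
          by (simp add: power_mult_distrib h_def power_divide)
      qed
    qed (use hm in \<open>rule borel_measurable_power\<close>)
    then show ?thesis using hm by (simp add: L2_def)
  qed
  have "integrable (dom_measure a) (\<lambda>x. slab e x * \<bar>h x\<bar>)"
    by (rule L2_mult_integrable[OF slab_L2(1)[OF a e] L2_abs[OF hL]])
  then show "integrable (dom_measure a) (\<lambda>x. slab e x * \<bar>reg_log \<delta> (u t x) - reg_log \<delta> (u 0 x)\<bar>)"
    by (simp add: h_def)
qed

text \<open>The flow only multiplies \<open>u\<close> by \<open>exp (2 \<integral> p)\<close>, and the averages of \<open>\<bar>p\<bar>\<close> over thin slabs are
  bounded; hence the average of \<open>\<bar>ln u(t) - ln u(0)\<bar>\<close> is bounded and \<open>u(t)\<close> still vanishes at the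
  bottom.\<close>

lemma boundary_decay:
  fixes \<epsilon> :: "nat \<Rightarrow> real"
  assumes t: "t \<in> {0..<T}"
    and u0: "\<And>\<kappa>. \<kappa> > 0 \<Longrightarrow> \<exists>e>0. AE x in dom_measure a. x$3 < e \<longrightarrow> \<bar>u 0 x\<bar> < \<kappa>"
    and \<epsilon>: "\<And>n. 0 < \<epsilon> n" "\<And>n. \<epsilon> n \<le> 3" "\<epsilon> \<longlonglongrightarrow> 0"
  shows "(\<lambda>n. (LINT x|dom_measure a. slab (\<epsilon> n) x * (u t x)\<^sup>2) / \<epsilon> n) \<longlonglongrightarrow> 0"
proof -
  have t0: "0 \<le> t" "t < T" using t by auto
  obtain Z where Z: "integrable lborel Z" "\<And>y. 0 \<le> Z y"
    "AE x in dom_measure a. x$3 < 3 \<longrightarrow> \<bar>(u t x)\<^sup>2\<bar> \<le> Z (x$1, x$2)"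
    using u_square_domination[OF t] by blast
  have m: "(\<lambda>x. (u t x)\<^sup>2) \<in> borel_measurable (dom_measure a)"
    using L2_measurable[OF u_L2[OF t]] by (rule borel_measurable_power)
  obtain K where K: "0 \<le> K" "\<And>s e. s \<in> {0..t} \<Longrightarrow> 0 < e \<Longrightarrow> e \<le> 3 \<Longrightarrow> (LINT x|dom_measure a. slab e x * \<bar>p s x\<bar>) \<le> e * K"
    using p_slab_bound[OF t0(2)] by blast
  show ?thesis
  proof (rule slab_average_tendsto_0[OF a m _ Z \<epsilon>(1,2)])
    fix \<kappa> :: real assume \<kappa>: "\<kappa> > 0"
    show "(\<lambda>n. (LINT x|dom_measure a. slab (\<epsilon> n) x * indicator {x. (u t x)\<^sup>2 > \<kappa>} x) / \<epsilon> n) \<longlonglongrightarrow> 0"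
    proof (rule LIMSEQ_I)
      fix r :: real assume r: "r > 0"
      \<comment> \<open>By Chebyshev's inequality the set where the logarithm rises by M has measure
        at most 2 e K t / M in the slab of height e; this M makes it less than e r.\<close>
      define M where "M = 2 * K * t / r + 1"
      have M: "M > 0" "2 * K * t < r * M"
        using K(1) t0 r by (auto simp: M_def field_simps add_pos_nonneg)
      \<comment> \<open>Chosen so that 2 \<delta>^2 = \<kappa> exp (- 2 M): where |u(0)| < \<delta>
        the regularised logarithm starts at most at (ln \<kappa>) / 2 - M, and u(t)^2 > \<kappa>
        lifts it to at least (ln \<kappa>) / 2.\<close>
      define \<delta> where "\<delta> = sqrt (\<kappa> / 2) * exp (- M)"
      have \<delta>: "\<delta> > 0" using \<kappa> by (simp add: \<delta>_def)
      have "\<delta>\<^sup>2 + \<delta>\<^sup>2 = \<kappa> * (exp (- M))\<^sup>2"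
        using \<kappa> by (simp add: \<delta>_def power_mult_distrib)
      moreover have "ln (\<kappa> * (exp (- M))\<^sup>2) = ln \<kappa> - 2 * M"
        using \<kappa> by (simp add: ln_mult ln_realpow)
      ultimately have ln\<delta>: "ln (\<delta>\<^sup>2 + \<delta>\<^sup>2) = ln \<kappa> - 2 * M" by simp
      obtain e where e: "e > 0" "AE x in dom_measure a. x$3 < e \<longrightarrow> \<bar>u 0 x\<bar> < \<delta>"
        using u0[OF \<delta>] by blast
      obtain n0 where n0': "\<forall>n\<ge>n0. norm (\<epsilon> n - 0) < e"
        using LIMSEQ_D[OF \<epsilon>(3) e(1)] by blast
      have n0: "\<epsilon> n < e" if "n \<ge> n0" for n
      proof -
        have "\<bar>\<epsilon> n\<bar> < e" using n0' that by simp
        then show ?thesis using abs_ge_self[of "\<epsilon> n"] by linarith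
      qed
      show "\<exists>no. \<forall>n\<ge>no. norm ((LINT x|dom_measure a. slab (\<epsilon> n) x * indicator {x. (u t x)\<^sup>2 > \<kappa>} x) / \<epsilon> n - 0) < r"
      proof (intro exI[of _ n0] allI impI)
        fix n assume n: "n \<ge> n0"
        let ?e = "\<epsilon> n"
        let ?I = "LINT x|dom_measure a. slab ?e x * indicator {x. (u t x)\<^sup>2 > \<kappa>} x"
        note rb = slab_reg_log_bound[OF t \<delta> \<epsilon>(1)[of n] K(2)[OF _ \<epsilon>(1,2)]]
        have I0: "0 \<le> ?I" by (intro integral_nonneg_AE) auto
        have ae: "AE x in dom_measure a. M * (slab ?e x * indicator {x. (u t x)\<^sup>2 > \<kappa>} x) \<le> slab ?e x * \<bar>reg_log \<delta> (u t x) - reg_log \<delta> (u 0 x)\<bar>"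
          using e(2)
        proof eventually_elim
          case (elim x)
          show ?case
          proof (cases "x$3 < ?e \<and> (u t x)\<^sup>2 > \<kappa>")
            case True
            then have "\<bar>u 0 x\<bar> < \<delta>" using elim n0[OF n] by auto
            then have "(u 0 x)\<^sup>2 \<le> \<delta>\<^sup>2" using abs_le_square_iff[of "u 0 x" \<delta>] \<delta> by auto
            then have "ln ((u 0 x)\<^sup>2 + \<delta>\<^sup>2) \<le> ln (\<delta>\<^sup>2 + \<delta>\<^sup>2)"
              using \<delta> reg_pos[OF \<delta>] by (subst ln_le_cancel_iff) auto
            moreover have "\<kappa> \<le> (u t x)\<^sup>2 + \<delta>\<^sup>2" using True zero_le_power2[of \<delta>] by linarith
            then have "ln \<kappa> \<le> ln ((u t x)\<^sup>2 + \<delta>\<^sup>2)"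
              using \<kappa> reg_pos[OF \<delta>, of "u t x"] by (subst ln_le_cancel_iff)
            ultimately have "M \<le> reg_log \<delta> (u t x) - reg_log \<delta> (u 0 x)"
              unfolding reg_log_def ln\<delta> by linarith
            then show ?thesis using True by simp
          qed (use M in \<open>auto simp: indicator_def\<close>)
        qed
        have "M * ?I = (LINT x|dom_measure a. M * (slab ?e x * indicator {x. (u t x)\<^sup>2 > \<kappa>} x))" by simp
        also have "\<dots> \<le> (LINT x|dom_measure a. slab ?e x * \<bar>reg_log \<delta> (u t x) - reg_log \<delta> (u 0 x)\<bar>)"
        proof (rule integral_mono_AE'[OF rb(1) ae])
          show "AE x in dom_measure a. 0 \<le> slab ?e x * \<bar>reg_log \<delta> (u t x) - reg_log \<delta> (u 0 x)\<bar>" by simp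
        qed auto
        also have "\<dots> \<le> 2 * (?e * K) * t" by (rule rb(2))
        finally have "M * ?I \<le> ?e * (2 * K * t)" by (simp add: mult_ac)
        also have "\<dots> < ?e * (r * M)" using M(2) \<epsilon>(1) by (intro mult_strict_left_mono)
        finally have "?I / ?e < r" using M(1) \<epsilon>(1)[of n] by (simp add: field_simps)
        moreover have "0 \<le> ?I / ?e" using I0 \<epsilon>(1)[of n] by simp
        ultimately show "norm (?I / ?e - 0) < r" by simp
      qed
    qed
  qed auto
qed

text \<open>The derivative of the regularised logarithm is integrated in time, and \<delta> tends to
  0. Its integrand converges to 2 p \<phi> only where u is nonzero, so the zero set of u at each
  time has to be shown to be null beforehand.\<close>

lemma log_lower_bound:
  assumes t: "t \<in> {0..<T}"
    and \<phi>: "\<phi> \<in> L2 (domain a)" "integrable (dom_measure a) \<phi>" "\<And>x. \<bar>\<phi> x\<bar> \<le> 1" "AE x in dom_measure a. 0 < \<phi> x"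
    and u0: "AE x in dom_measure a. 0 < u 0 x" "integrable (dom_measure a) (\<lambda>x. ln (u 0 x) * \<phi> x)"
  shows "(LINT x|dom_measure a. ln (u 0 x) * \<phi> x) + integral {0..t} (\<lambda>s. 2 * (LINT x|dom_measure a. p s x * \<phi> x))
    \<le> (LINT x|dom_measure a. \<bar>u t x\<bar> * \<phi> x)"
proof -
  have t0: "0 \<le> t" "t < T" and T0: "0 \<in> {0..<T}" using t by auto
  have \<phi>m: "\<phi> \<in> borel_measurable (dom_measure a)" using \<phi>(2) by simp
  define h where "h \<delta> s = (LINT x|dom_measure a. (reg_log \<delta> (u s x) - reg_log \<delta> (u 0 x)) * \<phi> x)" for \<delta> s
  define h' where "h' \<delta> s = (LINT x|dom_measure a. 2 * p s x * ((u s x)\<^sup>2 / ((u s x)\<^sup>2 + \<delta>\<^sup>2)) * \<phi> x)" for \<delta> s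
  note d = reg_log_flow_derivative[OF _ _ \<phi>(1,3), folded h_def h'_def]
  obtain K where K: "0 \<le> K" "\<And>s. s \<in> {0..t} \<Longrightarrow> sq_int a (p s) \<le> K" using L2_cont_bounded[OF p t0(2)] by blast
  define B where "B = 2 * (sqrt (sq_int a \<phi>) * sqrt K)"
  have pB: "2 * (LINT x|dom_measure a. \<bar>\<phi> x\<bar> * \<bar>p s x\<bar>) \<le> B" if "s \<in> {0..t}" for s
  proof -
    have s: "s \<in> {0..<T}" using that t0 by auto
    have "(LINT x|dom_measure a. \<bar>\<phi> x\<bar> * \<bar>p s x\<bar>) \<le> sqrt (sq_int a \<phi>) * sqrt (sq_int a (p s))"
      using Cauchy_Schwarz_abs(1)[OF \<phi>(1) p_L2[OF s]] by (simp add: abs_mult)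
    also have "\<dots> \<le> sqrt (sq_int a \<phi>) * sqrt K"
      using K(2)[OF that] by (intro mult_left_mono) (auto simp: sq_int_nonneg)
    finally show ?thesis by (simp add: B_def)
  qed
  have h'B: "\<bar>h' \<delta> s\<bar> \<le> B" if "s \<in> {0..t}" "\<delta> > 0" for s \<delta>
    using d(2)[OF that(2), of s] pB[OF that(1)] that(1) t0 by auto
  have hd: "(h \<delta> has_real_derivative h' \<delta> s) (at s within {0..r})" if "s \<in> {0..r}" "r \<le> t" "\<delta> > 0" for s r \<delta>
    by (rule DERIV_subset[OF d(1)[OF that(3)]]) (use that t0 in auto)
  have h0: "h \<delta> 0 = 0" for \<delta> by (simp add: h_def)
  have regint: "integrable (dom_measure a) (\<lambda>x. reg_log \<delta> (u s x) * \<phi> x)" if s: "s \<in> {0..t}" and \<delta>: "0 < \<delta>" "\<delta> \<le> 1" for \<delta> s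
  proof -
    have s': "s \<in> {0..<T}" using s t0 by auto
    have i: "integrable (dom_measure a) (\<lambda>x. \<bar>u s x\<bar> * \<bar>\<phi> x\<bar> + \<bar>ln \<delta>\<bar> * \<bar>\<phi> x\<bar>)"
      by (intro Bochner_Integration.integrable_add integrable_mult_right L2_mult_integrable L2_abs u_L2 s' \<phi> integrable_abs)
    show ?thesis
    proof (rule Bochner_Integration.integrable_bound[OF i])
      show "(\<lambda>x. reg_log \<delta> (u s x) * \<phi> x) \<in> borel_measurable (dom_measure a)"
        by (rule borel_measurable_times[OF measurable_compose[OF L2_measurable[OF u_L2[OF s']] reg_log_measurable(1)[OF \<delta>(1)]] \<phi>m])
      show "AE x in dom_measure a. norm (reg_log \<delta> (u s x) * \<phi> x) \<le> norm (\<bar>u s x\<bar> * \<bar>\<phi> x\<bar> + \<bar>ln \<delta>\<bar> * \<bar>\<phi> x\<bar>)"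
      proof (rule AE_I2)
        fix x
        have "\<bar>reg_log \<delta> (u s x)\<bar> \<le> \<bar>u s x\<bar> + \<bar>ln \<delta>\<bar>"
          using reg_log_le_abs[OF \<delta>, of "u s x"] reg_log_ge[OF \<delta>(1), of "u s x"] by linarith
        then have "\<bar>reg_log \<delta> (u s x)\<bar> * \<bar>\<phi> x\<bar> \<le> (\<bar>u s x\<bar> + \<bar>ln \<delta>\<bar>) * \<bar>\<phi> x\<bar>" by (intro mult_right_mono) auto
        then show "norm (reg_log \<delta> (u s x) * \<phi> x) \<le> norm (\<bar>u s x\<bar> * \<bar>\<phi> x\<bar> + \<bar>ln \<delta>\<bar> * \<bar>\<phi> x\<bar>)"
          by (simp add: abs_mult distrib_right)
      qed
    qed
  qed
  define A where "A = (LINT x|dom_measure a. ln (u 0 x) * \<phi> x)"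
  have u\<phi>: "integrable (dom_measure a) (\<lambda>x. \<bar>u s x\<bar> * \<phi> x)" if "s \<in> {0..t}" for s
    using that t0 by (intro L2_mult_integrable L2_abs u_L2 \<phi>) auto
  have A_le: "A \<le> (LINT x|dom_measure a. reg_log \<delta> (u 0 x) * \<phi> x)" if "0 < \<delta>" "\<delta> \<le> 1" for \<delta>
    unfolding A_def
  proof (rule integral_mono_AE[OF u0(2) regint[OF _ that]])
    show "AE x in dom_measure a. ln (u 0 x) * \<phi> x \<le> reg_log \<delta> (u 0 x) * \<phi> x"
      using u0(1) \<phi>(4) by eventually_elim (intro mult_right_mono reg_log_ge_ln that, auto)
  qed (use t0 in auto)
  have h_split: "h \<delta> s = (LINT x|dom_measure a. reg_log \<delta> (u s x) * \<phi> x) - (LINT x|dom_measure a. reg_log \<delta> (u 0 x) * \<phi> x)"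
    if "s \<in> {0..t}" "0 < \<delta>" "\<delta> \<le> 1" for s \<delta>
    unfolding h_def left_diff_distrib
    using regint[OF that] regint[OF _ that(2,3), of 0] t0 by simp
  \<comment> \<open>On the zero set \<open>reg_log \<delta> u\<close> equals ln \<delta>. A zero set
    of positive weight would push the weighted integral to minus infinity, although it is bounded
    below by A - B s for all \<delta> <= 1.\<close>
  have nonzero: "AE x in dom_measure a. u s x \<noteq> 0" if s: "s \<in> {0..t}" for s
  proof -
    have s': "s \<in> {0..<T}" using s t0 by auto
    define E where "E x = (indicator {x. u s x = 0} x * \<phi> x :: real)" for x
    have "{x \<in> space (dom_measure a). u s x = 0} \<in> sets (dom_measure a)"
      by (rule borel_measurable_eq) (use L2_measurable[OF u_L2[OF s']] in auto)
    then have "(indicator {x. u s x = 0} :: real^3 \<Rightarrow> real) \<in> borel_measurable (dom_measure a)"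
      by (auto simp: borel_measurable_indicator_iff Int_def conj_commute)
    then have Em: "E \<in> borel_measurable (dom_measure a)"
      unfolding E_def[abs_def] by (rule borel_measurable_times[OF _ \<phi>m])
    have Ei: "integrable (dom_measure a) E"
      by (rule Bochner_Integration.integrable_bound[OF \<phi>(2) Em]) (auto simp: E_def indicator_def)
    have E0: "AE x in dom_measure a. 0 \<le> E x" using \<phi>(4) by eventually_elim (auto simp: E_def indicator_def)
    then have EI0: "0 \<le> (LINT x|dom_measure a. E x)" by (rule integral_nonneg_AE)
    define I where "I = (LINT x|dom_measure a. \<bar>u s x\<bar> * \<phi> x)"
    have bnd: "- ln \<delta> * (LINT x|dom_measure a. E x) \<le> I - A + B * s" if \<delta>: "0 < \<delta>" "\<delta> \<le> 1" for \<delta>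
    proof -
      have "(LINT x|dom_measure a. reg_log \<delta> (u s x) * \<phi> x) \<le> (LINT x|dom_measure a. \<bar>u s x\<bar> * \<phi> x + ln \<delta> * E x)"
      proof (rule integral_mono_AE[OF regint[OF s \<delta>]])
        show "integrable (dom_measure a) (\<lambda>x. \<bar>u s x\<bar> * \<phi> x + ln \<delta> * E x)"
          using u\<phi>[OF s] Ei by simp
        show "AE x in dom_measure a. reg_log \<delta> (u s x) * \<phi> x \<le> \<bar>u s x\<bar> * \<phi> x + ln \<delta> * E x"
          using \<phi>(4)
        proof eventually_elim
          case (elim x)
          show ?case
          proof (cases "u s x = 0")
            case True then show ?thesis by (simp add: E_def reg_log_0[OF \<delta>(1)])
          next
            case False
            have "reg_log \<delta> (u s x) * \<phi> x \<le> \<bar>u s x\<bar> * \<phi> x"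
              using reg_log_le_abs[OF \<delta>] elim by (intro mult_right_mono) auto
            then show ?thesis using False by (simp add: E_def)
          qed
        qed
      qed
      also have "\<dots> = I + ln \<delta> * (LINT x|dom_measure a. E x)"
        unfolding I_def using u\<phi>[OF s] Ei by simp
      finally have 1: "(LINT x|dom_measure a. reg_log \<delta> (u s x) * \<phi> x) \<le> I + ln \<delta> * (LINT x|dom_measure a. E x)" .
      have "norm (h \<delta> s - h \<delta> 0) \<le> B * norm (s - 0)"
      proof (rule field_differentiable_bound[of "{0..s}" "h \<delta>" "h' \<delta>"])
        show "(h \<delta> has_real_derivative h' \<delta> r) (at r within {0..s})" if "r \<in> {0..s}" for r
          using that s \<delta> by (intro hd) auto
        show "norm (h' \<delta> r) \<le> B" if "r \<in> {0..s}" for r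
          using h'B[OF _ \<delta>(1), of r] that s by auto
      qed (use s in auto)
      then have "- (B * s) \<le> h \<delta> s" using s h0 by auto
      with 1 A_le[OF \<delta>] h_split[OF s \<delta>] show ?thesis by simp
    qed
    have "(LINT x|dom_measure a. E x) = 0"
    proof (rule ccontr)
      assume "(LINT x|dom_measure a. E x) \<noteq> 0"
      then have pos: "(LINT x|dom_measure a. E x) > 0" using EI0 by simp
      \<comment> \<open>The choice \<delta> = exp (- c) turns - ln \<delta> into c, and c times the
        integral of E exceeds the upper bound in \<open>bnd\<close> by at least 1.\<close>
      define c where "c = (\<bar>I - A + B * s\<bar> + 1) / (LINT x|dom_measure a. E x)"
      have c: "c > 0" "c * (LINT x|dom_measure a. E x) = \<bar>I - A + B * s\<bar> + 1" using pos by (auto simp: c_def)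
      have "c * (LINT x|dom_measure a. E x) \<le> I - A + B * s"
        using bnd[of "exp (- c)"] c(1) by simp
      then show False using c(2) by linarith
    qed
    then have "AE x in dom_measure a. E x = 0"
      using integral_nonneg_eq_0_iff_AE[OF Ei E0] by simp
    then show ?thesis using \<phi>(4) by eventually_elim (auto simp: E_def)
  qed
  define G where "G s = 2 * (LINT x|dom_measure a. p s x * \<phi> x)" for s
  define \<delta> where "\<delta> n = 1 / real (Suc n)" for n
  have \<delta>: "0 < \<delta> n" "\<delta> n \<le> 1" for n by (auto simp: \<delta>_def)
  have \<delta>lim: "\<delta> \<longlonglongrightarrow> 0" unfolding \<delta>_def by (rule LIMSEQ_Suc[OF lim_const_over_n])
  have FTC: "(h' (\<delta> n) has_integral h (\<delta> n) t - h (\<delta> n) 0) {0..t}" for n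
    by (rule fundamental_theorem_of_calculus[OF t0(1)])
      (use hd[of _ t "\<delta> n"] \<delta> in \<open>auto simp: has_real_derivative_iff_has_vector_derivative[symmetric]\<close>)
  have conv: "(\<lambda>n. h' (\<delta> n) s) \<longlonglongrightarrow> G s" if s: "s \<in> {0..t}" for s
  proof -
    have s': "s \<in> {0..<T}" using s t0 by auto
    have "(\<lambda>n. h' (\<delta> n) s) \<longlonglongrightarrow> (LINT x|dom_measure a. 2 * p s x * 1 * \<phi> x)"
      unfolding h'_def
    proof (rule integral_dominated_convergence[where w = "\<lambda>x. 2 * (\<bar>\<phi> x\<bar> * \<bar>p s x\<bar>)"])
      show "integrable (dom_measure a) (\<lambda>x. 2 * (\<bar>\<phi> x\<bar> * \<bar>p s x\<bar>))"
        by (intro integrable_mult_right L2_mult_integrable L2_abs \<phi> p_L2 s')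
      show "(\<lambda>x. 2 * p s x * 1 * \<phi> x) \<in> borel_measurable (dom_measure a)"
        using L2_measurable[OF p_L2[OF s']] \<phi>m by simp
      show "(\<lambda>x. 2 * p s x * ((u s x)\<^sup>2 / ((u s x)\<^sup>2 + (\<delta> n)\<^sup>2)) * \<phi> x) \<in> borel_measurable (dom_measure a)" for n
        using d(3)[OF \<delta>(1) s'] by (rule borel_measurable_integrable)
      show "AE x in dom_measure a. (\<lambda>n. 2 * p s x * ((u s x)\<^sup>2 / ((u s x)\<^sup>2 + (\<delta> n)\<^sup>2)) * \<phi> x) \<longlonglongrightarrow> 2 * p s x * 1 * \<phi> x"
        using nonzero[OF s]
      proof eventually_elim
        case (elim x)
        have "(\<lambda>n. (u s x)\<^sup>2 / ((u s x)\<^sup>2 + (\<delta> n)\<^sup>2)) \<longlonglongrightarrow> (u s x)\<^sup>2 / ((u s x)\<^sup>2 + 0\<^sup>2)"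
          using elim by (intro tendsto_intros \<delta>lim) auto
        then have "(\<lambda>n. (u s x)\<^sup>2 / ((u s x)\<^sup>2 + (\<delta> n)\<^sup>2)) \<longlonglongrightarrow> 1" using elim by simp
        then show ?case by (intro tendsto_intros)
      qed
      show "AE x in dom_measure a. norm (2 * p s x * ((u s x)\<^sup>2 / ((u s x)\<^sup>2 + (\<delta> n)\<^sup>2)) * \<phi> x) \<le> 2 * (\<bar>\<phi> x\<bar> * \<bar>p s x\<bar>)" for n
      proof (rule AE_I2)
        fix x
        have "0 \<le> (u s x)\<^sup>2 / ((u s x)\<^sup>2 + (\<delta> n)\<^sup>2)" "(u s x)\<^sup>2 / ((u s x)\<^sup>2 + (\<delta> n)\<^sup>2) \<le> 1"
          using reg_pos[OF \<delta>(1)[of n], of "u s x"] by (auto simp: divide_le_eq_1)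
        then have "\<bar>(u s x)\<^sup>2 / ((u s x)\<^sup>2 + (\<delta> n)\<^sup>2)\<bar> \<le> 1" by (subst abs_of_nonneg)
        then have "2 * (\<bar>\<phi> x\<bar> * \<bar>p s x\<bar>) * \<bar>(u s x)\<^sup>2 / ((u s x)\<^sup>2 + (\<delta> n)\<^sup>2)\<bar> \<le> 2 * (\<bar>\<phi> x\<bar> * \<bar>p s x\<bar>) * 1"
          by (intro mult_left_mono) auto
        moreover have "\<bar>2 * p s x * ((u s x)\<^sup>2 / ((u s x)\<^sup>2 + (\<delta> n)\<^sup>2)) * \<phi> x\<bar> = 2 * (\<bar>\<phi> x\<bar> * \<bar>p s x\<bar>) * \<bar>(u s x)\<^sup>2 / ((u s x)\<^sup>2 + (\<delta> n)\<^sup>2)\<bar>"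
          by (simp only: abs_mult) simp
        ultimately show "norm (2 * p s x * ((u s x)\<^sup>2 / ((u s x)\<^sup>2 + (\<delta> n)\<^sup>2)) * \<phi> x) \<le> 2 * (\<bar>\<phi> x\<bar> * \<bar>p s x\<bar>)"
          by (simp only: real_norm_def mult_1_right)
      qed
    qed
    then show ?thesis by (simp add: G_def mult.assoc)
  qed
  have "(\<lambda>n. integral {0..t} (h' (\<delta> n))) \<longlonglongrightarrow> integral {0..t} G"
  proof (rule dominated_convergence(2)[where h = "\<lambda>_. B"])
    show "h' (\<delta> n) integrable_on {0..t}" for n using FTC by blast
    show "norm (h' (\<delta> n) s) \<le> B" if "s \<in> {0..t}" for n s using h'B[OF that \<delta>(1)] by simp
  qed (use conv in auto)
  moreover have "integral {0..t} (h' (\<delta> n)) \<le> (LINT x|dom_measure a. \<bar>u t x\<bar> * \<phi> x) - A" for n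
  proof -
    have tt: "t \<in> {0..t}" using t0 by simp
    have "integral {0..t} (h' (\<delta> n)) = h (\<delta> n) t" using FTC[of n] h0 by (simp add: integral_unique)
    also have "\<dots> \<le> (LINT x|dom_measure a. reg_log (\<delta> n) (u t x) * \<phi> x) - A"
      using h_split[OF tt \<delta>] A_le[OF \<delta>, of n] by simp
    also have "(LINT x|dom_measure a. reg_log (\<delta> n) (u t x) * \<phi> x) \<le> (LINT x|dom_measure a. \<bar>u t x\<bar> * \<phi> x)"
    proof (rule integral_mono_AE[OF regint[OF tt \<delta>] u\<phi>[OF tt]])
      show "AE x in dom_measure a. reg_log (\<delta> n) (u t x) * \<phi> x \<le> \<bar>u t x\<bar> * \<phi> x"
        using \<phi>(4) by eventually_elim (intro mult_right_mono reg_log_le_abs[OF \<delta>], auto)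
    qed
    finally show ?thesis by simp
  qed
  ultimately have "integral {0..t} G \<le> (LINT x|dom_measure a. \<bar>u t x\<bar> * \<phi> x) - A"
    by (intro LIMSEQ_le_const2) auto
  then show ?thesis by (simp add: A_def G_def[abs_def])
qed

end

section \<open>Boundary layers\<close>

lemma closure_domainI:
  assumes "a > 0" "0 \<le> y$1" "y$1 \<le> a" "0 \<le> y$2" "y$2 \<le> a" "0 \<le> y$3"
  shows "y \<in> closure (domain a)"
proof -
  define l where "l = (vector [0, 0, 0] :: real^3)"
  define u where "u = (vector [a, a, y$3 + 1] :: real^3)"
  have sub: "box l u \<subseteq> domain a"
    by (auto simp: mem_box_cart forall_3 l_def u_def domain_def)
  have "box l u \<noteq> {}"
    using assms by (auto simp: interval_ne_empty_cart forall_3 l_def u_def)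
  then have "closure (box l u) = cbox l u" by (rule closure_box)
  moreover have "y \<in> cbox l u" using assms by (auto simp: mem_box_cart forall_3 l_def u_def)
  ultimately show ?thesis using closure_mono[OF sub] by auto
qed

lemma closure_domainD:
  assumes "y \<in> closure (domain a)"
  shows "0 \<le> y$1" "y$1 \<le> a" "0 \<le> y$2" "y$2 \<le> a" "0 \<le> y$3"
proof -
  define S where "S = {y::real^3. 0 \<le> y$1} \<inter> {y. y$1 \<le> a} \<inter> {y. 0 \<le> y$2} \<inter> {y. y$2 \<le> a} \<inter> {y. 0 \<le> y$3}"
  have "closed S" unfolding S_def
    by (intro closed_Int closed_halfspace_component_le_cart closed_halfspace_component_ge_cart)
  moreover have "domain a \<subseteq> S" by (auto simp: domain_def S_def)
  ultimately have "y \<in> S" using assms closure_minimal by blast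
  then show "0 \<le> y$1" "y$1 \<le> a" "0 \<le> y$2" "y$2 \<le> a" "0 \<le> y$3" by (auto simp: S_def)
qed

definition upd :: "real^3 \<Rightarrow> 3 \<Rightarrow> real \<Rightarrow> real^3" where
  "upd x i v = (\<chi> j. if j = i then v else x$j)"

lemma dist_upd: "dist x (upd x i v) \<le> \<bar>x$i - v\<bar>"
proof -
  have "norm (x - upd x i v) \<le> (\<Sum>j\<in>UNIV. \<bar>(x - upd x i v) $ j\<bar>)" by (rule norm_le_l1_cart)
  also have "\<dots> = (\<Sum>j\<in>UNIV. if j = i then \<bar>x$i - v\<bar> else 0)"
    by (intro sum.cong) (auto simp: upd_def)
  also have "\<dots> = \<bar>x$i - v\<bar>" by simp
  finally show ?thesis by (simp add: dist_norm)
qed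

text \<open>The closure of the domain is unbounded, so uniform continuity of g is available only
  below a height d. Moving one coordinate of x onto a face where g vanishes then changes g by less
  than \<eta>.\<close>

lemma small_near_face:
  fixes g :: "real^3 \<Rightarrow> real"
  assumes g: "continuous_on (closure (domain a)) g" and \<eta>: "\<eta> > 0"
  obtains e where "e > 0" "\<And>x i v. x \<in> domain a \<Longrightarrow> x$3 \<le> d \<Longrightarrow> \<bar>x$i - v\<bar> < e \<Longrightarrow> upd x i v \<in> closure (domain a) \<Longrightarrow>
     upd x i v $ 3 \<le> d \<Longrightarrow> g (upd x i v) = 0 \<Longrightarrow> \<bar>g x\<bar> < \<eta>"
proof -
  define S where "S = closure (domain a) \<inter> {x. x$3 \<le> d}"
  have "closed S" unfolding S_def by (intro closed_Int closed_closure closed_halfspace_component_le_cart)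
  moreover have "S \<subseteq> cbox (vector [0, 0, 0]) (vector [a, a, d])"
    using closure_domainD by (auto simp: S_def mem_box_cart forall_3)
  ultimately have "compact S" by (meson bounded_cbox bounded_subset compact_eq_bounded_closed)
  then have "uniformly_continuous_on S g"
    using continuous_on_subset[OF g] by (intro compact_uniformly_continuous) (auto simp: S_def)
  then obtain e where e: "e > 0" "\<And>x y. x \<in> S \<Longrightarrow> y \<in> S \<Longrightarrow> dist y x < e \<Longrightarrow> dist (g y) (g x) < \<eta>"
    unfolding uniformly_continuous_on_def using \<eta> by blast
  have "\<bar>g x\<bar> < \<eta>" if "x \<in> domain a" "x$3 \<le> d" "\<bar>x$i - v\<bar> < e" "upd x i v \<in> closure (domain a)" "upd x i v $ 3 \<le> d" "g (upd x i v) = 0" for x i v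
  proof -
    have "x \<in> S" "upd x i v \<in> S" using that closure_subset by (auto simp: S_def)
    moreover have "dist x (upd x i v) < e" using dist_upd[of x i v] that(3) by linarith
    ultimately have "dist (g x) (g (upd x i v)) < \<eta>" using e(2) by blast
    then show ?thesis using that(6) by (simp add: dist_real_def)
  qed
  with e(1) that show ?thesis by blast
qed

text \<open>A point near the bottom is compared with its vertical projection, which lies in
  \<open>bottom a\<close>; the cap at height 1 confines the comparison to a compact set.\<close>

lemma small_near_bottom:
  assumes v: "vanishes_on (domain a) S h" and S: "bottom a \<subseteq> S" and a: "a > 0" and \<eta>: "\<eta> > 0"
  obtains e where "e > 0" "AE x in dom_measure a. x$3 < e \<longrightarrow> \<bar>h x\<bar> < \<eta>"
proof -
  obtain g where g: "continuous_on (closure (domain a)) g" "AE x in dom_measure a. g x = h x" "\<forall>x\<in>S. g x = 0"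
    using v by (auto simp: vanishes_on_def)
  obtain e where e: "e > 0" "\<And>x i v. x \<in> domain a \<Longrightarrow> x$3 \<le> 1 \<Longrightarrow> \<bar>x$i - v\<bar> < e \<Longrightarrow> upd x i v \<in> closure (domain a) \<Longrightarrow>
     upd x i v $ 3 \<le> 1 \<Longrightarrow> g (upd x i v) = 0 \<Longrightarrow> \<bar>g x\<bar> < \<eta>"
    using small_near_face[OF g(1) \<eta>] by blast
  have gs: "\<bar>g x\<bar> < \<eta>" if x: "x \<in> domain a" "x$3 < min e 1" for x
  proof (rule e(2)[where i = 3 and v = 0])
    have c: "upd x 3 0 $ 1 = x$1" "upd x 3 0 $ 2 = x$2" "upd x 3 0 $ 3 = 0" by (auto simp: upd_def)
    show "upd x 3 0 \<in> closure (domain a)" by (rule closure_domainI) (use x a c in \<open>auto simp: domain_def\<close>)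
    have "upd x 3 0 \<in> bottom a" using x c by (auto simp: domain_def bottom_def)
    then show "g (upd x 3 0) = 0" using g(3) S by blast
    show "upd x 3 0 $ 3 \<le> 1" using c by simp
  qed (use x in \<open>auto simp: domain_def\<close>)
  have "AE x in dom_measure a. x$3 < min e 1 \<longrightarrow> \<bar>h x\<bar> < \<eta>"
    using g(2) AE_space
  proof eventually_elim
    case (elim x)
    then show ?case using gs[of x] by auto
  qed
  with e(1) that[of "min e 1"] show ?thesis by simp
qed

section \<open>Layers along the side walls and the cut-off sine\<close>

definition side :: "real \<Rightarrow> 3 \<Rightarrow> real \<Rightarrow> real^3 \<Rightarrow> bool" where
  "side a i e x \<longleftrightarrow> x$i < e \<or> a - x$i < e"

lemma small_near_side:
  assumes v: "vanishes_on (domain a) (frontier (domain a) - bottom a) f" and a: "a > 0" and \<eta>: "\<eta> > 0"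
    and i: "i = 1 \<or> i = 2"
  obtains e where "e > 0" "AE x in dom_measure a. side a i e x \<and> x$3 \<le> d \<longrightarrow> \<bar>f x\<bar> < \<eta>"
proof -
  obtain g where g: "continuous_on (closure (domain a)) g" "AE x in dom_measure a. g x = f x"
    "\<forall>x\<in>frontier (domain a) - bottom a. g x = 0"
    using v by (auto simp: vanishes_on_def)
  obtain e where e: "e > 0" "\<And>x i v. x \<in> domain a \<Longrightarrow> x$3 \<le> d \<Longrightarrow> \<bar>x$i - v\<bar> < e \<Longrightarrow> upd x i v \<in> closure (domain a) \<Longrightarrow>
     upd x i v $ 3 \<le> d \<Longrightarrow> g (upd x i v) = 0 \<Longrightarrow> \<bar>g x\<bar> < \<eta>"
    using small_near_face[OF g(1) \<eta>] by blast
  have face: "\<bar>g x\<bar> < \<eta>" if x: "x \<in> domain a" "x$3 \<le> d" "\<bar>x$i - v\<bar> < e" and v: "v = 0 \<or> v = a" for x v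
  proof (rule e(2)[where i = i and v = v])
    have c: "upd x i v $ i = v" "\<And>j. j \<noteq> i \<Longrightarrow> upd x i v $ j = x$j" by (auto simp: upd_def)
    have c3: "upd x i v $ 3 = x$3" using i by (auto simp: upd_def)
    have c12: "0 \<le> upd x i v $ 1" "upd x i v $ 1 \<le> a" "0 \<le> upd x i v $ 2" "upd x i v $ 2 \<le> a"
      using x(1) v a i by (auto simp: upd_def domain_def)
    show cl: "upd x i v \<in> closure (domain a)"
      by (rule closure_domainI) (use x a c3 c12 in \<open>auto simp: domain_def\<close>)
    have out: "upd x i v \<notin> domain a" "upd x i v \<notin> bottom a"
      using i v c(1) by (auto simp: domain_def bottom_def)
    then have "upd x i v \<in> frontier (domain a) - bottom a"
      using cl by (simp add: frontier_def interior_open[OF domain_open])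
    then show "g (upd x i v) = 0" using g(3) by blast
    show "upd x i v $ 3 \<le> d" using c3 x by simp
  qed (use x in auto)
  have gs: "\<bar>g x\<bar> < \<eta>" if x: "x \<in> domain a" "x$3 \<le> d" "side a i e x" for x
  proof -
    have "0 < x$i" "x$i < a" using x(1) i by (auto simp: domain_def)
    then show ?thesis using face[of x 0] face[of x a] x by (auto simp: side_def)
  qed
  have "AE x in dom_measure a. side a i e x \<and> x$3 \<le> d \<longrightarrow> \<bar>f x\<bar> < \<eta>"
    using g(2) AE_space
  proof eventually_elim
    case (elim x)
    then show ?case using gs[of x] by auto
  qed
  with e(1) that show ?thesis by blast
qed

lemma side_measure:
  assumes a: "a > 0" and i: "i = 1 \<or> i = 2" and e: "0 < e" "e \<le> a" and d: "0 < d"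
  shows "integrable (dom_measure a) (indicator {x. side a i e x \<and> x$3 \<le> d} :: real^3 \<Rightarrow> real)"
    "(LINT x|dom_measure a. indicator {x. side a i e x \<and> x$3 \<le> d} x) \<le> 2 * e * a * d"
proof -
  define l where "l k = (\<chi> j. if j = i then k else (0 :: real))" for k
  define r where "r k = (\<chi> j. if j = i then k else if j = 3 then d else a)" for k
  define B where "B = cbox (l 0) (r e) \<union> cbox (l (a - e)) (r a)"
  have i3: "i \<noteq> 3" using i by auto
  have m: "measure lebesgue (cbox (l k) (r (k + e))) = e * a * d" for k
  proof -
    have "cbox (l k) (r (k + e)) \<noteq> {}"
      using e a d by (auto simp: interval_ne_empty_cart l_def r_def)
    then have "measure lborel (cbox (l k) (r (k + e))) = (\<Prod>j\<in>UNIV. r (k + e) $ j - l k $ j)"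
      by (rule content_cbox_cart)
    also have "\<dots> = e * a * d"
      using i unfolding UNIV_3 by (auto simp: l_def r_def)
    finally show ?thesis by (simp add: measure_completion)
  qed
  have Bs: "B \<in> sets lebesgue" unfolding B_def by auto
  have Bf: "emeasure lebesgue B < \<infinity>"
    unfolding B_def using fmeasurable.Un[OF lmeasurable_cbox lmeasurable_cbox] by (auto simp: fmeasurable_def)
  have Bm: "measure lebesgue B \<le> 2 * e * a * d"
  proof -
    have "measure lebesgue B \<le> measure lebesgue (cbox (l 0) (r (0 + e))) + measure lebesgue (cbox (l (a - e)) (r (a - e + e)))"
      unfolding B_def using measure_Un_le[of "cbox (l 0) (r e)" lebesgue "cbox (l (a - e)) (r a)"] by simp
    then show ?thesis using m[of 0] m[of "a - e"] by (simp add: mult_ac)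
  qed
  have sub: "indicator (domain a) x * indicator {x. side a i e x \<and> x$3 \<le> d} x \<le> (indicator B x :: real)" for x
  proof (cases "x \<in> domain a \<and> side a i e x \<and> x$3 \<le> d")
    case True
    then have "x \<in> B"
      using i unfolding B_def side_def mem_box_cart Un_iff l_def r_def forall_3 by (auto simp: domain_def)
    then show ?thesis by (simp add: indicator_def)
  qed (auto simp: indicator_def)
  have Ss: "{x. side a i e x \<and> x$3 \<le> d} \<in> sets lebesgue"
  proof -
    have "{x. side a i e x \<and> x$3 \<le> d} = ({x. x$i < e} \<union> {x. x$i > a - e}) \<inter> {x. x$3 \<le> d}"
      by (auto simp: side_def)
    also have "\<dots> \<in> sets borel"
      by (intro sets.Int sets.Un borel_open borel_closed open_halfspace_component_lt_cart open_halfspace_component_gt_cart closed_halfspace_component_le_cart)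
    finally show ?thesis by simp
  qed
  have iB: "integrable lebesgue (indicator B :: real^3 \<Rightarrow> real)" using Bs Bf by (rule integrable_real_indicator)
  have i2: "integrable lebesgue (\<lambda>x. indicator (domain a) x * indicator {x. side a i e x \<and> x$3 \<le> d} x :: real)"
  proof (rule Bochner_Integration.integrable_bound[OF iB])
    show "(\<lambda>x. indicator (domain a) x * indicator {x. side a i e x \<and> x$3 \<le> d} x :: real) \<in> borel_measurable lebesgue"
      by (intro borel_measurable_times borel_measurable_indicator Ss domain_lebesgue)
    show "AE x in lebesgue. norm (indicator (domain a) x * indicator {x. side a i e x \<and> x$3 \<le> d} x :: real) \<le> norm (indicator B x :: real)"
    proof (rule AE_I2)
      fix x show "norm (indicator (domain a) x * indicator {x. side a i e x \<and> x$3 \<le> d} x :: real) \<le> norm (indicator B x :: real)"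
        using sub[of x] by (simp add: abs_mult)
    qed
  qed
  then show "integrable (dom_measure a) (indicator {x. side a i e x \<and> x$3 \<le> d} :: real^3 \<Rightarrow> real)"
    by (simp add: integrable_domain_iff)
  have "(LINT x|dom_measure a. indicator {x. side a i e x \<and> x$3 \<le> d} x :: real) \<le> (LINT x|lebesgue. indicator B x)"
    unfolding integral_domain_eq by (rule integral_mono[OF i2 iB sub])
  then show "(LINT x|dom_measure a. indicator {x. side a i e x \<and> x$3 \<le> d} x) \<le> 2 * e * a * d"
    using Bm Bs by simp
qed

text \<open>The factor \<open>E n\<close> has size n on a layer of volume O(1/n), so it stays
  bounded in L1, while f tends to 0 uniformly on the layers.\<close>

lemma side_layer_tendsto_0:
  fixes E :: "nat \<Rightarrow> real^3 \<Rightarrow> real"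
  assumes v: "vanishes_on (domain a) (frontier (domain a) - bottom a) f" and a: "a > 0"
    and i: "i = 1 \<or> i = 2" and d: "d > 0" and fm: "f \<in> borel_measurable (dom_measure a)"
    and Em: "\<And>n. E n \<in> borel_measurable (dom_measure a)"
    and E: "\<And>n x. real n \<ge> 2 / a \<Longrightarrow> x \<in> domain a \<Longrightarrow> \<bar>E n x\<bar> \<le> K * real n * indicator {x. side a i (2 / real n) x \<and> x$3 \<le> d} x"
    and K: "K \<ge> 0"
  shows "(\<lambda>n. LINT x|dom_measure a. f x * E n x) \<longlonglongrightarrow> 0"
proof (rule LIMSEQ_I)
  fix r :: real assume r: "r > 0"
  \<comment> \<open>The two layers together have volume at most 4 a d / n and |E n| is at most K n
    there, so the integral is at most \<eta> 4 a d K; the added ones keep the denominator positive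
    and the inequality strict.\<close>
  define \<eta> where "\<eta> = r / (4 * a * d * (K + 1) + 1)"
  have \<eta>: "\<eta> > 0" "\<eta> * (4 * a * d * K) < r"
  proof -
    have p: "0 \<le> 4 * a * d * (K + 1)" "4 * a * d * K \<le> 4 * a * d * (K + 1)" using a d K by auto
    then show "\<eta> > 0" using r by (simp add: \<eta>_def)
    then have "\<eta> * (4 * a * d * K) \<le> \<eta> * (4 * a * d * (K + 1))" using p a d by (intro mult_left_mono) auto
    also have "\<dots> < \<eta> * (4 * a * d * (K + 1) + 1)" using \<open>\<eta> > 0\<close> by (intro mult_strict_left_mono) auto
    also have "\<dots> = r" using p by (simp add: \<eta>_def)
    finally show "\<eta> * (4 * a * d * K) < r" .
  qed
  obtain e where e: "e > 0" "AE x in dom_measure a. side a i e x \<and> x$3 \<le> d \<longrightarrow> \<bar>f x\<bar> < \<eta>"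
    using small_near_side[OF v a \<eta>(1) i] by blast
  obtain n0 where n0: "real n0 \<ge> 2 / e" "real n0 \<ge> 2 / a"
  proof -
    obtain n0 where "real n0 \<ge> max (2 / e) (2 / a)" using real_arch_simple by blast
    then show ?thesis using that by auto
  qed
  show "\<exists>no. \<forall>n\<ge>no. norm ((LINT x|dom_measure a. f x * E n x) - 0) < r"
  proof (intro exI[of _ n0] allI impI)
    fix n assume "n \<ge> n0"
    then have n: "real n \<ge> 2 / e" "real n \<ge> 2 / a" using n0 by (meson of_nat_le_iff order_trans)+
    have np: "real n > 0" using n(2) a divide_pos_pos[of 2 a] by linarith
    have en: "0 < 2 / real n" "2 / real n \<le> a" "2 / real n \<le> e"
      using n np a e by (auto simp: field_simps)
    let ?I = "indicator {x. side a i (2 / real n) x \<and> x$3 \<le> d} :: real^3 \<Rightarrow> real"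
    note sm = side_measure[OF a i en(1,2) d]
    have ae: "AE x in dom_measure a. \<bar>f x * E n x\<bar> \<le> \<eta> * K * real n * ?I x"
      using e(2) AE_space
    proof eventually_elim
      case (elim x)
      then have Ex: "\<bar>E n x\<bar> \<le> K * real n * ?I x" using E[OF n(2)] by simp
      show ?case
      proof (cases "side a i (2 / real n) x \<and> x$3 \<le> d")
        case True
        then have "side a i e x" using en(3) by (auto simp: side_def)
        then have "\<bar>f x\<bar> \<le> \<eta>" using elim True by auto
        then have "\<bar>f x\<bar> * \<bar>E n x\<bar> \<le> \<eta> * (K * real n * ?I x)" using Ex \<eta>(1) by (intro mult_mono) auto
        then show ?thesis by (simp add: abs_mult mult_ac)
      next
        case False
        then have "?I x = 0" by (simp add: indicator_def)
        then have "E n x = 0" using Ex by simp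
        then show ?thesis using \<eta>(1) K by simp
      qed
    qed
    have i1: "integrable (dom_measure a) (\<lambda>x. \<eta> * K * real n * ?I x)" using sm(1) by (rule integrable_mult_right)
    have i2: "integrable (dom_measure a) (\<lambda>x. f x * E n x)"
      by (rule Bochner_Integration.integrable_bound[OF i1 borel_measurable_times[OF fm Em]])
        (use ae in \<open>eventually_elim, auto intro: order_trans[OF _ abs_ge_self]\<close>)
    have "\<bar>LINT x|dom_measure a. f x * E n x\<bar> \<le> (LINT x|dom_measure a. \<bar>f x * E n x\<bar>)" by (rule integral_abs_bound)
    also have "\<dots> \<le> (LINT x|dom_measure a. \<eta> * K * real n * ?I x)"
      by (rule integral_mono_AE[OF integrable_abs[OF i2] i1 ae])
    also have "\<dots> \<le> \<eta> * K * real n * (2 * (2 / real n) * a * d)"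
      using sm(2) \<eta>(1) K by (simp del: times_divide_eq_right) (intro mult_left_mono, auto)
    also have "\<dots> = \<eta> * (4 * a * d * K)" using np by simp
    finally show "norm ((LINT x|dom_measure a. f x * E n x) - 0) < r" using \<eta>(2) by simp
  qed
qed

text \<open>The end points 1 and 2 are included: there \<open>step\<close> attains its minimum or
  maximum, and wherever \<open>deriv step\<close> is 0 it attains its own minimum.\<close>

lemma deriv_step_zero: "x \<le> 1 \<or> x \<ge> 2 \<Longrightarrow> deriv step x = 0 \<and> deriv (deriv step) x = 0"
proof -
  assume x: "x \<le> 1 \<or> x \<ge> 2"
  have d1: "(step has_real_derivative deriv step x) (at x)"
    by (rule smooth_real_deriv(2)[OF smooth_real_step])
  have d2: "(deriv step has_real_derivative deriv (deriv step) x) (at x)"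
    by (rule smooth_real_deriv(2)[OF smooth_real_deriv(1)[OF smooth_real_step]])
  have 1: "deriv step x = 0"
    using x
  proof
    assume "x \<le> 1"
    then show ?thesis
      by (intro DERIV_local_min[OF d1, of 1]) (auto simp: step_eq_0 step_nonneg)
  next
    assume "x \<ge> 2"
    then show ?thesis
      by (intro DERIV_local_max[OF d1, of 1]) (auto simp: step_eq_1 step_le_1)
  qed
  moreover have "deriv (deriv step) x = 0"
    by (rule DERIV_local_min[OF d2, of 1]) (auto simp: 1 deriv_step_nonneg)
  ultimately show ?thesis by simp
qed

lemma deriv_mult_smooth:
  assumes "smooth_real f" "smooth_real g"
  shows "deriv (\<lambda>x. f x * g x) = (\<lambda>x. deriv f x * g x + f x * deriv g x)"
proof
  fix x show "deriv (\<lambda>x. f x * g x) x = deriv f x * g x + f x * deriv g x"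
    using DERIV_mult[OF smooth_real_deriv(2)[OF assms(1), of x] smooth_real_deriv(2)[OF assms(2), of x]]
    by (intro DERIV_imp_deriv) (simp add: mult.commute add.commute)
qed

lemma deriv_add_smooth:
  assumes "smooth_real f" "smooth_real g"
  shows "deriv (\<lambda>x. f x + g x) = (\<lambda>x. deriv f x + deriv g x)"
proof
  fix x show "deriv (\<lambda>x. f x + g x) x = deriv f x + deriv g x"
    by (rule DERIV_imp_deriv, rule DERIV_add[OF smooth_real_deriv(2)[OF assms(1), of x] smooth_real_deriv(2)[OF assms(2), of x]])
qed

lemma deriv_affine_smooth:
  assumes "smooth_real f"
  shows "deriv (\<lambda>x. f (c * x + d)) = (\<lambda>x. c * deriv f (c * x + d))"
proof
  fix x
  have lin: "((\<lambda>x. c * x + d) has_real_derivative c) (at x)" by (auto intro!: derivative_eq_intros)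
  have "((\<lambda>x. f (c * x + d)) has_real_derivative deriv f (c * x + d) * c) (at x)"
    by (rule DERIV_chain2[where f = f and g = "\<lambda>x. c * x + d" and x = x and s = UNIV, OF smooth_real_deriv(2)[OF assms] lin])
  then show "deriv (\<lambda>x. f (c * x + d)) x = c * deriv f (c * x + d)"
    by (simp add: DERIV_imp_deriv mult.commute)
qed

definition sine :: "real \<Rightarrow> real \<Rightarrow> real" where "sine a x = sin (pi / a * x)"

definition cut_sine :: "real \<Rightarrow> nat \<Rightarrow> real \<Rightarrow> real" where
  "cut_sine a n = (\<lambda>x. sine a x * window 0 a n x)"

lemma smooth_real_sine: "smooth_real (sine a)"
  unfolding sine_def[abs_def] by (rule smooth_real_sin)

lemma smooth_real_cut_sine: "smooth_real (cut_sine a n)"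
  unfolding cut_sine_def by (intro smooth_real_mult smooth_real_sine smooth_real_window)

lemma test_real_cut_sine: "n > 0 \<Longrightarrow> test_real {0<..<a} (cut_sine a n)"
  unfolding cut_sine_def by (intro test_real_mult test_real_window smooth_real_sine) auto

lemma abs_sine_le: "\<bar>sine a x\<bar> \<le> 1"
  by (simp add: sine_def)

lemma abs_cut_sine_le: "\<bar>cut_sine a n x\<bar> \<le> 1"
  unfolding cut_sine_def abs_mult using abs_sine_le[of a x] window_nonneg[of 0 a n x] window_le_1[of 0 a n x]
  by (intro mult_le_one) auto

lemma deriv_sine: "deriv (sine a) = (\<lambda>x. pi / a * cos (pi / a * x))" "deriv (deriv (sine a)) = (\<lambda>x. - ((pi / a)\<^sup>2 * sine a x))"
proof -
  have "((\<lambda>x. sin (c * x)) has_real_derivative c * cos (c * x)) (at x)" for c x :: real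
    by (auto intro!: derivative_eq_intros)
  then show 1: "deriv (sine a) = (\<lambda>x. pi / a * cos (pi / a * x))"
    unfolding sine_def[abs_def] by (intro ext DERIV_imp_deriv)
  have "((\<lambda>x. c * cos (c * x)) has_real_derivative - (c\<^sup>2 * sin (c * x))) (at x)" for c x :: real
    by (auto intro!: derivative_eq_intros simp: power2_eq_square)
  then show "deriv (deriv (sine a)) = (\<lambda>x. - ((pi / a)\<^sup>2 * sine a x))"
    unfolding 1 unfolding sine_def[abs_def] by (intro ext DERIV_imp_deriv)
qed

text \<open>Near the side walls the sine is \<open>O(1/n)\<close>, which gains one power of \<open>n\<close> in the second derivative
  of the cut-off.\<close>

lemma cut_sine_defect:
  assumes a: "a > 0"
  obtains K where "K \<ge> 0" "\<And>n x. real n \<ge> 2 / a \<Longrightarrow> 0 < x \<Longrightarrow> x < a \<Longrightarrow>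
    \<bar>deriv (deriv (cut_sine a n)) x + (pi / a)\<^sup>2 * cut_sine a n x\<bar> \<le> K * real n * (if x < 2 / real n \<or> a - x < 2 / real n then 1 else 0)"
proof -
  define \<omega> where "\<omega> = pi / a"
  have \<omega>: "\<omega> > 0" using a by (simp add: \<omega>_def)
  obtain C where C: "C \<ge> 0" "\<And>x. \<bar>deriv step x\<bar> \<le> C" "\<And>x. \<bar>deriv (deriv step) x\<bar> \<le> C"
    using bounded_derivs_step by blast
  \<comment> \<open>The first term bounds 2 sine' window', where window' is at most 2 C n; the
    second bounds sine window'', where the sine is at most 2 \<omega> / n in the layer and window''
    at most n^2 (2 C + 2 C^2).\<close>
  define K where "K = 2 * \<omega> * (2 * C) + 2 * \<omega> * (2 * C + 2 * (C * C))"
  have K0: "K \<ge> 0" using \<omega> C(1) by (simp add: K_def)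
  have "\<bar>deriv (deriv (cut_sine a n)) x + (pi / a)\<^sup>2 * cut_sine a n x\<bar> \<le> K * real n * (if x < 2 / real n \<or> a - x < 2 / real n then 1 else 0)"
    if n: "real n \<ge> 2 / a" and x: "0 < x" "x < a" for n x
  proof -
    have np: "real n > 0" using n a divide_pos_pos[of 2 a] by linarith
    let ?N = "real n"
    define s0 where "s0 = step"
    define s1 where "s1 = deriv step"
    define s2 where "s2 = deriv (deriv step)"
    have sm: "smooth_real s0" "smooth_real s1" "smooth_real s2"
      unfolding s0_def s1_def s2_def by (intro smooth_real_step smooth_real_deriv)+
    have ds: "deriv s0 = s1" "deriv s1 = s2" by (simp_all add: s0_def s1_def s2_def)
    have w: "window 0 a n = (\<lambda>x. s0 (?N * x + 0) * s0 ((- ?N) * x + ?N * a))"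
      by (auto simp: fun_eq_iff window_def s0_def algebra_simps)
    have d1: "deriv (window 0 a n) = (\<lambda>x. ?N * s1 (?N * x + 0) * s0 ((- ?N) * x + ?N * a) + s0 (?N * x + 0) * ((- ?N) * s1 ((- ?N) * x + ?N * a)))"
      unfolding w by (simp only: deriv_mult_smooth[OF smooth_real_affine[OF sm(1)] smooth_real_affine[OF sm(1)]] deriv_affine_smooth[OF sm(1)] ds)
    have aff: "smooth_real (\<lambda>x. k * f (c * x + d))" if "smooth_real f" for k c d f
      by (intro smooth_real_mult smooth_real_const smooth_real_affine that)
    have daff: "deriv (\<lambda>x. k * f (c * x + d)) = (\<lambda>x. k * (c * deriv f (c * x + d)))" if "smooth_real f" for k c d f
      using deriv_mult_smooth[OF smooth_real_const[of k] smooth_real_affine[OF that, of c d]] deriv_affine_smooth[OF that, of c d]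
      by simp
    have d2: "deriv (deriv (window 0 a n)) x = ?N * ?N * s2 (?N * x + 0) * s0 ((- ?N) * x + ?N * a)
       - 2 * (?N * ?N) * (s1 (?N * x + 0) * s1 ((- ?N) * x + ?N * a)) + ?N * ?N * (s0 (?N * x + 0) * s2 ((- ?N) * x + ?N * a))"
      unfolding d1
      by (subst deriv_add_smooth[OF smooth_real_mult[OF aff[OF sm(2)] smooth_real_affine[OF sm(1)]] smooth_real_mult[OF smooth_real_affine[OF sm(1)] aff[OF sm(2)]]],
          subst deriv_mult_smooth[OF aff[OF sm(2)] smooth_real_affine[OF sm(1)]],
          subst deriv_mult_smooth[OF smooth_real_affine[OF sm(1)] aff[OF sm(2)]])
        (simp only: daff[OF sm(2)] deriv_affine_smooth[OF sm(1)] ds, simp add: algebra_simps)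
    have sw: "smooth_real (window 0 a n)" "smooth_real (deriv (window 0 a n))" "smooth_real (sine a)" "smooth_real (deriv (sine a))"
      by (intro smooth_real_window smooth_real_deriv smooth_real_sine)+
    have "deriv (deriv (cut_sine a n)) x = deriv (deriv (sine a)) x * window 0 a n x + 2 * (deriv (sine a) x * deriv (window 0 a n) x)
        + sine a x * deriv (deriv (window 0 a n)) x"
      unfolding cut_sine_def deriv_mult_smooth[OF sw(3,1)]
      by (subst deriv_add_smooth[OF smooth_real_mult[OF sw(4,1)] smooth_real_mult[OF sw(3,2)]],
          subst deriv_mult_smooth[OF sw(4,1)], subst deriv_mult_smooth[OF sw(3,2)]) simp
    \<comment> \<open>The eigenvalue relation for the sine removes the terms in which the window is
      not differentiated.\<close>
    then have eq: "deriv (deriv (cut_sine a n)) x + (pi / a)\<^sup>2 * cut_sine a n x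
       = 2 * (\<omega> * cos (\<omega> * x) * deriv (window 0 a n) x) + sine a x * deriv (deriv (window 0 a n)) x"
      unfolding deriv_sine(2) unfolding deriv_sine(1) by (simp add: cut_sine_def \<omega>_def)
    show ?thesis
    proof (cases "x < 2 / ?N \<or> a - x < 2 / ?N")
      case False
      then have "?N * x \<ge> 2" "?N * (a - x) \<ge> 2" using np by (auto simp: field_simps)
      then have "s1 (?N * x + 0) = 0" "s2 (?N * x + 0) = 0" "s1 ((- ?N) * x + ?N * a) = 0" "s2 ((- ?N) * x + ?N * a) = 0"
        using deriv_step_zero[of "?N * x + 0"] deriv_step_zero[of "(- ?N) * x + ?N * a"]
        by (auto simp: s1_def s2_def algebra_simps)
      then show ?thesis unfolding eq unfolding d2 unfolding d1 using False by simp
    next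
      case True
      let ?A = "?N * x + 0" and ?B = "(- ?N) * x + ?N * a"
      have s0b: "\<bar>s0 y\<bar> \<le> 1" for y using step_nonneg[of y] step_le_1[of y] by (simp add: s0_def)
      have s1b: "\<bar>s1 y\<bar> \<le> C" and s2b: "\<bar>s2 y\<bar> \<le> C" for y using C by (auto simp: s1_def s2_def)
      have pb: "\<bar>f y * g z\<bar> \<le> F * G" if "\<bar>f y\<bar> \<le> F" "\<bar>g z\<bar> \<le> G" "0 \<le> F" for f g :: "real \<Rightarrow> real" and y z F G
        unfolding abs_mult using that by (intro mult_mono) auto
      have "\<bar>s1 ?A * s0 ?B\<bar> \<le> C * 1" "\<bar>s0 ?A * s1 ?B\<bar> \<le> 1 * C"
        by (rule pb; use s0b s1b C in simp)+
      then have "\<bar>s1 ?A * s0 ?B - s0 ?A * s1 ?B\<bar> \<le> 2 * C" by linarith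
      moreover have "deriv (window 0 a n) x = ?N * (s1 ?A * s0 ?B - s0 ?A * s1 ?B)"
        unfolding d1 by (simp add: algebra_simps)
      ultimately have w1: "\<bar>deriv (window 0 a n) x\<bar> \<le> ?N * (2 * C)"
        using np by (simp add: abs_mult)
      have "\<bar>s2 ?A * s0 ?B\<bar> \<le> C * 1" "\<bar>s0 ?A * s2 ?B\<bar> \<le> 1 * C" "\<bar>s1 ?A * s1 ?B\<bar> \<le> C * C"
        by (rule pb; use s0b s1b s2b C in simp)+
      then have "\<bar>s2 ?A * s0 ?B - 2 * (s1 ?A * s1 ?B) + s0 ?A * s2 ?B\<bar> \<le> 2 * C + 2 * (C * C)" by linarith
      moreover have "deriv (deriv (window 0 a n)) x = ?N * ?N * (s2 ?A * s0 ?B - 2 * (s1 ?A * s1 ?B) + s0 ?A * s2 ?B)"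
        unfolding d2 by (simp add: algebra_simps)
      ultimately have w2: "\<bar>deriv (deriv (window 0 a n)) x\<bar> \<le> ?N * ?N * (2 * C + 2 * (C * C))"
        using np by (simp add: abs_mult)
      have sb: "\<bar>sine a x\<bar> \<le> \<omega> * (2 / ?N)"
        using True
      proof
        assume l: "x < 2 / ?N"
        have "\<bar>sin (\<omega> * x)\<bar> \<le> \<bar>\<omega> * x\<bar>" by (rule abs_sin_x_le_abs_x)
        also have "\<dots> \<le> \<omega> * (2 / ?N)" using \<omega> x l by (simp only: abs_of_pos mult_pos_pos) (intro mult_left_mono, auto)
        finally show ?thesis by (simp add: sine_def \<omega>_def)
      next
        assume l: "a - x < 2 / ?N"
        have "sin (\<omega> * x) = sin (pi - \<omega> * x)" by simp
        also have "pi - \<omega> * x = \<omega> * (a - x)" using a by (simp add: \<omega>_def field_simps)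
        finally have "\<bar>sin (\<omega> * x)\<bar> \<le> \<bar>\<omega> * (a - x)\<bar>" using abs_sin_x_le_abs_x[of "\<omega> * (a - x)"] by simp
        also have "\<bar>\<omega> * (a - x)\<bar> = \<omega> * (a - x)" using \<omega> x by (intro abs_of_pos mult_pos_pos) auto
        also have "\<dots> \<le> \<omega> * (2 / ?N)" by (rule mult_left_mono) (use l \<omega> in auto)
        finally show ?thesis by (simp add: sine_def \<omega>_def)
      qed
      have "\<bar>\<omega> * cos (\<omega> * x) * deriv (window 0 a n) x\<bar> \<le> (\<omega> * 1) * (?N * (2 * C))"
        unfolding abs_mult using \<omega> w1 by (intro mult_mono) auto
      moreover have "\<bar>sine a x * deriv (deriv (window 0 a n)) x\<bar> \<le> \<omega> * (2 / ?N) * (?N * ?N * (2 * C + 2 * (C * C)))"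
        unfolding abs_mult using sb w2 \<omega> np by (intro mult_mono) auto
      moreover have "\<omega> * (2 / ?N) * (?N * ?N * (2 * C + 2 * (C * C))) = 2 * \<omega> * (2 * C + 2 * (C * C)) * ?N"
        using np by (simp add: field_simps)
      ultimately have "\<bar>deriv (deriv (cut_sine a n)) x + (pi / a)\<^sup>2 * cut_sine a n x\<bar> \<le> 2 * ((\<omega> * 1) * (?N * (2 * C))) + 2 * \<omega> * (2 * C + 2 * (C * C)) * ?N"
        unfolding eq by linarith
      also have "\<dots> = K * ?N" by (simp add: K_def algebra_simps)
      finally show ?thesis using True by simp
    qed
  qed
  with K0 that show ?thesis by blast
qed

lemma cut_sine_tendsto: "0 < x \<Longrightarrow> x < a \<Longrightarrow> (\<lambda>n. cut_sine a n x) \<longlonglongrightarrow> sine a x"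
  using tendsto_mult[OF tendsto_const[of "sine a x"] window_tendsto[of 0 a x]] by (simp add: cut_sine_def)

lemma integral_cut_sine_tendsto:
  assumes f: "integrable (dom_measure a) (\<lambda>x. f x * r (x$3))"
  shows "(\<lambda>n. LINT x|dom_measure a. f x * tensor (cut_sine a n) (cut_sine a n) r x) \<longlonglongrightarrow>
    (LINT x|dom_measure a. f x * tensor (sine a) (sine a) r x)"
proof (rule integral_dominated_convergence[where w = "\<lambda>x. \<bar>f x * r (x$3)\<bar>"])
  have eq: "f x * tensor p q r x = p (x$1) * q (x$2) * (f x * r (x$3))" for p q x
    by (simp add: tensor_def)
  have m: "(\<lambda>x. f x * tensor p q r x) \<in> borel_measurable (dom_measure a)" if "smooth_real p" "smooth_real q" for p q
  proof -
    have "(\<lambda>x::real^3. p (x$1) * q (x$2) * 1) \<in> borel_measurable borel"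
      using tensor_measurable[OF that smooth_real_const[of 1]] by (simp add: tensor_def[abs_def])
    from borel_measurable_times[OF borel_measurable_dom[OF this] borel_measurable_integrable[OF f]]
    show ?thesis unfolding eq by simp
  qed
  show "(\<lambda>x. f x * tensor (sine a) (sine a) r x) \<in> borel_measurable (dom_measure a)"
    "(\<lambda>x. f x * tensor (cut_sine a n) (cut_sine a n) r x) \<in> borel_measurable (dom_measure a)" for n
    by (intro m smooth_real_sine smooth_real_cut_sine)+
  show "integrable (dom_measure a) (\<lambda>x. \<bar>f x * r (x$3)\<bar>)" using f by (rule integrable_abs)
  show "AE x in dom_measure a. (\<lambda>n. f x * tensor (cut_sine a n) (cut_sine a n) r x) \<longlonglongrightarrow> f x * tensor (sine a) (sine a) r x"
    unfolding tensor_def using AE_space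
    by eventually_elim (intro tendsto_intros cut_sine_tendsto, auto simp: domain_def)
  show "AE x in dom_measure a. norm (f x * tensor (cut_sine a n) (cut_sine a n) r x) \<le> \<bar>f x * r (x$3)\<bar>" for n
  proof (rule AE_I2)
    fix x :: "real^3"
    have "\<bar>cut_sine a n (x$1)\<bar> * \<bar>cut_sine a n (x$2)\<bar> \<le> 1"
      by (intro mult_le_one abs_cut_sine_le) auto
    then have "\<bar>cut_sine a n (x$1)\<bar> * \<bar>cut_sine a n (x$2)\<bar> * \<bar>f x * r (x$3)\<bar> \<le> 1 * \<bar>f x * r (x$3)\<bar>"
      by (intro mult_right_mono) auto
    then show "norm (f x * tensor (cut_sine a n) (cut_sine a n) r x) \<le> \<bar>f x * r (x$3)\<bar>"
      unfolding eq by (simp add: abs_mult)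
  qed
qed

text \<open>The second derivative of the cut-off sine is -(pi/a)^2 times itself, up to a defect of
  size n on layers of width 2/n along two opposite side walls. Paired with a function that vanishes
  on the walls, the defects disappear in the limit.\<close>

lemma lateral_limit:
  assumes a: "a > 0" and f: "f \<in> L2 (domain a)"
    and v: "vanishes_on (domain a) (frontier (domain a) - bottom a) f"
    and r: "test_real {0<..} r"
  shows "(\<lambda>n. (LINT x|dom_measure a. f x * tensor (deriv (deriv (cut_sine a n))) (cut_sine a n) r x)
     + (LINT x|dom_measure a. f x * tensor (cut_sine a n) (deriv (deriv (cut_sine a n))) r x)
     + 2 * (pi / a)\<^sup>2 * (LINT x|dom_measure a. f x * tensor (cut_sine a n) (cut_sine a n) r x)) \<longlonglongrightarrow> 0"
proof -
  let ?c = "cut_sine a"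
  let ?c2 = "\<lambda>n. deriv (deriv (cut_sine a n))"
  define e where "e n x = ?c2 n x + (pi / a)\<^sup>2 * ?c n x" for n x
  have se: "smooth_real (e n)" for n
    unfolding e_def[abs_def] by (intro smooth_real_add smooth_real_mult smooth_real_const smooth_real_deriv smooth_real_cut_sine)
  obtain K where K: "K \<ge> 0" "\<And>n x. real n \<ge> 2 / a \<Longrightarrow> 0 < x \<Longrightarrow> x < a \<Longrightarrow>
    \<bar>e n x\<bar> \<le> K * real n * (if x < 2 / real n \<or> a - x < 2 / real n then 1 else 0)"
    using cut_sine_defect[OF a] unfolding e_def by blast
  obtain R where R: "R \<ge> 0" "\<And>x. \<bar>r x\<bar> \<le> R" using test_real_bounded[OF r] by blast
  obtain c' d' where cd: "\<And>x. x \<notin> {c'..d'} \<Longrightarrow> r x = 0" using r by (auto simp: test_real_def)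
  \<comment> \<open>The support of r lies below d, so the wall layers that count have finite volume;
    the maximum with 1 keeps d positive.\<close>
  define d where "d = max d' 1"
  have d: "d > 0" "\<And>x. x > d \<Longrightarrow> r x = 0" using cd by (auto simp: d_def)
  define E1 where "E1 n = tensor (e n) (?c n) r" for n
  define E2 where "E2 n = tensor (?c n) (e n) r" for n
  have sr: "smooth_real r" by (rule test_real_smooth[OF r])
  have m: "E1 n \<in> borel_measurable (dom_measure a)" "E2 n \<in> borel_measurable (dom_measure a)" for n
    unfolding E1_def E2_def by (intro borel_measurable_dom tensor_measurable se sr smooth_real_cut_sine)+
  have bd: "\<bar>p * q * r z\<bar> \<le> K * R * real n * (if A \<and> z \<le> d then 1 else 0)"
    if "\<bar>p\<bar> \<le> K * real n * (if A then 1 else 0)" "\<bar>q\<bar> \<le> 1" for p q z n A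
  proof (cases "A \<and> z \<le> d")
    case True
    then have "\<bar>p\<bar> * \<bar>q\<bar> * \<bar>r z\<bar> \<le> (K * real n) * 1 * R"
      using that R K by (intro mult_mono) auto
    then show ?thesis using True by (simp add: abs_mult mult_ac)
  next
    case False
    then have "p = 0 \<or> r z = 0" using that(1) d(2)[of z] by auto
    then show ?thesis using K R by auto
  qed
  have ind: "indicator {x. side a i l x \<and> x$3 \<le> d} x = (if (x$i < l \<or> a - x$i < l) \<and> x$3 \<le> d then 1 else 0 :: real)" for i l x
    by (simp add: side_def indicator_def)
  have b1: "\<bar>E1 n x\<bar> \<le> K * R * real n * indicator {x. side a 1 (2 / real n) x \<and> x$3 \<le> d} x"
    if "real n \<ge> 2 / a" "x \<in> domain a" for n x
  proof -
    have x: "0 < x$1" "x$1 < a" using that(2) by (auto simp: domain_def)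
    show ?thesis unfolding E1_def tensor_def ind
      by (rule bd[OF K(2)[OF that(1) x] abs_cut_sine_le])
  qed
  have b2: "\<bar>E2 n x\<bar> \<le> K * R * real n * indicator {x. side a 2 (2 / real n) x \<and> x$3 \<le> d} x"
    if "real n \<ge> 2 / a" "x \<in> domain a" for n x
  proof -
    have x: "0 < x$2" "x$2 < a" using that(2) by (auto simp: domain_def)
    show ?thesis unfolding E2_def tensor_def ind mult.commute[of "?c n (x$1)"]
      by (rule bd[OF K(2)[OF that(1) x] abs_cut_sine_le])
  qed
  have KR: "K * R \<ge> 0" using K(1) R(1) by simp
  have l1: "(\<lambda>n. LINT x|dom_measure a. f x * E1 n x) \<longlonglongrightarrow> 0"
    by (rule side_layer_tendsto_0[OF v a _ d(1) L2_measurable[OF f] m(1) b1 KR]) auto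
  have l2: "(\<lambda>n. LINT x|dom_measure a. f x * E2 n x) \<longlonglongrightarrow> 0"
    by (rule side_layer_tendsto_0[OF v a _ d(1) L2_measurable[OF f] m(2) b2 KR]) auto
  have "(\<lambda>n. (LINT x|dom_measure a. f x * E1 n x) + (LINT x|dom_measure a. f x * E2 n x)) \<longlonglongrightarrow> 0 + 0"
    by (intro tendsto_add l1 l2)
  moreover have "eventually (\<lambda>n. (LINT x|dom_measure a. f x * E1 n x) + (LINT x|dom_measure a. f x * E2 n x)
    = (LINT x|dom_measure a. f x * tensor (?c2 n) (?c n) r x)
     + (LINT x|dom_measure a. f x * tensor (?c n) (?c2 n) r x)
     + 2 * (pi / a)\<^sup>2 * (LINT x|dom_measure a. f x * tensor (?c n) (?c n) r x)) sequentially"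
  proof (rule eventually_sequentiallyI[of 1])
    fix n :: nat assume "1 \<le> n"
    then have n: "n > 0" by simp
    note t = test_real_cut_sine[OF n, of a] test_real_deriv[OF test_real_deriv[OF test_real_cut_sine[OF n, of a]]]
    note loc = L2_locally_integrable[OF f]
    note i = integrable_tensor_mult[OF loc t(2) t(1) r] integrable_tensor_mult[OF loc t(1) t(2) r] integrable_tensor_mult[OF loc t(1) t(1) r]
    have "f x * E1 n x = f x * tensor (?c2 n) (?c n) r x + (pi / a)\<^sup>2 * (f x * tensor (?c n) (?c n) r x)"
      "f x * E2 n x = f x * tensor (?c n) (?c2 n) r x + (pi / a)\<^sup>2 * (f x * tensor (?c n) (?c n) r x)" for x
      by (simp_all add: E1_def E2_def e_def tensor_def algebra_simps)
    then show "(LINT x|dom_measure a. f x * E1 n x) + (LINT x|dom_measure a. f x * E2 n x)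
    = (LINT x|dom_measure a. f x * tensor (?c2 n) (?c n) r x)
     + (LINT x|dom_measure a. f x * tensor (?c n) (?c2 n) r x)
     + 2 * (pi / a)\<^sup>2 * (LINT x|dom_measure a. f x * tensor (?c n) (?c n) r x)"
      using i by simp
  qed
  ultimately show ?thesis
    using Lim_transform_eventually by fastforce
qed

section \<open>The coupled system\<close>

lemma test_real_vanishes_above:
  assumes "test_real S r" obtains d where "d > 0" "\<And>x. x \<ge> d \<Longrightarrow> r x = 0"
proof -
  obtain c d where cd: "\<And>x. x \<notin> {c..d} \<Longrightarrow> r x = 0" using assms by (auto simp: test_real_def)
  show ?thesis
  proof (rule that[of "max d 0 + 1"])
    fix x assume "x \<ge> max d 0 + 1"
    then show "r x = 0" by (intro cd) auto
  qed simp
qed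

text \<open>For n > 0 the support lies in [1/n, 2 n], and the value is 1 on [2/n, n] when that
  interval is nonempty. The lower edge is steep and produces the boundary term at the bottom; the
  upper edge is spread over a length n, so that its derivative is only O(1/n).\<close>

definition tail_cutoff :: "nat \<Rightarrow> real \<Rightarrow> real" where
  "tail_cutoff n z = step (real n * z) * (1 - step (z / real n))"

lemma tail_cutoff_smooth: "smooth_real (tail_cutoff n)"
proof -
  have "smooth_real (\<lambda>z. step (real n * z + 0) * (1 - step ((1 / real n) * z + 0)))"
    by (intro smooth_real_mult smooth_real_diff smooth_real_const smooth_real_affine smooth_real_step)
  then show ?thesis by (simp add: tail_cutoff_def[abs_def])
qed

lemma tail_cutoff_bounds: "0 \<le> tail_cutoff n z" "tail_cutoff n z \<le> 1"
  using step_nonneg[of "real n * z"] step_le_1[of "real n * z"] step_nonneg[of "z / real n"] step_le_1[of "z / real n"]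
  by (auto simp: tail_cutoff_def intro!: mult_le_one)

lemma tail_cutoff_test: "n > 0 \<Longrightarrow> test_real {0<..} (tail_cutoff n)"
proof -
  assume n: "n > 0"
  have "tail_cutoff n z = 0" if "z \<notin> {1 / real n..2 * real n}" for z
  proof -
    have "real n * z \<le> 1 \<or> z / real n \<ge> 2" using that n by (auto simp: field_simps not_le)
    then show ?thesis by (auto simp: tail_cutoff_def step_eq_0 step_eq_1)
  qed
  moreover have "{1 / real n..2 * real n} \<subseteq> {0<..}"
  proof
    fix z assume z: "z \<in> {1 / real n..2 * real n}"
    have "1 / real n > 0" using n by simp
    then show "z \<in> {0<..}" using z unfolding atLeastAtMost_iff greaterThan_iff by linarith
  qed
  ultimately show ?thesis using tail_cutoff_smooth unfolding test_real_def by blast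
qed

lemma tail_cutoff_tendsto: "0 < z \<Longrightarrow> (\<lambda>n. tail_cutoff n z) \<longlonglongrightarrow> 1"
proof -
  assume z: "0 < z"
  obtain N where N: "real N \<ge> max (2 / z) z" using real_arch_simple by blast
  have "tail_cutoff n z = 1" if "n \<ge> N + 1" for n
  proof -
    have n: "real n \<ge> 2 / z" "real n \<ge> z" "real n > 0" using N that by (auto intro: order_trans)
    then have "real n * z \<ge> 2" "z / real n \<le> 1" using z by (auto simp: field_simps)
    then show ?thesis by (simp add: tail_cutoff_def step_eq_1 step_eq_0)
  qed
  then show ?thesis by (intro tendsto_eventually eventually_sequentiallyI[of "N + 1"])
qed

lemma tail_cutoff_deriv_bound:
  obtains C where "C \<ge> 0" "\<And>n z. n > 0 \<Longrightarrow> 0 < z \<Longrightarrow> \<bar>deriv (tail_cutoff n) z\<bar> \<le> C * real n * (if z < 2 / real n then 1 else 0) + C / real n"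
proof -
  obtain C where C: "C \<ge> 0" "\<And>x. \<bar>deriv step x\<bar> \<le> C" using bounded_derivs_step by blast
  have "\<bar>deriv (tail_cutoff n) z\<bar> \<le> C * real n * (if z < 2 / real n then 1 else 0) + C / real n" if n: "n > 0" and z: "0 < z" for n z
  proof -
    let ?N = "real n"
    have N: "?N > 0" using n by simp
    have sd: "smooth_real (\<lambda>z. 1 - step ((1 / ?N) * z + 0))" "smooth_real (\<lambda>z. step (?N * z + 0))"
      by (intro smooth_real_diff smooth_real_const smooth_real_affine smooth_real_step)+
    have eq: "tail_cutoff n = (\<lambda>z. step (?N * z + 0) * (1 - step ((1 / ?N) * z + 0)))"
      by (simp add: tail_cutoff_def[abs_def])
    have d1: "deriv (\<lambda>z. 1 - step ((1 / ?N) * z + 0)) z = - ((1 / ?N) * deriv step (z / ?N))"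
    proof (rule DERIV_imp_deriv)
      have "((\<lambda>z. step ((1 / ?N) * z + 0)) has_real_derivative (1 / ?N) * deriv step ((1 / ?N) * z + 0)) (at z)"
        using smooth_real_deriv(2)[OF smooth_real_affine[OF smooth_real_step, of "1 / ?N" 0], of z]
        unfolding deriv_affine_smooth[OF smooth_real_step] .
      from DERIV_diff[OF DERIV_const[of 1] this]
      show "((\<lambda>z. 1 - step ((1 / ?N) * z + 0)) has_real_derivative - ((1 / ?N) * deriv step (z / ?N))) (at z)" by simp
    qed
    have d: "deriv (tail_cutoff n) z = ?N * deriv step (?N * z) * (1 - step (z / ?N)) + step (?N * z) * (- ((1 / ?N) * deriv step (z / ?N)))"
      unfolding eq deriv_mult_smooth[OF sd(2,1)] d1 deriv_affine_smooth[OF smooth_real_step] by simp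
    have 1: "\<bar>?N * deriv step (?N * z) * (1 - step (z / ?N))\<bar> \<le> C * ?N * (if z < 2 / ?N then 1 else 0)"
    proof (cases "z < 2 / ?N")
      case True
      have "\<bar>?N * deriv step (?N * z)\<bar> * \<bar>1 - step (z / ?N)\<bar> \<le> (?N * C) * 1"
        using C N step_nonneg[of "z / ?N"] step_le_1[of "z / ?N"] by (intro mult_mono) (auto simp: abs_mult)
      then show ?thesis using True by (simp add: abs_mult mult_ac)
    next
      case False
      then have "?N * z \<ge> 2" using N by (simp add: field_simps)
      then show ?thesis using deriv_step_zero[of "?N * z"] False by simp
    qed
    have "\<bar>step (?N * z)\<bar> * \<bar>(1 / ?N) * deriv step (z / ?N)\<bar> \<le> 1 * ((1 / ?N) * C)"
      using C N step_nonneg[of "?N * z"] step_le_1[of "?N * z"] by (intro mult_mono) (auto simp: abs_mult divide_right_mono)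
    then have 2: "\<bar>step (?N * z) * (- ((1 / ?N) * deriv step (z / ?N)))\<bar> \<le> C / ?N"
      by (simp add: abs_mult)
    show ?thesis unfolding d using 1 2 by linarith
  qed
  with C(1) that show ?thesis by blast
qed

text \<open>The hypothesis \<open>evol\<close> is the second equation with both derivatives of the
  Laplacian moved to a product test function. The boundary data enter through \<open>side\<close>,
  the Robin condition \<open>bottom\<close>, and the smallness \<open>u0\<close> of the initial u
  near the bottom, the only information on u at the boundary.\<close>

locale coupled_flow = flow +
  fixes \<psi> \<psi>' :: "real \<Rightarrow> real^3 \<Rightarrow> real" and \<alpha> \<beta> :: real
  assumes \<psi>: "L2_C1 a T \<psi> \<psi>'"
    and \<psi>_weak: "t \<in> {0..<T} \<Longrightarrow> weak_dz a (\<psi> t) (p t)"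
    and evol: "\<lbrakk>t \<in> {0..<T}; test_real {0<..<a} f; test_real {0<..<a} h; test_real {0<..} r\<rbrakk> \<Longrightarrow>
      (LINT x|dom_measure a. \<psi>' t x * tensor (deriv (deriv f)) h r x)
      + (LINT x|dom_measure a. \<psi>' t x * tensor f (deriv (deriv h)) r x)
      + (LINT x|dom_measure a. \<psi>' t x * tensor f h (deriv (deriv r)) x)
      = (LINT x|dom_measure a. (u t x)\<^sup>2 * tensor f h (deriv r) x)"
    and side: "t \<in> {0..<T} \<Longrightarrow> vanishes_on (domain a) (frontier (domain a) - bottom a) (\<psi> t)"
    and bottom: "t \<in> {0..<T} \<Longrightarrow> vanishes_on (domain a) (bottom a) (\<lambda>x. p t x + \<beta> * \<psi> t x)"
    and u0: "\<kappa> > 0 \<Longrightarrow> \<exists>e>0. AE x in dom_measure a. x$3 < e \<longrightarrow> \<bar>u 0 x\<bar> < \<kappa>"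
    and \<alpha>\<beta>: "\<alpha> * \<beta> = 2 * (pi / a)\<^sup>2" "\<alpha> > 0"
begin

lemma \<psi>_L2: "t \<in> {0..<T} \<Longrightarrow> \<psi> t \<in> L2 (domain a)"
  by (rule L2_C1D(1)[OF \<psi>])

abbreviation S :: "(real \<Rightarrow> real) \<Rightarrow> real^3 \<Rightarrow> real" where
  "S \<equiv> tensor (sine a) (sine a)"

lemma column_test_integrable:
  assumes "f \<in> L2 (domain a)" "test_real {0<..} r"
  shows "integrable (dom_measure a) (\<lambda>x. f x * r (x$3))"
proof -
  obtain R where R: "R \<ge> 0" "\<And>x. \<bar>r x\<bar> \<le> R" using test_real_bounded[OF assms(2)] by blast
  obtain d where d: "d > 0" "\<And>x. x \<ge> d \<Longrightarrow> r x = 0" using test_real_vanishes_above[OF assms(2)] by blast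
  have "(\<lambda>x::real^3. 1 * 1 * r (x$3)) \<in> borel_measurable borel"
    using tensor_measurable[OF smooth_real_const[of 1] smooth_real_const[of 1] test_real_smooth[OF assms(2)]]
    by (simp add: tensor_def[abs_def])
  then have rm: "(\<lambda>x::real^3. r (x$3)) \<in> borel_measurable (dom_measure a)" by (intro borel_measurable_dom) simp
  have "integrable (dom_measure a) (\<lambda>x. R * (slab d x * f x))"
    by (intro integrable_mult_right slab_mult_integrable[OF a d(1) assms(1)])
  then show ?thesis
  proof (rule Bochner_Integration.integrable_bound)
    show "(\<lambda>x. f x * r (x$3)) \<in> borel_measurable (dom_measure a)"
      by (rule borel_measurable_times[OF L2_measurable[OF assms(1)] rm])
    show "AE x in dom_measure a. norm (f x * r (x$3)) \<le> norm (R * (slab d x * f x))"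
    proof (rule AE_I2)
      fix x show "norm (f x * r (x$3)) \<le> norm (R * (slab d x * f x))"
        using R(2)[of "x$3"] R(1) d(2)[of "x$3"]
        by (auto simp: indicator_def abs_mult mult.commute[of "\<bar>f x\<bar>"] intro!: mult_right_mono)
    qed
  qed
qed

lemma u_square_column_integrable:
  assumes t: "t \<in> {0..<T}" and r: "smooth_real r" "\<And>z. \<bar>r z\<bar> \<le> R"
  shows "integrable (dom_measure a) (\<lambda>x. (u t x)\<^sup>2 * r (x$3))"
proof (rule Bochner_Integration.integrable_bound)
  have "(\<lambda>x::real^3. 1 * 1 * r (x$3)) \<in> borel_measurable borel"
    using tensor_measurable[OF smooth_real_const[of 1] smooth_real_const[of 1] r(1)]
    by (simp add: tensor_def[abs_def])
  then have rm: "(\<lambda>x::real^3. r (x$3)) \<in> borel_measurable (dom_measure a)" by (intro borel_measurable_dom) simp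
  show "integrable (dom_measure a) (\<lambda>x. R * (u t x)\<^sup>2)" by (intro integrable_mult_right L2_square u_L2 t)
  show "(\<lambda>x. (u t x)\<^sup>2 * r (x$3)) \<in> borel_measurable (dom_measure a)"
    by (rule borel_measurable_times[OF borel_measurable_power[OF L2_measurable[OF u_L2[OF t]]] rm])
  show "AE x in dom_measure a. norm ((u t x)\<^sup>2 * r (x$3)) \<le> norm (R * (u t x)\<^sup>2)"
  proof (rule AE_I2)
    fix x
    have "\<bar>r (x$3)\<bar> * (u t x)\<^sup>2 \<le> \<bar>R\<bar> * (u t x)\<^sup>2" using r(2)[of "x$3"] by (intro mult_right_mono) auto
    then show "norm ((u t x)\<^sup>2 * r (x$3)) \<le> norm (R * (u t x)\<^sup>2)" by (simp add: abs_mult mult.commute)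
  qed
qed

text \<open>Only the vertical factor is differentiated, so the horizontal cut-offs can be removed by
  dominated convergence without any condition at the side walls.\<close>

lemma weak_dz_sine:
  assumes "f \<in> L2 (domain a)" "g' \<in> L2 (domain a)" "weak_dz a f g'" "test_real {0<..} r"
  shows "(LINT x|dom_measure a. f x * S (deriv r) x) = - (LINT x|dom_measure a. g' x * S r x)"
proof (rule LIMSEQ_unique)
  show "(\<lambda>n. LINT x|dom_measure a. f x * tensor (cut_sine a n) (cut_sine a n) (deriv r) x) \<longlonglongrightarrow>
    (LINT x|dom_measure a. f x * S (deriv r) x)"
    by (intro integral_cut_sine_tendsto column_test_integrable assms test_real_deriv)
  have "(\<lambda>n. - (LINT x|dom_measure a. g' x * tensor (cut_sine a n) (cut_sine a n) r x)) \<longlonglongrightarrow>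
    - (LINT x|dom_measure a. g' x * S r x)"
    by (intro tendsto_minus integral_cut_sine_tendsto column_test_integrable assms)
  moreover have "\<forall>\<^sub>F n in sequentially. - (LINT x|dom_measure a. g' x * tensor (cut_sine a n) (cut_sine a n) r x)
     = (LINT x|dom_measure a. f x * tensor (cut_sine a n) (cut_sine a n) (deriv r) x)"
    by (rule eventually_sequentiallyI[of 1]) (use assms(3,4) test_real_cut_sine in \<open>simp add: weak_dz_def\<close>)
  ultimately show "(\<lambda>n. LINT x|dom_measure a. f x * tensor (cut_sine a n) (cut_sine a n) (deriv r) x) \<longlonglongrightarrow>
    - (LINT x|dom_measure a. g' x * S r x)"
    by (rule Lim_transform_eventually)
qed

text \<open>The integral of \<psi> against the Laplacian of sine sine r, in weak form: the
  horizontal part contributes the eigenvalue - \<alpha> \<beta>, and one vertical derivative is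
  moved back to \<psi>, where it becomes p.\<close>

definition pairing :: "real \<Rightarrow> (real \<Rightarrow> real) \<Rightarrow> real" where
  "pairing t r = - (\<alpha> * \<beta>) * (LINT x|dom_measure a. \<psi> t x * S r x) - (LINT x|dom_measure a. p t x * S (deriv r) x)"

text \<open>The lateral boundary condition is available for \<psi> and not for \<psi>', so the
  tested equation is integrated in time while the horizontal cut-offs are present, and they are
  removed only afterwards. Dominated convergence in time handles the u^2 side.\<close>

lemma pairing_evolution:
  assumes t: "t \<in> {0..<T}" and r: "test_real {0<..} r"
  shows "((\<lambda>s. LINT x|dom_measure a. (u s x)\<^sup>2 * S (deriv r) x) has_integral pairing t r - pairing 0 r) {0..t}"
proof -
  have t0: "0 \<le> t" "t < T" and T0: "0 \<in> {0..<T}" using t by auto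
  let ?c = "cut_sine a"
  define L where "L n s = (LINT x|dom_measure a. \<psi> s x * tensor (deriv (deriv (?c n))) (?c n) r x)
     + (LINT x|dom_measure a. \<psi> s x * tensor (?c n) (deriv (deriv (?c n))) r x)
     + (LINT x|dom_measure a. \<psi> s x * tensor (?c n) (?c n) (deriv (deriv r)) x)" for n s
  define k where "k n s = (LINT x|dom_measure a. (u s x)\<^sup>2 * tensor (?c n) (?c n) (deriv r) x)" for n s
  obtain R where R: "R \<ge> 0" "\<And>x. \<bar>deriv r x\<bar> \<le> R" using test_real_bounded[OF test_real_deriv[OF r]] by blast
  have sr: "smooth_real (deriv r)" by (rule test_real_smooth[OF test_real_deriv[OF r]])
  have TL2: "tensor f h q \<in> L2 (domain a)" if tf: "test_real {0<..<a} f" and th: "test_real {0<..<a} h" and tq: "test_real {0<..} q" for f h q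
  proof -
    obtain A B D where b: "A \<ge> 0" "B \<ge> 0" "D \<ge> 0" "\<forall>x. \<bar>f x\<bar> \<le> A" "\<forall>x. \<bar>h x\<bar> \<le> B" "\<forall>x. \<bar>q x\<bar> \<le> D"
      using test_real_bounded[OF tf] test_real_bounded[OF th] test_real_bounded[OF tq] by blast
    obtain d where d: "d > 0" "\<And>x. x \<ge> d \<Longrightarrow> q x = 0" using test_real_vanishes_above[OF tq] by blast
    have eq: "tensor f h q x = tensor f h q x * slab d x" for x
      using d(2)[of "x$3"] by (auto simp: tensor_def indicator_def)
    have "(\<lambda>x. tensor f h q x * slab d x) \<in> L2 (domain a)"
    proof (rule L2_bounded_mult(1)[OF slab_L2(1)[OF a d(1)]])
      show "tensor f h q \<in> borel_measurable (dom_measure a)"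
        by (intro borel_measurable_dom tensor_measurable test_real_smooth[OF tf] test_real_smooth[OF th] test_real_smooth[OF tq])
      show "\<bar>tensor f h q x\<bar> \<le> A * B * D" for x
        using b by (auto simp: tensor_def abs_mult intro!: mult_mono)
    qed
    then show ?thesis using eq by (simp add: fun_eq_iff[symmetric])
  qed
  have FTC: "(k n has_integral L n t - L n 0) {0..t}" if n: "n > 0" for n
  proof (rule fundamental_theorem_of_calculus[OF t0(1)])
    fix s assume s: "s \<in> {0..t}"
    then have s': "s \<in> {0..<T}" using t0 by auto
    note tc = test_real_cut_sine[OF n, of a]
    note tc2 = test_real_deriv[OF test_real_deriv[OF tc]] and tr2 = test_real_deriv[OF test_real_deriv[OF r]]
    have "(L n has_real_derivative (LINT x|dom_measure a. \<psi>' s x * tensor (deriv (deriv (?c n))) (?c n) r x)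
      + (LINT x|dom_measure a. \<psi>' s x * tensor (?c n) (deriv (deriv (?c n))) r x)
      + (LINT x|dom_measure a. \<psi>' s x * tensor (?c n) (?c n) (deriv (deriv r)) x)) (at s within {0..<T})"
      unfolding L_def[abs_def]
      by (intro DERIV_add has_derivative_integral_mult[OF \<psi> s'] TL2 tc tc2 tr2 r)
    then have "(L n has_real_derivative k n s) (at s within {0..<T})"
      unfolding evol[OF s' tc tc r] k_def .
    then have "(L n has_real_derivative k n s) (at s within {0..t})"
      by (rule DERIV_subset) (use t0 in auto)
    then show "(L n has_vector_derivative k n s) (at s within {0..t})"
      by (simp add: has_real_derivative_iff_has_vector_derivative)
  qed
  have Llim: "(\<lambda>n. L n s) \<longlonglongrightarrow> pairing s r" if s: "s \<in> {0..<T}" for s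
  proof -
    note c1 = integral_cut_sine_tendsto[OF column_test_integrable[OF \<psi>_L2[OF s] r]]
      and c2 = integral_cut_sine_tendsto[OF column_test_integrable[OF \<psi>_L2[OF s] test_real_deriv[OF test_real_deriv[OF r]]]]
    \<comment> \<open>Adding and subtracting the eigenvalue term isolates the expression that
      \<open>lateral_limit\<close> sends to 0.\<close>
    have "(\<lambda>n. ((LINT x|dom_measure a. \<psi> s x * tensor (deriv (deriv (?c n))) (?c n) r x)
     + (LINT x|dom_measure a. \<psi> s x * tensor (?c n) (deriv (deriv (?c n))) r x)
     + 2 * (pi / a)\<^sup>2 * (LINT x|dom_measure a. \<psi> s x * tensor (?c n) (?c n) r x))
     - 2 * (pi / a)\<^sup>2 * (LINT x|dom_measure a. \<psi> s x * tensor (?c n) (?c n) r x)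
     + (LINT x|dom_measure a. \<psi> s x * tensor (?c n) (?c n) (deriv (deriv r)) x))
     \<longlonglongrightarrow> 0 - 2 * (pi / a)\<^sup>2 * (LINT x|dom_measure a. \<psi> s x * S r x) + (LINT x|dom_measure a. \<psi> s x * S (deriv (deriv r)) x)"
      by (intro tendsto_add tendsto_diff tendsto_mult tendsto_const lateral_limit[OF a \<psi>_L2[OF s] side[OF s] r] c1 c2)
    moreover have "(LINT x|dom_measure a. \<psi> s x * S (deriv (deriv r)) x) = - (LINT x|dom_measure a. p s x * S (deriv r) x)"
      by (rule weak_dz_sine[OF \<psi>_L2[OF s] p_L2[OF s] \<psi>_weak[OF s] test_real_deriv[OF r]])
    then have "pairing s r = 0 - 2 * (pi / a)\<^sup>2 * (LINT x|dom_measure a. \<psi> s x * S r x) + (LINT x|dom_measure a. \<psi> s x * S (deriv (deriv r)) x)"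
      by (simp add: pairing_def \<alpha>\<beta>(1))
    ultimately show ?thesis by (simp only: L_def add_diff_cancel_right')
  qed
  obtain K where K: "0 \<le> K" "\<And>s. s \<in> {0..t} \<Longrightarrow> sq_int a (u s) \<le> K" using L2_cont_bounded[OF u_cont t0(2)] by blast
  have kB: "norm (k n s) \<le> R * K" if s: "s \<in> {0..t}" for n s
  proof -
    have s': "s \<in> {0..<T}" using s t0 by auto
    have u2: "integrable (dom_measure a) (\<lambda>x. R * (u s x)\<^sup>2)" by (intro integrable_mult_right L2_square u_L2 s')
    have le: "\<bar>(u s x)\<^sup>2 * tensor (?c n) (?c n) (deriv r) x\<bar> \<le> R * (u s x)\<^sup>2" for x
    proof -
      have "\<bar>?c n (x$1)\<bar> * \<bar>?c n (x$2)\<bar> * \<bar>deriv r (x$3)\<bar> \<le> 1 * R"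
        using R by (intro mult_mono mult_le_one abs_cut_sine_le) auto
      then have "\<bar>tensor (?c n) (?c n) (deriv r) x\<bar> \<le> R" by (simp add: tensor_def abs_mult)
      then have "\<bar>tensor (?c n) (?c n) (deriv r) x\<bar> * (u s x)\<^sup>2 \<le> R * (u s x)\<^sup>2" by (intro mult_right_mono) auto
      then show ?thesis by (simp add: abs_mult mult.commute)
    qed
    have "norm (k n s) \<le> (LINT x|dom_measure a. R * (u s x)\<^sup>2)"
      unfolding k_def real_norm_def
    proof (rule integral_abs_bound_integral[OF _ u2 le])
      have m: "tensor (?c n) (?c n) (deriv r) \<in> borel_measurable (dom_measure a)"
        by (intro borel_measurable_dom tensor_measurable smooth_real_cut_sine sr)
      show "integrable (dom_measure a) (\<lambda>x. (u s x)\<^sup>2 * tensor (?c n) (?c n) (deriv r) x)"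
        by (rule Bochner_Integration.integrable_bound[OF u2 borel_measurable_times[OF borel_measurable_power[OF L2_measurable[OF u_L2[OF s']]] m]])
          (use le R in auto)
    qed
    also have "\<dots> \<le> R * K" using K(2)[OF s] R(1) by (simp add: sq_int_def mult_left_mono)
    finally show ?thesis .
  qed
  have klim: "(\<lambda>n. k (Suc n) s) \<longlonglongrightarrow> (LINT x|dom_measure a. (u s x)\<^sup>2 * S (deriv r) x)" if s: "s \<in> {0..t}" for s
  proof -
    have s': "s \<in> {0..<T}" using s t0 by auto
    show ?thesis
      unfolding k_def using LIMSEQ_Suc[OF integral_cut_sine_tendsto[OF u_square_column_integrable[OF s' sr R(2)]]] .
  qed
  have ki: "k (Suc n) integrable_on {0..t}" for n using FTC[of "Suc n"] by blast
  note dc = dominated_convergence[OF ki, of "\<lambda>_. R * K", OF _ kB klim]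
  have "(\<lambda>n. integral {0..t} (k (Suc n))) \<longlonglongrightarrow> integral {0..t} (\<lambda>s. LINT x|dom_measure a. (u s x)\<^sup>2 * S (deriv r) x)"
    by (rule dc(2)) auto
  moreover have "integral {0..t} (k (Suc n)) = L (Suc n) t - L (Suc n) 0" for n
    using FTC[of "Suc n"] by (simp add: integral_unique)
  ultimately have "(\<lambda>n. L (Suc n) t - L (Suc n) 0) \<longlonglongrightarrow> integral {0..t} (\<lambda>s. LINT x|dom_measure a. (u s x)\<^sup>2 * S (deriv r) x)"
    by simp
  moreover have "(\<lambda>n. L (Suc n) t - L (Suc n) 0) \<longlonglongrightarrow> pairing t r - pairing 0 r"
    by (intro tendsto_diff LIMSEQ_Suc Llim t T0)
  ultimately have eq: "integral {0..t} (\<lambda>s. LINT x|dom_measure a. (u s x)\<^sup>2 * S (deriv r) x) = pairing t r - pairing 0 r"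
    by (rule LIMSEQ_unique)
  have "(\<lambda>s. LINT x|dom_measure a. (u s x)\<^sup>2 * S (deriv r) x) integrable_on {0..t}"
    by (rule dc(1)) auto
  from integrable_integral[OF this] show ?thesis unfolding eq .
qed

end

section \<open>The weight and its total mass\<close>

lemma integral_exp_half_line:
  assumes "\<gamma> > 0"
  shows "integrable lborel (\<lambda>z::real. indicator {0..} z * exp (- \<gamma> * z))"
    and "(LINT z|lborel. indicator {0..} z * exp (- \<gamma> * z)) = 1 / \<gamma>"
proof -
  have "((\<lambda>z. - exp (- \<gamma> * z) / \<gamma>) \<longlongrightarrow> - 0 / \<gamma>) at_top"
    using assms by (intro tendsto_intros filterlim_compose[OF exp_at_bot] filterlim_tendsto_neg_mult_at_bot[OF tendsto_const _ filterlim_ident]) auto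
  then have lim: "((\<lambda>z. - exp (- \<gamma> * z) / \<gamma>) \<longlongrightarrow> 0) at_top" by simp
  have "(\<integral>\<^sup>+z. ennreal (exp (- \<gamma> * z)) * indicator {0..} z \<partial>lborel) = ennreal (0 - (- exp (- \<gamma> * 0) / \<gamma>))"
    by (rule nn_integral_FTC_atLeast[OF _ _ _ lim]) (use assms in \<open>auto intro!: derivative_eq_intros\<close>)
  moreover have "ennreal (exp (- \<gamma> * z)) * indicator {0..} z = ennreal (indicator {0..} z * exp (- \<gamma> * z))" for z
    by (simp add: indicator_def)
  ultimately have "(\<integral>\<^sup>+z. ennreal (indicator {0..} z * exp (- \<gamma> * z)) \<partial>lborel) = ennreal (1 / \<gamma>)" by simp
  then have "has_bochner_integral lborel (\<lambda>z. indicator {0..} z * exp (- \<gamma> * z)) (1 / \<gamma>)"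
    using assms by (intro has_bochner_integral_nn_integral) auto
  then show "integrable lborel (\<lambda>z::real. indicator {0..} z * exp (- \<gamma> * z))"
    "(LINT z|lborel. indicator {0..} z * exp (- \<gamma> * z)) = 1 / \<gamma>"
    by (auto simp: has_bochner_integral_iff)
qed

lemma integral_sine_interval:
  assumes a: "a > 0"
  shows "integrable lborel (\<lambda>x. indicator {0..a} x * sine a x)"
    and "(LINT x|lborel. indicator {0..a} x * sine a x) = 2 * a / pi"
proof -
  have d: "((\<lambda>x. - cos (pi / a * x) * (a / pi)) has_real_derivative sine a x) (at x)" for x
    unfolding sine_def using a by (auto intro!: derivative_eq_intros)
  have c: "isCont (sine a) x" for x
    using smooth_real_deriv(2)[OF smooth_real_sine] by (rule DERIV_isCont)
  have "has_bochner_integral lborel (\<lambda>x. sine a x * indicator {0..a} x) (- cos (pi / a * a) * (a / pi) - (- cos (pi / a * 0) * (a / pi)))"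
    by (rule has_bochner_integral_FTC_Icc_real) (use a d c in auto)
  then show "integrable lborel (\<lambda>x. indicator {0..a} x * sine a x)"
    "(LINT x|lborel. indicator {0..a} x * sine a x) = 2 * a / pi"
    using a by (auto simp: has_bochner_integral_iff mult.commute)
qed

lemma sine_pos: "0 < x \<Longrightarrow> x < a \<Longrightarrow> 0 < sine a x"
proof -
  assume x: "0 < x" "x < a"
  then have "pi * x < pi * a" by simp
  then have "0 < pi / a * x" "pi / a * x < pi" using x by (auto simp: field_simps)
  then show ?thesis unfolding sine_def by (rule sin_gt_zero)
qed

definition exp_weight :: "real \<Rightarrow> real^3 \<Rightarrow> real" where
  "exp_weight \<gamma> x = exp (- \<gamma> * x$3)"

lemma exp_weight_measurable: "exp_weight \<gamma> \<in> borel_measurable (dom_measure a)"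
  unfolding exp_weight_def[abs_def] by (intro borel_measurable_dom) measurable

lemma dom_integral_le_lborel:
  fixes f h :: "real^3 \<Rightarrow> real"
  assumes h: "integrable lborel h" and f: "f \<in> borel_measurable (dom_measure a)"
    and le: "\<And>x. x \<in> domain a \<Longrightarrow> 0 \<le> f x \<and> f x \<le> h x" "\<And>x. 0 \<le> h x"
  shows "integrable (dom_measure a) f" "(LINT x|dom_measure a. f x) \<le> (LINT x|lborel. h x)"
proof -
  have hm: "h \<in> borel_measurable borel" using h by simp
  have hl: "integrable lebesgue h" using h hm by (simp add: integrable_completion)
  have fm: "(\<lambda>x. indicator (domain a) x * f x) \<in> borel_measurable lebesgue"
    using f by (simp add: borel_measurable_restrict_space_iff)
  have i: "integrable lebesgue (\<lambda>x. indicator (domain a) x * f x)"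
  proof (rule Bochner_Integration.integrable_bound[OF hl fm], rule AE_I2)
    fix x show "norm (indicator (domain a) x * f x) \<le> norm (h x)"
      using le(1)[of x] le(2)[of x] by (cases "x \<in> domain a") auto
  qed
  then show "integrable (dom_measure a) f" by (simp add: integrable_domain_iff)
  have "(LINT x|dom_measure a. f x) \<le> (LINT x|lebesgue. h x)"
    unfolding integral_domain_eq
  proof (rule integral_mono[OF i hl])
    fix x show "indicator (domain a) x * f x \<le> h x"
      using le(1)[of x] le(2)[of x] by (cases "x \<in> domain a") auto
  qed
  then show "(LINT x|dom_measure a. f x) \<le> (LINT x|lborel. h x)"
    using hm by (simp add: integral_completion)
qed

lemma exp_weight_integrable:
  assumes a: "a > 0" and \<gamma>: "\<gamma> > 0"
  shows "integrable (dom_measure a) (exp_weight \<gamma>)" "exp_weight \<gamma> \<in> L2 (domain a)"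
proof -
  have gen: "integrable (dom_measure a) (exp_weight \<gamma>)" if "\<gamma> > 0" for \<gamma>
  proof -
    define H where "H = (indicator (box (0, 0) (a, a)) :: real \<times> real \<Rightarrow> real)"
    have H: "integrable lborel H"
      unfolding H_def using emeasure_lborel_box_finite[of "(0,0)" "(a,a)"] by (intro integrable_real_indicator) auto
    show ?thesis
    proof (rule dom_integral_le_lborel(1)[OF integral_column_mult(1)[OF H integral_exp_half_line(1)[OF that]] exp_weight_measurable])
      show "0 \<le> exp_weight \<gamma> x \<and> exp_weight \<gamma> x \<le> (indicator {0..} (x$3) * exp (- \<gamma> * x$3)) * H (x$1, x$2)" if "x \<in> domain a" for x
        using that by (auto simp: exp_weight_def H_def indicator_def domain_def box_def Basis_prod_def)
    qed (simp add: H_def)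
  qed
  show "integrable (dom_measure a) (exp_weight \<gamma>)" by (rule gen[OF \<gamma>])
  have "(exp_weight \<gamma> x)\<^sup>2 = exp_weight (2 * \<gamma>) x" for x
    by (simp add: exp_weight_def power2_eq_square exp_add[symmetric])
  then show "exp_weight \<gamma> \<in> L2 (domain a)"
    using gen[of "2 * \<gamma>"] \<gamma> by (simp add: L2_def exp_weight_measurable)
qed

context coupled_flow
begin

text \<open>The indicator makes the pointwise bounds valid on the whole space, where the sines
  change sign and the exponential is unbounded below the bottom.\<close>

definition phi :: "real^3 \<Rightarrow> real" where
  "phi x = indicator (domain a) x * S (\<lambda>z. exp (- \<alpha> * z)) x"

lemma phi_bounds: "\<bar>phi x\<bar> \<le> exp_weight \<alpha> x"
proof -
  have "\<bar>sine a (x$1)\<bar> * \<bar>sine a (x$2)\<bar> * exp (- \<alpha> * x$3) \<le> 1 * exp (- \<alpha> * x$3)"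
    by (intro mult_right_mono mult_le_one abs_sine_le) auto
  then show ?thesis by (auto simp: phi_def tensor_def abs_mult exp_weight_def indicator_def)
qed

lemma phi_pos: "x \<in> domain a \<Longrightarrow> 0 < phi x"
  using sine_pos[of "x$1" a] sine_pos[of "x$2" a] by (simp add: phi_def tensor_def domain_def)

lemma phi_measurable: "phi \<in> borel_measurable (dom_measure a)"
  unfolding phi_def[abs_def]
  by (intro borel_measurable_dom borel_measurable_times tensor_measurable smooth_real_sine smooth_real_exp
      borel_measurable_indicator domain_lebesgue)

lemma phi_integrable: "integrable (dom_measure a) phi"
  by (rule Bochner_Integration.integrable_bound[OF exp_weight_integrable(1)[OF a \<alpha>\<beta>(2)] phi_measurable])
    (use phi_bounds in \<open>auto intro!: AE_I2 order_trans[OF _ abs_ge_self]\<close>)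

lemma phi_L2: "phi \<in> L2 (domain a)"
proof -
  have "integrable (dom_measure a) (\<lambda>x. (phi x)\<^sup>2)"
  proof (rule Bochner_Integration.integrable_bound[OF L2_square[OF exp_weight_integrable(2)[OF a \<alpha>\<beta>(2)]]])
    show "AE x in dom_measure a. norm ((phi x)\<^sup>2) \<le> norm ((exp_weight \<alpha> x)\<^sup>2)"
    proof (rule AE_I2)
      fix x show "norm ((phi x)\<^sup>2) \<le> norm ((exp_weight \<alpha> x)\<^sup>2)"
        using power_mono[OF phi_bounds[of x], of 2] by simp
    qed
  qed (intro borel_measurable_power phi_measurable)
  then show ?thesis using phi_measurable by (simp add: L2_def)
qed

lemma phi_le_1: "\<bar>phi x\<bar> \<le> 1"
proof (cases "x \<in> domain a")
  case True
  then have "exp_weight \<alpha> x \<le> 1" using \<alpha>\<beta>(2) by (simp add: exp_weight_def domain_def)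
  then show ?thesis using phi_bounds[of x] by linarith
qed (simp add: phi_def)

text \<open>The constant is the product of two sine integrals 2 a / pi and the exponential integral
  1 / \<alpha>. Its reciprocal becomes the factor lost in Cauchy-Schwarz, and thus part of the
  blow-up time.\<close>

lemma integral_phi_le: "(LINT x|dom_measure a. phi x) \<le> 4 * a\<^sup>2 / (\<alpha> * pi\<^sup>2)"
proof -
  let ?s = "\<lambda>x. indicator {0..a} x * sine a x"
  have snn: "0 \<le> ?s x" for x
    using sine_pos[of x a] by (cases "x = 0 \<or> x = a") (auto simp: indicator_def sine_def less_le)
  define H where "H y = ?s (fst y) * ?s (snd y)" for y
  have nH: "norm (H (x, y)) = ?s x * ?s y" for x y
    unfolding H_def fst_conv snd_conv real_norm_def by (rule abs_of_nonneg[OF mult_nonneg_nonneg[OF snn snn]])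
  have Hi: "integrable (lborel \<Otimes>\<^sub>M lborel) H"
  proof (rule lborel_pair.Fubini_integrable)
    have sm: "?s \<in> borel_measurable borel" using integral_sine_interval(1)[OF a] by simp
    show "H \<in> borel_measurable (lborel \<Otimes>\<^sub>M lborel)"
      unfolding lborel_prod measurable_lborel2 H_def[abs_def]
      by (intro borel_measurable_times compose_fst[OF sm] compose_snd[OF sm])
    show "integrable lborel (\<lambda>x. LINT y|lborel. norm (H (x, y)))"
      unfolding nH using integral_sine_interval(1)[OF a] by simp
    show "AE x in lborel. integrable lborel (\<lambda>y. H (x, y))"
      using integral_sine_interval(1)[OF a] by (simp add: H_def)
  qed
  have HI: "(LINT y|lborel. H y) = (2 * a / pi) * (2 * a / pi)"
  proof -
    have "(LINT x|lborel. LINT y|lborel. H (x, y)) = (2 * a / pi) * (2 * a / pi)"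
      using integral_sine_interval(2)[OF a] by (simp add: H_def)
    with lborel_pair.integral_fst'[OF Hi] show ?thesis unfolding lborel_prod by (simp only:)
  qed
  have "(LINT x|dom_measure a. phi x) \<le> (LINT x|(lborel :: (real^3) measure). (indicator {0..} (x$3) * exp (- \<alpha> * x$3)) * H (x$1, x$2))"
  proof (rule dom_integral_le_lborel(2)[OF integral_column_mult(1)[OF _ integral_exp_half_line(1)[OF \<alpha>\<beta>(2)]] phi_measurable])
    show "integrable lborel H" using Hi by (simp add: lborel_prod)
    show "0 \<le> phi x \<and> phi x \<le> (indicator {0..} (x$3) * exp (- \<alpha> * x$3)) * H (x$1, x$2)" if "x \<in> domain a" for x
      using phi_pos[OF that] that by (auto simp: phi_def tensor_def H_def domain_def mult_ac)
    show "0 \<le> (indicator {0..} (x$3) * exp (- \<alpha> * x$3)) * H (x$1, x$2)" for x :: "real^3"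
      unfolding H_def fst_conv snd_conv by (rule mult_nonneg_nonneg[OF _ mult_nonneg_nonneg[OF snn snn]]) auto
  qed
  also have "\<dots> = (1 / \<alpha>) * ((2 * a / pi) * (2 * a / pi))"
    using integral_column_mult(2)[OF _ integral_exp_half_line(1)[OF \<alpha>\<beta>(2)], of H] Hi HI integral_exp_half_line(2)[OF \<alpha>\<beta>(2)]
    by (simp add: lborel_prod)
  also have "\<dots> = 4 * a\<^sup>2 / (\<alpha> * pi\<^sup>2)" by (simp add: power2_eq_square)
  finally show ?thesis .
qed

end

section \<open>Removal of the vertical cut-off\<close>

context coupled_flow
begin

definition qn :: "nat \<Rightarrow> real \<Rightarrow> real" where
  "qn n = (\<lambda>z. exp (- \<alpha> * z) * tail_cutoff n z)"

text \<open>The part of the derivative of \<open>qn n\<close> in which the cut-off is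
  differentiated; it carries the boundary terms.\<close>

definition dqn :: "nat \<Rightarrow> real \<Rightarrow> real" where
  "dqn n = (\<lambda>z. exp (- \<alpha> * z) * deriv (tail_cutoff n) z)"

lemma qn_test: "n > 0 \<Longrightarrow> test_real {0<..} (qn n)" "n > 0 \<Longrightarrow> test_real {0<..} (dqn n)"
  unfolding qn_def dqn_def
  using test_real_mult[OF tail_cutoff_test smooth_real_exp] test_real_mult[OF test_real_deriv[OF tail_cutoff_test] smooth_real_exp]
  by blast+

lemma deriv_qn: "deriv (qn n) = (\<lambda>z. - \<alpha> * qn n z + dqn n z)"
proof -
  have "deriv (\<lambda>z. exp (- \<alpha> * z)) = (\<lambda>z. - \<alpha> * exp (- \<alpha> * z))"
    by (rule ext, rule DERIV_imp_deriv) (auto intro!: derivative_eq_intros)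
  then show ?thesis
    unfolding qn_def dqn_def deriv_mult_smooth[OF smooth_real_exp tail_cutoff_smooth] by (simp only: mult.assoc)
qed

lemma S_test_integrable:
  fixes f :: "real^3 \<Rightarrow> real"
  assumes "integrable (dom_measure a) (\<lambda>x. f x * r (x$3))"
  shows "integrable (dom_measure a) (\<lambda>x. f x * S r x)"
proof (rule Bochner_Integration.integrable_bound[OF assms])
  have eq: "f x * S r x = tensor (sine a) (sine a) (\<lambda>_. 1) x * (f x * r (x$3))" for x :: "real^3"
    by (simp add: tensor_def)
  show "(\<lambda>x. f x * S r x) \<in> borel_measurable (dom_measure a)"
    unfolding eq
    by (intro borel_measurable_times[OF borel_measurable_dom[OF tensor_measurable] borel_measurable_integrable[OF assms]]
        smooth_real_sine smooth_real_const)
  show "AE x in dom_measure a. norm (f x * S r x) \<le> norm (f x * r (x$3))"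
  proof (rule AE_I2)
    fix x :: "real^3"
    have "\<bar>sine a (x$1)\<bar> * \<bar>sine a (x$2)\<bar> \<le> 1" by (intro mult_le_one abs_sine_le) auto
    then have "\<bar>sine a (x$1)\<bar> * \<bar>sine a (x$2)\<bar> * \<bar>f x * r (x$3)\<bar> \<le> 1 * \<bar>f x * r (x$3)\<bar>" by (intro mult_right_mono) auto
    then show "norm (f x * S r x) \<le> norm (f x * r (x$3))" unfolding eq by (simp add: abs_mult tensor_def)
  qed
qed

lemma S_deriv_qn: "S (deriv (qn n)) x = - \<alpha> * S (qn n) x + S (dqn n) x"
  by (simp add: deriv_qn tensor_def algebra_simps)

lemma S_split:
  assumes "f \<in> L2 (domain a)" "n > 0"
  shows "(LINT x|dom_measure a. f x * S (deriv (qn n)) x) =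
    - \<alpha> * (LINT x|dom_measure a. f x * S (qn n) x) + (LINT x|dom_measure a. f x * S (dqn n) x)"
proof -
  note i = qn_test[OF assms(2), THEN column_test_integrable[OF assms(1)], THEN S_test_integrable]
  have "(LINT x|dom_measure a. f x * S (deriv (qn n)) x) = (LINT x|dom_measure a. - \<alpha> * (f x * S (qn n) x) + f x * S (dqn n) x)"
    by (simp add: S_deriv_qn algebra_simps)
  then show ?thesis using i by simp
qed

text \<open>With \<open>r = exp (- \<alpha> z) \<chi>\<close> the terms containing \<open>\<psi>\<close> combine with those containing \<open>\<chi>'\<close> into the
  Robin expression \<open>p + \<beta> \<psi>\<close>, which is small near the bottom.\<close>

lemma pairing_qn:
  assumes t: "t \<in> {0..<T}" and n: "n > 0"
  shows "pairing t (qn n) = - (\<beta> - \<alpha>) * (LINT x|dom_measure a. p t x * S (qn n) x)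
    - (LINT x|dom_measure a. (p t x + \<beta> * \<psi> t x) * S (dqn n) x)"
proof -
  note q = qn_test[OF n]
  define P where "P = (LINT x|dom_measure a. p t x * S (qn n) x)"
  define P' where "P' = (LINT x|dom_measure a. p t x * S (dqn n) x)"
  define R where "R = (LINT x|dom_measure a. \<psi> t x * S (qn n) x)"
  define R' where "R' = (LINT x|dom_measure a. \<psi> t x * S (dqn n) x)"
  \<comment> \<open>Testing the relation between \<psi> and its z-derivative p with
    \<open>qn n\<close> expresses R by P and R', so that \<psi> remains only in the layer
    term.\<close>
  have "- \<alpha> * R + R' = - P"
    using weak_dz_sine[OF \<psi>_L2[OF t] p_L2[OF t] \<psi>_weak[OF t] q(1)] S_split[OF \<psi>_L2[OF t] n]
    by (simp add: R_def R'_def P_def)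
  then have "\<alpha> * R = R' + P" by simp
  then have "\<beta> * (\<alpha> * R) = \<beta> * (R' + P)" by (rule arg_cong)
  then have aR: "\<alpha> * \<beta> * R = \<beta> * R' + \<beta> * P" by (simp only: distrib_left mult_ac)
  have "(LINT x|dom_measure a. (p t x + \<beta> * \<psi> t x) * S (dqn n) x) = P' + \<beta> * R'"
    using column_test_integrable[OF p_L2[OF t] q(2), THEN S_test_integrable] column_test_integrable[OF \<psi>_L2[OF t] q(2), THEN S_test_integrable]
    by (simp add: P'_def R'_def distrib_right mult.assoc)
  moreover have "pairing t (qn n) = - (\<alpha> * \<beta> * R) - (- \<alpha> * P + P')"
    unfolding pairing_def S_split[OF p_L2[OF t] n] R_def P_def P'_def by simp
  moreover have "- (\<beta> - \<alpha>) * P = \<alpha> * P - \<beta> * P" by (simp add: algebra_simps)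
  ultimately show ?thesis using aR unfolding P_def[symmetric] by linarith
qed

text \<open>The derivative of the cut-off is O(n) on the slab of height 2/n, which turns the slab
  integral into an average, and O(1/n) beyond it. The constant C serves all f and n at once, as the
  domination in time requires.\<close>

lemma layer_bound:
  obtains C where "C \<ge> 0" "\<And>f n. \<lbrakk>n > 0; integrable (dom_measure a) (\<lambda>x. f x * exp_weight \<alpha> x); integrable (dom_measure a) (\<lambda>x. slab (2 / real n) x * f x)\<rbrakk> \<Longrightarrow>
     \<bar>LINT x|dom_measure a. f x * S (dqn n) x\<bar> \<le> C * ((LINT x|dom_measure a. slab (2 / real n) x * \<bar>f x\<bar>) / (2 / real n))
       + (C / real n) * (LINT x|dom_measure a. \<bar>f x\<bar> * exp_weight \<alpha> x)"
proof -
  obtain C where C: "C \<ge> 0" "\<And>n z. n > 0 \<Longrightarrow> 0 < z \<Longrightarrow> \<bar>deriv (tail_cutoff n) z\<bar> \<le> C * real n * (if z < 2 / real n then 1 else 0) + C / real n"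
    using tail_cutoff_deriv_bound by blast
  have "\<bar>LINT x|dom_measure a. f x * S (dqn n) x\<bar> \<le> (2 * C) * ((LINT x|dom_measure a. slab (2 / real n) x * \<bar>f x\<bar>) / (2 / real n))
       + ((2 * C) / real n) * (LINT x|dom_measure a. \<bar>f x\<bar> * exp_weight \<alpha> x)"
    if n: "n > 0" and f1: "integrable (dom_measure a) (\<lambda>x. f x * exp_weight \<alpha> x)" and f2: "integrable (dom_measure a) (\<lambda>x. slab (2 / real n) x * f x)" for f n
  proof -
    have N: "real n > 0" using n by simp
    have ep: "exp_weight \<alpha> x > 0" for x by (simp add: exp_weight_def)
    have i1: "integrable (dom_measure a) (\<lambda>x. \<bar>f x\<bar> * exp_weight \<alpha> x)"
      using integrable_abs[OF f1] ep by (simp add: abs_mult less_imp_le)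
    have i2: "integrable (dom_measure a) (\<lambda>x. slab (2 / real n) x * \<bar>f x\<bar>)"
      using integrable_abs[OF f2] by (simp add: abs_mult)
    have b: "\<bar>f x * S (dqn n) x\<bar> \<le> C * real n * (slab (2 / real n) x * \<bar>f x\<bar>) + (C / real n) * (\<bar>f x\<bar> * exp_weight \<alpha> x)"
      if x: "x \<in> domain a" for x
    proof -
      have z: "0 < x$3" using x by (simp add: domain_def)
      have e1: "exp_weight \<alpha> x \<le> 1" using z \<alpha>\<beta>(2) by (simp add: exp_weight_def)
      have ss: "\<bar>sine a (x$1)\<bar> * \<bar>sine a (x$2)\<bar> \<le> 1" by (intro mult_le_one abs_sine_le) auto
      have "\<bar>S (dqn n) x\<bar> = \<bar>sine a (x$1)\<bar> * \<bar>sine a (x$2)\<bar> * (exp_weight \<alpha> x * \<bar>deriv (tail_cutoff n) (x$3)\<bar>)"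
        by (simp add: tensor_def dqn_def abs_mult exp_weight_def)
      also have "\<dots> \<le> 1 * (exp_weight \<alpha> x * \<bar>deriv (tail_cutoff n) (x$3)\<bar>)"
        using ss ep[of x] by (intro mult_right_mono) (auto simp: less_imp_le)
      also have "\<dots> \<le> exp_weight \<alpha> x * (C * real n * slab (2 / real n) x + C / real n)"
        using C(2)[OF n z] ep[of x] by (auto simp: indicator_def less_imp_le intro!: mult_left_mono)
      also have "\<dots> = exp_weight \<alpha> x * (C * real n * slab (2 / real n) x) + (C / real n) * exp_weight \<alpha> x"
        by (simp add: algebra_simps)
      also have "\<dots> \<le> 1 * (C * real n * slab (2 / real n) x) + (C / real n) * exp_weight \<alpha> x"
        using e1 C(1) by (intro add_right_mono mult_right_mono) auto
      finally have "\<bar>S (dqn n) x\<bar> \<le> C * real n * slab (2 / real n) x + (C / real n) * exp_weight \<alpha> x" by simp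
      then have "\<bar>f x\<bar> * \<bar>S (dqn n) x\<bar> \<le> \<bar>f x\<bar> * (C * real n * slab (2 / real n) x + (C / real n) * exp_weight \<alpha> x)"
        by (intro mult_left_mono) auto
      then show ?thesis by (simp add: abs_mult algebra_simps)
    qed
    have i3: "integrable (dom_measure a) (\<lambda>x. C * real n * (slab (2 / real n) x * \<bar>f x\<bar>) + (C / real n) * (\<bar>f x\<bar> * exp_weight \<alpha> x))"
      by (intro Bochner_Integration.integrable_add integrable_mult_right i1 i2)
    have ae: "AE x in dom_measure a. \<bar>f x * S (dqn n) x\<bar> \<le> C * real n * (slab (2 / real n) x * \<bar>f x\<bar>) + (C / real n) * (\<bar>f x\<bar> * exp_weight \<alpha> x)"
      using AE_space by eventually_elim (use b in auto)
    have "\<bar>LINT x|dom_measure a. f x * S (dqn n) x\<bar> \<le> (LINT x|dom_measure a. \<bar>f x * S (dqn n) x\<bar>)" by (rule integral_abs_bound)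
    also have "\<dots> \<le> (LINT x|dom_measure a. C * real n * (slab (2 / real n) x * \<bar>f x\<bar>) + (C / real n) * (\<bar>f x\<bar> * exp_weight \<alpha> x))"
      using C(1) N ep by (intro integral_mono_AE'[OF i3 ae] AE_I2 add_nonneg_nonneg mult_nonneg_nonneg) (auto simp: less_imp_le)
    also have "\<dots> = C * real n * (LINT x|dom_measure a. slab (2 / real n) x * \<bar>f x\<bar>) + (C / real n) * (LINT x|dom_measure a. \<bar>f x\<bar> * exp_weight \<alpha> x)"
      using i1 i2 by simp
    also have "C * real n * (LINT x|dom_measure a. slab (2 / real n) x * \<bar>f x\<bar>) = (2 * C) * ((LINT x|dom_measure a. slab (2 / real n) x * \<bar>f x\<bar>) / (2 / real n))"
      using N by simp
    also have "(C / real n) * (LINT x|dom_measure a. \<bar>f x\<bar> * exp_weight \<alpha> x) \<le> ((2 * C) / real n) * (LINT x|dom_measure a. \<bar>f x\<bar> * exp_weight \<alpha> x)"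
      using C(1) N ep by (intro mult_right_mono divide_right_mono integral_nonneg_AE) (auto simp: less_imp_le)
    finally show ?thesis by simp
  qed
  with C(1) that[of "2 * C"] show ?thesis by simp
qed

lemma layer_tendsto_0:
  assumes f1: "integrable (dom_measure a) (\<lambda>x. f x * exp_weight \<alpha> x)"
    and f2: "\<And>e. e > 0 \<Longrightarrow> integrable (dom_measure a) (\<lambda>x. slab e x * f x)"
    and lim: "(\<lambda>n. (LINT x|dom_measure a. slab (2 / real (Suc n)) x * \<bar>f x\<bar>) / (2 / real (Suc n))) \<longlonglongrightarrow> 0"
  shows "(\<lambda>n. LINT x|dom_measure a. f x * S (dqn (Suc n)) x) \<longlonglongrightarrow> 0"
proof -
  obtain C where C: "C \<ge> 0" "\<And>f n. \<lbrakk>n > 0; integrable (dom_measure a) (\<lambda>x. f x * exp_weight \<alpha> x); integrable (dom_measure a) (\<lambda>x. slab (2 / real n) x * f x)\<rbrakk> \<Longrightarrow>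
     \<bar>LINT x|dom_measure a. f x * S (dqn n) x\<bar> \<le> C * ((LINT x|dom_measure a. slab (2 / real n) x * \<bar>f x\<bar>) / (2 / real n))
       + (C / real n) * (LINT x|dom_measure a. \<bar>f x\<bar> * exp_weight \<alpha> x)"
    using layer_bound by blast
  have "(\<lambda>n. C * ((LINT x|dom_measure a. slab (2 / real (Suc n)) x * \<bar>f x\<bar>) / (2 / real (Suc n)))
       + (C / real (Suc n)) * (LINT x|dom_measure a. \<bar>f x\<bar> * exp_weight \<alpha> x)) \<longlonglongrightarrow> C * 0 + 0 * (LINT x|dom_measure a. \<bar>f x\<bar> * exp_weight \<alpha> x)"
    by (intro tendsto_add tendsto_mult tendsto_const lim LIMSEQ_Suc[OF lim_const_over_n])
  then have l: "(\<lambda>n. C * ((LINT x|dom_measure a. slab (2 / real (Suc n)) x * \<bar>f x\<bar>) / (2 / real (Suc n)))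
       + (C / real (Suc n)) * (LINT x|dom_measure a. \<bar>f x\<bar> * exp_weight \<alpha> x)) \<longlonglongrightarrow> 0" by simp
  show ?thesis
  proof (rule Lim_null_comparison[OF _ l])
    show "\<forall>\<^sub>F n in sequentially. norm (LINT x|dom_measure a. f x * S (dqn (Suc n)) x) \<le> C * ((LINT x|dom_measure a. slab (2 / real (Suc n)) x * \<bar>f x\<bar>) / (2 / real (Suc n)))
       + (C / real (Suc n)) * (LINT x|dom_measure a. \<bar>f x\<bar> * exp_weight \<alpha> x)"
    proof (rule always_eventually, rule allI)
      fix n show "norm (LINT x|dom_measure a. f x * S (dqn (Suc n)) x) \<le> C * ((LINT x|dom_measure a. slab (2 / real (Suc n)) x * \<bar>f x\<bar>) / (2 / real (Suc n)))
       + (C / real (Suc n)) * (LINT x|dom_measure a. \<bar>f x\<bar> * exp_weight \<alpha> x)"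
        unfolding real_norm_def by (rule C(2)[OF _ f1 f2]) auto
    qed
  qed
qed

text \<open>All integrands are dominated by |f| times \<open>exp_weight \<alpha>\<close>; the second
  estimate is uniform in n, for use under the time integral.\<close>

lemma qn_tendsto:
  assumes f: "integrable (dom_measure a) (\<lambda>x. f x * exp_weight \<alpha> x)"
  shows "(\<lambda>n. LINT x|dom_measure a. f x * S (qn (Suc n)) x) \<longlonglongrightarrow> (LINT x|dom_measure a. f x * phi x)"
    and "\<bar>LINT x|dom_measure a. f x * S (qn n) x\<bar> \<le> (LINT x|dom_measure a. \<bar>f x * exp_weight \<alpha> x\<bar>)"
proof -
  have eq: "f x * S (qn n) x = S (tail_cutoff n) x * (f x * exp_weight \<alpha> x)" for n x
    by (simp add: tensor_def qn_def exp_weight_def)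
  have m: "(\<lambda>x. f x * S (qn n) x) \<in> borel_measurable (dom_measure a)" for n
    unfolding eq by (intro borel_measurable_times[OF borel_measurable_dom[OF tensor_measurable] borel_measurable_integrable[OF f]]
        smooth_real_sine tail_cutoff_smooth)
  have b: "\<bar>f x * S (qn n) x\<bar> \<le> \<bar>f x * exp_weight \<alpha> x\<bar>" for n x
  proof -
    have "\<bar>sine a (x$1)\<bar> * \<bar>sine a (x$2)\<bar> * \<bar>tail_cutoff n (x$3)\<bar> \<le> 1"
      using tail_cutoff_bounds[of n "x$3"] by (intro mult_le_one abs_sine_le) auto
    then have "\<bar>S (tail_cutoff n) x\<bar> \<le> 1" by (simp add: tensor_def abs_mult)
    then have "\<bar>S (tail_cutoff n) x\<bar> * \<bar>f x * exp_weight \<alpha> x\<bar> \<le> 1 * \<bar>f x * exp_weight \<alpha> x\<bar>" by (intro mult_right_mono) auto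
    then show ?thesis unfolding eq abs_mult[of "S (tail_cutoff n) x"] by simp
  qed
  have fa: "integrable (dom_measure a) (\<lambda>x. \<bar>f x * exp_weight \<alpha> x\<bar>)" using f by (rule integrable_abs)
  have i: "integrable (dom_measure a) (\<lambda>x. f x * S (qn n) x)" for n
    by (rule Bochner_Integration.integrable_bound[OF fa m]) (use b in auto)
  show "\<bar>LINT x|dom_measure a. f x * S (qn n) x\<bar> \<le> (LINT x|dom_measure a. \<bar>f x * exp_weight \<alpha> x\<bar>)"
    by (rule integral_abs_bound_integral[OF i fa b])
  show "(\<lambda>n. LINT x|dom_measure a. f x * S (qn (Suc n)) x) \<longlonglongrightarrow> (LINT x|dom_measure a. f x * phi x)"
  proof (rule integral_dominated_convergence[OF _ m fa])
    have "(\<lambda>x. f x * phi x) = (\<lambda>x. (indicator (domain a) x * S (\<lambda>_. 1) x) * (f x * exp_weight \<alpha> x))"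
      by (simp add: phi_def tensor_def exp_weight_def fun_eq_iff)
    moreover have "(\<lambda>x. indicator (domain a) x * S (\<lambda>_. 1) x) \<in> borel_measurable (dom_measure a)"
      by (intro borel_measurable_dom borel_measurable_times tensor_measurable smooth_real_sine smooth_real_const borel_measurable_indicator domain_lebesgue)
    ultimately show "(\<lambda>x. f x * phi x) \<in> borel_measurable (dom_measure a)"
      using borel_measurable_times[OF _ borel_measurable_integrable[OF f]] by simp
    show "AE x in dom_measure a. (\<lambda>n. f x * S (qn (Suc n)) x) \<longlonglongrightarrow> f x * phi x"
      using AE_space
    proof eventually_elim
      case (elim x)
      then have x: "x \<in> domain a" by simp
      then have "(\<lambda>n. tail_cutoff (Suc n) (x$3)) \<longlonglongrightarrow> 1"
        by (intro LIMSEQ_Suc tail_cutoff_tendsto) (simp add: domain_def)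
      then have "(\<lambda>n. f x * (sine a (x$1) * sine a (x$2) * (exp (- \<alpha> * x$3) * tail_cutoff (Suc n) (x$3)))) \<longlonglongrightarrow> f x * (sine a (x$1) * sine a (x$2) * (exp (- \<alpha> * x$3) * 1))"
        by (intro tendsto_intros)
      then show ?case using x by (simp add: tensor_def qn_def phi_def)
    qed
    show "AE x in dom_measure a. norm (f x * S (qn (Suc n)) x) \<le> \<bar>f x * exp_weight \<alpha> x\<bar>" for n
      using b by simp
  qed
qed

text \<open>The remainder left by \<open>pairing_qn\<close> is the layer integral of the Robin
  expression, which the boundary condition makes uniformly small near the bottom, so its slab
  averages tend to 0.\<close>

lemma pairing_limit:
  assumes t: "t \<in> {0..<T}"
  shows "(\<lambda>n. pairing t (qn (Suc n))) \<longlonglongrightarrow> - (\<beta> - \<alpha>) * (LINT x|dom_measure a. p t x * phi x)"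
proof -
  note eL = exp_weight_integrable(2)[OF a \<alpha>\<beta>(2)]
  define h where "h x = p t x + \<beta> * \<psi> t x" for x
  have hL: "h \<in> L2 (domain a)"
    unfolding h_def[abs_def] by (intro L2_add L2_cmult p_L2 \<psi>_L2 t)
  have hlim: "(\<lambda>n. (LINT x|dom_measure a. slab (2 / real (Suc n)) x * \<bar>h x\<bar>) / (2 / real (Suc n))) \<longlonglongrightarrow> 0"
  proof (rule LIMSEQ_I)
    fix r :: real assume r: "r > 0"
    define \<eta> where "\<eta> = r / (2 * a\<^sup>2)"
    have \<eta>: "\<eta> > 0" "\<eta> * a\<^sup>2 < r" using r a by (auto simp: \<eta>_def field_simps)
    obtain e where e: "e > 0" "AE x in dom_measure a. x$3 < e \<longrightarrow> \<bar>h x\<bar> < \<eta>"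
      using small_near_bottom[OF bottom[OF t] order_refl a \<eta>(1)] unfolding h_def by blast
    obtain n0 where n0: "real n0 \<ge> 2 / e" using real_arch_simple by blast
    show "\<exists>no. \<forall>n\<ge>no. norm ((LINT x|dom_measure a. slab (2 / real (Suc n)) x * \<bar>h x\<bar>) / (2 / real (Suc n)) - 0) < r"
    proof (intro exI[of _ n0] allI impI)
      fix n assume n: "n \<ge> n0"
      let ?e = "2 / real (Suc n)"
      have e0: "?e > 0" by simp
      have "real (Suc n) \<ge> 2 / e" using n n0 by simp
      then have ee: "?e \<le> e" using e(1) by (simp add: field_simps)
      note s = slab_integrable[OF e0 a]
      have "(LINT x|dom_measure a. slab ?e x * \<bar>h x\<bar>) \<le> (LINT x|dom_measure a. \<eta> * slab ?e x)"
      proof (rule integral_mono_AE)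
        show "integrable (dom_measure a) (\<lambda>x. slab ?e x * \<bar>h x\<bar>)"
          by (rule slab_mult_integrable(1)[OF a e0 L2_abs[OF hL]])
        show "integrable (dom_measure a) (\<lambda>x. \<eta> * slab ?e x)" using s(1) by (rule integrable_mult_right)
        show "AE x in dom_measure a. slab ?e x * \<bar>h x\<bar> \<le> \<eta> * slab ?e x"
          using e(2) by eventually_elim (use ee in \<open>auto simp: indicator_def\<close>)
      qed
      also have "\<dots> \<le> \<eta> * (?e * a\<^sup>2)" using mult_left_mono[OF s(2), of \<eta>] \<eta>(1) s(1) by simp
      also have "\<dots> = \<eta> * a\<^sup>2 * ?e" by (simp only: mult_ac)
      finally have "(LINT x|dom_measure a. slab ?e x * \<bar>h x\<bar>) / ?e \<le> \<eta> * a\<^sup>2"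
        by (subst pos_divide_le_eq[OF e0])
      moreover have "0 \<le> (LINT x|dom_measure a. slab ?e x * \<bar>h x\<bar>) / ?e"
        by (intro divide_nonneg_pos integral_nonneg_AE) auto
      ultimately show "norm ((LINT x|dom_measure a. slab ?e x * \<bar>h x\<bar>) / ?e - 0) < r"
        using \<eta>(2) by simp
    qed
  qed
  have l1: "(\<lambda>n. LINT x|dom_measure a. h x * S (dqn (Suc n)) x) \<longlonglongrightarrow> 0"
    by (rule layer_tendsto_0[OF L2_mult_integrable[OF hL eL] slab_mult_integrable(1)[OF a _ hL] hlim])
  have "(\<lambda>n. - (\<beta> - \<alpha>) * (LINT x|dom_measure a. p t x * S (qn (Suc n)) x) - (LINT x|dom_measure a. h x * S (dqn (Suc n)) x))
    \<longlonglongrightarrow> - (\<beta> - \<alpha>) * (LINT x|dom_measure a. p t x * phi x) - 0"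
    by (intro tendsto_diff tendsto_mult tendsto_const l1 qn_tendsto(1) L2_mult_integrable p_L2 t eL)
  then show ?thesis by (simp add: pairing_qn[OF t] h_def)
qed

text \<open>\<open>pairing_evolution\<close> is applied with \<open>qn (Suc n)\<close>, and n tends
  to infinity. On the u^2 side the differentiated exponential yields - \<alpha> \<phi>, while the
  differentiated cut-off yields the boundary term. Slab bounds uniform in time justify the limit
  under the time integral.\<close>

lemma momentum_identity:
  assumes t: "t \<in> {0..<T}"
  shows "(\<beta> - \<alpha>) * ((LINT x|dom_measure a. p t x * phi x) - (LINT x|dom_measure a. p 0 x * phi x))
    = \<alpha> * integral {0..t} (\<lambda>s. LINT x|dom_measure a. (u s x)\<^sup>2 * phi x)"
proof -
  have t0: "0 \<le> t" "t < T" and T0: "0 \<in> {0..<T}" using t by auto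
  define E where "E s = (LINT x|dom_measure a. (u s x)\<^sup>2 * phi x)" for s
  define k where "k n s = (LINT x|dom_measure a. (u s x)\<^sup>2 * S (deriv (qn (Suc n))) x)" for n s
  have kint: "(k n has_integral pairing t (qn (Suc n)) - pairing 0 (qn (Suc n))) {0..t}" for n
    unfolding k_def[abs_def] by (rule pairing_evolution[OF t qn_test(1)]) simp
  obtain C where C: "C \<ge> 0" "\<And>f n. \<lbrakk>n > 0; integrable (dom_measure a) (\<lambda>x. f x * exp_weight \<alpha> x); integrable (dom_measure a) (\<lambda>x. slab (2 / real n) x * f x)\<rbrakk> \<Longrightarrow>
     \<bar>LINT x|dom_measure a. f x * S (dqn n) x\<bar> \<le> C * ((LINT x|dom_measure a. slab (2 / real n) x * \<bar>f x\<bar>) / (2 / real n))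
       + (C / real n) * (LINT x|dom_measure a. \<bar>f x\<bar> * exp_weight \<alpha> x)"
    using layer_bound by blast
  obtain K1 where K1: "0 \<le> K1" "\<And>s e. s \<in> {0..t} \<Longrightarrow> 0 < e \<Longrightarrow> e \<le> 3 \<Longrightarrow> (LINT x|dom_measure a. slab e x * (u s x)\<^sup>2) \<le> e * K1"
    using u_slab_bound[OF t0(2)] by blast
  obtain K2 where K2: "0 \<le> K2" "\<And>s. s \<in> {0..t} \<Longrightarrow> sq_int a (u s) \<le> K2" using L2_cont_bounded[OF u_cont t0(2)] by blast
  have ep: "exp_weight \<alpha> x > 0" for x by (simp add: exp_weight_def)
  have u2e: "integrable (dom_measure a) (\<lambda>x. (u s x)\<^sup>2 * exp_weight \<alpha> x)"
    "(LINT x|dom_measure a. (u s x)\<^sup>2 * exp_weight \<alpha> x) \<le> sq_int a (u s)" if s: "s \<in> {0..<T}" for s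
  proof -
    have u2: "integrable (dom_measure a) (\<lambda>x. (u s x)\<^sup>2)" by (rule L2_square[OF u_L2[OF s]])
    have le: "(u s x)\<^sup>2 * exp_weight \<alpha> x \<le> (u s x)\<^sup>2" if "x \<in> domain a" for x
    proof -
      have "exp_weight \<alpha> x \<le> 1" using that \<alpha>\<beta>(2) by (simp add: exp_weight_def domain_def)
      then show ?thesis using mult_left_mono[of "exp_weight \<alpha> x" 1 "(u s x)\<^sup>2"] by simp
    qed
    have ae: "AE x in dom_measure a. (u s x)\<^sup>2 * exp_weight \<alpha> x \<le> (u s x)\<^sup>2"
      using AE_space by eventually_elim (use le in auto)
    show i: "integrable (dom_measure a) (\<lambda>x. (u s x)\<^sup>2 * exp_weight \<alpha> x)"
    proof (rule Bochner_Integration.integrable_bound[OF u2 borel_measurable_times[OF borel_measurable_power[OF L2_measurable[OF u_L2[OF s]]] exp_weight_measurable]])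
      show "AE x in dom_measure a. norm ((u s x)\<^sup>2 * exp_weight \<alpha> x) \<le> norm ((u s x)\<^sup>2)"
        using ae by eventually_elim (simp add: abs_mult abs_of_pos[OF ep])
    qed
    show "(LINT x|dom_measure a. (u s x)\<^sup>2 * exp_weight \<alpha> x) \<le> sq_int a (u s)"
      unfolding sq_int_def by (rule integral_mono_AE[OF i u2 ae])
  qed
  have u2s: "integrable (dom_measure a) (\<lambda>x. slab e x * (u s x)\<^sup>2)" if s: "s \<in> {0..<T}" for s e
    by (rule Bochner_Integration.integrable_bound[OF L2_square[OF u_L2[OF s]]
          borel_measurable_times[OF borel_measurable_dom[OF slab_measurable] borel_measurable_power[OF L2_measurable[OF u_L2[OF s]]]]])
      (auto simp: indicator_def)
  have ksplit: "k n s = - \<alpha> * (LINT x|dom_measure a. (u s x)\<^sup>2 * S (qn (Suc n)) x) + (LINT x|dom_measure a. (u s x)\<^sup>2 * S (dqn (Suc n)) x)"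
    if s: "s \<in> {0..<T}" for n s
  proof -
    have i: "integrable (dom_measure a) (\<lambda>x. (u s x)\<^sup>2 * S r x)" if r: "test_real {0<..} r" for r
    proof -
      obtain R where "\<forall>x. \<bar>r x\<bar> \<le> R" using test_real_bounded[OF r] by blast
      then show ?thesis
        by (intro S_test_integrable u_square_column_integrable[OF s test_real_smooth[OF r], of R]) auto
    qed
    have "k n s = (LINT x|dom_measure a. - \<alpha> * ((u s x)\<^sup>2 * S (qn (Suc n)) x) + (u s x)\<^sup>2 * S (dqn (Suc n)) x)"
      unfolding k_def S_deriv_qn by (simp add: algebra_simps)
    then show ?thesis using i[OF qn_test(1)[of "Suc n"]] i[OF qn_test(2)[of "Suc n"]] by simp
  qed
  define B where "B = \<alpha> * K2 + (C * K1 + C * K2)"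
  have kB: "norm (k n s) \<le> B" if s: "s \<in> {0..t}" for n s
  proof -
    have s': "s \<in> {0..<T}" using s t0 by auto
    \<comment> \<open>The index \<open>Suc n\<close> keeps the slab height at most 2, inside the
      range e <= 3 of the slab bounds.\<close>
    have e: "(0::real) < 2 / real (Suc n)" "2 / real (Suc n) \<le> 3" by (auto simp: field_simps)
    have absu: "(LINT x|dom_measure a. \<bar>(u s x)\<^sup>2 * exp_weight \<alpha> x\<bar>) \<le> K2"
      using u2e(2)[OF s'] K2(2)[OF s] by (simp add: abs_mult abs_of_pos[OF ep])
    have "\<bar>LINT x|dom_measure a. (u s x)\<^sup>2 * S (qn (Suc n)) x\<bar> \<le> K2"
      using qn_tendsto(2)[OF u2e(1)[OF s'], of "Suc n"] absu by linarith
    then have 1: "\<bar>\<alpha> * (LINT x|dom_measure a. (u s x)\<^sup>2 * S (qn (Suc n)) x)\<bar> \<le> \<alpha> * K2"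
      using \<alpha>\<beta>(2) by (simp add: abs_mult)
    have "\<bar>LINT x|dom_measure a. (u s x)\<^sup>2 * S (dqn (Suc n)) x\<bar> \<le> C * ((LINT x|dom_measure a. slab (2 / real (Suc n)) x * \<bar>(u s x)\<^sup>2\<bar>) / (2 / real (Suc n)))
       + (C / real (Suc n)) * (LINT x|dom_measure a. \<bar>(u s x)\<^sup>2\<bar> * exp_weight \<alpha> x)"
      by (rule C(2)[OF _ u2e(1)[OF s'] u2s[OF s']]) simp
    also have "\<dots> \<le> C * K1 + C * K2"
    proof (intro add_mono)
      have "(LINT x|dom_measure a. slab (2 / real (Suc n)) x * \<bar>(u s x)\<^sup>2\<bar>) / (2 / real (Suc n)) \<le> K1"
        using K1(2)[OF s e] e(1) by (subst pos_divide_le_eq) (simp_all add: mult.commute)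
      then show "C * ((LINT x|dom_measure a. slab (2 / real (Suc n)) x * \<bar>(u s x)\<^sup>2\<bar>) / (2 / real (Suc n))) \<le> C * K1"
        using C(1) by (rule mult_left_mono)
      have "C / real (Suc n) \<le> C / 1" using C(1) by (intro divide_left_mono) auto
      moreover have "(LINT x|dom_measure a. \<bar>(u s x)\<^sup>2\<bar> * exp_weight \<alpha> x) \<le> K2"
        using u2e(2)[OF s'] K2(2)[OF s] by simp
      moreover have "0 \<le> (LINT x|dom_measure a. \<bar>(u s x)\<^sup>2\<bar> * exp_weight \<alpha> x)"
        using ep by (intro integral_nonneg_AE) (auto simp: less_imp_le)
      ultimately show "(C / real (Suc n)) * (LINT x|dom_measure a. \<bar>(u s x)\<^sup>2\<bar> * exp_weight \<alpha> x) \<le> C * K2"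
        using C(1) by (intro mult_mono) auto
    qed
    finally have 2: "\<bar>LINT x|dom_measure a. (u s x)\<^sup>2 * S (dqn (Suc n)) x\<bar> \<le> C * K1 + C * K2" .
    show ?thesis unfolding ksplit[OF s'] B_def real_norm_def using 1 2 by linarith
  qed
  have klim: "(\<lambda>n. k n s) \<longlonglongrightarrow> - \<alpha> * E s" if s: "s \<in> {0..t}" for s
  proof -
    have s': "s \<in> {0..<T}" using s t0 by auto
    \<comment> \<open>Here the boundary term of (u^2)_z is disposed of: the vanishing of u at the
      bottom has been carried from time 0 to time s.\<close>
    have bd: "(\<lambda>n. (LINT x|dom_measure a. slab (2 / real (Suc n)) x * (u s x)\<^sup>2) / (2 / real (Suc n))) \<longlonglongrightarrow> 0"
    proof (rule boundary_decay[OF s' u0])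
      show "(\<lambda>n. 2 / real (Suc n)) \<longlonglongrightarrow> 0" by (rule LIMSEQ_Suc[OF lim_const_over_n])
    qed (auto simp: field_simps)
    have "(\<lambda>n. LINT x|dom_measure a. (u s x)\<^sup>2 * S (dqn (Suc n)) x) \<longlonglongrightarrow> 0"
      by (rule layer_tendsto_0[OF u2e(1)[OF s'] u2s[OF s']]) (use bd in simp)
    then have "(\<lambda>n. - \<alpha> * (LINT x|dom_measure a. (u s x)\<^sup>2 * S (qn (Suc n)) x) + (LINT x|dom_measure a. (u s x)\<^sup>2 * S (dqn (Suc n)) x))
      \<longlonglongrightarrow> - \<alpha> * (LINT x|dom_measure a. (u s x)\<^sup>2 * phi x) + 0"
      by (intro tendsto_add tendsto_mult tendsto_const qn_tendsto(1) u2e s')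
    then show ?thesis by (simp add: ksplit[OF s'] E_def)
  qed
  have ki: "k n integrable_on {0..t}" for n using kint by blast
  have "(\<lambda>n. integral {0..t} (k n)) \<longlonglongrightarrow> integral {0..t} (\<lambda>s. - \<alpha> * E s)"
    by (rule dominated_convergence(2)[OF ki, of "\<lambda>_. B", OF _ kB klim]) auto
  then have "(\<lambda>n. pairing t (qn (Suc n)) - pairing 0 (qn (Suc n))) \<longlonglongrightarrow> integral {0..t} (\<lambda>s. - \<alpha> * E s)"
    by (simp only: integral_unique[OF kint])
  moreover have "(\<lambda>n. pairing t (qn (Suc n)) - pairing 0 (qn (Suc n))) \<longlonglongrightarrow>
    - (\<beta> - \<alpha>) * (LINT x|dom_measure a. p t x * phi x) - (- (\<beta> - \<alpha>) * (LINT x|dom_measure a. p 0 x * phi x))"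
    by (intro tendsto_diff pairing_limit t T0)
  ultimately have "integral {0..t} (\<lambda>s. - \<alpha> * E s) =
    - (\<beta> - \<alpha>) * (LINT x|dom_measure a. p t x * phi x) - (- (\<beta> - \<alpha>) * (LINT x|dom_measure a. p 0 x * phi x))"
    by (rule LIMSEQ_unique)
  then show ?thesis by (simp add: E_def[abs_def] algebra_simps)
qed

end

section \<open>Blow-up of the comparison problem\<close>

text \<open>The derivatives are taken within S, hence may be one-sided at the end points of the
  interval; the increment of f is recovered as the integral of f'.\<close>

lemma le_if_deriv_nonneg_within:
  fixes f :: "real \<Rightarrow> real"
  assumes "x \<le> y" "{x..y} \<subseteq> S"
    and "\<And>t. t \<in> {x..y} \<Longrightarrow> (f has_real_derivative f' t) (at t within S)" "\<And>t. t \<in> {x..y} \<Longrightarrow> 0 \<le> f' t"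
  shows "f x \<le> f y"
proof -
  have "(f' has_integral f y - f x) {x..y}"
    by (rule fundamental_theorem_of_calculus[OF assms(1)])
      (use DERIV_subset[OF assms(3,2)] in \<open>auto simp: has_real_derivative_iff_has_vector_derivative[symmetric]\<close>)
  then have "0 \<le> f y - f x" by (rule has_integral_nonneg) (rule assms(4))
  then show ?thesis by simp
qed

abbreviation cubic_density :: "real \<Rightarrow> real" where
  "cubic_density x \<equiv> 1 / sqrt (x ^ 3 + 1)"

lemma cubic_density_continuous: "continuous_on {0..r} cubic_density"
  by (intro continuous_intros) (auto simp: add_nonneg_pos less_imp_neq[symmetric])

text \<open>The majorant \<open>2 (x + 1) powr (- 3 / 2)\<close> comes from
  \<open>4 (x\<^sup>3 + 1) - (x + 1)\<^sup>3 = 3 (x - 1)\<^sup>2 (x + 1)\<close>.\<close>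

lemma cubic_density_integrable: "integrable (lebesgue_on {0..}) cubic_density"
proof -
  let ?g = "\<lambda>x::real. 2 / ((x + 1) * sqrt (x + 1))"
  have lim: "((\<lambda>x. - 4 / sqrt (x + 1)) \<longlongrightarrow> 0) at_top"
    by (rule real_tendsto_divide_at_top[OF tendsto_const])
      (intro filterlim_compose[OF sqrt_at_top] filterlim_tendsto_add_at_top[OF tendsto_const, of "\<lambda>x. x" _ 1, unfolded add.commute[of 1]] filterlim_ident)
  have "(\<integral>\<^sup>+x. ennreal (?g x) * indicator {0..} x \<partial>lborel) = ennreal (0 - (- 4 / sqrt (0 + 1)))"
  proof (rule nn_integral_FTC_atLeast[OF _ _ _ lim])
    show "((\<lambda>x. - 4 / sqrt (x + 1)) has_real_derivative ?g x) (at x)" if "0 \<le> x" for x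
      using that by (auto intro!: derivative_eq_intros simp: field_simps power2_eq_square)
  qed auto
  moreover have "ennreal (?g x) * indicator {0..} x = ennreal (indicator {0..} x * ?g x)" for x
    by (simp add: indicator_def)
  ultimately have "(\<integral>\<^sup>+x. ennreal (indicator {0..} x * ?g x) \<partial>lborel) = ennreal 4" by simp
  then have "has_bochner_integral lborel (\<lambda>x. indicator {0..} x * ?g x) 4"
    by (intro has_bochner_integral_nn_integral) (auto simp: indicator_def)
  then have gi: "integrable lborel (\<lambda>x. indicator {0..} x * ?g x)" by (simp add: has_bochner_integral_iff)
  have le: "cubic_density x \<le> ?g x" if x: "0 \<le> x" for x
  proof -
    have "0 \<le> 3 * ((x - 1)\<^sup>2 * (x + 1))" using x by simp
    then have "(x + 1) ^ 3 \<le> 4 * (x ^ 3 + 1)" by (simp add: power2_eq_square power3_eq_cube algebra_simps)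
    then have "sqrt ((x + 1) ^ 3) \<le> 2 * sqrt (x ^ 3 + 1)" using real_sqrt_le_mono[of "(x + 1) ^ 3" "4 * (x ^ 3 + 1)"] by (simp only: real_sqrt_mult real_sqrt_four)
    moreover have "sqrt ((x + 1) ^ 3) = (x + 1) * sqrt (x + 1)" using x by (simp add: power3_eq_cube real_sqrt_mult)
    moreover have "0 < (x + 1) * sqrt (x + 1)" "0 < sqrt (x ^ 3 + 1)" using x by (auto simp: add_nonneg_pos)
    ultimately show ?thesis by (simp add: field_simps)
  qed
  have "integrable lborel (\<lambda>x. indicator {0..} x * cubic_density x)"
  proof (rule Bochner_Integration.integrable_bound[OF gi _ AE_I2])
    fix x :: real show "norm (indicator {0..} x * cubic_density x) \<le> norm (indicator {0..} x * ?g x)"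
      using le[of x] by (cases "0 \<le> x") auto
  qed simp
  then have "integrable lebesgue (\<lambda>x::real. indicator {0..} x * cubic_density x)"
    by (simp add: integrable_completion)
  then show ?thesis by (simp add: integrable_restrict_space)
qed

text \<open>A passage from the gauge integral over a bounded interval, to which differentiation
  rules apply, to the Lebesgue integral over the half line that defines the blow-up time.\<close>

lemma integral_cubic_density_le: "integral {0..r} cubic_density \<le> (LINT x|lebesgue_on {0..}. cubic_density x)"
proof -
  have i: "integrable lebesgue (\<lambda>x::real. indicator {0..} x * cubic_density x)"
    using cubic_density_integrable by (simp add: integrable_restrict_space)
  have "integrable lebesgue (\<lambda>x::real. indicator {0..r} x * (indicator {0..} x * cubic_density x))"
    using integrable_mult_indicator[OF _ i, of "{0..r}"] by simp
  moreover have eq: "indicator {0..r} x * (indicator {0..} x * cubic_density x) = indicator {0..r} x * cubic_density x" for x :: real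
    by (auto simp: indicator_def)
  ultimately have j: "integrable lebesgue (\<lambda>x. indicator {0..r} x * cubic_density x)" by (simp only: eq)
  then have jr: "integrable (lebesgue_on {0..r}) cubic_density" by (simp add: integrable_restrict_space)
  have "integral {0..r} cubic_density = (LINT x|lebesgue. indicator {0..r} x * cubic_density x)"
    using lebesgue_integral_eq_integral[OF jr] by (simp add: integral_restrict_space)
  also have "\<dots> \<le> (LINT x|lebesgue. indicator {0..} x * cubic_density x)"
    by (rule integral_mono[OF j i]) (auto simp: indicator_def)
  also have "\<dots> = (LINT x|lebesgue_on {0..}. cubic_density x)" by (simp add: integral_restrict_space)
  finally show ?thesis .
qed

text \<open>With \<open>Y = A + \<integral> G\<close> the hypotheses say \<open>Y'' \<ge> c Y\<^sup>2\<close>, \<open>Y' 0 = B\<close>.  The energy \<open>G\<^sup>2 - (2 c / 3) Y\<^sup>3\<close> is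
  nondecreasing, so that \<open>y = (Y - A) / (\<mu> B)\<close> satisfies \<open>y' \<ge> sqrt (1 + y\<^sup>3) / \<mu>\<close>.\<close>

lemma blow_up_time_le:
  fixes A B c1 c2 r :: real and E G :: "real \<Rightarrow> real"
  assumes pos: "0 \<le> r" "0 \<le> A" "0 < B" "0 < c1" "0 < c2"
    and cont: "continuous_on {0..r} E" "continuous_on {0..r} G"
    and G: "\<And>t. t \<in> {0..r} \<Longrightarrow> G t = B + c1 * integral {0..t} E"
    and E: "\<And>t. \<lbrakk>t \<in> {0..r}; 0 \<le> A + integral {0..t} G\<rbrakk> \<Longrightarrow> c2 * (A + integral {0..t} G)\<^sup>2 \<le> E t"
    and E0: "\<And>t. t \<in> {0..r} \<Longrightarrow> 0 \<le> E t"
  shows "r \<le> (2 * (c1 * c2) * B / 3) powr (- 1 / 3) * (LINT x|lebesgue_on {0..}. cubic_density x)"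
proof -
  define Y where "Y t = A + integral {0..t} G" for t
  define k where "k = 2 * (c1 * c2) / 3"
  \<comment> \<open>The time scale of the comparison problem, fixed by k \<mu>^3 B = 1: in the
    variable y = (Y - A) / (\<mu> B) the energy inequality becomes G^2 >= B^2 (1 + y^3).\<close>
  define \<mu> where "\<mu> = (2 * (c1 * c2) * B / 3) powr (- 1 / 3)"
  have k: "k > 0" using pos by (simp add: k_def)
  have kB: "2 * (c1 * c2) * B / 3 = k * B" by (simp add: k_def)
  have \<mu>: "\<mu> > 0" using pos by (simp add: \<mu>_def)
  have \<mu>3: "k * \<mu> ^ 3 * B = 1"
  proof -
    have "\<mu> ^ 3 = \<mu> powr real 3" using \<mu> by (simp add: powr_realpow)
    also have "\<dots> = (k * B) powr (- 1)" unfolding \<mu>_def kB by (simp add: powr_powr)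
    also have "\<dots> = 1 / (k * B)" using k pos by (simp add: powr_minus_divide)
    finally show ?thesis using k pos by simp
  qed
  have sub: "continuous_on {0..t} E" "continuous_on {0..t} G" if "t \<in> {0..r}" for t
    using cont that by (auto intro: continuous_on_subset)
  have GB: "B \<le> G t" if t: "t \<in> {0..r}" for t
  proof -
    have "0 \<le> integral {0..t} E" using E0 t by (intro integral_nonneg integrable_continuous_interval sub) auto
    then show ?thesis using G[OF t] pos by simp
  qed
  have YA: "A \<le> Y t" if t: "t \<in> {0..r}" for t
  proof -
    have "0 \<le> integral {0..t} G"
    proof (intro integral_nonneg integrable_continuous_interval sub t)
      fix s assume "s \<in> {0..t}" then show "0 \<le> G s" using GB[of s] t pos by auto
    qed
    then show ?thesis by (simp add: Y_def)
  qed
  have dY: "(Y has_real_derivative G t) (at t within {0..r})" if "t \<in> {0..r}" for t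
    using integral_has_real_derivative[OF cont(2) that] unfolding Y_def[abs_def] by (auto intro!: derivative_eq_intros)
  have dG: "(G has_real_derivative c1 * E t) (at t within {0..r})" if t: "t \<in> {0..r}" for t
  proof -
    have "((\<lambda>t. B + c1 * integral {0..t} E) has_real_derivative c1 * E t) (at t within {0..r})"
      using integral_has_real_derivative[OF cont(1) t] by (auto intro!: derivative_eq_intros)
    then show ?thesis by (rule has_field_derivative_transform_within[of _ _ _ _ 1]) (use t G in auto)
  qed
  have Y0: "Y 0 = A" "G 0 = B" using G[of 0] pos by (simp_all add: Y_def)
  have energy: "B\<^sup>2 * (1 + ((Y t - A) / (\<mu> * B)) ^ 3) \<le> (G t)\<^sup>2" if t: "t \<in> {0..r}" for t
  proof -
    have "(G 0)\<^sup>2 - k * (Y 0) ^ 3 \<le> (G t)\<^sup>2 - k * (Y t) ^ 3"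
    proof (rule le_if_deriv_nonneg_within[where S = "{0..r}" and f = "\<lambda>t. (G t)\<^sup>2 - k * (Y t) ^ 3"])
      fix s assume "s \<in> {0..t}"
      then have s: "s \<in> {0..r}" using t by auto
      show "((\<lambda>t. (G t)\<^sup>2 - k * (Y t) ^ 3) has_real_derivative 2 * c1 * G s * (E s - c2 * (Y s)\<^sup>2)) (at s within {0..r})"
        by (rule derivative_eq_intros dG[OF s] dY[OF s] refl)+ (simp add: k_def algebra_simps)
      have "c2 * (Y s)\<^sup>2 \<le> E s" using E[OF s] YA[OF s] pos unfolding Y_def by simp
      then show "0 \<le> 2 * c1 * G s * (E s - c2 * (Y s)\<^sup>2)" using GB[OF s] pos by simp
    qed (use t in auto)
    then have e: "B\<^sup>2 + k * ((Y t) ^ 3 - A ^ 3) \<le> (G t)\<^sup>2" unfolding Y0 by (simp add: algebra_simps)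
    define w where "w = Y t - A"
    have w: "w \<ge> 0" "Y t = A + w" using YA[OF t] by (auto simp: w_def)
    \<comment> \<open>This is the excess of (A + w)^3 - A^3 over w^3; A >= 0 allows the initial
      value to be dropped.\<close>
    have "0 \<le> 3 * (A * w * (A + w))" using w pos by simp
    then have "w ^ 3 \<le> (Y t) ^ 3 - A ^ 3" by (simp add: w(2) power3_eq_cube algebra_simps)
    then have "k * w ^ 3 \<le> k * ((Y t) ^ 3 - A ^ 3)" using k by (intro mult_left_mono) auto
    moreover have "B\<^sup>2 * (w / (\<mu> * B)) ^ 3 = k * w ^ 3"
    proof -
      have "B\<^sup>2 * (w / (\<mu> * B)) ^ 3 = w ^ 3 / (\<mu> ^ 3 * B)" using pos \<mu> by (simp add: field_simps power2_eq_square power3_eq_cube)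
      also have "\<dots> = k * w ^ 3" using \<mu>3 pos \<mu> by (simp add: field_simps)
      finally show ?thesis .
    qed
    ultimately show ?thesis using e unfolding w_def by (simp add: distrib_left)
  qed
  define y where "y t = (Y t - A) / (\<mu> * B)" for t
  have y0: "0 \<le> y t" if "t \<in> {0..r}" for t using YA[OF that] \<mu> pos by (simp add: y_def)
  have yr: "y t \<le> y r" if t: "t \<in> {0..r}" for t
  proof -
    have "Y t \<le> Y r"
    proof (rule le_if_deriv_nonneg_within[where S = "{0..r}", OF _ _ dY])
      fix s assume "s \<in> {t..r}" then show "0 \<le> G s" using GB[of s] t pos by auto
    qed (use t in auto)
    then show ?thesis using \<mu> pos by (simp add: y_def divide_right_mono)
  qed
  have dy: "(y has_real_derivative G t / (\<mu> * B)) (at t within {0..r})" if "t \<in> {0..r}" for t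
    using DERIV_cdivide[OF DERIV_diff[OF dY[OF that] DERIV_const], of A "\<mu> * B"] unfolding y_def[abs_def] by simp
  \<comment> \<open>Separation of variables: since y' >= sqrt (1 + y^3) / \<mu>, the primitive of
    the density along y grows at least as fast as t / \<mu>.\<close>
  have "integral {0..y 0} cubic_density - 0 / \<mu> \<le> integral {0..y r} cubic_density - r / \<mu>"
  proof (rule le_if_deriv_nonneg_within[where S = "{0..r}" and f = "\<lambda>t. integral {0..y t} cubic_density - t / \<mu>"])
    fix t assume t: "t \<in> {0..r}"
    have "((\<lambda>x. integral {0..x} cubic_density) has_real_derivative cubic_density (y t)) (at (y t) within {0..y r})"
      by (rule integral_has_real_derivative[OF cubic_density_continuous]) (use y0[OF t] yr[OF t] in auto)
    then have "((\<lambda>x. integral {0..x} cubic_density) has_real_derivative cubic_density (y t)) (at (y t) within y ` {0..r})"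
      by (rule DERIV_subset) (use y0 yr in auto)
    from DERIV_image_chain[OF this dy[OF t]]
    have "((\<lambda>t. integral {0..y t} cubic_density) has_real_derivative cubic_density (y t) * (G t / (\<mu> * B))) (at t within {0..r})"
      by (simp add: o_def)
    then show "((\<lambda>t. integral {0..y t} cubic_density - t / \<mu>) has_real_derivative
        cubic_density (y t) * (G t / (\<mu> * B)) - 1 / \<mu>) (at t within {0..r})"
      by (rule DERIV_diff) (use DERIV_cdivide[OF DERIV_ident, of \<mu> t "{0..r}"] in simp)
    have s: "sqrt ((y t) ^ 3 + 1) > 0" using y0[OF t] by (simp add: add_nonneg_pos)
    have "sqrt (B\<^sup>2 * (1 + (y t) ^ 3)) \<le> sqrt ((G t)\<^sup>2)"
      using energy[OF t] unfolding y_def by (rule real_sqrt_le_mono)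
    then have "B * sqrt ((y t) ^ 3 + 1) \<le> G t"
      using GB[OF t] pos by (simp add: real_sqrt_mult add.commute)
    then have "1 \<le> G t / (B * sqrt ((y t) ^ 3 + 1))" using pos s by (simp add: le_divide_eq)
    then have "1 / \<mu> \<le> G t / (B * sqrt ((y t) ^ 3 + 1)) / \<mu>" using \<mu> by (intro divide_right_mono) auto
    also have "\<dots> = cubic_density (y t) * (G t / (\<mu> * B))" by (simp add: mult_ac)
    finally show "0 \<le> cubic_density (y t) * (G t / (\<mu> * B)) - 1 / \<mu>" by simp
  qed (use pos in auto)
  then have "r / \<mu> \<le> integral {0..y r} cubic_density" by (simp add: y_def Y0)
  then have "r / \<mu> \<le> (LINT x|lebesgue_on {0..}. cubic_density x)" using integral_cubic_density_le[of "y r"] by linarith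
  then show ?thesis using \<mu> unfolding \<mu>_def[symmetric] by (simp add: pos_divide_le_eq mult.commute)
qed

section \<open>Upper bound for the existence time\<close>

context coupled_flow
begin

text \<open>The comparison problem has c1 = 2 \<alpha> / (\<beta> - \<alpha>), from
  \<open>momentum_identity\<close> and the factor 2 in G, and c2 = \<alpha> pi^2 / (4 a^2), from
  Cauchy-Schwarz with the bound for the integral of \<open>phi\<close>.\<close>

lemma existence_time_le:
  fixes A B :: real
  assumes \<beta>: "\<alpha> < \<beta>" and A: "A = (LINT x|dom_measure a. ln (u 0 x) * phi x)" "0 \<le> A"
    and i: "integrable (dom_measure a) (\<lambda>x. ln (u 0 x) * phi x)" and pos: "AE x in dom_measure a. 0 < u 0 x"
    and B: "B = 2 * (LINT x|dom_measure a. p 0 x * phi x)" "0 < B"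
  shows "T \<le> (2 * (2 * \<alpha> / (\<beta> - \<alpha>) * (\<alpha> * pi\<^sup>2 / (4 * a\<^sup>2))) * B / 3) powr (- 1 / 3) * (LINT x|lebesgue_on {0..}. cubic_density x)"
proof (rule dense_le)
  \<comment> \<open>The flow lives on the half-open interval [0,T), so the comparison is made on
    [0,r] for every r < T.\<close>
  fix r assume "r < T"
  define K where "K = (2 * (2 * \<alpha> / (\<beta> - \<alpha>) * (\<alpha> * pi\<^sup>2 / (4 * a\<^sup>2))) * B / 3) powr (- 1 / 3) * (LINT x|lebesgue_on {0..}. cubic_density x)"
  have K0: "0 \<le> K"
    using integral_cubic_density_le[of 0] unfolding K_def by simp
  define E where "E s = (LINT x|dom_measure a. (u s x)\<^sup>2 * phi x)" for s
  define G where "G s = 2 * (LINT x|dom_measure a. p s x * phi x)" for s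
  have "r \<le> K" if r0: "0 \<le> r"
    unfolding K_def
  proof (rule blow_up_time_le[OF r0 A(2) B(2)])
    have sub: "t \<in> {0..<T}" if "t \<in> {0..r}" for t using that \<open>r < T\<close> by auto
    show c1: "0 < 2 * \<alpha> / (\<beta> - \<alpha>)" and c2: "0 < \<alpha> * pi\<^sup>2 / (4 * a\<^sup>2)" using \<beta> \<alpha>\<beta>(2) a by auto
    show "continuous_on {0..r} E"
      unfolding E_def[abs_def]
      by (rule continuous_on_withinI[OF tendsto_integral_square[OF u_cont _ phi_measurable phi_le_1] \<open>r < T\<close>])
    show "continuous_on {0..r} G"
      unfolding G_def[abs_def]
      by (intro continuous_on_mult continuous_on_const continuous_on_withinI[OF tendsto_integral_mult[OF p _ phi_L2] \<open>r < T\<close>])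
    show "G t = B + 2 * \<alpha> / (\<beta> - \<alpha>) * integral {0..t} E" if "t \<in> {0..r}" for t
    proof -
      have "(\<beta> - \<alpha>) * ((LINT x|dom_measure a. p t x * phi x) - (LINT x|dom_measure a. p 0 x * phi x)) = \<alpha> * integral {0..t} E"
        using momentum_identity[OF sub[OF that]] unfolding E_def[abs_def] .
      then have "(LINT x|dom_measure a. p t x * phi x) - (LINT x|dom_measure a. p 0 x * phi x) = \<alpha> * integral {0..t} E / (\<beta> - \<alpha>)"
        using \<beta> by (simp add: eq_divide_eq mult.commute)
      then show ?thesis by (simp add: G_def B(1))
    qed
    have phi0: "0 \<le> phi x" for x using phi_pos[of x] by (cases "x \<in> domain a") (auto simp: phi_def)
    then show "0 \<le> E t" for t
      unfolding E_def by (intro integral_nonneg_AE AE_I2 mult_nonneg_nonneg) auto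
    show "\<alpha> * pi\<^sup>2 / (4 * a\<^sup>2) * (A + integral {0..t} G)\<^sup>2 \<le> E t" if t: "t \<in> {0..r}" and Y: "0 \<le> A + integral {0..t} G" for t
    proof -
      note t' = sub[OF t]
      \<comment> \<open>Cauchy-Schwarz is applied to the factorisation of |u| \<open>phi\<close>
        into |u| sqrt \<open>phi\<close> and sqrt \<open>phi\<close>.\<close>
      have sm: "(\<lambda>x. sqrt (phi x)) \<in> borel_measurable (dom_measure a)"
        using phi_measurable by measurable
      define V where "V = (LINT x|dom_measure a. \<bar>u t x\<bar> * phi x)"
      have "A + integral {0..t} G \<le> V"
        unfolding A(1) G_def[abs_def] V_def
        by (rule log_lower_bound[OF t' phi_L2 phi_integrable phi_le_1 _ pos i]) (use AE_space phi_pos in auto)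
      then have "(A + integral {0..t} G)\<^sup>2 \<le> V\<^sup>2" using Y by (rule power_mono)
      also have "\<dots> \<le> E t * (LINT x|dom_measure a. phi x)"
      proof -
        have m: "(\<lambda>x. u t x * sqrt (phi x)) \<in> L2 (domain a)"
        proof -
          have "\<bar>sqrt (phi x)\<bar> \<le> 1" for x using phi_le_1[of x] phi0[of x] by simp
          from L2_bounded_mult(1)[OF u_L2[OF t'] sm this] show ?thesis by (simp add: mult.commute)
        qed
        have s: "(\<lambda>x. sqrt (phi x)) \<in> L2 (domain a)"
          using sm phi_integrable phi0 by (simp add: L2_def)
        have "(LINT x|dom_measure a. \<bar>u t x * sqrt (phi x) * sqrt (phi x)\<bar>)\<^sup>2 \<le> sq_int a (\<lambda>x. u t x * sqrt (phi x)) * sq_int a (\<lambda>x. sqrt (phi x))"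
          by (rule Cauchy_Schwarz_integral[OF m s])
        moreover have "\<bar>u t x * sqrt (phi x) * sqrt (phi x)\<bar> = \<bar>u t x\<bar> * phi x" for x
          using phi0[of x] by (simp add: abs_mult mult.assoc)
        ultimately show ?thesis using phi0 by (simp add: V_def E_def sq_int_def power_mult_distrib)
      qed
      also have "\<dots> \<le> E t * (4 * a\<^sup>2 / (\<alpha> * pi\<^sup>2))"
        using \<open>0 \<le> E t\<close> integral_phi_le by (intro mult_left_mono)
      finally have "\<alpha> * pi\<^sup>2 / (4 * a\<^sup>2) * (A + integral {0..t} G)\<^sup>2 \<le> \<alpha> * pi\<^sup>2 / (4 * a\<^sup>2) * (E t * (4 * a\<^sup>2 / (\<alpha> * pi\<^sup>2)))"
        using c2 by (intro mult_left_mono) auto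
      then show ?thesis using a \<alpha>\<beta>(2) by simp
    qed
  qed
  with K0 show "r \<le> K" by (cases "0 \<le> r") auto
qed

end

section \<open>Solutions of the problem as coupled flows\<close>

lemma multi_order_axis: "multi_order (axis i k) = k"
  by (simp add: multi_order_def axis_def)

lemma weak_deriv_tensor:
  assumes "has_weak_deriv (domain a) (axis i k) f g"
    and "test_real {0<..<a} p" "test_real {0<..<a} q" "test_real {0<..} r"
  shows "(LINT x|dom_measure a. f x * tensor ((deriv ^^ (axis i k $ 1)) p) ((deriv ^^ (axis i k $ 2)) q) ((deriv ^^ (axis i k $ 3)) r) x)
    = (-1) ^ k * (LINT x|dom_measure a. g x * tensor p q r x)"
proof -
  have "(LINT x|dom_measure a. f x * multi_deriv (axis i k) (tensor p q r) x)
    = (-1) ^ multi_order (axis i k) * (LINT x|dom_measure a. g x * tensor p q r x)"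
    using assms(1) test_function_tensor[OF assms(2-4)] unfolding has_weak_deriv_def by blast
  then show ?thesis
    unfolding multi_deriv_tensor[OF assms(2-4)[THEN test_real_smooth]] multi_order_axis .
qed

lemma axis_3_nth: "axis (3::3) k $ 1 = 0" "axis (3::3) k $ 2 = 0" "axis (3::3) k $ 3 = k"
  "axis (2::3) k $ 1 = 0" "axis (2::3) k $ 2 = k" "axis (2::3) k $ 3 = 0"
  "axis (1::3) k $ 1 = k" "axis (1::3) k $ 2 = 0" "axis (1::3) k $ 3 = 0"
  by (simp_all add: axis_def)

lemma weak_dz_if_has_weak_deriv:
  "has_weak_deriv (domain a) (axis 3 1) f g \<Longrightarrow> weak_dz a f g"
  unfolding weak_dz_def using weak_deriv_tensor[of a 3 1 f g] by (simp add: axis_3_nth)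

text \<open>The integral of f against p q r'' is evaluated twice: as a first derivative tested with
  r', and as a second derivative tested with r.\<close>

lemma weak_dz_second:
  assumes "has_weak_deriv (domain a) (axis 3 1) f g" "has_weak_deriv (domain a) (axis 3 2) f h"
  shows "weak_dz a g h"
  unfolding weak_dz_def
proof (intro allI impI, elim conjE)
  fix p q r assume t: "test_real {0<..<a} p" "test_real {0<..<a} q" "test_real {0<..} r"
  show "(LINT x|dom_measure a. g x * tensor p q (deriv r) x) = - (LINT x|dom_measure a. h x * tensor p q r x)"
    using weak_deriv_tensor[OF assms(1) t(1,2) test_real_deriv[OF t(3)]] weak_deriv_tensor[OF assms(2) t]
    by (simp add: axis_3_nth numeral_2_eq_2)
qed

text \<open>The order 0 term of the Sobolev norm contains \<open>weak_deriv\<close> at the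
  multi-index 0, which agrees with the function only almost everywhere; the limits are transferred
  along this agreement.\<close>

lemma C1_Sobolev_L2_C1:
  assumes "C1_Sobolev k (domain a) T f f'" shows "L2_C1 a T f f'"
proof -
  let ?D = "weak_deriv (domain a) 0"
  have C: "L2_C1 a T (\<lambda>t. ?D (f t)) (\<lambda>t. ?D (f' t))"
    by (rule C1_Sobolev_weak_deriv[OF assms]) (simp add: multi_order_def)
  have H: "f t \<in> Sobolev_H k (domain a)" "f' t \<in> Sobolev_H k (domain a)" if "t \<in> {0..<T}" for t
    using assms that by (auto simp: C1_Sobolev_def)
  note ae = H(1)[THEN weak_deriv_0] H(2)[THEN weak_deriv_0] and L = H(1)[THEN Sobolev_H_L2] H(2)[THEN Sobolev_H_L2]
  show ?thesis
    unfolding L2_C1_def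
  proof (intro ballI conjI)
    fix t assume t: "t \<in> {0..<T}"
    show "f t \<in> L2 (domain a)" "f' t \<in> L2 (domain a)" using L t by auto
    show "((\<lambda>s. sq_int a (\<lambda>x. (f s x - f t x) / (s - t) - f' t x)) \<longlongrightarrow> 0) (at t within {0..<T})"
    proof (rule Lim_transform_eventually[OF L2_C1D(3)[OF C t]])
      show "\<forall>\<^sub>F s in at t within {0..<T}. sq_int a (\<lambda>x. (?D (f s) x - ?D (f t) x) / (s - t) - ?D (f' t) x) =
        sq_int a (\<lambda>x. (f s x - f t x) / (s - t) - f' t x)"
        using eventually_within
      proof eventually_elim
        case (elim s)
        then have s: "s \<in> {0..<T}" by simp
        have "sq_int a (\<lambda>x. (f s x - f t x) / (s - t) - f' t x) = sq_int a (\<lambda>x. (?D (f s) x - ?D (f t) x) / (s - t) - ?D (f' t) x)"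
        proof (rule sq_int_cong_AE)
          show "(\<lambda>x. (f s x - f t x) / (s - t) - f' t x) \<in> L2 (domain a)" by (intro L2_diff L2_quotient L s t)
          show "AE x in dom_measure a. (f s x - f t x) / (s - t) - f' t x = (?D (f s) x - ?D (f t) x) / (s - t) - ?D (f' t) x"
            using ae(1)[OF s] ae(1)[OF t] ae(2)[OF t] by eventually_elim simp
        qed
        then show ?case by (rule sym)
      qed
    qed
    show "((\<lambda>s. sq_int a (\<lambda>x. f' s x - f' t x)) \<longlongrightarrow> 0) (at t within {0..<T})"
    proof (rule Lim_transform_eventually[OF L2_contD(2)[OF L2_C1_imp_cont(2)[OF C] t]])
      show "\<forall>\<^sub>F s in at t within {0..<T}. sq_int a (\<lambda>x. ?D (f' s) x - ?D (f' t) x) = sq_int a (\<lambda>x. f' s x - f' t x)"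
        using eventually_within
      proof eventually_elim
        case (elim s)
        then have s: "s \<in> {0..<T}" by simp
        have "sq_int a (\<lambda>x. f' s x - f' t x) = sq_int a (\<lambda>x. ?D (f' s) x - ?D (f' t) x)"
        proof (rule sq_int_cong_AE)
          show "(\<lambda>x. f' s x - f' t x) \<in> L2 (domain a)" by (intro L2_diff L s t)
          show "AE x in dom_measure a. f' s x - f' t x = ?D (f' s) x - ?D (f' t) x"
            using ae(2)[OF s] ae(2)[OF t] by eventually_elim simp
        qed
        then show ?case by (rule sym)
      qed
    qed
  qed
qed

lemma L2_cont_add:
  assumes "L2_cont a T f" "L2_cont a T g" shows "L2_cont a T (\<lambda>t x. f t x + g t x)"
  unfolding L2_cont_def
proof (intro ballI conjI)
  fix t assume t: "t \<in> {0..<T}"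
  note f = L2_contD[OF assms(1)] and g = L2_contD[OF assms(2)]
  show "(\<lambda>x. f t x + g t x) \<in> L2 (domain a)" by (intro L2_add f g t)
  have "((\<lambda>s. 2 * sq_int a (\<lambda>x. f s x - f t x) + 2 * sq_int a (\<lambda>x. g s x - g t x)) \<longlongrightarrow> 2 * 0 + 2 * 0) (at t within {0..<T})"
    by (intro tendsto_intros f(2) g(2) t)
  then have l: "((\<lambda>s. 2 * sq_int a (\<lambda>x. f s x - f t x) + 2 * sq_int a (\<lambda>x. g s x - g t x)) \<longlongrightarrow> 0) (at t within {0..<T})" by simp
  show "((\<lambda>s. sq_int a (\<lambda>x. (f s x + g s x) - (f t x + g t x))) \<longlongrightarrow> 0) (at t within {0..<T})"
  proof (rule Lim_null_comparison[OF _ l])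
    show "\<forall>\<^sub>F s in at t within {0..<T}. norm (sq_int a (\<lambda>x. (f s x + g s x) - (f t x + g t x)))
      \<le> 2 * sq_int a (\<lambda>x. f s x - f t x) + 2 * sq_int a (\<lambda>x. g s x - g t x)"
      using eventually_within
    proof eventually_elim
      case (elim s)
      then have "sq_int a (\<lambda>x. (f s x - f t x) + (g s x - g t x)) \<le> 2 * sq_int a (\<lambda>x. f s x - f t x) + 2 * sq_int a (\<lambda>x. g s x - g t x)"
        by (intro sq_int_add_le L2_diff f g t) auto
      moreover have "(f s x - f t x) + (g s x - g t x) = (f s x + g s x) - (f t x + g t x)" for x by simp
      ultimately show ?case using sq_int_nonneg by simp
    qed
  qed
qed

lemma L2_cont_minus:
  assumes "L2_cont a T f" shows "L2_cont a T (\<lambda>t x. - f t x)"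
proof -
  have "sq_int a (\<lambda>x. f t x - f s x) = sq_int a (\<lambda>x. f s x - f t x)" for s t
    by (simp add: sq_int_def power2_commute)
  then show ?thesis using assms by (auto simp: L2_cont_def L2_def)
qed

lemma bottom_subset_frontier: "bottom a \<subseteq> frontier (domain a)"
proof
  fix x assume x: "x \<in> bottom a"
  then have "x \<notin> domain a" by (simp add: bottom_def domain_def)
  moreover have "x \<in> closure (domain a)"
    using x by (intro closure_domainI) (auto simp: bottom_def)
  ultimately show "x \<in> frontier (domain a)"
    using domain_open by (simp add: frontier_def interior_open)
qed

text \<open>The role of (u^2)_z is taken by minus the Laplacian of \<psi>', whose L2 continuity in
  time comes from \<psi> being C1 with values in H^3; \<open>pz\<close> is the second weak
  z-derivative of \<psi>. The smallness of u(0) near the bottom is inherited from the initial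
  datum.\<close>

lemma solution_coupled_flow:
  fixes a \<beta> \<alpha> T :: real
  assumes a: "a > 0" and T: "T > 0" and \<alpha>\<beta>: "\<alpha> * \<beta> = 2 * (pi / a)\<^sup>2" "\<alpha> > 0"
    and u0: "vanishes_on (domain a) (frontier (domain a)) u0"
    and sol: "is_solution a \<beta> u0 \<psi>0 T u \<psi>"
  obtains u' \<psi>' pz g where
    "coupled_flow a T u u' (\<lambda>t. weak_deriv (domain a) (axis 3 1) (\<psi> t)) pz g \<psi> \<psi>' \<alpha> \<beta>"
    "AE x in dom_measure a. u 0 x = u0 x" "AE x in dom_measure a. \<psi> 0 x = \<psi>0 x"
    "has_weak_deriv (domain a) (axis 3 1) (\<psi> 0) (weak_deriv (domain a) (axis 3 1) (\<psi> 0))"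
proof -
  obtain u' \<psi>' where s: "C1_Sobolev 2 (domain a) T u u'" "C1_Sobolev 3 (domain a) T \<psi> \<psi>'"
    and init: "AE x in dom_measure a. u 0 x = u0 x" "AE x in dom_measure a. \<psi> 0 x = \<psi>0 x"
    and eqs: "\<And>t. t \<in> {0..<T} \<Longrightarrow> psi_boundary_condition a \<beta> (\<psi> t)"
      "\<And>t. t \<in> {0..<T} \<Longrightarrow> AE x in dom_measure a. u' t x = 2 * u t x * weak_deriv (domain a) (axis 3 1) (\<psi> t) x"
      "\<And>t. t \<in> {0..<T} \<Longrightarrow> has_weak_deriv (domain a) (axis 3 1) (\<lambda>x. (u t x)\<^sup>2) (\<lambda>x. - weak_laplacian (domain a) (\<psi>' t) x)"
    using sol unfolding is_solution_def by blast
  let ?D = "\<lambda>i k. weak_deriv (domain a) (axis i k)"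
  have w: "has_weak_deriv (domain a) (axis i k) (\<psi> t) (?D i k (\<psi> t))"
    "has_weak_deriv (domain a) (axis i k) (\<psi>' t) (?D i k (\<psi>' t))"
    if "t \<in> {0..<T}" "k \<le> 3" for i k t
    using s(2) that by (auto simp: C1_Sobolev_def multi_order_axis intro!: weak_deriv_Sobolev(1)[where k = 3])
  have D: "L2_C1 a T (\<lambda>t. ?D i k (\<psi> t)) (\<lambda>t. ?D i k (\<psi>' t))" if "k \<le> 3" for i k
    by (rule C1_Sobolev_weak_deriv[OF s(2)]) (simp add: multi_order_axis that)
  have lap: "weak_laplacian (domain a) f x = ?D 1 2 f x + ?D 2 2 f x + ?D 3 2 f x" for f x
    by (simp add: weak_laplacian_def sum_3)
  have "coupled_flow a T u u' (\<lambda>t. ?D 3 1 (\<psi> t)) (\<lambda>t. ?D 3 2 (\<psi> t)) (\<lambda>t x. - weak_laplacian (domain a) (\<psi>' t) x) \<psi> \<psi>' \<alpha> \<beta>"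
  proof unfold_locales
    show "L2_C1 a T u u'" "L2_C1 a T \<psi> \<psi>'" by (rule C1_Sobolev_L2_C1[OF s(1)] C1_Sobolev_L2_C1[OF s(2)])+
    show "L2_cont a T (\<lambda>t. ?D 3 1 (\<psi> t))" "L2_cont a T (\<lambda>t. ?D 3 2 (\<psi> t))" by (rule L2_C1_imp_cont[OF D]; simp)+
    show "L2_cont a T (\<lambda>t x. - weak_laplacian (domain a) (\<psi>' t) x)"
      unfolding lap by (intro L2_cont_minus L2_cont_add L2_C1_imp_cont(2)[OF D]) simp_all
    show "weak_dz a (?D 3 1 (\<psi> t)) (?D 3 2 (\<psi> t))" if "t \<in> {0..<T}" for t
      by (rule weak_dz_second[OF w(1) w(1)]) (use that in auto)
    show "weak_dz a (\<lambda>x. (u t x)\<^sup>2) (\<lambda>x. - weak_laplacian (domain a) (\<psi>' t) x)" if "t \<in> {0..<T}" for t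
      by (rule weak_dz_if_has_weak_deriv[OF eqs(3)[OF that]])
    show "weak_dz a (\<psi> t) (?D 3 1 (\<psi> t))" if "t \<in> {0..<T}" for t
      by (rule weak_dz_if_has_weak_deriv[OF w(1)]) (use that in auto)
    show "(LINT x|dom_measure a. \<psi>' t x * tensor (deriv (deriv f)) h r x)
      + (LINT x|dom_measure a. \<psi>' t x * tensor f (deriv (deriv h)) r x)
      + (LINT x|dom_measure a. \<psi>' t x * tensor f h (deriv (deriv r)) x)
      = (LINT x|dom_measure a. (u t x)\<^sup>2 * tensor f h (deriv r) x)"
      if t: "t \<in> {0..<T}" and tr: "test_real {0<..<a} f" "test_real {0<..<a} h" "test_real {0<..} r" for t f h r
    proof -
      have int: "integrable (dom_measure a) (\<lambda>x. ?D i 2 (\<psi>' t) x * tensor f h r x)" for i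
        using w(2)[OF t, of 2 i] by (intro integrable_tensor_mult tr) (auto simp: has_weak_deriv_def)
      have "(LINT x|dom_measure a. (u t x)\<^sup>2 * tensor f h (deriv r) x) = (LINT x|dom_measure a. weak_laplacian (domain a) (\<psi>' t) x * tensor f h r x)"
        using weak_dz_if_has_weak_deriv[OF eqs(3)[OF t]] tr by (simp add: weak_dz_def)
      also have "\<dots> = (LINT x|dom_measure a. ?D 1 2 (\<psi>' t) x * tensor f h r x) + (LINT x|dom_measure a. ?D 2 2 (\<psi>' t) x * tensor f h r x)
          + (LINT x|dom_measure a. ?D 3 2 (\<psi>' t) x * tensor f h r x)"
        unfolding lap distrib_right using int by simp
      finally show ?thesis
        using weak_deriv_tensor[OF w(2)[OF t] tr, of 2 1] weak_deriv_tensor[OF w(2)[OF t] tr, of 2 2] weak_deriv_tensor[OF w(2)[OF t] tr, of 2 3]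
        by (simp add: axis_3_nth numeral_2_eq_2)
    qed
    show "vanishes_on (domain a) (frontier (domain a) - bottom a) (\<psi> t)" "vanishes_on (domain a) (bottom a) (\<lambda>x. ?D 3 1 (\<psi> t) x + \<beta> * \<psi> t x)"
      if "t \<in> {0..<T}" for t
      using eqs(1)[OF that] by (auto simp: psi_boundary_condition_def)
    show "\<exists>e>0. AE x in dom_measure a. x $ 3 < e \<longrightarrow> \<bar>u 0 x\<bar> < \<kappa>" if \<kappa>: "\<kappa> > 0" for \<kappa>
    proof -
      obtain e where e: "e > 0" "AE x in dom_measure a. x$3 < e \<longrightarrow> \<bar>u0 x\<bar> < \<kappa>"
        using small_near_bottom[OF u0 bottom_subset_frontier a \<kappa>] by blast
      have "AE x in dom_measure a. x$3 < e \<longrightarrow> \<bar>u 0 x\<bar> < \<kappa>"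
        using e(2) init(1) by eventually_elim simp
      with e(1) show ?thesis by blast
    qed
  qed (use a T \<alpha>\<beta> eqs(2) in auto)
  moreover have "has_weak_deriv (domain a) (axis 3 1) (\<psi> 0) (?D 3 1 (\<psi> 0))" using w(1)[of 0 1 3] T by simp
  ultimately show ?thesis using that init by blast
qed

theorem theorem3p1:
  fixes a \<beta> \<alpha> A B D I_inf T_star :: real
    and u0 \<psi>0 \<phi> :: "real^3 \<Rightarrow> real"
  assumes "a > 0"
    and "\<beta> \<in> S_infinity a"
    and "\<beta> > sqrt 2 * pi / a"
    and "u0 \<in> Sobolev_H 2 (domain a)"
    and "vanishes_on (domain a) (frontier (domain a)) u0"
    and "\<And>x. x \<in> domain a \<Longrightarrow> u0 x > 0"
    and "\<psi>0 \<in> Sobolev_H 3 (domain a)"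
    and "psi_boundary_condition a \<beta> \<psi>0"
    and "\<alpha> = 2 * pi\<^sup>2 / (\<beta> * a\<^sup>2)"
    and "\<phi> = (\<lambda>x. exp (- \<alpha> * x$3) * sin (pi * x$1 / a) * sin (pi * x$2 / a))"
    and "A = (LINT x|lebesgue_on (domain a). ln (u0 x) * \<phi> x)"
    and "B = 2 * (LINT x|lebesgue_on (domain a). weak_deriv (domain a) (axis 3 1) \<psi>0 x * \<phi> x)"
    and "D = pi * \<alpha> powr (5/2) / (a * (2 * (pi / a)\<^sup>2 - \<alpha>\<^sup>2))"
    and "I_inf = (LINT x|lebesgue_on {0..}. 1 / sqrt (x^3 + 1))"
    and "T_star = (2 * D * B / 3 * (sqrt \<alpha> * pi / (2 * a))) powr (-1/3) * I_inf"
    and "A > 0"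
    and "B > 0"
  shows "develops_singularity_by a \<beta> u0 \<psi>0 T_star"
proof -
  note a = assms(1)
  have "sqrt 2 * pi / a > 0" using a by simp
  then have \<beta>0: "\<beta> > 0" using assms(3) by linarith
  have \<alpha>0: "\<alpha> > 0" using a \<beta>0 assms(9) by simp
  have \<alpha>\<beta>: "\<alpha> * \<beta> = 2 * (pi / a)\<^sup>2" using a \<beta>0 assms(9) by (simp add: power_divide)
  \<comment> \<open>Multiplied by \<beta>, the claim reads 2 (pi/a)^2 < \<beta>^2, which is the
    lower bound assumed for \<beta>.\<close>
  have less: "\<alpha> < \<beta>"
  proof (rule ccontr)
    assume "\<not> \<alpha> < \<beta>"
    then have "\<beta>\<^sup>2 \<le> \<alpha> * \<beta>" using \<beta>0 by (simp add: power2_eq_square)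
    moreover have "(sqrt 2 * pi / a)\<^sup>2 < \<beta>\<^sup>2" using assms(3) a by (intro power_strict_mono) auto
    moreover have "(sqrt 2 * pi / a)\<^sup>2 = 2 * (pi / a)\<^sup>2" by (simp add: power_mult_distrib power_divide)
    ultimately show False using \<alpha>\<beta> by linarith
  qed
  \<comment> \<open>This identifies the constant with the one of \<open>existence_time_le\<close>:
    \<alpha> \<beta> = 2 (pi/a)^2 turns 2 (pi/a)^2 - \<alpha>^2 into \<alpha> (\<beta> - \<alpha>),
    and \<alpha> powr (5/2) times sqrt \<alpha> is \<alpha>^3.\<close>
  have const: "2 * D * B / 3 * (sqrt \<alpha> * pi / (2 * a)) = 2 * (2 * \<alpha> / (\<beta> - \<alpha>) * (\<alpha> * pi\<^sup>2 / (4 * a\<^sup>2))) * B / 3"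
  proof -
    have "\<alpha> powr (5/2) * sqrt \<alpha> = \<alpha> powr 3"
      using \<alpha>0 by (simp add: powr_half_sqrt[symmetric] powr_add[symmetric])
    then have pw: "\<alpha> powr (5/2) * sqrt \<alpha> = \<alpha> * \<alpha>\<^sup>2" using \<alpha>0 by (simp add: powr_numeral power3_eq_cube power2_eq_square)
    have "2 * (pi / a)\<^sup>2 - \<alpha>\<^sup>2 = \<alpha> * (\<beta> - \<alpha>)" using \<alpha>\<beta> by (simp add: algebra_simps power2_eq_square)
    then have "D * (sqrt \<alpha> * pi / (2 * a)) = (\<alpha> powr (5/2) * sqrt \<alpha>) * pi\<^sup>2 / (2 * a\<^sup>2 * (\<alpha> * (\<beta> - \<alpha>)))"
      unfolding assms(13) by (simp only: times_divide_times_eq power2_eq_square mult_ac)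
    also have "\<dots> = \<alpha>\<^sup>2 * pi\<^sup>2 / (2 * a\<^sup>2 * (\<beta> - \<alpha>))" unfolding pw using \<alpha>0 by simp
    also have "\<dots> = 2 * \<alpha> / (\<beta> - \<alpha>) * (\<alpha> * pi\<^sup>2 / (4 * a\<^sup>2))" using less a by (simp add: frac_eq_eq power2_eq_square)
    finally have eq: "D * (sqrt \<alpha> * pi / (2 * a)) = 2 * \<alpha> / (\<beta> - \<alpha>) * (\<alpha> * pi\<^sup>2 / (4 * a\<^sup>2))" .
    have "2 * D * B / 3 * w = 2 * (D * w) * B / 3" for w by simp
    then show ?thesis unfolding eq[symmetric] .
  qed
  \<comment> \<open>The bound holds for the lifetime of every solution, and the supremum defining
    the largest existence time inherits it.\<close>
  have "T \<le> T_star" if T: "0 < T" and sol: "is_solution a \<beta> u0 \<psi>0 T u \<psi>" for T u \<psi>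
  proof -
    obtain u' \<psi>' pz g where cf: "coupled_flow a T u u' (\<lambda>t. weak_deriv (domain a) (axis 3 1) (\<psi> t)) pz g \<psi> \<psi>' \<alpha> \<beta>"
      and init: "AE x in dom_measure a. u 0 x = u0 x" "AE x in dom_measure a. \<psi> 0 x = \<psi>0 x"
      and w: "has_weak_deriv (domain a) (axis 3 1) (\<psi> 0) (weak_deriv (domain a) (axis 3 1) (\<psi> 0))"
      using solution_coupled_flow[OF a T \<alpha>\<beta> \<alpha>0 assms(5) sol] by blast
    interpret coupled_flow a T u u' "\<lambda>t. weak_deriv (domain a) (axis 3 1) (\<psi> t)" pz g \<psi> \<psi>' \<alpha> \<beta>
      by (rule cf)
    have phi: "\<phi> x = phi x" if "x \<in> domain a" for x
      using that by (simp add: assms(10) phi_def tensor_def sine_def mult_ac)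
    have w0: "has_weak_deriv (domain a) (axis 3 1) \<psi>0 (weak_deriv (domain a) (axis 3 1) \<psi>0)"
      by (rule weak_deriv_Sobolev(1)[OF assms(7)]) (simp add: multi_order_axis)
    have p0: "weak_deriv (domain a) (axis 3 1) \<psi>0 \<in> L2 (domain a)"
      by (rule weak_deriv_Sobolev(2)[OF assms(7)]) (simp add: multi_order_axis)
    \<comment> \<open>A non-integrable function has Bochner integral 0 by convention, so A > 0
      yields integrability of the weighted logarithm.\<close>
    have "integrable (dom_measure a) (\<lambda>x. ln (u0 x) * \<phi> x)"
      using not_integrable_integral_eq[of "dom_measure a" "\<lambda>x. ln (u0 x) * \<phi> x"] assms(11,16) by auto
    moreover have "integrable (dom_measure a) (\<lambda>x. ln (u0 x) * \<phi> x) \<longleftrightarrow> integrable (dom_measure a) (\<lambda>x. ln (u0 x) * phi x)"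
      by (rule Bochner_Integration.integrable_cong) (simp_all add: phi)
    ultimately have i0: "integrable (dom_measure a) (\<lambda>x. ln (u0 x) * phi x)" by (rule iffD1[rotated])
    have lnm: "(\<lambda>x. ln (u 0 x) * phi x) \<in> borel_measurable (dom_measure a)"
      using L2_measurable[OF u_L2[of 0]] T by (intro borel_measurable_times[OF _ phi_measurable]) simp
    have lnae: "AE x in dom_measure a. ln (u0 x) * phi x = ln (u 0 x) * phi x"
      using init(1) by eventually_elim simp
    have i: "integrable (dom_measure a) (\<lambda>x. ln (u 0 x) * phi x)"
      by (rule integrable_cong_AE_imp[OF i0 lnm]) (use init(1) in eventually_elim, simp)
    have "A = (LINT x|dom_measure a. ln (u0 x) * phi x)"
      unfolding assms(11) by (rule Bochner_Integration.integral_cong) (simp_all add: phi)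
    also have "\<dots> = (LINT x|dom_measure a. ln (u 0 x) * phi x)"
      by (rule integral_cong_AE[OF _ lnm lnae]) (use i0 in simp)
    finally have A: "A = (LINT x|dom_measure a. ln (u 0 x) * phi x)" .
    have pos: "AE x in dom_measure a. 0 < u 0 x"
      using init(1) AE_space by eventually_elim (use assms(6) in auto)
    have "(LINT x|dom_measure a. weak_deriv (domain a) (axis 3 1) \<psi>0 x * \<phi> x) = (LINT x|dom_measure a. weak_deriv (domain a) (axis 3 1) \<psi>0 x * phi x)"
      by (rule Bochner_Integration.integral_cong) (simp_all add: phi)
    also have "\<dots> = (LINT x|dom_measure a. weak_deriv (domain a) (axis 3 1) (\<psi> 0) x * phi x)"
    proof (rule integral_cong_AE)
      show "AE x in dom_measure a. weak_deriv (domain a) (axis 3 1) \<psi>0 x * phi x = weak_deriv (domain a) (axis 3 1) (\<psi> 0) x * phi x"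
        using has_weak_deriv_unique[OF w w0 init(2)] by eventually_elim simp
    qed (use L2_measurable[OF p0] L2_measurable[OF p_L2[of 0]] T in \<open>auto intro!: borel_measurable_times[OF _ phi_measurable]\<close>)
    finally have B: "B = 2 * (LINT x|dom_measure a. weak_deriv (domain a) (axis 3 1) (\<psi> 0) x * phi x)"
      unfolding assms(12) by simp
    show ?thesis
      using existence_time_le[OF less A less_imp_le[OF assms(16)] i pos B assms(17)]
      unfolding assms(15) const assms(14) by simp
  qed
  then show ?thesis
    unfolding develops_singularity_by_def max_existence_time_def by (auto intro!: Sup_least)
qed

end
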